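(* Let $d\in\mathbb{R}$ with $d^2\ge4$, and let $\Phi$ be a unitary fiber functor on the C*-tensor category $\mathcal{O}_d$. Choose orthonormal bases $\{v_i\}_{i=1}^n$ of $V=\Phi(X)$ and $\{w_j\}_{j=1}^n$ of $W=\Phi(X^* )$, and let $A=(a_{ij})$ be the invertible matrix $a_{ij}=\Phi(\epsilon_X)(v_i\otimes w_j)$. Then the compact quantum group associated to $\Phi$ is naturally isomorphic to the universal quantum group $A_u(AA^* )$ in the sense of Van Daele and Wang, i.e. to $A_u(A^* )$ in the sense of Banica (the matrix of coefficients of $V$ with respect to $\{v_i\}$ corresponding to the fundamental unitary matrix $u$).
   Context: A Kauffman diagram of type $(m,n)$ is a planar isotopy class (boundary fixed) of $(m+n)/2$ pairwise disjoint strings (arcs, no closed loops) in a rectangle, joining in pairs $m$ points on the upper edge and $n$ points on the lower edge. An oriented Kauffman diagram is one in which every string is oriented. Label an upper vertex by $X$ if a string starts there and by $X^*$ if a string ends there; label a lower vertex by $X$ if a string ends there and by $X^*$ if a string starts there. Reading labels from left to right gives an upper word $w$ and a lower word $w'$ in the letters $X,X^*$; the diagram is of type $(w,w')$. Let $K_{w,w'}$ be the set of oriented Kauffman diagrams of type $(w,w')$. $\mathcal{O}_d$ is the strict $\mathbb{C}$-linear tensor category whose objects are the symbols $X^w$ for finite (possibly empty) words $w$ in $X,X^*$, with $\mathrm{Hom}(X^w,X^{w'})=\mathbb{C}[K_{w,w'}]$ (the vector space with basis $K_{w,w'}$). Composition is the bilinear extension of vertical concatenation (first map on top), each resulting closed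 loop being replaced by the scalar $d$. The tensor product is concatenation of words and horizontal juxtaposition of diagrams; the unit object is $I=X^\emptyset$. The basic arc $\epsilon_X:X\otimes X^*\to I$ is the unique diagram of this type. For $d\in\mathbb{R}$, $d^2\ge4$, $\mathcal{O}_d$ is a C*-tensor category with the conjugate-linear $*$-operation $D^*=(d/|d|)^{\sharp(D)}D'$ on diagrams, where $\sharp(D)$ is the number of strings of $D$ joining two upper vertices minus the number joining two lower vertices, and $D'$ is obtained from $D$ by reflecting in a horizontal line and reversing all orientations. A unitary fiber functor is a $\mathbb{C}$-linear (strictly) monoidal functor $\Phi$ from $\mathcal{O}_d$ to the C*-tensor category of finite-dimensional Hilbert spaces with $\Phi(f^* )=\Phi(f)^*$ for all morphisms $f$. The compact quantum group associated to $\Phi$ is given by Tannaka-Krein duality through its Hopf $*$-algebra $H$: as a Hopf algebra, $H$ is the coend of $\Phi$, i.e. it is spanned by coefficients $u^{w}_{ij}$ of the spaces $\Phi(X^w)$ (with respect to bases, depending on the bases in the usual covariant manner), subject exactly to the linear relations expressing that for every morphism $f:X^w\to X^{w'}$ the linear map $\Phi(f)$ intertwines the coactions $\xi_j\mapsto\sum_i\xi_i\otimes u^w_{ij}$ on $\Phi(X^w)$ and similarly on $\Phi(X^{w'})$; the product is given by $u^{w}_{ij}u^{w'}_{kl}=u^{ww'}_{ik;jl}$ (coefficients for the tensor product basis), the comultiplication by $\Delta(u^w_{ij})=\sum_ku^w_{ik}\otimes u^w_{kj}$, and the $*$-structure is the one for which each matrix $(u^w_{ij})$ with respect to an orthonormal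 basis of $\Phi(X^w)$ is unitary. For a positive definite $Q\in\mathrm{GL}(n,\mathbb{C})$, $A_u(Q)$ in the sense of Van Daele and Wang is the universal Hopf $*$-algebra (compact quantum group) generated by the entries of $u=(u_{ij})_{1\le i,j\le n}$ with relations $uu^*=1=u^*u$ and ${}^tu\,Q\,\overline u\,Q^{-1}=1=Q\,\overline u\,Q^{-1}\,{}^tu$, where $\overline u=(u_{ij}^* )$ and ${}^tu$ is the transpose, with $\Delta(u_{ij})=\sum_ku_{ik}\otimes u_{kj}$. For $G\in\mathrm{GL}(n,\mathbb{C})$, $A_u(G)$ in the sense of Banica is the one generated by the entries of $u$ with the relations that $u$ and $G\overline uG^{-1}$ are unitary. *)

theory Defs
  imports
    "HOL-Library.Poly_Mapping"
    "HOL-Algebra.QuotRing"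
    "Jordan_Normal_Form.Gauss_Jordan_Elimination"
    "Jordan_Normal_Form.Schur_Decomposition"
begin

section \<open>Free complex vector spaces\<close>

text \<open>The free complex vector space on a set \<open>S\<close> is the set of all \<open>a :: 'g \<Rightarrow>\<^sub>0 complex\<close> with
  \<open>Poly_Mapping.keys a \<subseteq> S\<close>.\<close>

abbreviation bvec :: "'g \<Rightarrow> ('g \<Rightarrow>\<^sub>0 complex)" where
  "bvec g \<equiv> Poly_Mapping.single g 1"

definition cscale :: "complex \<Rightarrow> ('g \<Rightarrow>\<^sub>0 complex) \<Rightarrow> ('g \<Rightarrow>\<^sub>0 complex)" where
  "cscale c a = Poly_Mapping.map ((*) c) a"

lemma lookup_cscale [simp]: "Poly_Mapping.lookup (cscale c a) g = c * Poly_Mapping.lookup a g"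
  by (simp add: cscale_def Poly_Mapping.map.rep_eq when_def)

interpretation fvec: vector_space cscale
  by unfold_locales (auto intro!: poly_mapping_eqI simp: lookup_add algebra_simps)

definition lin_ext :: "('g \<Rightarrow> ('h \<Rightarrow>\<^sub>0 complex)) \<Rightarrow> ('g \<Rightarrow>\<^sub>0 complex) \<Rightarrow> ('h \<Rightarrow>\<^sub>0 complex)" where
  "lin_ext f a = (\<Sum>g\<in>Poly_Mapping.keys a. cscale (Poly_Mapping.lookup a g) (f g))"

definition conj_lin_ext :: "('g \<Rightarrow> ('h \<Rightarrow>\<^sub>0 complex)) \<Rightarrow> ('g \<Rightarrow>\<^sub>0 complex) \<Rightarrow> ('h \<Rightarrow>\<^sub>0 complex)" where
  "conj_lin_ext f a = (\<Sum>g\<in>Poly_Mapping.keys a. cscale (cnj (Poly_Mapping.lookup a g)) (f g))"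

definition bilin_ext ::
  "('g \<Rightarrow> 'h \<Rightarrow> ('k \<Rightarrow>\<^sub>0 complex)) \<Rightarrow> ('g \<Rightarrow>\<^sub>0 complex) \<Rightarrow> ('h \<Rightarrow>\<^sub>0 complex) \<Rightarrow> ('k \<Rightarrow>\<^sub>0 complex)" where
  "bilin_ext f a b = lin_ext (\<lambda>g. lin_ext (\<lambda>h. f g h) b) a"


section \<open>Oriented Kauffman diagrams and the category \<open>\<O>\<^sub>d\<close>\<close>

text \<open>\<open>Xstar\<close> is the letter \<open>X\<^sup>*\<close>.\<close>

datatype letter = X | Xstar

type_synonym word = "letter list"

text \<open>\<open>Up i\<close> and \<open>Lo j\<close> are the points on the upper and on the lower edge, numbered from the left
  starting with \<open>0\<close>.\<close>

datatype vertex = Up nat | Lo nat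

text \<open>A planar isotopy class of pairwise disjoint strings in a rectangle is determined by the pairs of
  boundary points that are joined, and the pairings that occur are exactly the noncrossing ones. A
  string oriented from \<open>a\<close> to \<open>b\<close> is the pair \<open>(a, b)\<close>.\<close>

type_synonym diagram = "(vertex \<times> vertex) set"

definition vertices :: "nat \<Rightarrow> nat \<Rightarrow> vertex set" where
  "vertices m n = Up ` {..<m} \<union> Lo ` {..<n}"

text \<open>Position on the boundary of the rectangle, read clockwise from the upper left corner.\<close>

fun boundary_pos :: "nat \<Rightarrow> nat \<Rightarrow> vertex \<Rightarrow> nat" where
  "boundary_pos m n (Up i) = i"
| "boundary_pos m n (Lo j) = m + (n - 1 - j)"

definition crossing :: "nat \<Rightarrow> nat \<Rightarrow> vertex \<times> vertex \<Rightarrow> vertex \<times> vertex \<Rightarrow> bool" where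
  "crossing m n s t \<longleftrightarrow>
    (let p = boundary_pos m n;
         lo = (\<lambda>(a, b). min (p a) (p b));
         hi = (\<lambda>(a, b). max (p a) (p b))
     in lo s < lo t \<and> lo t < hi s \<and> hi s < hi t)"

definition oriented_kauffman :: "nat \<Rightarrow> nat \<Rightarrow> diagram \<Rightarrow> bool" where
  "oriented_kauffman m n D \<longleftrightarrow>
    D \<subseteq> vertices m n \<times> vertices m n \<and>
    (\<forall>(a, b)\<in>D. a \<noteq> b) \<and>
    (\<forall>x\<in>vertices m n. \<exists>!s. s \<in> D \<and> (x = fst s \<or> x = snd s)) \<and>
    (\<forall>s\<in>D. \<forall>t\<in>D. \<not> crossing m n s t)"

definition upper_word :: "nat \<Rightarrow> diagram \<Rightarrow> word" where
  "upper_word m D = map (\<lambda>i. if \<exists>b. (Up i, b) \<in> D then X else Xstar) [0..<m]"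

definition lower_word :: "nat \<Rightarrow> diagram \<Rightarrow> word" where
  "lower_word n D = map (\<lambda>j. if \<exists>a. (a, Lo j) \<in> D then X else Xstar) [0..<n]"

definition K :: "word \<Rightarrow> word \<Rightarrow> diagram set" where
  "K w w' = {D. oriented_kauffman (length w) (length w') D \<and>
                upper_word (length w) D = w \<and> lower_word (length w') D = w'}"

type_synonym morphism = "diagram \<Rightarrow>\<^sub>0 complex"

definition Hom :: "word \<Rightarrow> word \<Rightarrow> morphism set" where
  "Hom w w' = {f. Poly_Mapping.keys f \<subseteq> K w w'}"

definition id_diagram :: "word \<Rightarrow> diagram" where
  "id_diagram w = {if w ! i = X then (Up i, Lo i) else (Lo i, Up i) |i. i < length w}"

text \<open>Vertical concatenation: \<open>D\<close> is placed between the levels \<open>0\<close> and \<open>1\<close>, and \<open>E\<close> below it between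
  the levels \<open>1\<close> and \<open>2\<close>. When the words on level \<open>1\<close> agree, the orientations of the strings match
  there, so the strings of the concatenation are the maximal directed paths and its closed loops are
  the directed cycles.\<close>

fun place :: "nat \<Rightarrow> nat \<Rightarrow> vertex \<Rightarrow> nat \<times> nat" where
  "place k l (Up i) = (k, i)"
| "place k l (Lo j) = (l, j)"

definition glue :: "diagram \<Rightarrow> diagram \<Rightarrow> ((nat \<times> nat) \<times> (nat \<times> nat)) set" where
  "glue D E = map_prod (place 0 1) (place 0 1) ` D \<union> map_prod (place 1 2) (place 1 2) ` E"

definition concat_diagram :: "diagram \<Rightarrow> diagram \<Rightarrow> diagram" where
  "concat_diagram D E = {(a, b). (place 0 2 a, place 0 2 b) \<in> (glue D E)\<^sup>+}"

definition loops :: "diagram \<Rightarrow> diagram \<Rightarrow> nat" where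
  "loops D E = card {{y. (x, y) \<in> (glue D E)\<^sup>+} |x. (x, x) \<in> (glue D E)\<^sup>+}"

text \<open>\<open>comp_mor d g f\<close> is \<open>g \<circ> f\<close>.\<close>

definition comp_mor :: "real \<Rightarrow> morphism \<Rightarrow> morphism \<Rightarrow> morphism" where
  "comp_mor d g f =
    bilin_ext (\<lambda>D E. cscale (of_real d ^ loops D E) (bvec (concat_diagram D E))) f g"

fun shift :: "nat \<Rightarrow> nat \<Rightarrow> vertex \<Rightarrow> vertex" where
  "shift m n (Up i) = Up (m + i)"
| "shift m n (Lo j) = Lo (n + j)"

text \<open>\<open>tensor_mor m n f g\<close> is \<open>f \<otimes> g\<close> for \<open>f\<close> of a type \<open>(w, w')\<close> with \<open>length w = m\<close> and
  \<open>length w' = n\<close>.\<close>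

definition tensor_mor :: "nat \<Rightarrow> nat \<Rightarrow> morphism \<Rightarrow> morphism \<Rightarrow> morphism" where
  "tensor_mor m n f g =
    bilin_ext (\<lambda>D E. bvec (D \<union> map_prod (shift m n) (shift m n) ` E)) f g"

fun flip :: "vertex \<Rightarrow> vertex" where
  "flip (Up i) = Lo i"
| "flip (Lo i) = Up i"

definition sharp :: "diagram \<Rightarrow> int" where
  "sharp D = int (card {s \<in> D. fst s \<in> range Up \<and> snd s \<in> range Up})
           - int (card {s \<in> D. fst s \<in> range Lo \<and> snd s \<in> range Lo})"

definition reflect :: "diagram \<Rightarrow> diagram" where
  "reflect D = {(flip b, flip a) |a b. (a, b) \<in> D}"

definition star_mor :: "real \<Rightarrow> morphism \<Rightarrow> morphism" where
  "star_mor d = conj_lin_ext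
    (\<lambda>D. cscale (of_real ((d / \<bar>d\<bar>) powi sharp D)) (bvec (reflect D)))"

text \<open>The basic arc \<open>\<epsilon>\<^sub>X : X \<otimes> X\<^sup>* \<rightarrow> I\<close>.\<close>

definition eps_X :: morphism where
  "eps_X = bvec {(Up 0, Up 1)}"


section \<open>Unitary fiber functors\<close>

text \<open>Hilbert spaces are subspaces of an ambient complex vector space, each with its own inner product
  (conjugate-linear in the first argument). The ambient space is a mere container: every family of
  finite-dimensional Hilbert spaces can be placed in one, for instance in its direct sum.\<close>

locale fd_hilbert_space = vector_space scale
  for scale :: "complex \<Rightarrow> 'a::ab_group_add \<Rightarrow> 'a" +
  fixes S :: "'a set" and ip :: "'a \<Rightarrow> 'a \<Rightarrow> complex"
  assumes subspace: "subspace S"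
    and finite_dim: "\<exists>B. finite B \<and> B \<subseteq> S \<and> span B = S"
    and inner_add: "\<lbrakk>x \<in> S; y \<in> S; z \<in> S\<rbrakk> \<Longrightarrow> ip x (y + z) = ip x y + ip x z"
    and inner_scale: "\<lbrakk>x \<in> S; y \<in> S\<rbrakk> \<Longrightarrow> ip x (scale c y) = c * ip x y"
    and inner_cnj: "\<lbrakk>x \<in> S; y \<in> S\<rbrakk> \<Longrightarrow> ip y x = cnj (ip x y)"
    and inner_pos: "\<lbrakk>x \<in> S; x \<noteq> 0\<rbrakk> \<Longrightarrow> Re (ip x x) > 0"
begin

definition orthonormal_basis :: "'a list \<Rightarrow> bool" where
  "orthonormal_basis vs \<longleftrightarrow>
    set vs \<subseteq> S \<and> span (set vs) = S \<and>
    (\<forall>i<length vs. \<forall>j<length vs. ip (vs ! i) (vs ! j) = (if i = j then 1 else 0))"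

end

text \<open>A finite-dimensional Hilbert space \<open>T\<close> with a bilinear map \<open>t : U \<times> V \<rightarrow> T\<close> is the Hilbert space
  tensor product of \<open>U\<close> and \<open>V\<close>, with \<open>t x y\<close> in the role of \<open>x \<otimes> y\<close>.\<close>

locale hilbert_tensor =
  U: fd_hilbert_space scale U innerU + V: fd_hilbert_space scale V innerV +
  T: fd_hilbert_space scale T innerT
  for scale :: "complex \<Rightarrow> 'a::ab_group_add \<Rightarrow> 'a" and U innerU V innerV T innerT +
  fixes t :: "'a \<Rightarrow> 'a \<Rightarrow> 'a"
  assumes closed: "\<lbrakk>x \<in> U; y \<in> V\<rbrakk> \<Longrightarrow> t x y \<in> T"
    and add_left: "\<lbrakk>x \<in> U; x' \<in> U; y \<in> V\<rbrakk> \<Longrightarrow> t (x + x') y = t x y + t x' y"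
    and add_right: "\<lbrakk>x \<in> U; y \<in> V; y' \<in> V\<rbrakk> \<Longrightarrow> t x (y + y') = t x y + t x y'"
    and scale_left: "\<lbrakk>x \<in> U; y \<in> V\<rbrakk> \<Longrightarrow> t (scale c x) y = scale c (t x y)"
    and scale_right: "\<lbrakk>x \<in> U; y \<in> V\<rbrakk> \<Longrightarrow> t x (scale c y) = scale c (t x y)"
    and inner_tensor: "\<lbrakk>x \<in> U; x' \<in> U; y \<in> V; y' \<in> V\<rbrakk> \<Longrightarrow>
      innerT (t x y) (t x' y') = innerU x x' * innerV y y'"
    and spanning: "T = U.span {t x y |x y. x \<in> U \<and> y \<in> V}"

text \<open>The data of a functor \<open>\<Phi>\<close>: the space \<open>\<Phi>(X\<^sup>w)\<close> is \<open>obj \<Phi> w\<close> with inner product \<open>ip \<Phi> w\<close>;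
  \<open>unit_vector \<Phi>\<close> is the number \<open>1\<close> in \<open>\<Phi>(I) = \<complex>\<close>; \<open>tens \<Phi> w w' x y\<close> is the vector \<open>x \<otimes> y\<close> of
  \<open>\<Phi>(X\<^sup>w) \<otimes> \<Phi>(X\<^sup>w\<^sup>') = \<Phi>(X\<^sup>w \<otimes> X\<^sup>w\<^sup>')\<close>; and \<open>mor \<Phi> w w' f\<close> is \<open>\<Phi>(f)\<close> for \<open>f : X\<^sup>w \<rightarrow> X\<^sup>w\<^sup>'\<close>. Only the
  values on the respective subspaces matter.\<close>

record 'a functor_data =
  scal :: "complex \<Rightarrow> 'a \<Rightarrow> 'a"
  obj :: "word \<Rightarrow> 'a set"
  ip :: "word \<Rightarrow> 'a \<Rightarrow> 'a \<Rightarrow> complex"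
  unit_vector :: 'a
  tens :: "word \<Rightarrow> word \<Rightarrow> 'a \<Rightarrow> 'a \<Rightarrow> 'a"
  mor :: "word \<Rightarrow> word \<Rightarrow> morphism \<Rightarrow> 'a \<Rightarrow> 'a"

locale unitary_fiber_functor =
  fixes d :: real and \<Phi> :: "'a::ab_group_add functor_data"
  assumes hilbert: "fd_hilbert_space (scal \<Phi>) (obj \<Phi> w) (ip \<Phi> w)"
    and mor_closed: "\<lbrakk>f \<in> Hom w w'; x \<in> obj \<Phi> w\<rbrakk> \<Longrightarrow> mor \<Phi> w w' f x \<in> obj \<Phi> w'"
    and mor_add: "\<lbrakk>f \<in> Hom w w'; x \<in> obj \<Phi> w; y \<in> obj \<Phi> w\<rbrakk> \<Longrightarrow>
      mor \<Phi> w w' f (x + y) = mor \<Phi> w w' f x + mor \<Phi> w w' f y"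
    and mor_scale: "\<lbrakk>f \<in> Hom w w'; x \<in> obj \<Phi> w\<rbrakk> \<Longrightarrow>
      mor \<Phi> w w' f (scal \<Phi> c x) = scal \<Phi> c (mor \<Phi> w w' f x)"
    and id: "x \<in> obj \<Phi> w \<Longrightarrow> mor \<Phi> w w (bvec (id_diagram w)) x = x"
    and comp: "\<lbrakk>f \<in> Hom w w'; g \<in> Hom w' w''; x \<in> obj \<Phi> w\<rbrakk> \<Longrightarrow>
      mor \<Phi> w w'' (comp_mor d g f) x = mor \<Phi> w' w'' g (mor \<Phi> w w' f x)"
    and linear_add: "\<lbrakk>f \<in> Hom w w'; g \<in> Hom w w'; x \<in> obj \<Phi> w\<rbrakk> \<Longrightarrow>
      mor \<Phi> w w' (f + g) x = mor \<Phi> w w' f x + mor \<Phi> w w' g x"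
    and linear_scale: "\<lbrakk>f \<in> Hom w w'; x \<in> obj \<Phi> w\<rbrakk> \<Longrightarrow>
      mor \<Phi> w w' (cscale c f) x = scal \<Phi> c (mor \<Phi> w w' f x)"
    and tensor_obj: "hilbert_tensor (scal \<Phi>) (obj \<Phi> w) (ip \<Phi> w) (obj \<Phi> w') (ip \<Phi> w')
      (obj \<Phi> (w @ w')) (ip \<Phi> (w @ w')) (tens \<Phi> w w')"
    and tensor_assoc: "\<lbrakk>x \<in> obj \<Phi> w; y \<in> obj \<Phi> w'; z \<in> obj \<Phi> w''\<rbrakk> \<Longrightarrow>
      tens \<Phi> (w @ w') w'' (tens \<Phi> w w' x y) z = tens \<Phi> w (w' @ w'') x (tens \<Phi> w' w'' y z)"
    and unit_obj: "obj \<Phi> [] = range (\<lambda>c. scal \<Phi> c (unit_vector \<Phi>))"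
    and unit_inner: "ip \<Phi> [] (unit_vector \<Phi>) (unit_vector \<Phi>) = 1"
    and unit_left: "x \<in> obj \<Phi> w \<Longrightarrow> tens \<Phi> [] w (unit_vector \<Phi>) x = x"
    and unit_right: "x \<in> obj \<Phi> w \<Longrightarrow> tens \<Phi> w [] x (unit_vector \<Phi>) = x"
    and tensor_mor: "\<lbrakk>f \<in> Hom w1 w1'; g \<in> Hom w2 w2'; x \<in> obj \<Phi> w1; y \<in> obj \<Phi> w2\<rbrakk> \<Longrightarrow>
      mor \<Phi> (w1 @ w2) (w1' @ w2') (tensor_mor (length w1) (length w1') f g) (tens \<Phi> w1 w2 x y) =
      tens \<Phi> w1' w2' (mor \<Phi> w1 w1' f x) (mor \<Phi> w2 w2' g y)"
    and star: "\<lbrakk>f \<in> Hom w w'; x \<in> obj \<Phi> w; y \<in> obj \<Phi> w'\<rbrakk> \<Longrightarrow>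
      ip \<Phi> w (mor \<Phi> w' w (star_mor d f) y) x = ip \<Phi> w' y (mor \<Phi> w w' f x)"

definition onb :: "'a::ab_group_add functor_data \<Rightarrow> word \<Rightarrow> 'a list \<Rightarrow> bool" where
  "onb \<Phi> w vs \<longleftrightarrow>
    fd_hilbert_space.orthonormal_basis (scal \<Phi>) (obj \<Phi> w) (ip \<Phi> w) vs"


section \<open>Hopf \<open>*\<close>-algebras and their isomorphisms\<close>

text \<open>An element of \<open>M \<otimes> M\<close> is a coset, in the free vector space on \<open>carrier M \<times> carrier M\<close>, of the span
  of the bilinearity relations.\<close>

definition tensor_rel :: "(complex, 'a, 'm) module_scheme \<Rightarrow> ('a \<times> 'a \<Rightarrow>\<^sub>0 complex) set" where
  "tensor_rel M = fvec.span (
     {bvec (x \<oplus>\<^bsub>M\<^esub> x', y) - bvec (x, y) - bvec (x', y) |x x' y.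
        x \<in> carrier M \<and> x' \<in> carrier M \<and> y \<in> carrier M} \<union>
     {bvec (x, y \<oplus>\<^bsub>M\<^esub> y') - bvec (x, y) - bvec (x, y') |x y y'.
        x \<in> carrier M \<and> y \<in> carrier M \<and> y' \<in> carrier M} \<union>
     {bvec (c \<odot>\<^bsub>M\<^esub> x, y) - cscale c (bvec (x, y)) |c x y. x \<in> carrier M \<and> y \<in> carrier M} \<union>
     {bvec (x, c \<odot>\<^bsub>M\<^esub> y) - cscale c (bvec (x, y)) |c x y. x \<in> carrier M \<and> y \<in> carrier M})"

definition tensor_class ::
  "(complex, 'a, 'm) module_scheme \<Rightarrow> ('a \<times> 'a \<Rightarrow>\<^sub>0 complex) \<Rightarrow> ('a \<times> 'a \<Rightarrow>\<^sub>0 complex) set" where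
  "tensor_class M t = {t + r |r. r \<in> tensor_rel M}"

text \<open>Counit and antipode are not part of the data, being determined by product and
  comultiplication.\<close>

record 'a hopf_star = "(complex, 'a) module" +
  star :: "'a \<Rightarrow> 'a"
  comult :: "'a \<Rightarrow> ('a \<times> 'a \<Rightarrow>\<^sub>0 complex) set"

definition hopf_star_iso :: "'a hopf_star \<Rightarrow> 'b hopf_star \<Rightarrow> ('a \<Rightarrow> 'b) \<Rightarrow> bool" where
  "hopf_star_iso A B \<theta> \<longleftrightarrow>
    \<theta> \<in> ring_iso A B \<and>
    (\<forall>c. \<forall>x\<in>carrier A. \<theta> (c \<odot>\<^bsub>A\<^esub> x) = c \<odot>\<^bsub>B\<^esub> \<theta> x) \<and>
    (\<forall>x\<in>carrier A. \<theta> (star A x) = star B (\<theta> x)) \<and>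
    (\<forall>x\<in>carrier A. comult B (\<theta> x) =
      (\<Union>t\<in>comult A x. tensor_class B (lin_ext (\<lambda>(y, z). bvec (\<theta> y, \<theta> z)) t)))"

text \<open>Quotients of an algebra \<open>F\<close> by an ideal \<open>I\<close>, and the maps induced on them by \<open>s : F \<rightarrow> F\<close> and by
  \<open>\<delta> : F \<rightarrow> F \<otimes> F\<close>, where \<open>\<delta>\<close> is given by representatives.\<close>

definition quotient_algebra ::
  "(complex, 'a, 'm) module_scheme \<Rightarrow> 'a set \<Rightarrow> (complex, 'a set) module" where
  "quotient_algebra F I =
    \<lparr>carrier = carrier (F Quot I), monoid.mult = monoid.mult (F Quot I), one = one (F Quot I),
     zero = zero (F Quot I), add = add (F Quot I),
     module.smult = (\<lambda>c S. \<Union>a\<in>S. I +>\<^bsub>F\<^esub> (c \<odot>\<^bsub>F\<^esub> a))\<rparr>"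

definition quotient_map ::
  "(complex, 'a, 'm) module_scheme \<Rightarrow> 'a set \<Rightarrow> ('a \<Rightarrow> 'a) \<Rightarrow> 'a set \<Rightarrow> 'a set" where
  "quotient_map F I s S = (\<Union>a\<in>S. I +>\<^bsub>F\<^esub> s a)"

definition quotient_comult ::
  "(complex, 'a, 'm) module_scheme \<Rightarrow> 'a set \<Rightarrow> ('a \<Rightarrow> ('a \<times> 'a \<Rightarrow>\<^sub>0 complex)) \<Rightarrow>
   'a set \<Rightarrow> ('a set \<times> 'a set \<Rightarrow>\<^sub>0 complex) set" where
  "quotient_comult F I \<delta> S =
    (\<Union>a\<in>S. tensor_class (quotient_algebra F I)
      (lin_ext (\<lambda>(x, y). bvec (I +>\<^bsub>F\<^esub> x, I +>\<^bsub>F\<^esub> y)) (\<delta> a)))"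

definition with_hopf_star ::
  "(complex, 'a) module \<Rightarrow> ('a \<Rightarrow> 'a) \<Rightarrow> ('a \<Rightarrow> ('a \<times> 'a \<Rightarrow>\<^sub>0 complex) set) \<Rightarrow> 'a hopf_star" where
  "with_hopf_star M s \<Delta> =
    \<lparr>carrier = carrier M, monoid.mult = monoid.mult M, one = one M, zero = zero M, add = add M,
     module.smult = module.smult M, star = s, comult = \<Delta>\<rparr>"


section \<open>The Hopf \<open>*\<close>-algebra associated to a unitary fiber functor\<close>

text \<open>The symbol \<open>(w, x, y)\<close> with \<open>x, y \<in> \<Phi>(X\<^sup>w)\<close> stands for the coefficient \<open>(\<langle>x| \<otimes> id) \<delta>(y)\<close> of the
  coaction \<open>\<delta>\<close> on \<open>\<Phi>(X\<^sup>w)\<close>, so that \<open>u\<^sup>w\<^sub>i\<^sub>j\<close> with respect to an orthonormal basis \<open>\<xi>\<close> is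
  \<open>(w, \<xi>\<^sub>i, \<xi>\<^sub>j)\<close>. Covariance under changes of bases is sesquilinearity in \<open>(x, y)\<close>.\<close>

type_synonym 'a coeff_symbol = "word \<times> 'a \<times> 'a"

type_synonym 'a coeff_space = "'a coeff_symbol \<Rightarrow>\<^sub>0 complex"

definition coeff_symbols :: "'a::ab_group_add functor_data \<Rightarrow> 'a coeff_symbol set" where
  "coeff_symbols \<Phi> = {(w, x, y). x \<in> obj \<Phi> w \<and> y \<in> obj \<Phi> w}"

definition coeff_algebra ::
  "'a::ab_group_add functor_data \<Rightarrow> (complex, 'a coeff_space) module" where
  "coeff_algebra \<Phi> =
    \<lparr>carrier = {a. Poly_Mapping.keys a \<subseteq> coeff_symbols \<Phi>},
     monoid.mult = bilin_ext (\<lambda>(w, x, y) (w', x', y'). bvec (w @ w', tens \<Phi> w w' x x', tens \<Phi> w w' y y')),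
     one = bvec ([], unit_vector \<Phi>, unit_vector \<Phi>),
     zero = 0,
     add = (+),
     module.smult = cscale\<rparr>"

definition covariance_rel :: "'a::ab_group_add functor_data \<Rightarrow> 'a coeff_space set" where
  "covariance_rel \<Phi> =
     {bvec (w, x + x', y) - bvec (w, x, y) - bvec (w, x', y) |w x x' y.
        x \<in> obj \<Phi> w \<and> x' \<in> obj \<Phi> w \<and> y \<in> obj \<Phi> w} \<union>
     {bvec (w, x, y + y') - bvec (w, x, y) - bvec (w, x, y') |w x y y'.
        x \<in> obj \<Phi> w \<and> y \<in> obj \<Phi> w \<and> y' \<in> obj \<Phi> w} \<union>
     {bvec (w, scal \<Phi> c x, y) - cscale (cnj c) (bvec (w, x, y)) |w c x y.
        x \<in> obj \<Phi> w \<and> y \<in> obj \<Phi> w} \<union>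
     {bvec (w, x, scal \<Phi> c y) - cscale c (bvec (w, x, y)) |w c x y.
        x \<in> obj \<Phi> w \<and> y \<in> obj \<Phi> w}"

text \<open>With \<open>f\<^sub>k\<^sub>i = \<langle>\<eta>\<^sub>k, \<Phi>(f) \<xi>\<^sub>i\<rangle>\<close> the matrix of \<open>\<Phi>(f)\<close>, the intertwining relations are
  \<open>\<Sum>\<^sub>i f\<^sub>k\<^sub>i u\<^sup>w\<^sub>i\<^sub>j = \<Sum>\<^sub>l f\<^sub>l\<^sub>j u\<^sup>w\<^sup>'\<^sub>k\<^sub>l\<close>.\<close>

definition intertwiner_rel :: "'a::ab_group_add functor_data \<Rightarrow> 'a coeff_space set" where
  "intertwiner_rel \<Phi> =
     {(\<Sum>i<length \<xi>. cscale (ip \<Phi> w' (\<eta> ! k) (mor \<Phi> w w' f (\<xi> ! i))) (bvec (w, \<xi> ! i, \<xi> ! j))) -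
      (\<Sum>l<length \<eta>. cscale (ip \<Phi> w' (\<eta> ! l) (mor \<Phi> w w' f (\<xi> ! j))) (bvec (w', \<eta> ! k, \<eta> ! l)))
      |w w' f \<xi> \<eta> j k. f \<in> Hom w w' \<and> onb \<Phi> w \<xi> \<and> onb \<Phi> w' \<eta> \<and> j < length \<xi> \<and> k < length \<eta>}"

definition coend_rel :: "'a::ab_group_add functor_data \<Rightarrow> 'a coeff_space set" where
  "coend_rel \<Phi> = fvec.span (covariance_rel \<Phi> \<union> intertwiner_rel \<Phi>)"

definition coend_algebra ::
  "'a::ab_group_add functor_data \<Rightarrow> (complex, 'a coeff_space set) module" where
  "coend_algebra \<Phi> = quotient_algebra (coeff_algebra \<Phi>) (coend_rel \<Phi>)"

definition coefficient ::
  "'a::ab_group_add functor_data \<Rightarrow> word \<Rightarrow> 'a \<Rightarrow> 'a \<Rightarrow> 'a coeff_space set" where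
  "coefficient \<Phi> w x y = coend_rel \<Phi> +>\<^bsub>coeff_algebra \<Phi>\<^esub> bvec (w, x, y)"

definition coeff_comult ::
  "'a::ab_group_add functor_data \<Rightarrow> 'a coeff_space \<Rightarrow> ('a coeff_space \<times> 'a coeff_space \<Rightarrow>\<^sub>0 complex)" where
  "coeff_comult \<Phi> = lin_ext (\<lambda>(w, x, y).
     let \<xi> = (SOME \<xi>. onb \<Phi> w \<xi>)
     in \<Sum>k<length \<xi>. bvec (bvec (w, x, \<xi> ! k), bvec (w, \<xi> ! k, y)))"

definition star_structure :: "(complex, 'a) module \<Rightarrow> ('a \<Rightarrow> 'a) \<Rightarrow> bool" where
  "star_structure M s \<longleftrightarrow>
    s \<in> carrier M \<rightarrow>\<^sub>E carrier M \<and>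
    (\<forall>x\<in>carrier M. \<forall>y\<in>carrier M. s (x \<oplus>\<^bsub>M\<^esub> y) = s x \<oplus>\<^bsub>M\<^esub> s y) \<and>
    (\<forall>c. \<forall>x\<in>carrier M. s (c \<odot>\<^bsub>M\<^esub> x) = cnj c \<odot>\<^bsub>M\<^esub> s x) \<and>
    (\<forall>x\<in>carrier M. \<forall>y\<in>carrier M. s (x \<otimes>\<^bsub>M\<^esub> y) = s y \<otimes>\<^bsub>M\<^esub> s x) \<and>
    (\<forall>x\<in>carrier M. s (s x) = x)"

definition coend_star ::
  "'a::ab_group_add functor_data \<Rightarrow> 'a coeff_space set \<Rightarrow> 'a coeff_space set" where
  "coend_star \<Phi> = (THE s. let M = coend_algebra \<Phi> in
     star_structure M s \<and>
     (\<forall>w \<xi>. onb \<Phi> w \<xi> \<longrightarrow>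
       (let u = (\<lambda>i j. coefficient \<Phi> w (\<xi> ! i) (\<xi> ! j)); n = length \<xi>
        in \<forall>i<n. \<forall>j<n.
          (\<Oplus>\<^bsub>M\<^esub>k\<in>{..<n}. u i k \<otimes>\<^bsub>M\<^esub> s (u j k)) = (if i = j then \<one>\<^bsub>M\<^esub> else \<zero>\<^bsub>M\<^esub>) \<and>
          (\<Oplus>\<^bsub>M\<^esub>k\<in>{..<n}. s (u k i) \<otimes>\<^bsub>M\<^esub> u k j) = (if i = j then \<one>\<^bsub>M\<^esub> else \<zero>\<^bsub>M\<^esub>))))"

definition tannaka_algebra ::
  "'a::ab_group_add functor_data \<Rightarrow> 'a coeff_space set hopf_star" where
  "tannaka_algebra \<Phi> = with_hopf_star (coend_algebra \<Phi>) (coend_star \<Phi>)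
     (quotient_comult (coeff_algebra \<Phi>) (coend_rel \<Phi>) (coeff_comult \<Phi>))"


section \<open>The universal quantum groups\<close>

datatype 'g fword = FWord (letters: "'g list")

instantiation fword :: (type) monoid_add
begin

definition "0 = FWord []"

definition "v + w = FWord (letters v @ letters w)"

instance
  by standard (auto simp: zero_fword_def plus_fword_def)

end

text \<open>The letter \<open>(i, j, False)\<close> stands for \<open>u\<^sub>i\<^sub>j\<close> and \<open>(i, j, True)\<close> for \<open>u\<^sub>i\<^sub>j\<^sup>*\<close>. The product of
  finitely supported functions is convolution, so that this is the free \<open>*\<close>-algebra on the \<open>u\<^sub>i\<^sub>j\<close>
  when the indices are restricted to \<open>i, j < n\<close>.\<close>

type_synonym free_star = "(nat \<times> nat \<times> bool) fword \<Rightarrow>\<^sub>0 complex"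

definition gen :: "nat \<times> nat \<times> bool \<Rightarrow> free_star" where
  "gen g = bvec (FWord [g])"

definition free_algebra :: "nat \<Rightarrow> (complex, free_star) module" where
  "free_algebra n =
    \<lparr>carrier = {a. \<forall>w\<in>Poly_Mapping.keys a. \<forall>(i, j, s)\<in>set (letters w). i < n \<and> j < n},
     monoid.mult = (*), one = 1, zero = 0, add = (+), module.smult = cscale\<rparr>"

definition free_invol :: "free_star \<Rightarrow> free_star" where
  "free_invol = conj_lin_ext
     (\<lambda>w. bvec (FWord (rev (map (\<lambda>(i, j, s). (i, j, \<not> s)) (letters w)))))"

text \<open>The multiplicative extension of \<open>\<Delta>(u\<^sub>i\<^sub>j) = \<Sum>\<^sub>k u\<^sub>i\<^sub>k \<otimes> u\<^sub>k\<^sub>j\<close> and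
  \<open>\<Delta>(u\<^sub>i\<^sub>j\<^sup>*) = \<Sum>\<^sub>k u\<^sub>i\<^sub>k\<^sup>* \<otimes> u\<^sub>k\<^sub>j\<^sup>*\<close>.\<close>

fun word_comult :: "nat \<Rightarrow> (nat \<times> nat \<times> bool) list \<Rightarrow> (free_star \<times> free_star \<Rightarrow>\<^sub>0 complex)" where
  "word_comult n [] = bvec (1, 1)"
| "word_comult n ((i, j, s) # gs) =
    (\<Sum>k<n. lin_ext (\<lambda>(a, b). bvec (gen (i, k, s) * a, gen (k, j, s) * b)) (word_comult n gs))"

definition free_comult :: "nat \<Rightarrow> free_star \<Rightarrow> (free_star \<times> free_star \<Rightarrow>\<^sub>0 complex)" where
  "free_comult n = lin_ext (\<lambda>w. word_comult n (letters w))"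

text \<open>The universal \<open>*\<close>-algebra generated by the \<open>u\<^sub>i\<^sub>j\<close> subject to \<open>r = 0\<close> for all \<open>r \<in> Rel\<close>.\<close>

definition star_ideal :: "nat \<Rightarrow> free_star set \<Rightarrow> free_star set" where
  "star_ideal n Rel = Idl\<^bsub>free_algebra n\<^esub> (Rel \<union> free_invol ` Rel)"

definition universal_algebra :: "nat \<Rightarrow> free_star set \<Rightarrow> free_star set hopf_star" where
  "universal_algebra n Rel =
    (let F = free_algebra n; I = star_ideal n Rel
     in with_hopf_star (quotient_algebra F I) (quotient_map F I free_invol)
          (quotient_comult F I (free_comult n)))"

definition fundamental_entry :: "nat \<Rightarrow> free_star set \<Rightarrow> nat \<Rightarrow> nat \<Rightarrow> free_star set" where
  "fundamental_entry n Rel i j = star_ideal n Rel +>\<^bsub>free_algebra n\<^esub> gen (i, j, False)"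

definition u_mat :: "nat \<Rightarrow> free_star mat" where
  "u_mat n = mat n n (\<lambda>(i, j). gen (i, j, False))"

definition bar_mat :: "free_star mat \<Rightarrow> free_star mat" where
  "bar_mat M = map_mat free_invol M"

definition scalar_mat :: "complex mat \<Rightarrow> free_star mat" where
  "scalar_mat Q = map_mat (\<lambda>c. Poly_Mapping.single 0 c) Q"

definition inv_mat :: "complex mat \<Rightarrow> complex mat" where
  "inv_mat Q = the (mat_inverse Q)"

definition unitary_rel :: "nat \<Rightarrow> free_star mat \<Rightarrow> free_star set" where
  "unitary_rel n M =
     elements_mat (M * transpose_mat (bar_mat M) - 1\<^sub>m n) \<union>
     elements_mat (transpose_mat (bar_mat M) * M - 1\<^sub>m n)"

definition van_daele_wang_rel :: "nat \<Rightarrow> complex mat \<Rightarrow> free_star set" where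
  "van_daele_wang_rel n Q =
    (let u = u_mat n; P = scalar_mat Q * bar_mat u * scalar_mat (inv_mat Q)
     in unitary_rel n u \<union>
        elements_mat (transpose_mat u * P - 1\<^sub>m n) \<union>
        elements_mat (P * transpose_mat u - 1\<^sub>m n))"

definition banica_rel :: "nat \<Rightarrow> complex mat \<Rightarrow> free_star set" where
  "banica_rel n G =
     unitary_rel n (u_mat n) \<union>
     unitary_rel n (scalar_mat G * bar_mat (u_mat n) * scalar_mat (inv_mat G))"

definition Au_van_daele_wang :: "nat \<Rightarrow> complex mat \<Rightarrow> free_star set hopf_star" where
  "Au_van_daele_wang n Q = universal_algebra n (van_daele_wang_rel n Q)"

definition Au_banica :: "nat \<Rightarrow> complex mat \<Rightarrow> free_star set hopf_star" where
  "Au_banica n G = universal_algebra n (banica_rel n G)"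

end

theory Submission
  imports Defs
begin

text \<open>
  Applying \<open>\<Phi>\<close> to the zigzag identities shows that the Riesz vectors \<open>q\<^sub>i\<close> of the functionals
  \<open>\<epsilon>(v\<^sub>i \<otimes> _)\<close> and the components \<open>p\<^sub>i\<close> of the cup vector are dual bases of \<open>\<Phi>(X\<^sup>*)\<close>; hence
  \<open>A\<close> is invertible, with Gram matrices \<open>(\<langle>q\<^sub>i, q\<^sub>j\<rangle>) = A A\<^sup>*\<close> and \<open>(\<langle>p\<^sub>i, p\<^sub>j\<rangle>) = (A A\<^sup>*)\<^sup>-\<^sup>1\<close>.
  Sending \<open>u\<^sub>i\<^sub>j\<close> to the coefficient of \<open>X\<close> at \<open>(v\<^sub>i, v\<^sub>j)\<close> and its formal adjoint to the coefficient of
  \<open>X\<^sup>*\<close> at \<open>(p\<^sub>i, q\<^sub>j)\<close> identifies the free algebra with the algebra of coefficients modulo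
  covariance. Removing an innermost arc shows that every diagram is built from identities, caps and
  cups by composition and tensor product, so the coend is the quotient by the intertwining relations
  of the caps and cups alone. These four families of relations become, after multiplication by
  invertible scalar matrices, the relations of Van Daele and Wang and those of Banica. The adjoint
  of the generators extends to a \<open>*\<close>-structure making all coefficient matrices unitary, and unitarity
  determines it.
\<close>

section \<open>Oriented Kauffman diagrams\<close>

text \<open>The obstacle is that the star operation is hidden by orthonormal bases of
  \<Phi>(\<open>Xstar\<close>): the formal adjoint of \<open>u_ij\<close> is a coefficient for the
  dual bases \<open>p\<close> and \<open>q\<close>, which need not be orthonormal. All bases are
  therefore subsumed under resolutions of the identity, here called frames, and the intertwining
  relation of f is put into a form free of bases: the symbol at (f^* x, y) is identified with the
  symbol at (x, f y). Sesquilinearity then allows each relation to be tested on whichever frame is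
  convenient. The Gram matrices enter when a coefficient at (q, q) or (p, p) is expanded into
  generators, which are coefficients at (p, q). With Q the Gram matrix of \<open>q\<close> and P
  that of \<open>p\<close>, the relations arise as follows: the cup of \<open>X\<close> gives u u^*
  = 1, the cap of \<open>Xstar\<close> gives u^* u = 1, the cap of \<open>X\<close> gives u^t Q ubar
  = Q, and the cup of \<open>Xstar\<close> gives ubar P u^t = P. On the side of diagrams, the
  decompositions are chosen so that gluing creates no closed loop; the composites that occur are
  then single diagrams without scalar factors.\<close>

text \<open>Once minima and maxima are resolved, only comparisons between the positions of ends
  remain, so the condition can be transported along any map that preserves or reverses the order of
  positions. \<open>K_pullback\<close>, \<open>dtensor_K\<close> and \<open>reflect_K\<close> rest
  on this form.\<close>

lemma crossing_iff:
  "crossing m n (a, b) (c, e) \<longleftrightarrow>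
    (let p = boundary_pos m n in
      (p a < p c \<and> p a < p e \<or> p b < p c \<and> p b < p e) \<and>
      (p c < p a \<or> p c < p b \<or> p e < p a \<or> p e < p b) \<and>
      (p a < p c \<and> p b < p c \<or> p a < p e \<and> p b < p e))"
  unfolding crossing_def Let_def by (auto simp: min_def max_def)

lemma vertices_simps [simp]:
  "Up i \<in> vertices m n \<longleftrightarrow> i < m" "Lo j \<in> vertices m n \<longleftrightarrow> j < n"
  by (auto simp: vertices_def)

lemma boundary_pos_inj:
  "x \<in> vertices m n \<Longrightarrow> y \<in> vertices m n \<Longrightarrow> boundary_pos m n x = boundary_pos m n y \<Longrightarrow> x = y"
  by (cases x; cases y) auto

lemma boundary_pos_less: "x \<in> vertices m n \<Longrightarrow> boundary_pos m n x < m + n"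
  by (cases x) auto

lemma boundary_pos_surj:
  assumes "k < m + n"
  obtains x where "x \<in> vertices m n" "boundary_pos m n x = k"
proof (cases "k < m")
  case True
  then show ?thesis using that[of "Up k"] by simp
next
  case False
  then show ?thesis using that[of "Lo (n - 1 - (k - m))"] assms by simp
qed

section \<open>Strings of a single noncrossing pairing\<close>

context
  fixes m n D
  assumes D: "oriented_kauffman m n D"
begin

lemma kauffman_vertices:
  assumes "(a, b) \<in> D"
  shows "a \<in> vertices m n" "b \<in> vertices m n" "a \<noteq> b"
  using D assms by (auto simp: oriented_kauffman_def)

lemma kauffman_unique:
  assumes "(a, b) \<in> D" "(c, e) \<in> D" "{a, b} \<inter> {c, e} \<noteq> {}"
  shows "a = c \<and> b = e"
proof -
  obtain x where x: "x \<in> {a, b}" "x \<in> {c, e}" using assms(3) by auto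
  then have "x \<in> vertices m n" using kauffman_vertices assms by auto
  then have "\<exists>!s. s \<in> D \<and> (x = fst s \<or> x = snd s)" using D by (auto simp: oriented_kauffman_def)
  then have "(a, b) = (c, e)" using assms(1,2) x by (metis fst_conv snd_conv empty_iff insert_iff)
  then show ?thesis by simp
qed

lemma kauffman_ex:
  assumes "x \<in> vertices m n"
  shows "\<exists>y. (x, y) \<in> D \<or> (y, x) \<in> D"
proof -
  have "\<exists>!s. s \<in> D \<and> (x = fst s \<or> x = snd s)" using D assms by (auto simp: oriented_kauffman_def)
  then obtain s where "s \<in> D" "x = fst s \<or> x = snd s" by blast
  then show ?thesis by (cases s) auto
qed

lemma kauffman_noncrossing: "s \<in> D \<Longrightarrow> t \<in> D \<Longrightarrow> \<not> crossing m n s t"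
  using D by (auto simp: oriented_kauffman_def)

text \<open>The induction on diagrams removes such a string. Positions run along the upper edge and
  then along the lower edge from right to left, so the two ends are neighbours on one edge or the
  last points of both edges; the left side of the rectangle, where the numbering jumps, does not
  occur.\<close>

lemma kauffman_adjacent:
  assumes "0 < m + n"
  shows "\<exists>a b. (a, b) \<in> D \<and> (boundary_pos m n b = Suc (boundary_pos m n a) \<or>
                              boundary_pos m n a = Suc (boundary_pos m n b))"
proof -
  let ?p = "boundary_pos m n"
  \<comment> \<open>the ends of a shortest string are adjacent, since a string starting between them would cross it or be shorter\<close>
  let ?len = "\<lambda>s. max (?p (fst s)) (?p (snd s)) - min (?p (fst s)) (?p (snd s))"
  obtain x0 where "x0 \<in> vertices m n" using boundary_pos_surj[OF assms] by blast
  then obtain s0 where "s0 \<in> D" using kauffman_ex by blast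
  then have "\<exists>s. s \<in> D \<and> (\<forall>t. t \<in> D \<longrightarrow> ?len s \<le> ?len t)" by (rule ex_has_least_nat)
  then obtain s where s: "s \<in> D" "\<And>t. t \<in> D \<Longrightarrow> ?len s \<le> ?len t" by blast
  obtain a b where ab: "s = (a, b)" by (cases s)
  have abV: "a \<in> vertices m n" "b \<in> vertices m n" "a \<noteq> b" using kauffman_vertices s ab by auto
  define l h where "l = min (?p a) (?p b)" and "h = max (?p a) (?p b)"
  have "?p a \<noteq> ?p b" using boundary_pos_inj abV by blast
  then have lh: "l < h" "h < m + n" using boundary_pos_less abV by (auto simp: l_def h_def)
  have "h = Suc l"
  proof (rule ccontr)
    assume "h \<noteq> Suc l"
    then have l2: "Suc l < h" using lh by simp
    then obtain x where x: "x \<in> vertices m n" "?p x = Suc l"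
      using boundary_pos_surj[of "Suc l"] lh by (metis less_trans)
    then obtain y where y: "(x, y) \<in> D \<or> (y, x) \<in> D" using kauffman_ex by blast
    then have yV: "y \<in> vertices m n" "x \<noteq> y" using kauffman_vertices by blast+
    have xab: "x \<noteq> a" "x \<noteq> b" using x l2 by (auto simp: l_def h_def min_def max_def split: if_splits)
    have "y \<noteq> a" "y \<noteq> b" using y s(1) ab xab kauffman_unique by blast+
    then have "?p y \<noteq> ?p a" "?p y \<noteq> ?p b" using boundary_pos_inj abV yV by blast+
    then have py: "?p y \<noteq> l" "?p y \<noteq> h" by (auto simp: l_def h_def min_def max_def)
    have pxy: "?p x \<noteq> ?p y" using boundary_pos_inj x(1) yV by blast
    consider "?p y < l" | "?p y > h" | "l < ?p y" "?p y < h" using py by linarith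
    then show False
    proof cases
      case 1
      then have "crossing m n (x, y) (a, b)" "crossing m n (y, x) (a, b)"
        using x l2 by (auto simp: crossing_def Let_def l_def h_def)
      then show False using y s(1) ab kauffman_noncrossing by blast
    next
      case 2
      then have "crossing m n (a, b) (x, y)" "crossing m n (a, b) (y, x)"
        using x l2 by (auto simp: crossing_def Let_def l_def h_def)
      then show False using y s(1) ab kauffman_noncrossing by blast
    next
      case 3
      then have "max (?p x) (?p y) - min (?p x) (?p y) < h - l" using x l2 pxy by auto
      moreover have "h - l \<le> max (?p x) (?p y) - min (?p x) (?p y)"
        using y s(2)[of "(x, y)"] s(2)[of "(y, x)"] ab
        by (auto simp: l_def h_def max.commute min.commute)
      ultimately show False by simp
    qed
  qed
  then show ?thesis using s(1) ab \<open>?p a \<noteq> ?p b\<close>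
    by (intro exI[of _ a] exI[of _ b]) (auto simp: l_def h_def min_def max_def split: if_splits)
qed

end

lemma oriented_kauffmanI:
  assumes "\<And>a b. (a, b) \<in> D \<Longrightarrow> a \<in> vertices m n \<and> b \<in> vertices m n \<and> a \<noteq> b"
    and "\<And>a b c e. (a, b) \<in> D \<Longrightarrow> (c, e) \<in> D \<Longrightarrow> {a, b} \<inter> {c, e} \<noteq> {} \<Longrightarrow> a = c \<and> b = e"
    and "\<And>x. x \<in> vertices m n \<Longrightarrow> \<exists>y. (x, y) \<in> D \<or> (y, x) \<in> D"
    and "\<And>a b c e. (a, b) \<in> D \<Longrightarrow> (c, e) \<in> D \<Longrightarrow> \<not> crossing m n (a, b) (c, e)"
  shows "oriented_kauffman m n D"
  unfolding oriented_kauffman_def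
proof (intro conjI ballI)
  show "D \<subseteq> vertices m n \<times> vertices m n" using assms(1) by auto
  show "case s of (a, b) \<Rightarrow> a \<noteq> b" if "s \<in> D" for s using assms(1) that by auto
  show "\<not> crossing m n s t" if "s \<in> D" "t \<in> D" for s t
    using assms(4) that by (cases s; cases t) auto
  fix x assume "x \<in> vertices m n"
  then obtain y where y: "(x, y) \<in> D \<or> (y, x) \<in> D" using assms(3) by blast
  have uniq: "s = t" if "s \<in> D \<and> (x = fst s \<or> x = snd s)" "t \<in> D \<and> (x = fst t \<or> x = snd t)" for s t
    using assms(2)[of "fst s" "snd s" "fst t" "snd t"] that by (cases s; cases t) auto
  show "\<exists>!s. s \<in> D \<and> (x = fst s \<or> x = snd s)"
    using y uniq by (metis fst_conv snd_conv)
qed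

lemma K_iff:
  "D \<in> K w w' \<longleftrightarrow> oriented_kauffman (length w) (length w') D \<and>
    (\<forall>i<length w. (\<exists>b. (Up i, b) \<in> D) \<longleftrightarrow> w ! i = X) \<and>
    (\<forall>j<length w'. (\<exists>a. (a, Lo j) \<in> D) \<longleftrightarrow> w' ! j = X)"
proof -
  have ex: "(if P then X else Xstar) = l \<longleftrightarrow> (P \<longleftrightarrow> l = X)" for P l by (cases l) auto
  show ?thesis
    unfolding K_def upper_word_def lower_word_def list_eq_iff_nth_eq by (simp add: ex cong: conj_cong)
qed

lemma K_kauffman: "D \<in> K w w' \<Longrightarrow> oriented_kauffman (length w) (length w') D"
  by (simp add: K_iff)

text \<open>By uniqueness of the string at a vertex, a vertex at which a string ends cannot start
  another one. This settles the letter \<open>Xstar\<close>, which \<open>K_iff\<close> captures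
  only as the failure of \<open>X\<close>.\<close>

lemma K_letters:
  assumes "D \<in> K w w'"
  shows "(Up i, b) \<in> D \<Longrightarrow> w ! i = X" "(b, Up i) \<in> D \<Longrightarrow> w ! i = Xstar"
    "(b, Lo j) \<in> D \<Longrightarrow> w' ! j = X" "(Lo j, b) \<in> D \<Longrightarrow> w' ! j = Xstar"
proof -
  have k: "oriented_kauffman (length w) (length w') D" using assms by (simp add: K_iff)
  have letter: "l = Xstar" if "l \<noteq> X" for l using that by (cases l) auto
  note V = kauffman_vertices[OF k] and U = kauffman_unique[OF k]
  show "w ! i = X" if "(Up i, b) \<in> D" using that V[OF that] assms by (auto simp: K_iff)
  show "w' ! j = X" if "(b, Lo j) \<in> D" using that V[OF that] assms by (auto simp: K_iff)
  show "w ! i = Xstar" if h: "(b, Up i) \<in> D"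
  proof (rule letter, rule notI)
    assume "w ! i = X"
    then obtain c where "(Up i, c) \<in> D" using h V[OF h] assms by (auto simp: K_iff)
    then show False using U[OF h] V[OF h] by auto
  qed
  show "w' ! j = Xstar" if h: "(Lo j, b) \<in> D"
  proof (rule letter, rule notI)
    assume "w' ! j = X"
    then obtain c where "(c, Lo j) \<in> D" using h V[OF h] assms by (auto simp: K_iff)
    then show False using U[OF h] V[OF h] by auto
  qed
qed

section \<open>Restriction and juxtaposition of diagrams\<close>

fun vmap :: "(nat \<Rightarrow> nat) \<Rightarrow> (nat \<Rightarrow> nat) \<Rightarrow> vertex \<Rightarrow> vertex" where
  "vmap f g (Up i) = Up (f i)"
| "vmap f g (Lo j) = Lo (g j)"

text \<open>A union of strings of \<open>D\<close>, renumbered, is again a diagram. The increasing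
  maps \<open>f\<close> and \<open>g\<close> embed the new points into the old ones and respect
  letters; \<open>closed\<close> says that no string leads out of their image. As the order along
  the boundary is preserved, no crossing can arise. This serves to remove an arc as well as a
  through string.\<close>

lemma K_pullback:
  assumes D: "D \<in> K w w'"
    and f: "\<And>i. i < length u \<Longrightarrow> f i < length w \<and> u ! i = w ! f i"
      "\<And>i j. i < j \<Longrightarrow> j < length u \<Longrightarrow> f i < f j"
    and g: "\<And>i. i < length u' \<Longrightarrow> g i < length w' \<and> u' ! i = w' ! g i"
      "\<And>i j. i < j \<Longrightarrow> j < length u' \<Longrightarrow> g i < g j"
    and closed: "\<And>x b. x \<in> vertices (length u) (length u') \<Longrightarrow>
      (vmap f g x, b) \<in> D \<or> (b, vmap f g x) \<in> D \<Longrightarrow> b \<in> vmap f g ` vertices (length u) (length u')"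
  shows "{(x, y). x \<in> vertices (length u) (length u') \<and> y \<in> vertices (length u) (length u') \<and>
           (vmap f g x, vmap f g y) \<in> D} \<in> K u u'" (is "?D \<in> _")
proof -
  let ?V = "vertices (length u) (length u')" and ?\<phi> = "vmap f g"
  let ?p = "boundary_pos (length u) (length u')" and ?q = "boundary_pos (length w) (length w')"
  have k: "oriented_kauffman (length w) (length w') D" using D by (simp add: K_iff)
  \<comment> \<open>Upper points precede lower ones on both sides. On the lower edge positions count
    backwards, so larger positions are smaller indices, and the increasing map \<open>g\<close>
    still preserves the order.\<close>
  have less: "?q (?\<phi> x) < ?q (?\<phi> y)" if "x \<in> ?V" "y \<in> ?V" "?p x < ?p y" for x y
  proof (cases x; cases y)
    fix i j assume "x = Up i" "y = Up j"
    then show ?thesis using that f by auto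
  next
    fix i j assume xy: "x = Up i" "y = Lo j"
    then show ?thesis using that f(1)[of i] by auto
  next
    fix i j assume xy: "x = Lo i" "y = Lo j"
    then have "j < i" "i < length u'" using that by auto
    then have "g j < g i" "g i < length w'" using g by auto
    then show ?thesis using xy by auto
  qed (use that in auto)
  have iff: "?p x < ?p y \<longleftrightarrow> ?q (?\<phi> x) < ?q (?\<phi> y)" if "x \<in> ?V" "y \<in> ?V" for x y
    using less[OF that] less[OF that(2,1)] boundary_pos_inj[OF that] by (metis linorder_neqE_nat less_asym)
  have inj: "x = y" if "x \<in> ?V" "y \<in> ?V" "?\<phi> x = ?\<phi> y" for x y
    using iff[OF that(1,2)] iff[OF that(2,1)] that boundary_pos_inj[OF that(1,2)]
    by (metis linorder_neqE_nat less_irrefl)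
  have "oriented_kauffman (length u) (length u') ?D"
  proof (rule oriented_kauffmanI)
    show "a \<in> ?V \<and> b \<in> ?V \<and> a \<noteq> b" if "(a, b) \<in> ?D" for a b
      using that kauffman_vertices(3)[OF k] by auto
    show "a = c \<and> b = e" if "(a, b) \<in> ?D" "(c, e) \<in> ?D" "{a, b} \<inter> {c, e} \<noteq> {}" for a b c e
    proof -
      have "?\<phi> a = ?\<phi> c \<and> ?\<phi> b = ?\<phi> e"
        using that by (intro kauffman_unique[OF k]) auto
      then show ?thesis using inj that by auto
    qed
    show "\<exists>y. (x, y) \<in> ?D \<or> (y, x) \<in> ?D" if x: "x \<in> ?V" for x
    proof -
      have "?\<phi> x \<in> vertices (length w) (length w')" using x f g by (cases x) auto
      then obtain b where b: "(?\<phi> x, b) \<in> D \<or> (b, ?\<phi> x) \<in> D" using kauffman_ex[OF k] by blast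
      then obtain y where "y \<in> ?V" "b = ?\<phi> y" using closed[OF x] by blast
      then show ?thesis using b x by auto
    qed
    show "\<not> crossing (length u) (length u') (a, b) (c, e)" if "(a, b) \<in> ?D" "(c, e) \<in> ?D" for a b c e
    proof -
      have "\<not> crossing (length w) (length w') (?\<phi> a, ?\<phi> b) (?\<phi> c, ?\<phi> e)"
        using that kauffman_noncrossing[OF k] by auto
      then show ?thesis using that by (simp add: crossing_iff iff Let_def)
    qed
  qed
  moreover have "(\<exists>b. (Up i, b) \<in> ?D) \<longleftrightarrow> u ! i = X" if "i < length u" for i
  proof -
    have "u ! i = X \<longleftrightarrow> (\<exists>b. (Up (f i), b) \<in> D)" using f(1)[OF that] D by (auto simp: K_iff)
    also have "\<dots> \<longleftrightarrow> (\<exists>b. (Up i, b) \<in> ?D)" using closed[of "Up i"] that by fastforce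
    finally show ?thesis by simp
  qed
  moreover have "(\<exists>b. (b, Lo i) \<in> ?D) \<longleftrightarrow> u' ! i = X" if "i < length u'" for i
  proof -
    have "u' ! i = X \<longleftrightarrow> (\<exists>b. (b, Lo (g i)) \<in> D)" using g(1)[OF that] D by (auto simp: K_iff)
    also have "\<dots> \<longleftrightarrow> (\<exists>b. (b, Lo i) \<in> ?D)" using closed[of "Lo i"] that by fastforce
    finally show ?thesis by simp
  qed
  ultimately show ?thesis by (simp add: K_iff)
qed

definition dtensor :: "nat \<Rightarrow> nat \<Rightarrow> diagram \<Rightarrow> diagram \<Rightarrow> diagram" where
  "dtensor m n D E = D \<union> map_prod (shift m n) (shift m n) ` E"

text \<open>The two halves cannot cross: along the boundary the points of the second diagram fill
  one interval, from \<open>m1\<close> up to but excluding \<open>m1 + m2 + n2\<close>, and those of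
  the first lie outside it. Within each half the order of positions is unchanged.\<close>

lemma dtensor_K:
  assumes D: "D \<in> K w w'" and E: "E \<in> K u u'"
  shows "dtensor (length w) (length w') D E \<in> K (w @ u) (w' @ u')"
proof -
  define m1 n1 m2 n2 where "m1 = length w" and "n1 = length w'" and "m2 = length u" and "n2 = length u'"
  note defs = m1_def n1_def m2_def n2_def
  let ?s = "shift m1 n1" and ?p = "boundary_pos (m1 + m2) (n1 + n2)"
  let ?T = "dtensor m1 n1 D E"
  have kD: "oriented_kauffman m1 n1 D" and kE: "oriented_kauffman m2 n2 E"
    using D E by (simp_all add: K_iff defs)
  note VD = kauffman_vertices[OF kD] and VE = kauffman_vertices[OF kE]
  have T: "(a, b) \<in> ?T \<longleftrightarrow> (a, b) \<in> D \<or> (\<exists>x y. (x, y) \<in> E \<and> a = ?s x \<and> b = ?s y)" for a b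
    by (auto simp: dtensor_def)
  have sV: "?s x \<in> vertices (m1 + m2) (n1 + n2) \<and> ?s x \<notin> vertices m1 n1"
    if "x \<in> vertices m2 n2" for x using that by (cases x) auto
  have DV: "x \<in> vertices (m1 + m2) (n1 + n2)" if "x \<in> vertices m1 n1" for x
    using that by (cases x) auto
  have s_inj: "?s x = ?s y \<longleftrightarrow> x = y" for x y by (cases x; cases y) auto
  have split: "x \<in> vertices m1 n1 \<or> (\<exists>y\<in>vertices m2 n2. x = ?s y)"
    if "x \<in> vertices (m1 + m2) (n1 + n2)" for x
  proof (cases x)
    case (Up i) then show ?thesis using that
      by (cases "i < m1") (auto intro!: bexI[of _ "Up (i - m1)"])
  next
    case (Lo i) then show ?thesis using that
      by (cases "i < n1") (auto intro!: bexI[of _ "Lo (i - n1)"])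
  qed
  have pD: "?p x < ?p y \<longleftrightarrow> boundary_pos m1 n1 x < boundary_pos m1 n1 y"
    if "x \<in> vertices m1 n1" "y \<in> vertices m1 n1" for x y using that by (cases x; cases y) auto
  have pE: "?p (?s x) < ?p (?s y) \<longleftrightarrow> boundary_pos m2 n2 x < boundary_pos m2 n2 y"
    if "x \<in> vertices m2 n2" "y \<in> vertices m2 n2" for x y using that by (cases x; cases y) auto
  have rD: "?p x < m1 \<or> m1 + m2 + n2 \<le> ?p x" if "x \<in> vertices m1 n1" for x
    using that by (cases x) auto
  have rE: "m1 \<le> ?p (?s x) \<and> ?p (?s x) < m1 + m2 + n2" if "x \<in> vertices m2 n2" for x
    using that by (cases x) auto
  have "oriented_kauffman (m1 + m2) (n1 + n2) ?T"
  proof (rule oriented_kauffmanI)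
    show "a \<in> vertices (m1 + m2) (n1 + n2) \<and> b \<in> vertices (m1 + m2) (n1 + n2) \<and> a \<noteq> b"
      if "(a, b) \<in> ?T" for a b
      using that VD VE sV DV s_inj unfolding T by blast
    show "a = c \<and> b = e" if h: "(a, b) \<in> ?T" "(c, e) \<in> ?T" "{a, b} \<inter> {c, e} \<noteq> {}" for a b c e
    proof -
      consider "(a, b) \<in> D" "(c, e) \<in> D"
        | x y where "(a, b) \<in> D" "(x, y) \<in> E" "c = ?s x" "e = ?s y"
        | x y where "(c, e) \<in> D" "(x, y) \<in> E" "a = ?s x" "b = ?s y"
        | x y z t where "(x, y) \<in> E" "(z, t) \<in> E" "a = ?s x" "b = ?s y" "c = ?s z" "e = ?s t"
        using h(1,2) unfolding T by blast
      then show ?thesis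
      proof cases
        case 1 then show ?thesis using kauffman_unique[OF kD] h(3) by blast
      next
        case 2 then show ?thesis using VD VE sV h(3) by blast
      next
        case 3 then show ?thesis using VD VE sV h(3) by blast
      next
        case 4
        then have "{x, y} \<inter> {z, t} \<noteq> {}" using h(3) s_inj by auto
        then have "x = z \<and> y = t" by (rule kauffman_unique[OF kE 4(1,2)])
        then show ?thesis unfolding 4(3-6) by simp
      qed
    qed
    show "\<exists>y. (x, y) \<in> ?T \<or> (y, x) \<in> ?T" if "x \<in> vertices (m1 + m2) (n1 + n2)" for x
      using split[OF that] kauffman_ex[OF kD] kauffman_ex[OF kE] unfolding T by blast
    show "\<not> crossing (m1 + m2) (n1 + n2) (a, b) (c, e)" if h: "(a, b) \<in> ?T" "(c, e) \<in> ?T" for a b c e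
    proof -
      consider "(a, b) \<in> D" "(c, e) \<in> D"
        | x y where "(a, b) \<in> D" "(x, y) \<in> E" "c = ?s x" "e = ?s y"
        | x y where "(c, e) \<in> D" "(x, y) \<in> E" "a = ?s x" "b = ?s y"
        | x y z t where "(x, y) \<in> E" "(z, t) \<in> E" "a = ?s x" "b = ?s y" "c = ?s z" "e = ?s t"
        using h unfolding T by blast
      then show ?thesis
      proof cases
        case 1 then show ?thesis
          using kauffman_noncrossing[OF kD 1] VD[OF 1(1)] VD[OF 1(2)] by (simp add: crossing_iff pD Let_def)
      next
        case 2 then show ?thesis
          using rD[OF VD(1)[OF 2(1)]] rD[OF VD(2)[OF 2(1)]] rE[OF VE(1)[OF 2(2)]] rE[OF VE(2)[OF 2(2)]]
          unfolding crossing_iff Let_def 2(3,4) by linarith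
      next
        case 3 then show ?thesis
          using rD[OF VD(1)[OF 3(1)]] rD[OF VD(2)[OF 3(1)]] rE[OF VE(1)[OF 3(2)]] rE[OF VE(2)[OF 3(2)]]
          unfolding crossing_iff Let_def 3(3,4) by linarith
      next
        case 4 then show ?thesis
          using kauffman_noncrossing[OF kE 4(1,2)] VE[OF 4(1)] VE[OF 4(2)] by (simp add: crossing_iff pE Let_def)
      qed
    qed
  qed
  moreover have "(\<exists>b. (Up i, b) \<in> ?T) \<longleftrightarrow> (w @ u) ! i = X" if "i < m1 + m2" for i
  proof (cases "i < m1")
    case True
    then have "Up i \<noteq> ?s x" for x by (cases x) auto
    then have "(\<exists>b. (Up i, b) \<in> ?T) \<longleftrightarrow> (\<exists>b. (Up i, b) \<in> D)" by (simp add: T)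
    then show ?thesis using True D by (simp add: K_iff nth_append defs)
  next
    case False
    have s: "Up i = ?s x \<longleftrightarrow> x = Up (i - m1)" for x using False by (cases x) auto
    have nD: "(Up i, b) \<notin> D" for b using VD(1)[of "Up i" b] False by auto
    have "(Up i, b) \<in> ?T \<longleftrightarrow> (\<exists>y. (Up (i - m1), y) \<in> E \<and> b = ?s y)" for b by (simp add: T s nD)
    then have "(\<exists>b. (Up i, b) \<in> ?T) \<longleftrightarrow> (\<exists>b. (Up (i - m1), b) \<in> E)" by auto
    then show ?thesis using False that E by (simp add: K_iff nth_append defs)
  qed
  moreover have "(\<exists>b. (b, Lo i) \<in> ?T) \<longleftrightarrow> (w' @ u') ! i = X" if "i < n1 + n2" for i
  proof (cases "i < n1")
    case True
    then have "Lo i \<noteq> ?s x" for x by (cases x) auto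
    then have "(\<exists>b. (b, Lo i) \<in> ?T) \<longleftrightarrow> (\<exists>b. (b, Lo i) \<in> D)" by (simp add: T)
    then show ?thesis using True D by (simp add: K_iff nth_append defs)
  next
    case False
    have s: "Lo i = ?s x \<longleftrightarrow> x = Lo (i - n1)" for x using False by (cases x) auto
    have nD: "(b, Lo i) \<notin> D" for b using VD(2)[of b "Lo i"] False by auto
    have "(b, Lo i) \<in> ?T \<longleftrightarrow> (\<exists>y. (y, Lo (i - n1)) \<in> E \<and> b = ?s y)" for b by (simp add: T s nD)
    then have "(\<exists>b. (b, Lo i) \<in> ?T) \<longleftrightarrow> (\<exists>b. (b, Lo (i - n1)) \<in> E)" by auto
    then show ?thesis using False that E by (simp add: K_iff nth_append defs)
  qed
  ultimately show ?thesis by (simp add: K_iff defs)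
qed

lemma diagram_eqI: "(\<And>a b. (a, b) \<in> D \<longleftrightarrow> (a, b) \<in> E) \<Longrightarrow> D = (E :: diagram)"
  by auto

lemma in_id_diagram:
  "(x, y) \<in> id_diagram w \<longleftrightarrow>
    (\<exists>i<length w. w ! i = X \<and> x = Up i \<and> y = Lo i \<or> w ! i = Xstar \<and> x = Lo i \<and> y = Up i)"
proof -
  have "w ! i \<noteq> X \<longleftrightarrow> w ! i = Xstar" for i by (cases "w ! i") auto
  then show ?thesis unfolding id_diagram_def by auto
qed

lemma id_diagram_Nil: "id_diagram [] = {}"
  by (simp add: id_diagram_def)

lemma id_diagram_append:
  "id_diagram (w @ w') = dtensor (length w) (length w) (id_diagram w) (id_diagram w')"
proof (rule diagram_eqI)
  fix a b
  let ?s = "shift (length w) (length w)"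
  have "(a, b) \<in> dtensor (length w) (length w) (id_diagram w) (id_diagram w') \<longleftrightarrow>
      (a, b) \<in> id_diagram w \<or> (\<exists>x y. (x, y) \<in> id_diagram w' \<and> a = ?s x \<and> b = ?s y)"
    by (auto simp: dtensor_def)
  also have "\<dots> \<longleftrightarrow> (a, b) \<in> id_diagram w \<or> (\<exists>i<length w'.
      w' ! i = X \<and> a = Up (length w + i) \<and> b = Lo (length w + i) \<or>
      w' ! i = Xstar \<and> a = Lo (length w + i) \<and> b = Up (length w + i))"
    unfolding in_id_diagram by (auto; metis shift.simps)
  also have "\<dots> \<longleftrightarrow> (a, b) \<in> id_diagram (w @ w')" (is "?l \<longleftrightarrow> ?r")
  proof
    assume ?l
    then show ?r
    proof
      assume "(a, b) \<in> id_diagram w"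
      then show ?r unfolding in_id_diagram by (force simp: nth_append)
    next
      assume "\<exists>i<length w'. w' ! i = X \<and> a = Up (length w + i) \<and> b = Lo (length w + i) \<or>
        w' ! i = Xstar \<and> a = Lo (length w + i) \<and> b = Up (length w + i)"
      then obtain i where "i < length w'" "w' ! i = X \<and> a = Up (length w + i) \<and> b = Lo (length w + i) \<or>
        w' ! i = Xstar \<and> a = Lo (length w + i) \<and> b = Up (length w + i)" by blast
      then show ?r unfolding in_id_diagram by (intro exI[of _ "length w + i"]) auto
    qed
  next
    assume ?r
    then obtain i where i: "i < length w + length w'"
      "(w @ w') ! i = X \<and> a = Up i \<and> b = Lo i \<or> (w @ w') ! i = Xstar \<and> a = Lo i \<and> b = Up i"
      unfolding in_id_diagram by auto
    show ?l
    proof (cases "i < length w")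
      case True then show ?thesis using i unfolding in_id_diagram by (auto simp: nth_append)
    next
      case False
      then have "length w + (i - length w) = i" "i - length w < length w'" using i by auto
      then show ?thesis using i False by (intro disjI2 exI[of _ "i - length w"]) (auto simp: nth_append)
    qed
  qed
  finally show "(a, b) \<in> id_diagram (w @ w') \<longleftrightarrow>
      (a, b) \<in> dtensor (length w) (length w) (id_diagram w) (id_diagram w')" by simp
qed

lemma id_diagram_single:
  "id_diagram [a] = (if a = X then {(Up 0, Lo 0)} else {(Lo 0, Up 0)})"
  by (auto simp: id_diagram_def)

lemma vertices_expand:
  "x \<in> vertices m n \<longleftrightarrow> (\<exists>i<m. x = Up i) \<or> (\<exists>j<n. x = Lo j)"
  by (cases x) auto

lemma single_arc_K:
  "id_diagram [a] \<in> K [a] [a]"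
  "{(Up 0, Up 1)} \<in> K [X, Xstar] []" "{(Up 1, Up 0)} \<in> K [Xstar, X] []"
  "{(Lo 1, Lo 0)} \<in> K [] [X, Xstar]" "{(Lo 0, Lo 1)} \<in> K [] [Xstar, X]"
  by (cases a; auto simp: K_iff id_diagram_single less_Suc_eq numeral_2_eq_2 vertices_expand crossing_def
      intro!: oriented_kauffmanI)+

lemma empty_K: "{} \<in> K [] []"
  by (auto simp: K_iff vertices_expand intro!: oriented_kauffmanI)

lemma id_diagram_K: "id_diagram w \<in> K w w"
proof (induction w)
  case Nil then show ?case using empty_K by (simp add: id_diagram_Nil)
next
  case (Cons a w)
  then show ?case using dtensor_K[OF single_arc_K(1)[of a] Cons] id_diagram_append[of "[a]" w] by simp
qed

section \<open>Reflection in a horizontal line\<close>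

lemma flip_flip [simp]: "flip (flip x) = x" by (cases x) auto

lemma flip_eq_iff [simp]: "flip x = flip y \<longleftrightarrow> x = y" by (metis flip_flip)

lemma in_reflect [simp]: "(a, b) \<in> reflect D \<longleftrightarrow> (flip b, flip a) \<in> D"
  unfolding reflect_def by (auto, metis flip_flip)

lemma reflect_reflect [simp]: "reflect (reflect D) = D"
  by auto

lemma reflect_dtensor: "reflect (dtensor m n D E) = dtensor n m (reflect D) (reflect E)"
proof -
  have sf: "flip (shift m n x) = shift n m (flip x)" for x m n by (cases x) auto
  have *: "(a, b) \<in> dtensor m n D E \<longleftrightarrow>
     (a, b) \<in> D \<or> (\<exists>x y. (x, y) \<in> E \<and> a = shift m n x \<and> b = shift m n y)" for a b m n D E
    by (auto simp: dtensor_def)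
  have "(a, b) \<in> reflect (dtensor m n D E) \<longleftrightarrow> (a, b) \<in> dtensor n m (reflect D) (reflect E)" for a b
    unfolding in_reflect * by (metis sf flip_flip)
  then show ?thesis by auto
qed

lemma reflect_id_diagram: "reflect (id_diagram w) = id_diagram w"
proof -
  have "(a, b) \<in> reflect (id_diagram w) \<longleftrightarrow> (a, b) \<in> id_diagram w" for a b
    unfolding in_reflect in_id_diagram by (cases a; cases b) auto
  then show ?thesis by auto
qed

text \<open>Reflection reverses the order of the boundary positions. Under this reversal a crossing
  of s and t becomes a crossing of t and s, and the noncrossing condition covers both orders of a
  pair.\<close>

lemma reflect_K:
  assumes D: "D \<in> K w w'"
  shows "reflect D \<in> K w' w"
proof -
  let ?m = "length w" and ?n = "length w'"
  have k: "oriented_kauffman ?m ?n D" using D by (simp add: K_iff)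
  have V: "flip x \<in> vertices m n \<longleftrightarrow> x \<in> vertices n m" for x m n by (cases x) auto
  have p: "boundary_pos ?n ?m x < boundary_pos ?n ?m y \<longleftrightarrow>
      boundary_pos ?m ?n (flip y) < boundary_pos ?m ?n (flip x)"
    if "x \<in> vertices ?n ?m" "y \<in> vertices ?n ?m" for x y
    using that by (cases x; cases y) auto
  have "oriented_kauffman ?n ?m (reflect D)"
  proof (rule oriented_kauffmanI)
    show "a \<in> vertices ?n ?m \<and> b \<in> vertices ?n ?m \<and> a \<noteq> b" if "(a, b) \<in> reflect D" for a b
      using that kauffman_vertices[OF k] V by (metis in_reflect)
    show "a = c \<and> b = e" if "(a, b) \<in> reflect D" "(c, e) \<in> reflect D" "{a, b} \<inter> {c, e} \<noteq> {}"
      for a b c e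
      using kauffman_unique[OF k, of "flip b" "flip a" "flip e" "flip c"] that by auto
    show "\<exists>y. (x, y) \<in> reflect D \<or> (y, x) \<in> reflect D" if "x \<in> vertices ?n ?m" for x
      using kauffman_ex[OF k, of "flip x"] that V by (metis in_reflect flip_flip)
    show "\<not> crossing ?n ?m (a, b) (c, e)" if "(a, b) \<in> reflect D" "(c, e) \<in> reflect D" for a b c e
    proof -
      have v: "a \<in> vertices ?n ?m" "b \<in> vertices ?n ?m" "c \<in> vertices ?n ?m" "e \<in> vertices ?n ?m"
        using that kauffman_vertices[OF k] V by (metis in_reflect)+
      have "\<not> crossing ?m ?n (flip e, flip c) (flip b, flip a)"
        using that kauffman_noncrossing[OF k] by auto
      then show ?thesis unfolding crossing_iff Let_def using v by (simp add: p) blast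
    qed
  qed
  moreover have "(\<exists>b. (Up i, b) \<in> reflect D) \<longleftrightarrow> w' ! i = X" if "i < ?n" for i
  proof -
    have "(\<exists>b. (Up i, b) \<in> reflect D) \<longleftrightarrow> (\<exists>b. (b, Lo i) \<in> D)" by (metis in_reflect flip_flip flip.simps)
    then show ?thesis using D that by (simp add: K_iff)
  qed
  moreover have "(\<exists>b. (b, Lo i) \<in> reflect D) \<longleftrightarrow> w ! i = X" if "i < ?m" for i
  proof -
    have "(\<exists>b. (b, Lo i) \<in> reflect D) \<longleftrightarrow> (\<exists>b. (Up i, b) \<in> D)" by (metis in_reflect flip_flip flip.simps)
    then show ?thesis using D that by (simp add: K_iff)
  qed
  ultimately show ?thesis by (simp add: K_iff)
qed

lemma in_glue:
  "(x, y) \<in> glue D E \<longleftrightarrow> (\<exists>a b. (a, b) \<in> D \<and> x = place 0 1 a \<and> y = place 0 1 b) \<or>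
    (\<exists>a b. (a, b) \<in> E \<and> x = place 1 2 a \<and> y = place 1 2 b)"
  by (auto simp: glue_def)

text \<open>The levels 0, 1, 2 of the glued graph turn into 2, 1, 0, which is the map
  \<open>(-) 2\<close>, and every edge is reversed because reflection reverses all orientations.
  Directed paths are therefore traversed backwards.\<close>

lemma glue_reflect:
  "(x, y) \<in> (glue D E)\<^sup>+ \<Longrightarrow>
    (map_prod ((-) 2) id y, map_prod ((-) 2) id x) \<in> (glue (reflect E) (reflect D))\<^sup>+"
proof -
  let ?\<rho> = "map_prod ((-) (2::nat)) (id :: nat \<Rightarrow> nat)"
  have p: "?\<rho> (place 0 1 a) = place 1 2 (flip a)" "?\<rho> (place 1 2 a) = place 0 1 (flip a)" for a
    by (cases a; simp)+
  have reflect_step: "(?\<rho> y, ?\<rho> x) \<in> glue (reflect E) (reflect D)" if "(x, y) \<in> glue D E" for x y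
    using that unfolding in_glue by (metis p in_reflect flip_flip)
  show "(x, y) \<in> (glue D E)\<^sup>+ \<Longrightarrow> (?\<rho> y, ?\<rho> x) \<in> (glue (reflect E) (reflect D))\<^sup>+"
  proof (induction rule: trancl_induct)
    case (base y) then show ?case by (intro r_into_trancl reflect_step)
  next
    case (step y z) then show ?case using trancl_into_trancl2[OF reflect_step] by blast
  qed
qed

lemma concat_reflect: "concat_diagram (reflect E) (reflect D) = reflect (concat_diagram D E)"
proof -
  let ?\<rho> = "map_prod ((-) (2::nat)) (id :: nat \<Rightarrow> nat)"
  have p: "?\<rho> (place 0 2 a) = place 0 2 (flip a)" for a by (cases a) auto
  have *: "(a, b) \<in> concat_diagram D E \<Longrightarrow> (flip b, flip a) \<in> concat_diagram (reflect E) (reflect D)"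
    for a b D E using glue_reflect[of "place 0 2 a" "place 0 2 b" D E] by (simp add: concat_diagram_def p)
  have "(a, b) \<in> concat_diagram (reflect E) (reflect D) \<longleftrightarrow> (a, b) \<in> reflect (concat_diagram D E)" for a b
    using *[of a b "reflect E" "reflect D"] *[of "flip b" "flip a" D E] by auto
  then show ?thesis by auto
qed

lemma acyclic_glue_reflect: "acyclic (glue D E) \<Longrightarrow> acyclic (glue (reflect E) (reflect D))"
  unfolding acyclic_def using glue_reflect[of _ _ "reflect E" "reflect D"]
  by (metis reflect_reflect)

lemma loops_acyclic: "acyclic (glue D E) \<Longrightarrow> loops D E = 0"
  by (simp add: loops_def acyclic_def)

section \<open>Splitting off an arc of the upper edge\<close>

fun dual :: "letter \<Rightarrow> letter" where
  "dual X = Xstar"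
| "dual Xstar = X"

definition cap :: "letter \<Rightarrow> diagram" where
  "cap a = (if a = X then {(Up 0, Up 1)} else {(Up 1, Up 0)})"

lemma cap_K: "cap a \<in> K [a, dual a] []"
  using single_arc_K by (cases a) (auto simp: cap_def)

text \<open>The arc is moved into a separate top layer \<open>C\<close> whose other strings run
  straight through, and \<open>D'\<close> is what remains of \<open>D\<close> below. Acyclicity
  belongs to the conclusion because it turns the equation of diagrams into an equation of
  morphisms.\<close>

lemma cap_decomposition:
  assumes D: "D \<in> K (w1 @ [a, dual a] @ w2) w'"
    and arc: "(if a = X then (Up (length w1), Up (Suc (length w1)))
               else (Up (Suc (length w1)), Up (length w1))) \<in> D" (is "?s \<in> D")
  defines "C \<equiv> dtensor (length w1) (length w1) (id_diagram w1) (dtensor 2 0 (cap a) (id_diagram w2))"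
  obtains D' where "D' \<in> K (w1 @ w2) w'" "concat_diagram C D' = D" "acyclic (glue C D')"
proof -
  define p where "p = length w1"
  define u where "u = w1 @ w2"
  define w where "w = w1 @ [a, dual a] @ w2"
  \<comment> \<open>Skips the two ends \<open>p\<close> and \<open>Suc p\<close> of the arc.\<close>
  define f where "f = (\<lambda>j. if j < p then j else j + 2)"
  let ?V = "vertices (length u) (length w')" and ?\<phi> = "vmap f id"
  define D' where "D' = {(x, y). x \<in> ?V \<and> y \<in> ?V \<and> (?\<phi> x, ?\<phi> y) \<in> D}"
  have DK: "D \<in> K w w'" using D by (simp add: w_def)
  have k: "oriented_kauffman (length w) (length w') D" using DK by (rule K_kauffman)
  have ends: "{fst ?s, snd ?s} = {Up p, Up (Suc p)}" by (auto simp: p_def)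
  have fw: "f i < length w \<and> u ! i = w ! f i" if "i < length u" for i
    using that by (auto simp: f_def u_def w_def p_def nth_append nth_Cons' numeral_2_eq_2)
  have fne: "f i \<noteq> p" "f i \<noteq> Suc p" for i by (auto simp: f_def)
  have fim: "\<exists>j<length u. i = f j" if "i < length w" "i \<noteq> p" "i \<noteq> Suc p" for i
  proof (cases "i < p")
    case True then show ?thesis by (intro exI[of _ i]) (auto simp: f_def u_def p_def)
  next
    case False
    then have "i \<ge> p + 2" using that by simp
    then show ?thesis using that by (intro exI[of _ "i - 2"]) (auto simp: f_def u_def p_def w_def)
  qed
  have \<phi>V: "x \<in> ?\<phi> ` ?V" if "x \<in> vertices (length w) (length w')" "x \<noteq> Up p" "x \<noteq> Up (Suc p)" for x
  proof (cases x)
    case (Up i) then show ?thesis using fim[of i] that by (auto intro!: image_eqI[of _ _ "Up _"])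
  next
    case (Lo i) then show ?thesis using that by (auto intro!: image_eqI[of _ _ "Lo i"])
  qed
  have \<phi>ne: "?\<phi> x \<noteq> Up p" "?\<phi> x \<noteq> Up (Suc p)" for x using fne by (cases x; auto)+
  have other: "x \<noteq> Up p \<and> x \<noteq> Up (Suc p) \<and> y \<noteq> Up p \<and> y \<noteq> Up (Suc p)"
    if "(x, y) \<in> D" "(x, y) \<noteq> ?s" for x y
    using kauffman_unique[OF k that(1), of "fst ?s" "snd ?s"] arc that(2) ends
    by (auto simp: p_def split: if_splits)
  have D'K: "D' \<in> K u w'"
    unfolding D'_def
  proof (rule K_pullback[OF DK])
    fix x b assume x: "x \<in> ?V" "(?\<phi> x, b) \<in> D \<or> (b, ?\<phi> x) \<in> D"
    then have "(?\<phi> x, b) \<noteq> ?s" "(b, ?\<phi> x) \<noteq> ?s" using \<phi>ne[of x] by (auto simp: p_def)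
    then have "b \<noteq> Up p" "b \<noteq> Up (Suc p)" using x(2) other by blast+
    moreover have "b \<in> vertices (length w) (length w')" using x(2) kauffman_vertices[OF k] by blast
    ultimately show "b \<in> ?\<phi> ` ?V" using \<phi>V by blast
  qed (auto simp: f_def fw[unfolded f_def])
  \<comment> \<open>Besides the arc, the layer \<open>C\<close> consists of straight strings between
    the upper point \<open>f j\<close> and the lower point \<open>j\<close>, directed downwards at
    the letter \<open>X\<close> and upwards at \<open>Xstar\<close>.\<close>
  let ?through = "\<lambda>x y. \<exists>j<length u. u ! j = X \<and> x = Up (f j) \<and> y = Lo j \<or>
      u ! j = Xstar \<and> x = Lo j \<and> y = Up (f j)"
  have inC: "(x, y) \<in> C \<longleftrightarrow> (x, y) = ?s \<or> ?through x y" for x y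
  proof -
    have cap: "(x, y) \<in> map_prod (shift p p) (shift p p) ` cap a \<longleftrightarrow> (x, y) = ?s" for x y
      by (auto simp: cap_def p_def)
    have id2: "(x, y) \<in> map_prod (shift p p) (shift p p) ` map_prod (shift 2 0) (shift 2 0) ` id_diagram w2 \<longleftrightarrow>
      (\<exists>i<length w2. w2 ! i = X \<and> x = Up (p + (2 + i)) \<and> y = Lo (p + i) \<or>
          w2 ! i = Xstar \<and> x = Lo (p + i) \<and> y = Up (p + (2 + i)))" (is "?l \<longleftrightarrow> ?r") for x y
    proof
      assume ?l then show ?r by (auto simp: in_id_diagram image_image)
    next
      assume ?r
      then obtain i where i: "i < length w2" "w2 ! i = X \<and> x = Up (p + (2 + i)) \<and> y = Lo (p + i) \<or>
          w2 ! i = Xstar \<and> x = Lo (p + i) \<and> y = Up (p + (2 + i))" by blast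
      from i(2) show ?l
      proof
        assume h: "w2 ! i = X \<and> x = Up (p + (2 + i)) \<and> y = Lo (p + i)"
        then have "(Up i, Lo i) \<in> id_diagram w2" using i(1) by (auto simp: in_id_diagram)
        moreover have "(x, y) = map_prod (shift p p) (shift p p) (map_prod (shift 2 0) (shift 2 0) (Up i, Lo i))"
          using h by simp
        ultimately show ?l by blast
      next
        assume h: "w2 ! i = Xstar \<and> x = Lo (p + i) \<and> y = Up (p + (2 + i))"
        then have "(Lo i, Up i) \<in> id_diagram w2" using i(1) by (auto simp: in_id_diagram)
        moreover have "(x, y) = map_prod (shift p p) (shift p p) (map_prod (shift 2 0) (shift 2 0) (Lo i, Up i))"
          using h by simp
        ultimately show ?l by blast
      qed
    qed
    have thr: "?through x y \<longleftrightarrow> (x, y) \<in> id_diagram w1 \<or>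
      (\<exists>i<length w2. w2 ! i = X \<and> x = Up (p + (2 + i)) \<and> y = Lo (p + i) \<or>
          w2 ! i = Xstar \<and> x = Lo (p + i) \<and> y = Up (p + (2 + i)))" (is "_ \<longleftrightarrow> _ \<or> ?r")
    proof
      assume "?through x y"
      then obtain j where j: "j < length u" "u ! j = X \<and> x = Up (f j) \<and> y = Lo j \<or>
        u ! j = Xstar \<and> x = Lo j \<and> y = Up (f j)" by blast
      show "(x, y) \<in> id_diagram w1 \<or> ?r"
      proof (cases "j < p")
        case True then show ?thesis using j by (auto simp: in_id_diagram f_def u_def p_def nth_append)
      next
        case False
        then have "?r" using j by (intro exI[of _ "j - p"]) (auto simp: f_def u_def p_def nth_append)
        then show ?thesis by blast
      qed
    next
      assume "(x, y) \<in> id_diagram w1 \<or> ?r"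
      then show "?through x y"
      proof
        assume "(x, y) \<in> id_diagram w1"
        then obtain i where "i < length w1" "w1 ! i = X \<and> x = Up i \<and> y = Lo i \<or>
           w1 ! i = Xstar \<and> x = Lo i \<and> y = Up i" by (auto simp: in_id_diagram)
        then show ?thesis by (intro exI[of _ i]) (auto simp: f_def u_def p_def nth_append)
      next
        assume ?r
        then obtain i where "i < length w2" "w2 ! i = X \<and> x = Up (p + (2 + i)) \<and> y = Lo (p + i) \<or>
          w2 ! i = Xstar \<and> x = Lo (p + i) \<and> y = Up (p + (2 + i))" by blast
        then show ?thesis by (intro exI[of _ "p + i"]) (auto simp: f_def u_def p_def nth_append)
      qed
    qed
    show ?thesis unfolding C_def dtensor_def p_def[symmetric] image_Un
      by (simp only: Un_iff cap id2 thr) (simp only: p_def disj_ac)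
  qed
  let ?R = "glue C D'"
  \<comment> \<open>\<open>rk\<close> increases along every step of the glued graph, which excludes closed loops; \<open>\<pi>\<close> projects
     the three lines of the glued graph to the vertices of \<open>D\<close>, so a path runs inside a single string\<close>
  define rk where "rk = (\<lambda>(l, i). if l = (1::nat) then if u ! i = X then 1 else 2
     else if l = 0 then if w ! i = X then 0 else 3 else if w' ! i = X then 3 else (0::nat))"
  define \<pi> where "\<pi> = (\<lambda>(l, i). if l = (0::nat) then Up i else if l = 1 then Up (f i) else Lo i)"
  have \<pi>12: "\<pi> (place 1 2 x) = ?\<phi> x" for x by (cases x) (auto simp: \<pi>_def)
  have \<pi>02: "\<pi> (place 0 2 x) = x" for x by (cases x) (auto simp: \<pi>_def)
  note L = K_letters[OF DK]
  have rank: "rk x < rk y" and proj: "\<pi> x = \<pi> y \<or> (\<pi> x, \<pi> y) \<in> D" if xy: "(x, y) \<in> ?R" for x y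
  proof -
    consider (cap) a' b' where "(a', b') \<in> C" "x = place 0 1 a'" "y = place 0 1 b'"
      | (rest) a' b' where "(a', b') \<in> D'" "x = place 1 2 a'" "y = place 1 2 b'"
      using xy unfolding in_glue by blast
    then have "rk x < rk y \<and> (\<pi> x = \<pi> y \<or> (\<pi> x, \<pi> y) \<in> D)"
    proof cases
      case cap
      show ?thesis
      proof (cases "(a', b') = ?s")
        case True
        then obtain i j where ij: "a' = Up i" "b' = Up j" "(Up i, Up j) \<in> D"
          using arc by (auto split: if_splits)
        then have "w ! i = X" "w ! j = Xstar" using L by auto
        then show ?thesis using cap ij by (auto simp: rk_def \<pi>_def)
      next
        case False
        then obtain j where "j < length u" "u ! j = X \<and> a' = Up (f j) \<and> b' = Lo j \<or>
          u ! j = Xstar \<and> a' = Lo j \<and> b' = Up (f j)" using cap(1) inC by blast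
        then show ?thesis using cap fw[of j] by (auto simp: rk_def \<pi>_def)
      qed
    next
      case rest
      then have m: "(?\<phi> a', ?\<phi> b') \<in> D" "a' \<in> ?V" "b' \<in> ?V" by (auto simp: D'_def)
      have "rk x \<le> 1" using rest(2) m L fw by (cases a') (auto simp: rk_def)
      moreover have "rk y \<ge> 2" using rest(3) m L fw by (cases b') (auto simp: rk_def)
      ultimately show ?thesis using rest m by (simp add: \<pi>12[simplified])
    qed
    then show "rk x < rk y" "\<pi> x = \<pi> y \<or> (\<pi> x, \<pi> y) \<in> D" by auto
  qed
  have acyc: "acyclic ?R"
    by (rule wf_acyclic, rule wf_subset[OF wf_measure[of rk]]) (auto intro: rank)
  have proj_trancl: "\<pi> x = \<pi> y \<or> (\<pi> x, \<pi> y) \<in> D" if "(x, y) \<in> ?R\<^sup>+" for x y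
    using that
  proof (induction rule: trancl_induct)
    case (base y) then show ?case by (rule proj)
  next
    case (step y z)
    show ?case
    proof (cases "\<pi> x = \<pi> y \<or> \<pi> y = \<pi> z")
      case True then show ?thesis using step.IH proj[OF step.hyps(2)] by auto
    next
      \<comment> \<open>Two consecutive moves under the projection would be two strings of
        \<open>D\<close> sharing the vertex \<open>\<pi> y\<close>, one ending and one starting
        there. Uniqueness makes them equal, so that \<open>\<pi> x = \<pi> y\<close>, a
        contradiction.\<close>
      case False
      then have "(\<pi> x, \<pi> y) \<in> D" "(\<pi> y, \<pi> z) \<in> D" using step.IH proj[OF step.hyps(2)] by auto
      then show ?thesis using kauffman_unique[OF k, of "\<pi> x" "\<pi> y" "\<pi> y" "\<pi> z"] False by auto
    qed
  qed
  have "concat_diagram C D' = D"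
  proof (rule diagram_eqI)
    fix x y
    show "(x, y) \<in> concat_diagram C D' \<longleftrightarrow> (x, y) \<in> D"
    proof
      assume "(x, y) \<in> concat_diagram C D'"
      then have t: "(place 0 2 x, place 0 2 y) \<in> ?R\<^sup>+" by (simp add: concat_diagram_def)
      then have "x \<noteq> y" using acyc unfolding acyclic_def by metis
      then show "(x, y) \<in> D" using proj_trancl[OF t] by (simp add: \<pi>02)
    next
      assume xy: "(x, y) \<in> D"
      show "(x, y) \<in> concat_diagram C D'"
      proof (cases "(x, y) = ?s")
        case True
        then have "(x, y) \<in> C" using inC by blast
        then have "(place 0 1 x, place 0 1 y) \<in> ?R" unfolding in_glue by blast
        moreover have "place 0 1 x = place 0 2 x" "place 0 1 y = place 0 2 y" using True by (auto split: if_splits)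
        ultimately show ?thesis by (auto simp: concat_diagram_def)
      next
        case False
        obtain x' y' where x': "x' \<in> ?V" "x = ?\<phi> x'" and y': "y' \<in> ?V" "y = ?\<phi> y'"
          using other[OF xy False] \<phi>V kauffman_vertices[OF k xy] by blast
        have mid: "(place 1 2 x', place 1 2 y') \<in> ?R"
          using xy x' y' unfolding in_glue D'_def by blast
        \<comment> \<open>A string that starts on the upper edge first passes down through the
          layer; a string that starts on the lower edge is already at its place, since
          \<open>place 1 2\<close> and \<open>place 0 2\<close> agree there.\<close>
        have pre: "(place 0 2 x, place 1 2 x') \<in> ?R\<^sup>*"
        proof (cases x')
          case (Up j)
          then have j: "j < length u" "u ! j = X" using x' xy L(1) fw[of j] by auto
          then have "(Up (f j), Lo j) \<in> C" using inC by blast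
          then have "(place 0 1 (Up (f j)), place 0 1 (Lo j)) \<in> ?R" unfolding in_glue by blast
          then show ?thesis using Up x' by auto
        next
          case (Lo j) then show ?thesis using x' by auto
        qed
        have post: "(place 1 2 y', place 0 2 y) \<in> ?R\<^sup>*"
        proof (cases y')
          case (Up j)
          then have j: "j < length u" "u ! j = Xstar" using y' xy L(2) fw[of j] by auto
          then have "(Lo j, Up (f j)) \<in> C" using inC by blast
          then have "(place 0 1 (Lo j), place 0 1 (Up (f j))) \<in> ?R" unfolding in_glue by blast
          then show ?thesis using Up y' by auto
        next
          case (Lo j) then show ?thesis using y' by auto
        qed
        have "(place 0 2 x, place 0 2 y) \<in> ?R\<^sup>+"
          using pre mid post by (meson rtrancl_into_trancl1 trancl_rtrancl_trancl)
        then show ?thesis by (simp add: concat_diagram_def)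
      qed
    qed
  qed
  then show ?thesis using that[of D'] D'K acyc by (simp add: u_def)
qed

section \<open>Free vector spaces\<close>

lemma keys_cscale: "Poly_Mapping.keys (cscale c a) \<subseteq> Poly_Mapping.keys a"
  by (auto simp: in_keys_iff)

text \<open>Sums over different supports can be compared only over a common finite set; this is how
  additivity is obtained.\<close>

lemma lin_ext_superset:
  assumes "finite S" "Poly_Mapping.keys a \<subseteq> S"
  shows "lin_ext f a = (\<Sum>g\<in>S. cscale (Poly_Mapping.lookup a g) (f g))"
  unfolding lin_ext_def using assms by (intro sum.mono_neutral_left) (auto simp: in_keys_iff)

lemma lin_ext_add: "lin_ext f (a + b) = lin_ext f a + lin_ext f b"
proof -
  let ?S = "Poly_Mapping.keys a \<union> Poly_Mapping.keys b"
  have "Poly_Mapping.keys (a + b) \<subseteq> ?S" by (rule Poly_Mapping.keys_add)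
  then show ?thesis
    by (simp add: lin_ext_superset[of ?S] lookup_add fvec.scale_left_distrib sum.distrib)
qed

lemma lin_ext_cscale: "lin_ext f (cscale c a) = cscale c (lin_ext f a)"
  using keys_cscale[of c a]
  by (simp add: lin_ext_superset[of "Poly_Mapping.keys a"] fvec.scale_sum_right)

lemma lin_ext_bvec [simp]: "lin_ext f (bvec g) = f g"
  by (simp add: lin_ext_def)

lemma lin_ext_zero [simp]: "lin_ext f 0 = 0"
  by (simp add: lin_ext_def)

lemma lin_ext_sum: "lin_ext f (sum g S) = (\<Sum>s\<in>S. lin_ext f (g s))"
  by (induction S rule: infinite_finite_induct) (auto simp: lin_ext_add)

lemma lin_ext_diff: "lin_ext f (a - b) = lin_ext f a - lin_ext f b"
  using lin_ext_add[of f "a - b" b] by simp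

lemma lin_ext_cong:
  "(\<And>g. g \<in> Poly_Mapping.keys a \<Longrightarrow> f g = f' g) \<Longrightarrow> lin_ext f a = lin_ext f' a"
  by (simp add: lin_ext_def)

lemma lin_ext_compose: "lin_ext f (lin_ext g a) = lin_ext (\<lambda>x. lin_ext f (g x)) a"
  by (simp add: lin_ext_def[of g] lin_ext_def[of "\<lambda>x. lin_ext f (g x)"] lin_ext_sum lin_ext_cscale)

lemma lin_ext_fun_add: "lin_ext (\<lambda>g. f g + f' g) a = lin_ext f a + lin_ext f' a"
  by (simp add: lin_ext_def fvec.scale_right_distrib sum.distrib)

lemma lin_ext_fun_cscale: "lin_ext (\<lambda>g. cscale c (f g)) a = cscale c (lin_ext f a)"
  by (simp add: lin_ext_def fvec.scale_sum_right mult.commute)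

lemma lin_ext_id [simp]: "lin_ext bvec a = a"
proof (rule poly_mapping_eqI)
  fix k
  have "Poly_Mapping.lookup (lin_ext bvec a) k =
      (\<Sum>g\<in>Poly_Mapping.keys a. if g = k then Poly_Mapping.lookup a g else 0)"
    unfolding lin_ext_def lookup_sum by (intro sum.cong) (auto simp: lookup_single)
  then show "Poly_Mapping.lookup (lin_ext bvec a) k = Poly_Mapping.lookup a k"
    by (simp add: in_keys_iff)
qed

lemma free_decomp: "a = (\<Sum>g\<in>Poly_Mapping.keys a. cscale (Poly_Mapping.lookup a g) (bvec g))"
  by (rule lin_ext_id[of a, unfolded lin_ext_def, symmetric])

lemma lin_ext_in_subspace:
  assumes "fvec.subspace M" "\<And>g. g \<in> Poly_Mapping.keys a \<Longrightarrow> f g \<in> M"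
  shows "lin_ext f a \<in> M"
  unfolding lin_ext_def using assms by (intro fvec.subspace_sum fvec.subspace_scale)

lemma subspace_free: "fvec.subspace {a. Poly_Mapping.keys a \<subseteq> S}"
proof (rule fvec.subspaceI)
  show "a + b \<in> {a. Poly_Mapping.keys a \<subseteq> S}"
    if "a \<in> {a. Poly_Mapping.keys a \<subseteq> S}" "b \<in> {a. Poly_Mapping.keys a \<subseteq> S}" for a b
    using that Poly_Mapping.keys_add[of a b] by blast
  show "cscale c a \<in> {a. Poly_Mapping.keys a \<subseteq> S}" if "a \<in> {a. Poly_Mapping.keys a \<subseteq> S}" for c a
    using that keys_cscale[of c a] by blast
qed simp

text \<open>Linearity is required on the whole free vector space, even for maps whose values matter
  only on a carrier. Restrictions to a carrier are recovered from the support of the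
  argument.\<close>

definition clinear :: "(('g \<Rightarrow>\<^sub>0 complex) \<Rightarrow> ('h \<Rightarrow>\<^sub>0 complex)) \<Rightarrow> bool" where
  "clinear F \<longleftrightarrow> (\<forall>a b. F (a + b) = F a + F b) \<and> (\<forall>c a. F (cscale c a) = cscale c (F a))"

lemma clinear_lin_ext: "clinear (lin_ext f)"
  by (simp add: clinear_def lin_ext_add lin_ext_cscale)

lemma clinearI:
  "(\<And>a b. F (a + b) = F a + F b) \<Longrightarrow> (\<And>c a. F (cscale c a) = cscale c (F a)) \<Longrightarrow> clinear F"
  by (simp add: clinear_def)

lemma clinear_add: "clinear F \<Longrightarrow> F (a + b) = F a + F b"
  by (simp add: clinear_def)

lemma clinear_cscale: "clinear F \<Longrightarrow> F (cscale c a) = cscale c (F a)"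
  by (simp add: clinear_def)

lemma clinear_zero: "clinear F \<Longrightarrow> F 0 = 0"
  using clinear_cscale[of F 0 0] by simp

lemma clinear_sum: "clinear F \<Longrightarrow> F (sum g S) = (\<Sum>s\<in>S. F (g s))"
  by (induction S rule: infinite_finite_induct) (simp_all add: clinear_zero clinear_add)

lemma clinear_diff: "clinear F \<Longrightarrow> F (a - b) = F a - F b"
  using clinear_add[of F "a - b" b] by simp

lemma clinear_eq_lin_ext:
  assumes "clinear F"
  shows "F a = lin_ext (\<lambda>g. F (bvec g)) a"
proof -
  have "F a = F (\<Sum>g\<in>Poly_Mapping.keys a. cscale (Poly_Mapping.lookup a g) (bvec g))"
    by (rule arg_cong[OF free_decomp])
  then show ?thesis by (simp only: clinear_sum[OF assms] clinear_cscale[OF assms] lin_ext_def)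
qed

text \<open>Agreement is asked only on the basis elements that occur in \<open>a\<close>. Membership
  of \<open>a\<close> in a carrier thus constrains the basis elements that have to be
  checked.\<close>

lemma clinear_cong:
  assumes "clinear F" "clinear G" "\<And>g. g \<in> Poly_Mapping.keys a \<Longrightarrow> F (bvec g) = G (bvec g)"
  shows "F a = G a"
  unfolding clinear_eq_lin_ext[OF assms(1), of a] clinear_eq_lin_ext[OF assms(2), of a]
  by (rule lin_ext_cong) (rule assms(3))

lemma clinear_id: "clinear (\<lambda>a. a)"
  by (simp add: clinear_def)

lemma clinear_compose: "clinear F \<Longrightarrow> clinear G \<Longrightarrow> clinear (\<lambda>a. F (G a))"
  by (simp add: clinear_def)

lemma subspace_preimage: "clinear F \<Longrightarrow> fvec.subspace M \<Longrightarrow> fvec.subspace {a. F a \<in> M}"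
  by (simp add: fvec.subspace_def clinear_zero clinear_add clinear_cscale)

lemma clinear_span:
  assumes "clinear F" "fvec.subspace M" "\<And>s. s \<in> S \<Longrightarrow> F s \<in> M" "a \<in> fvec.span S"
  shows "F a \<in> M"
  using fvec.span_minimal[of S "{a. F a \<in> M}"] subspace_preimage[OF assms(1,2)] assms(3,4) by auto

lemma clinear_in_subspace:
  assumes "clinear F" "fvec.subspace M" "\<And>g. g \<in> Poly_Mapping.keys a \<Longrightarrow> F (bvec g) \<in> M"
  shows "F a \<in> M"
  unfolding clinear_eq_lin_ext[OF assms(1), of a] by (intro lin_ext_in_subspace assms)

section \<open>Bilinear and conjugate-linear extension\<close>

lemma bilin_ext_bvec [simp]: "bilin_ext f (bvec g) (bvec h) = f g h"
  by (simp add: bilin_ext_def)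

lemma clinear_bilin_left: "clinear (\<lambda>a. bilin_ext f a b)"
  by (simp add: bilin_ext_def clinear_lin_ext)

lemma clinear_bilin_right: "clinear (bilin_ext f a)"
  by (simp add: bilin_ext_def clinear_def lin_ext_add lin_ext_cscale lin_ext_fun_add lin_ext_fun_cscale)

lemma conj_lin_ext_superset:
  assumes "finite S" "Poly_Mapping.keys a \<subseteq> S"
  shows "conj_lin_ext f a = (\<Sum>g\<in>S. cscale (cnj (Poly_Mapping.lookup a g)) (f g))"
  unfolding conj_lin_ext_def using assms by (intro sum.mono_neutral_left) (auto simp: in_keys_iff)

lemma conj_lin_ext_add: "conj_lin_ext f (a + b) = conj_lin_ext f a + conj_lin_ext f b"
proof -
  let ?S = "Poly_Mapping.keys a \<union> Poly_Mapping.keys b"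
  have "Poly_Mapping.keys (a + b) \<subseteq> ?S" by (rule Poly_Mapping.keys_add)
  then show ?thesis
    by (simp add: conj_lin_ext_superset[of ?S] lookup_add fvec.scale_left_distrib sum.distrib)
qed

lemma conj_lin_ext_cscale: "conj_lin_ext f (cscale c a) = cscale (cnj c) (conj_lin_ext f a)"
  using keys_cscale[of c a]
  by (simp add: conj_lin_ext_superset[of "Poly_Mapping.keys a"] fvec.scale_sum_right)

lemma conj_lin_ext_bvec [simp]: "conj_lin_ext f (bvec g) = f g"
  by (simp add: conj_lin_ext_def)

lemma conj_lin_ext_in_subspace:
  assumes "fvec.subspace M" "\<And>g. g \<in> Poly_Mapping.keys a \<Longrightarrow> f g \<in> M"
  shows "conj_lin_ext f a \<in> M"
  unfolding conj_lin_ext_def using assms by (intro fvec.subspace_sum fvec.subspace_scale)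

section \<open>Composites of single diagrams, and the strings that are split off\<close>

lemma subspace_Hom: "fvec.subspace (Hom w w')"
  unfolding Hom_def by (rule subspace_free)

lemma bvec_Hom: "D \<in> K w w' \<Longrightarrow> bvec D \<in> Hom w w'"
  by (simp add: Hom_def)

lemma comp_mor_acyclic:
  "acyclic (glue D E) \<Longrightarrow> comp_mor d (bvec E) (bvec D) = bvec (concat_diagram D E)"
  by (simp add: comp_mor_def loops_acyclic)

lemma tensor_mor_bvec: "tensor_mor m n (bvec D) (bvec E) = bvec (dtensor m n D E)"
  by (simp add: tensor_mor_def dtensor_def)

text \<open>A string joining two neighbours of the upper edge starts at the one labelled
  \<open>X\<close> and ends at the one labelled \<open>Xstar\<close>; its orientation therefore
  forces the two letters to be dual.\<close>

lemma K_split_adjacent: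
  assumes D: "D \<in> K w w'" and arc: "(Up p, Up (Suc p)) \<in> D \<or> (Up (Suc p), Up p) \<in> D"
  obtains w1 a w2 where "w = w1 @ [a, dual a] @ w2" "length w1 = p"
    "(if a = X then (Up p, Up (Suc p)) else (Up (Suc p), Up p)) \<in> D"
proof -
  have l: "p < length w" "Suc p < length w" using arc kauffman_vertices[OF K_kauffman[OF D]] by fastforce+
  have a: "w ! Suc p = dual (w ! p)" "(if w ! p = X then (Up p, Up (Suc p)) else (Up (Suc p), Up p)) \<in> D"
    using arc K_letters(1,2)[OF D] by fastforce+
  have "w = take p w @ drop p w" by simp
  also have "drop p w = w ! p # w ! Suc p # drop (Suc (Suc p)) w"
    using l by (simp add: Cons_nth_drop_Suc)
  finally show ?thesis using that[of "take p w" "w ! p" "drop (Suc (Suc p)) w"] l a by simp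
qed

text \<open>A string joining the last points of the two edges has everything else on its left, so it
  is a tensor factor. The remaining diagram is the restriction along identity maps, only the last
  indices being dropped.\<close>

lemma K_split_last:
  assumes D: "D \<in> K w w'" and ij: "Suc i = length w" "Suc j = length w'"
    and arc: "(Up i, Lo j) \<in> D \<or> (Lo j, Up i) \<in> D"
  obtains u u' c D' where "w = u @ [c]" "w' = u' @ [c]" "D' \<in> K u u'"
    "D = dtensor (length u) (length u') D' (id_diagram [c])"
proof -
  define u u' c where "u = butlast w" and "u' = butlast w'" and "c = w ! i"
  have k: "oriented_kauffman (length w) (length w') D" using D by (rule K_kauffman)
  note U = kauffman_unique[OF k]
  have ne: "w \<noteq> []" "w' \<noteq> []" using ij by auto
  have len: "length u = i" "length u' = j" using ij by (auto simp: u_def u'_def)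
  have w: "w = u @ [c]" using ne ij by (metis append_butlast_last_id c_def u_def last_conv_nth diff_Suc_1)
  have c': "w' ! j = c" using arc K_letters[OF D] by (auto simp: c_def)
  have w': "w' = u' @ [c]" using ne ij c' by (metis append_butlast_last_id u'_def last_conv_nth diff_Suc_1)
  let ?V = "vertices (length u) (length u')"
  have vid: "vmap id id x = x" for x by (cases x) auto
  define D' where "D' = {(x, y). x \<in> ?V \<and> y \<in> ?V \<and> (vmap id id x, vmap id id y) \<in> D}"
  have V: "x \<in> ?V \<longleftrightarrow> x \<noteq> Up i \<and> x \<noteq> Lo j" if "x \<in> vertices (length w) (length w')" for x
    using that ij[symmetric] by (cases x) (auto simp: len)
  let ?s = "if c = X then (Up i, Lo j) else (Lo j, Up i)"
  have s: "?s \<in> D" using arc K_letters(1,2)[OF D] by (auto simp: c_def)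
  have dich: "x \<in> ?V \<and> y \<in> ?V \<or> (x, y) = ?s" if "(x, y) \<in> D" for x y
    using kauffman_vertices[OF k that] U[OF that, of "fst ?s" "snd ?s"] s V[of x] V[of y]
    by (auto split: if_splits)
  have "D' \<in> K u u'"
    unfolding D'_def
  proof (rule K_pullback[OF D])
    fix x b assume "x \<in> ?V" "(vmap id id x, b) \<in> D \<or> (b, vmap id id x) \<in> D"
    then have "b \<in> ?V" using dich[of x b] dich[of b x] by (auto simp: vid len split: if_splits)
    then show "b \<in> vmap id id ` ?V" by (simp add: vid)
  qed (auto simp: w w' nth_append)
  moreover have "D = dtensor (length u) (length u') D' (id_diagram [c])"
  proof (rule diagram_eqI)
    fix x y
    have "(x, y) \<in> dtensor (length u) (length u') D' (id_diagram [c]) \<longleftrightarrow>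
        x \<in> ?V \<and> y \<in> ?V \<and> (x, y) \<in> D \<or> (x, y) = ?s"
      by (auto simp: dtensor_def D'_def vid id_diagram_single len)
    then show "(x, y) \<in> D \<longleftrightarrow> (x, y) \<in> dtensor (length u) (length u') D' (id_diagram [c])"
      using dich[of x y] s by auto
  qed
  ultimately show ?thesis using that w w' by blast
qed

section \<open>Diagrams generated by caps and cups\<close>

text \<open>Induction on the number of boundary points along the three cases left by
  \<open>kauffman_adjacent\<close>: an arc on the upper edge is split off by
  \<open>cap_decomposition\<close>, an arc on the lower edge becomes one on the upper edge of the
  reflected diagram, and a string between the two last points is split off as a tensor
  factor.\<close>

theorem K_generated:
  assumes id: "\<And>a. G [a] [a] (bvec (id_diagram [a]))"
    and empty: "G [] [] (bvec {})"
    and cap: "\<And>a. G [a, dual a] [] (bvec (cap a))"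
    and cup: "\<And>a. G [] [a, dual a] (bvec (reflect (cap a)))"
    and comp: "\<And>w w' w'' f g. f \<in> Hom w w' \<Longrightarrow> g \<in> Hom w' w'' \<Longrightarrow> G w w' f \<Longrightarrow> G w' w'' g \<Longrightarrow>
      G w w'' (comp_mor d g f)"
    and tensor: "\<And>w1 w1' w2 w2' f g. f \<in> Hom w1 w1' \<Longrightarrow> g \<in> Hom w2 w2' \<Longrightarrow> G w1 w1' f \<Longrightarrow> G w2 w2' g \<Longrightarrow>
      G (w1 @ w2) (w1' @ w2') (tensor_mor (length w1) (length w1') f g)"
  shows "D \<in> K w w' \<Longrightarrow> G w w' (bvec D)"
proof (induction "length w + length w'" arbitrary: w w' D rule: less_induct)
  case less
  have tens: "G (w1 @ w2) (w1' @ w2') (bvec (dtensor (length w1) (length w1') D E))"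
    if "D \<in> K w1 w1'" "E \<in> K w2 w2'" "G w1 w1' (bvec D)" "G w2 w2' (bvec E)" for w1 w1' w2 w2' D E
    using tensor[OF bvec_Hom[OF that(1)] bvec_Hom[OF that(2)] that(3,4)] by (simp add: tensor_mor_bvec)
  have idw: "G u u (bvec (id_diagram u))" for u
  proof (induction u)
    case Nil then show ?case using empty by (simp add: id_diagram_Nil)
  next
    case (Cons a u)
    then show ?case
      using tens[OF id_diagram_K id_diagram_K id[of a] Cons] id_diagram_append[of "[a]" u] by simp
  qed
  let ?cap = "\<lambda>w1 a w2. dtensor (length w1) (length w1) (id_diagram w1) (dtensor 2 0 (cap a) (id_diagram w2))"
  have capw: "?cap w1 a w2 \<in> K (w1 @ [a, dual a] @ w2) (w1 @ w2)"
    "G (w1 @ [a, dual a] @ w2) (w1 @ w2) (bvec (?cap w1 a w2))"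
    "G (w1 @ w2) (w1 @ [a, dual a] @ w2) (bvec (reflect (?cap w1 a w2)))" for w1 a w2
  proof -
    have 2: "length [a, dual a] = 2" by simp
    have c1: "dtensor 2 0 (cap a) (id_diagram w2) \<in> K ([a, dual a] @ w2) w2"
      using dtensor_K[OF cap_K[of a] id_diagram_K[of w2]] by (simp add: numeral_2_eq_2)
    have g1: "G ([a, dual a] @ w2) w2 (bvec (dtensor 2 0 (cap a) (id_diagram w2)))"
      using tens[OF cap_K[of a] id_diagram_K[of w2] cap idw] by (simp add: numeral_2_eq_2)
    have c2: "dtensor 0 2 (reflect (cap a)) (id_diagram w2) \<in> K w2 ([a, dual a] @ w2)"
      using dtensor_K[OF reflect_K[OF cap_K[of a]] id_diagram_K[of w2]] by (simp add: numeral_2_eq_2)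
    have g2: "G w2 ([a, dual a] @ w2) (bvec (dtensor 0 2 (reflect (cap a)) (id_diagram w2)))"
      using tens[OF reflect_K[OF cap_K[of a]] id_diagram_K[of w2] cup idw] by (simp add: numeral_2_eq_2)
    show "?cap w1 a w2 \<in> K (w1 @ [a, dual a] @ w2) (w1 @ w2)"
      using dtensor_K[OF id_diagram_K[of w1] c1] by simp
    show "G (w1 @ [a, dual a] @ w2) (w1 @ w2) (bvec (?cap w1 a w2))"
      using tens[OF id_diagram_K[of w1] c1 idw g1] by simp
    show "G (w1 @ w2) (w1 @ [a, dual a] @ w2) (bvec (reflect (?cap w1 a w2)))"
      using tens[OF id_diagram_K[of w1] c2 idw g2] by (simp add: reflect_dtensor reflect_id_diagram)
  qed
  let ?m = "length w" and ?n = "length w'"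
  have k: "oriented_kauffman ?m ?n D" using less.prems by (rule K_kauffman)
  show ?case
  proof (cases "?m + ?n = 0")
    case True
    then have "D = {}" using kauffman_vertices[OF k] by (force simp: vertices_expand)
    then show ?thesis using True empty by simp
  next
    case False
    then obtain x y where xy: "(x, y) \<in> D \<or> (y, x) \<in> D"
      and pos: "boundary_pos ?m ?n y = Suc (boundary_pos ?m ?n x)"
      using kauffman_adjacent[OF k] by blast
    have V: "x \<in> vertices ?m ?n" "y \<in> vertices ?m ?n" using xy kauffman_vertices[OF k] by auto
    \<comment> \<open>The lower edge is read from right to left, so there the later vertex
      \<open>y\<close> has the smaller index. In the middle case the position moves from the end of
      the upper edge to the right end of the lower one.\<close>
    consider (upper) p where "x = Up p" "y = Up (Suc p)"
      | (through) i j where "x = Up i" "y = Lo j" "Suc i = ?m" "Suc j = ?n"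
      | (lower) j where "y = Lo j" "x = Lo (Suc j)"
      using V pos by (cases x; cases y) auto
    then show ?thesis
    proof cases
      case upper
      then obtain w1 a w2 where w: "w = w1 @ [a, dual a] @ w2" "length w1 = p"
        "(if a = X then (Up p, Up (Suc p)) else (Up (Suc p), Up p)) \<in> D"
        using K_split_adjacent[OF less.prems, of p] xy by blast
      obtain D' where D': "D' \<in> K (w1 @ w2) w'" "concat_diagram (?cap w1 a w2) D' = D"
        "acyclic (glue (?cap w1 a w2) D')"
        using cap_decomposition[of D w1 a w2 w'] less.prems w by (simp only:) blast
      have "G (w1 @ w2) w' (bvec D')" using less.hyps D'(1) w by simp
      from comp[OF bvec_Hom[OF capw(1)[of w1 a w2]] bvec_Hom[OF D'(1)] capw(2)[of w1 a w2] this]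
      show ?thesis using D' w by (simp add: comp_mor_acyclic)
    next
      case through
      have arc: "(Up i, Lo j) \<in> D \<or> (Lo j, Up i) \<in> D" using xy through by simp
      obtain u u' c D' where D': "w = u @ [c]" "w' = u' @ [c]" "D' \<in> K u u'"
        "D = dtensor (length u) (length u') D' (id_diagram [c])"
        by (rule K_split_last[OF less.prems through(3,4) arc])
      have "G u u' (bvec D')" by (rule less.hyps[OF _ D'(3)]) (simp add: D')
      from tens[OF D'(3) id_diagram_K this id[of c]] show ?thesis unfolding D' .
    next
      case lower
      then have "(Up j, Up (Suc j)) \<in> reflect D \<or> (Up (Suc j), Up j) \<in> reflect D" using xy by auto
      then obtain w1 a w2 where w: "w' = w1 @ [a, dual a] @ w2" "length w1 = j"
        "(if a = X then (Up j, Up (Suc j)) else (Up (Suc j), Up j)) \<in> reflect D"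
        using K_split_adjacent[OF reflect_K[OF less.prems], of j] by blast
      obtain D' where D': "D' \<in> K (w1 @ w2) w" "concat_diagram (?cap w1 a w2) D' = reflect D"
        "acyclic (glue (?cap w1 a w2) D')"
        using cap_decomposition[of "reflect D" w1 a w2 w] reflect_K[OF less.prems] w by (simp only:) blast
      have eq: "concat_diagram (reflect D') (reflect (?cap w1 a w2)) = D"
        unfolding concat_reflect D'(2) by simp
      have "G w (w1 @ w2) (bvec (reflect D'))" using less.hyps reflect_K[OF D'(1)] w by simp
      from comp[OF bvec_Hom[OF reflect_K[OF D'(1)]] bvec_Hom[OF reflect_K[OF capw(1)[of w1 a w2]]] this capw(3)[of w1 w2 a]]
      show ?thesis using eq w acyclic_glue_reflect[OF D'(3)] by (simp add: comp_mor_acyclic)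
    qed
  qed
qed

text \<open>Turns congruences modulo a subspace into equations, to which the simplifier applies.\<close>
lemma exists_linear_with_kernel:
  fixes M :: "('g \<Rightarrow>\<^sub>0 complex) set"
  assumes "fvec.subspace M"
  obtains \<pi> :: "('g \<Rightarrow>\<^sub>0 complex) \<Rightarrow> ('g \<Rightarrow>\<^sub>0 complex)"
  where "clinear \<pi>" "\<And>a. \<pi> a = 0 \<longleftrightarrow> a \<in> M"
proof -
  interpret P: vector_space_pair "cscale :: complex \<Rightarrow> ('g \<Rightarrow>\<^sub>0 complex) \<Rightarrow> _"
    "cscale :: complex \<Rightarrow> ('g \<Rightarrow>\<^sub>0 complex) \<Rightarrow> _" ..
  obtain B where B: "B \<subseteq> M" "fvec.independent B" "M \<subseteq> fvec.span B"
    using fvec.maximal_independent_subset[of M] by blast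
  have spB: "fvec.span B = M"
    using B fvec.span_minimal[OF B(1) assms] by blast
  define E where "E = fvec.extend_basis B"
  have E: "B \<subseteq> E" "fvec.independent E" "fvec.span E = UNIV"
    using B(2) by (auto simp: E_def fvec.extend_basis_superset fvec.independent_extend_basis)
  \<comment> \<open>The projection along a complement: a basis of \<open>M\<close> is extended to a
    basis of the whole space, \<open>g\<close> kills the former and fixes the added vectors.\<close>
  obtain g where g: "Vector_Spaces.linear cscale cscale g" "\<And>x. x \<in> E \<Longrightarrow> g x = (if x \<in> B then 0 else x)"
    using P.linear_independent_extend[OF E(2), of "\<lambda>x. if x \<in> B then 0 else x"] by blast
  have gB: "g x = 0" if "x \<in> fvec.span B" for x
    by (rule P.linear_eq_0_on_span[OF g(1) _ that]) (use g(2) E(1) in auto)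
  have gE: "g x = x" if "x \<in> fvec.span (E - B)" for x
    using P.linear_eq_on_span[OF g(1) fvec.linear_id _ that] g(2) by auto
  have "g a = 0 \<longleftrightarrow> a \<in> M" for a
  proof
    assume "a \<in> M"
    then show "g a = 0" using gB spB by simp
  next
    assume a: "g a = 0"
    have "E = B \<union> (E - B)" using E(1) by blast
    then have "a \<in> fvec.span (B \<union> (E - B))" using E(3) by simp
    then obtain m c where mc: "a = m + c" "m \<in> fvec.span B" "c \<in> fvec.span (E - B)"
      unfolding fvec.span_Un by blast
    have "g a = g m + g c" unfolding mc(1) by (rule P.linear_add[OF g(1)])
    then show "a \<in> M" using a gB[OF mc(2)] gE[OF mc(3)] mc spB by simp
  qed
  moreover have "clinear g" by (rule clinearI) (rule P.linear_add[OF g(1)], rule P.linear_scale[OF g(1)])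
  ultimately show ?thesis by (rule that[rotated])
qed

lemma linear_with_kernel_eq: "clinear \<pi> \<Longrightarrow> (\<And>a. \<pi> a = 0 \<longleftrightarrow> a \<in> M) \<Longrightarrow> \<pi> a = \<pi> b \<longleftrightarrow> a - b \<in> M"
  by (metis clinear_diff right_minus_eq)

lemma tensor_mor_Hom:
  assumes f: "f \<in> Hom w1 w1'" and g: "g \<in> Hom w2 w2'"
  shows "tensor_mor (length w1) (length w1') f g \<in> Hom (w1 @ w2) (w1' @ w2')"
  unfolding tensor_mor_def
proof (rule clinear_in_subspace[OF clinear_bilin_left subspace_Hom])
  fix D assume "D \<in> Poly_Mapping.keys f"
  then have D: "D \<in> K w1 w1'" using f by (auto simp: Hom_def)
  show "bilin_ext (\<lambda>D E. bvec (D \<union> map_prod (shift (length w1) (length w1')) (shift (length w1) (length w1')) ` E))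
      (bvec D) g \<in> Hom (w1 @ w2) (w1' @ w2')"
  proof (rule clinear_in_subspace[OF clinear_bilin_right subspace_Hom])
    fix E assume "E \<in> Poly_Mapping.keys g"
    then have E: "E \<in> K w2 w2'" using g by (auto simp: Hom_def)
    show "bilin_ext (\<lambda>D E. bvec (D \<union> map_prod (shift (length w1) (length w1')) (shift (length w1) (length w1')) ` E))
      (bvec D) (bvec E) \<in> Hom (w1 @ w2) (w1' @ w2')"
      using bvec_Hom[OF dtensor_K[OF D E]] by (simp add: dtensor_def)
  qed
qed

lemma star_mor_Hom: "f \<in> Hom w w' \<Longrightarrow> star_mor d f \<in> Hom w' w"
  unfolding star_mor_def
proof (rule conj_lin_ext_in_subspace[OF subspace_Hom])
  fix D assume "f \<in> Hom w w'" "D \<in> Poly_Mapping.keys f"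
  then have "D \<in> K w w'" by (auto simp: Hom_def)
  then show "cscale (of_real ((d / \<bar>d\<bar>) powi sharp D)) (bvec (reflect D)) \<in> Hom w' w"
    by (intro fvec.subspace_scale[OF subspace_Hom] bvec_Hom reflect_K)
qed

section \<open>Dual bases in the spaces of a fiber functor\<close>

context unitary_fiber_functor
begin

sublocale H: fd_hilbert_space "scal \<Phi>" "obj \<Phi> w" "ip \<Phi> w" for w
  by (rule hilbert)

sublocale T: hilbert_tensor "scal \<Phi>" "obj \<Phi> w" "ip \<Phi> w" "obj \<Phi> w'" "ip \<Phi> w'"
  "obj \<Phi> (w @ w')" "ip \<Phi> (w @ w')" "tens \<Phi> w w'" for w w'
  by (rule tensor_obj)

lemmas obj_zero [simp] = H.subspace_0[OF H.subspace]
lemmas obj_add [simp] = H.subspace_add[OF H.subspace]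
lemmas obj_scale [simp] = H.subspace_scale[OF H.subspace]
lemmas obj_sum = H.subspace_sum[OF H.subspace]
lemmas tens_closed [simp] = T.closed

section \<open>Calculus of inner products and linear combinations\<close>

lemma ip_cnj: "x \<in> obj \<Phi> w \<Longrightarrow> y \<in> obj \<Phi> w \<Longrightarrow> cnj (ip \<Phi> w x y) = ip \<Phi> w y x"
  by (rule H.inner_cnj[symmetric])

lemma ip_add_left:
  "x \<in> obj \<Phi> w \<Longrightarrow> y \<in> obj \<Phi> w \<Longrightarrow> z \<in> obj \<Phi> w \<Longrightarrow> ip \<Phi> w (x + y) z = ip \<Phi> w x z + ip \<Phi> w y z"
  by (simp add: ip_cnj[of z w, symmetric] H.inner_add)

lemma ip_scale_left:
  "x \<in> obj \<Phi> w \<Longrightarrow> z \<in> obj \<Phi> w \<Longrightarrow> ip \<Phi> w (scal \<Phi> c x) z = cnj c * ip \<Phi> w x z"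
  by (simp add: ip_cnj[of z w, symmetric] H.inner_scale)

lemma ip_zero_right [simp]: "x \<in> obj \<Phi> w \<Longrightarrow> ip \<Phi> w x 0 = 0"
  using H.inner_add[of x w 0 0] by simp

lemma ip_zero_left [simp]: "x \<in> obj \<Phi> w \<Longrightarrow> ip \<Phi> w 0 x = 0"
  using ip_add_left[of 0 w 0 x] by simp

lemma ip_sum_right:
  "x \<in> obj \<Phi> w \<Longrightarrow> (\<And>k. k \<in> S \<Longrightarrow> y k \<in> obj \<Phi> w) \<Longrightarrow> ip \<Phi> w x (sum y S) = (\<Sum>k\<in>S. ip \<Phi> w x (y k))"
  by (induction S rule: infinite_finite_induct) (simp_all add: H.inner_add obj_sum)

lemma ip_sum_left:
  "x \<in> obj \<Phi> w \<Longrightarrow> (\<And>k. k \<in> S \<Longrightarrow> y k \<in> obj \<Phi> w) \<Longrightarrow> ip \<Phi> w (sum y S) x = (\<Sum>k\<in>S. ip \<Phi> w (y k) x)"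
  by (induction S rule: infinite_finite_induct) (simp_all add: ip_add_left obj_sum)

lemma ip_ext:
  assumes "x \<in> obj \<Phi> w" "y \<in> obj \<Phi> w" "\<And>z. z \<in> obj \<Phi> w \<Longrightarrow> ip \<Phi> w z x = ip \<Phi> w z y"
  shows "x = y"
proof (rule ccontr)
  assume "x \<noteq> y"
  define z where "z = x + scal \<Phi> (-1) y"
  have z: "z \<in> obj \<Phi> w" unfolding z_def by (intro obj_add obj_scale assms)
  have "z \<noteq> 0" using \<open>x \<noteq> y\<close> by (simp add: z_def)
  moreover have "ip \<Phi> w z z = 0"
  proof -
    have "ip \<Phi> w z (x + scal \<Phi> (-1) y) = ip \<Phi> w z x + (-1) * ip \<Phi> w z y"
      by (simp only: H.inner_add H.inner_scale z assms obj_scale)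
    then show ?thesis using assms(3)[OF z] by (simp add: z_def)
  qed
  ultimately show False using H.inner_pos[OF z] by simp
qed

lemma tens_sum_left:
  "(\<And>k. k \<in> S \<Longrightarrow> x k \<in> obj \<Phi> w) \<Longrightarrow> y \<in> obj \<Phi> w' \<Longrightarrow>
    tens \<Phi> w w' (\<Sum>k\<in>S. scal \<Phi> (c k) (x k)) y = (\<Sum>k\<in>S. scal \<Phi> (c k) (tens \<Phi> w w' (x k) y))"
proof (induction S rule: infinite_finite_induct)
  case empty
  then show ?case using T.scale_left[of 0 w y w' 0] by simp
next
  case (infinite A)
  then show ?case using T.scale_left[of 0 w y w' 0] by simp
next
  case (insert k S)
  then show ?case by (simp add: T.add_left T.scale_left obj_sum)
qed

lemma tens_sum_right:
  "(\<And>k. k \<in> S \<Longrightarrow> y k \<in> obj \<Phi> w') \<Longrightarrow> x \<in> obj \<Phi> w \<Longrightarrow>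
    tens \<Phi> w w' x (\<Sum>k\<in>S. scal \<Phi> (c k) (y k)) = (\<Sum>k\<in>S. scal \<Phi> (c k) (tens \<Phi> w w' x (y k)))"
proof (induction S rule: infinite_finite_induct)
  case empty
  then show ?case using T.scale_right[of x w 0 w' 0] by simp
next
  case (infinite A)
  then show ?case using T.scale_right[of x w 0 w' 0] by simp
next
  case (insert k S)
  then show ?case by (simp add: T.add_right T.scale_right obj_sum)
qed

lemma mor_sum:
  "f \<in> Hom w w' \<Longrightarrow> (\<And>k. k \<in> S \<Longrightarrow> x k \<in> obj \<Phi> w) \<Longrightarrow>
    mor \<Phi> w w' f (\<Sum>k\<in>S. scal \<Phi> (c k) (x k)) = (\<Sum>k\<in>S. scal \<Phi> (c k) (mor \<Phi> w w' f (x k)))"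
proof (induction S rule: infinite_finite_induct)
  case empty
  then show ?case using mor_scale[of f w w' 0 0] by simp
next
  case (infinite A)
  then show ?case using mor_scale[of f w w' 0 0] by simp
next
  case (insert k S)
  then show ?case by (simp add: mor_add mor_scale obj_sum)
qed

text \<open>By the axiom \<open>star\<close> this is the Hilbert space adjoint of \<Phi>(f). Working
  with it avoids reflected diagrams and their signs.\<close>

definition adj :: "word \<Rightarrow> word \<Rightarrow> morphism \<Rightarrow> 'a \<Rightarrow> 'a" where
  "adj w w' f x = mor \<Phi> w' w (star_mor d f) x"

lemma adj_closed [simp]: "f \<in> Hom w w' \<Longrightarrow> x \<in> obj \<Phi> w' \<Longrightarrow> adj w w' f x \<in> obj \<Phi> w"
  by (simp add: adj_def mor_closed star_mor_Hom)

lemma ip_adj: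
  "f \<in> Hom w w' \<Longrightarrow> x \<in> obj \<Phi> w' \<Longrightarrow> y \<in> obj \<Phi> w \<Longrightarrow>
    ip \<Phi> w (adj w w' f x) y = ip \<Phi> w' x (mor \<Phi> w w' f y)"
  unfolding adj_def by (rule star)

lemma adj_unique:
  assumes "f \<in> Hom w w'" "x \<in> obj \<Phi> w'" "z \<in> obj \<Phi> w"
    "\<And>y. y \<in> obj \<Phi> w \<Longrightarrow> ip \<Phi> w z y = ip \<Phi> w' x (mor \<Phi> w w' f y)"
  shows "adj w w' f x = z"
proof (rule ip_ext)
  show "ip \<Phi> w y (adj w w' f x) = ip \<Phi> w y z" if "y \<in> obj \<Phi> w" for y
    using ip_cnj[of z w y] ip_cnj[of "adj w w' f x" w y] assms that by (simp add: ip_adj)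
qed (use assms in auto)

section \<open>Resolutions of the identity and orthonormal bases\<close>

text \<open>The identity operator written as the sum of |\<open>C k\<close>><\<open>R k\<close>|.
  Orthonormal bases are the case \<open>C = R\<close>; the dual bases \<open>p\<close> and
  \<open>q\<close> of \<Phi>(\<open>Xstar\<close>) form another instance, in either order.\<close>

definition frame :: "word \<Rightarrow> 'k set \<Rightarrow> ('k \<Rightarrow> 'a) \<Rightarrow> ('k \<Rightarrow> 'a) \<Rightarrow> bool" where
  "frame w S C R \<longleftrightarrow> finite S \<and> (\<forall>k\<in>S. C k \<in> obj \<Phi> w \<and> R k \<in> obj \<Phi> w) \<and>
    (\<forall>y\<in>obj \<Phi> w. (\<Sum>k\<in>S. scal \<Phi> (ip \<Phi> w (R k) y) (C k)) = y)"

lemma frameD: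
  assumes "frame w S C R"
  shows "finite S" "k \<in> S \<Longrightarrow> C k \<in> obj \<Phi> w" "k \<in> S \<Longrightarrow> R k \<in> obj \<Phi> w"
    "y \<in> obj \<Phi> w \<Longrightarrow> (\<Sum>k\<in>S. scal \<Phi> (ip \<Phi> w (R k) y) (C k)) = y"
  using assms by (auto simp: frame_def)

text \<open>The adjoint of the resolution of the identity, which exchanges the roles of
  \<open>C\<close> and \<open>R\<close>.\<close>

lemma frame_sym:
  assumes "frame w S C R"
  shows "frame w S R C"
  unfolding frame_def
proof (intro conjI ballI)
  note F = frameD[OF assms]
  fix x assume x: "x \<in> obj \<Phi> w"
  show "(\<Sum>k\<in>S. scal \<Phi> (ip \<Phi> w (C k) x) (R k)) = x"
  proof (rule ip_ext)
    fix y assume y: "y \<in> obj \<Phi> w"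
    have "ip \<Phi> w y (\<Sum>k\<in>S. scal \<Phi> (ip \<Phi> w (C k) x) (R k)) = (\<Sum>k\<in>S. ip \<Phi> w (C k) x * ip \<Phi> w y (R k))"
      using y F by (simp add: ip_sum_right H.inner_scale)
    also have "\<dots> = (\<Sum>k\<in>S. ip \<Phi> w (scal \<Phi> (ip \<Phi> w (R k) y) (C k)) x)"
      using x y F by (intro sum.cong) (auto simp: ip_scale_left ip_cnj)
    also have "\<dots> = ip \<Phi> w (\<Sum>k\<in>S. scal \<Phi> (ip \<Phi> w (R k) y) (C k)) x"
      using x F by (simp add: ip_sum_left)
    also have "\<dots> = ip \<Phi> w y x" using F(4)[OF y] by simp
    finally show "ip \<Phi> w y (\<Sum>k\<in>S. scal \<Phi> (ip \<Phi> w (C k) x) (R k)) = ip \<Phi> w y x" .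
  qed (use x F in \<open>auto intro!: obj_sum\<close>)
qed (use frameD[OF assms] in auto)

lemma subspace_eq_on:
  assumes "\<And>x y. x \<in> obj \<Phi> w \<Longrightarrow> y \<in> obj \<Phi> w \<Longrightarrow> f (x + y) = f x + f y"
    and "\<And>c x. x \<in> obj \<Phi> w \<Longrightarrow> f (scal \<Phi> c x) = scal \<Phi> c (f x)"
  shows "H.subspace {x \<in> obj \<Phi> w. f x = x}"
  using assms assms(2)[of 0 0] by (intro H.subspaceI) auto

text \<open>Both sides of the expansion are linear in \<open>y\<close>, so a spanning set suffices.
  For tensor products it consists of the simple tensors, which span by definition.\<close>

lemma frameI_span:
  assumes fin: "finite S" and CR: "\<And>k. k \<in> S \<Longrightarrow> C k \<in> obj \<Phi> w" "\<And>k. k \<in> S \<Longrightarrow> R k \<in> obj \<Phi> w"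
    and G: "obj \<Phi> w \<subseteq> H.span G" "G \<subseteq> obj \<Phi> w"
    and eq: "\<And>y. y \<in> G \<Longrightarrow> (\<Sum>k\<in>S. scal \<Phi> (ip \<Phi> w (R k) y) (C k)) = y"
  shows "frame w S C R"
proof -
  define f where "f y = (\<Sum>k\<in>S. scal \<Phi> (ip \<Phi> w (R k) y) (C k))" for y
  have "H.subspace {y \<in> obj \<Phi> w. f y = y}"
    by (rule subspace_eq_on)
      (auto simp: f_def H.inner_add H.inner_scale CR H.scale_left_distrib sum.distrib H.scale_sum_right)
  then have "H.span G \<subseteq> {y \<in> obj \<Phi> w. f y = y}"
    using G eq by (intro H.span_minimal) (auto simp: f_def)
  then show ?thesis using fin CR G by (auto simp: frame_def f_def)
qed

lemma onbD:
  assumes "onb \<Phi> w \<xi>"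
  shows "i < length \<xi> \<Longrightarrow> \<xi> ! i \<in> obj \<Phi> w" "set \<xi> \<subseteq> obj \<Phi> w" "H.span (set \<xi>) = obj \<Phi> w"
    "i < length \<xi> \<Longrightarrow> j < length \<xi> \<Longrightarrow> ip \<Phi> w (\<xi> ! i) (\<xi> ! j) = (if i = j then 1 else 0)"
  using assms nth_mem[of i \<xi>] unfolding onb_def H.orthonormal_basis_def by auto

lemma onb_frame:
  assumes "onb \<Phi> w \<xi>"
  shows "frame w {..<length \<xi>} ((!) \<xi>) ((!) \<xi>)"
proof (rule frameI_span)
  note o = onbD[OF assms]
  show "obj \<Phi> w \<subseteq> H.span (set \<xi>)" "set \<xi> \<subseteq> obj \<Phi> w" using o by auto
  fix y assume "y \<in> set \<xi>"
  then obtain j where j: "j < length \<xi>" "y = \<xi> ! j" by (auto simp: in_set_conv_nth)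
  have "(\<Sum>k<length \<xi>. scal \<Phi> (ip \<Phi> w (\<xi> ! k) y) (\<xi> ! k)) = (\<Sum>k<length \<xi>. if k = j then \<xi> ! k else 0)"
    using j o(4) by (intro sum.cong) auto
  then show "(\<Sum>k<length \<xi>. scal \<Phi> (ip \<Phi> w (\<xi> ! k) y) (\<xi> ! k)) = y" using j by simp
qed (use onbD[OF assms] in auto)

lemma frame_tensor:
  assumes F: "frame w S C R" and F': "frame w' S' C' R'"
  shows "frame (w @ w') (S \<times> S') (\<lambda>(i, j). tens \<Phi> w w' (C i) (C' j)) (\<lambda>(i, j). tens \<Phi> w w' (R i) (R' j))"
proof (rule frameI_span)
  note f = frameD[OF F] and f' = frameD[OF F']
  let ?G = "{tens \<Phi> w w' x y |x y. x \<in> obj \<Phi> w \<and> y \<in> obj \<Phi> w'}"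
  show "obj \<Phi> (w @ w') \<subseteq> H.span ?G" using T.spanning[of w w'] by simp
  show "?G \<subseteq> obj \<Phi> (w @ w')" by auto
  fix z assume "z \<in> ?G"
  then obtain x y where xy: "z = tens \<Phi> w w' x y" "x \<in> obj \<Phi> w" "y \<in> obj \<Phi> w'" by blast
  have "z = tens \<Phi> w w' (\<Sum>k\<in>S. scal \<Phi> (ip \<Phi> w (R k) x) (C k)) (\<Sum>k\<in>S'. scal \<Phi> (ip \<Phi> w' (R' k) y) (C' k))"
    by (simp add: xy f(4) f'(4))
  also have "\<dots> = (\<Sum>i\<in>S. scal \<Phi> (ip \<Phi> w (R i) x)
      (\<Sum>j\<in>S'. scal \<Phi> (ip \<Phi> w' (R' j) y) (tens \<Phi> w w' (C i) (C' j))))"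
  proof -
    have "(\<Sum>k\<in>S'. scal \<Phi> (ip \<Phi> w' (R' k) y) (C' k)) \<in> obj \<Phi> w'" using f' by (auto intro: obj_sum)
    then show ?thesis using f f' by (simp add: tens_sum_left tens_sum_right)
  qed
  also have "\<dots> = (\<Sum>(i, j)\<in>S \<times> S'. scal \<Phi> (ip \<Phi> (w @ w') (tens \<Phi> w w' (R i) (R' j)) z) (tens \<Phi> w w' (C i) (C' j)))"
    using f f' xy by (simp add: H.scale_sum_right sum.cartesian_product T.inner_tensor cong: sum.cong)
      (intro sum.cong, auto simp: T.inner_tensor)
  finally show "(\<Sum>k\<in>S \<times> S'. scal \<Phi> (ip \<Phi> (w @ w') ((\<lambda>(i, j). tens \<Phi> w w' (R i) (R' j)) k) z)
      ((\<lambda>(i, j). tens \<Phi> w w' (C i) (C' j)) k)) = z"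
    by (simp add: case_prod_beta)
qed (use frameD[OF F] frameD[OF F'] in auto)

lemma onbI:
  assumes "\<And>i. i < length \<xi> \<Longrightarrow> \<xi> ! i \<in> obj \<Phi> w"
    "\<And>i j. i < length \<xi> \<Longrightarrow> j < length \<xi> \<Longrightarrow> ip \<Phi> w (\<xi> ! i) (\<xi> ! j) = (if i = j then 1 else 0)"
    "obj \<Phi> w \<subseteq> H.span (set \<xi>)"
  shows "onb \<Phi> w \<xi>"
proof -
  have "set \<xi> \<subseteq> obj \<Phi> w" using assms(1) by (auto simp: in_set_conv_nth)
  moreover then have "H.span (set \<xi>) \<subseteq> obj \<Phi> w" by (intro H.span_minimal H.subspace)
  ultimately show ?thesis using assms unfolding onb_def H.orthonormal_basis_def by auto
qed

lemma onb_tensor: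
  assumes \<xi>: "onb \<Phi> w \<xi>" and \<eta>: "onb \<Phi> w' \<eta>"
  shows "onb \<Phi> (w @ w') (map (\<lambda>(x, y). tens \<Phi> w w' x y) (List.product \<xi> \<eta>))" (is "onb _ _ ?\<zeta>")
proof (rule onbI)
  let ?m = "length \<eta>"
  \<comment> \<open>The product list is ordered lexicographically, so position \<open>i\<close>
    corresponds to the pair of indices \<open>i div ?m\<close> and \<open>i mod ?m\<close>.\<close>
  have nth: "?\<zeta> ! i = tens \<Phi> w w' (\<xi> ! (i div ?m)) (\<eta> ! (i mod ?m))"
    and ix: "i div ?m < length \<xi>" "i mod ?m < ?m" if "i < length ?\<zeta>" for i
  proof -
    have i: "i < length \<xi> * ?m" using that by simp
    then have "?m > 0" by (cases ?m) auto
    then show "i div ?m < length \<xi>" "i mod ?m < ?m" using i by (auto simp: less_mult_imp_div_less)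
    show "?\<zeta> ! i = tens \<Phi> w w' (\<xi> ! (i div ?m)) (\<eta> ! (i mod ?m))" using i by (simp add: product_nth)
  qed
  show "?\<zeta> ! i \<in> obj \<Phi> (w @ w')" if "i < length ?\<zeta>" for i
    unfolding nth[OF that] using ix[OF that] onbD(1)[OF \<xi>] onbD(1)[OF \<eta>] by simp
  show "ip \<Phi> (w @ w') (?\<zeta> ! i) (?\<zeta> ! j) = (if i = j then 1 else 0)"
    if i: "i < length ?\<zeta>" and j: "j < length ?\<zeta>" for i j
  proof -
    have "ip \<Phi> (w @ w') (?\<zeta> ! i) (?\<zeta> ! j) =
        (if i div ?m = j div ?m then 1 else 0) * (if i mod ?m = j mod ?m then 1 else 0)"
      unfolding nth[OF i] nth[OF j]
      using ix[OF i] ix[OF j] onbD(1,4)[OF \<xi>] onbD(1,4)[OF \<eta>] by (simp add: T.inner_tensor)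
    moreover have "i = j \<longleftrightarrow> i div ?m = j div ?m \<and> i mod ?m = j mod ?m"
      by (metis div_mult_mod_eq)
    ultimately show ?thesis by simp
  qed
  show "obj \<Phi> (w @ w') \<subseteq> H.span (set ?\<zeta>)"
  proof
    fix z assume z: "z \<in> obj \<Phi> (w @ w')"
    note f = frame_tensor[OF onb_frame[OF \<xi>] onb_frame[OF \<eta>]]
    have "tens \<Phi> w w' (\<xi> ! i) (\<eta> ! j) \<in> set ?\<zeta>" if "i < length \<xi>" "j < length \<eta>" for i j
      using that by force
    then have "(\<Sum>k\<in>{..<length \<xi>} \<times> {..<length \<eta>}. scal \<Phi>
      (ip \<Phi> (w @ w') ((\<lambda>(i, j). tens \<Phi> w w' (\<xi> ! i) (\<eta> ! j)) k) z)
      ((\<lambda>(i, j). tens \<Phi> w w' (\<xi> ! i) (\<eta> ! j)) k)) \<in> H.span (set ?\<zeta>)"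
      by (intro H.span_sum H.span_scale H.span_base) (auto simp del: set_map)
    then show "z \<in> H.span (set ?\<zeta>)" using frameD(4)[OF f z] by simp
  qed
qed

lemma unit_closed [simp]: "unit_vector \<Phi> \<in> obj \<Phi> []"
proof -
  have "scal \<Phi> 1 (unit_vector \<Phi>) \<in> obj \<Phi> []" unfolding unit_obj by (rule rangeI)
  then show ?thesis by simp
qed

lemma onb_unit: "onb \<Phi> [] [unit_vector \<Phi>]"
proof (rule onbI)
  show "obj \<Phi> [] \<subseteq> H.span (set [unit_vector \<Phi>])"
    unfolding unit_obj by (auto intro: H.span_scale H.span_base)
qed (auto simp: unit_inner)

lemma obj_Nil_eq: "x \<in> obj \<Phi> [] \<Longrightarrow> scal \<Phi> (ip \<Phi> [] (unit_vector \<Phi>) x) (unit_vector \<Phi>) = x"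
  using frameD(4)[OF onb_frame[OF onb_unit]] by simp

text \<open>The vectors that pair equally with \<open>x\<close> and \<open>y\<close> form a
  subspace, and it contains the simple tensors. Conjugation moves the test vectors to the other
  argument of the inner product.\<close>

lemma ip_tens_ext:
  assumes "x \<in> obj \<Phi> (w @ w')" "y \<in> obj \<Phi> (w @ w')"
    "\<And>a b. a \<in> obj \<Phi> w \<Longrightarrow> b \<in> obj \<Phi> w' \<Longrightarrow> ip \<Phi> (w @ w') x (tens \<Phi> w w' a b) = ip \<Phi> (w @ w') y (tens \<Phi> w w' a b)"
  shows "x = y"
proof (rule ip_ext[OF assms(1,2)])
  fix z assume "z \<in> obj \<Phi> (w @ w')"
  let ?G = "{tens \<Phi> w w' x y |x y. x \<in> obj \<Phi> w \<and> y \<in> obj \<Phi> w'}"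
  let ?E = "{z \<in> obj \<Phi> (w @ w'). ip \<Phi> (w @ w') z x = ip \<Phi> (w @ w') z y}"
  have "H.span ?G \<subseteq> ?E"
  proof (rule H.span_minimal)
    show "?G \<subseteq> ?E"
    proof safe
      fix a b assume ab: "a \<in> obj \<Phi> w" "b \<in> obj \<Phi> w'"
      then have t: "tens \<Phi> w w' a b \<in> obj \<Phi> (w @ w')" by simp
      then show "ip \<Phi> (w @ w') (tens \<Phi> w w' a b) x = ip \<Phi> (w @ w') (tens \<Phi> w w' a b) y"
        using assms(3)[OF ab] ip_cnj[OF assms(1) t] ip_cnj[OF assms(2) t] by simp
    qed auto
    show "H.subspace ?E" using assms(1,2) by (intro H.subspaceI) (auto simp: ip_add_left ip_scale_left)
  qed
  then show "ip \<Phi> (w @ w') z x = ip \<Phi> (w @ w') z y"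
    using T.spanning[of w w'] \<open>z \<in> obj \<Phi> (w @ w')\<close> by blast
qed

text \<open>The adjoint of a tensor product of operators is the tensor product of the adjoints.
  Deriving this from inner products makes it unnecessary to relate \<open>star_mor\<close> to
  juxtaposition of diagrams.\<close>

lemma adj_tensor:
  assumes f: "f \<in> Hom w1 w1'" and g: "g \<in> Hom w2 w2'" and x: "x \<in> obj \<Phi> w1'" and y: "y \<in> obj \<Phi> w2'"
  shows "adj (w1 @ w2) (w1' @ w2') (tensor_mor (length w1) (length w1') f g) (tens \<Phi> w1' w2' x y) =
    tens \<Phi> w1 w2 (adj w1 w1' f x) (adj w2 w2' g y)"
proof (rule ip_tens_ext)
  note h = tensor_mor_Hom[OF f g]
  fix a b assume ab: "a \<in> obj \<Phi> w1" "b \<in> obj \<Phi> w2"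
  show "ip \<Phi> (w1 @ w2) (adj (w1 @ w2) (w1' @ w2') (tensor_mor (length w1) (length w1') f g) (tens \<Phi> w1' w2' x y))
      (tens \<Phi> w1 w2 a b) = ip \<Phi> (w1 @ w2) (tens \<Phi> w1 w2 (adj w1 w1' f x) (adj w2 w2' g y)) (tens \<Phi> w1 w2 a b)"
    using f g x y ab mor_closed[OF f] mor_closed[OF g]
    by (simp add: ip_adj[OF h] tensor_mor[OF f g] T.inner_tensor ip_adj)
qed (use tensor_mor_Hom[OF f g] assms in auto)

section \<open>Sesquilinear maps and their expansion in frames\<close>

text \<open>Conjugate-linear in the first and linear in the second argument, as coefficients are.
  Two different words are allowed because the comultiplication of an intertwining relation leads to
  a form mixing its source and its target.\<close>

definition sesq :: "word \<Rightarrow> word \<Rightarrow> ('a \<Rightarrow> 'a \<Rightarrow> ('k \<Rightarrow>\<^sub>0 complex)) \<Rightarrow> bool" where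
  "sesq w w' \<beta> \<longleftrightarrow>
    (\<forall>x\<in>obj \<Phi> w. \<forall>x'\<in>obj \<Phi> w. \<forall>y\<in>obj \<Phi> w'. \<beta> (x + x') y = \<beta> x y + \<beta> x' y) \<and>
    (\<forall>x\<in>obj \<Phi> w. \<forall>y\<in>obj \<Phi> w'. \<forall>y'\<in>obj \<Phi> w'. \<beta> x (y + y') = \<beta> x y + \<beta> x y') \<and>
    (\<forall>c. \<forall>x\<in>obj \<Phi> w. \<forall>y\<in>obj \<Phi> w'. \<beta> (scal \<Phi> c x) y = cscale (cnj c) (\<beta> x y)) \<and>
    (\<forall>c. \<forall>x\<in>obj \<Phi> w. \<forall>y\<in>obj \<Phi> w'. \<beta> x (scal \<Phi> c y) = cscale c (\<beta> x y))"

lemma sesqI: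
  assumes "\<And>x x' y. x \<in> obj \<Phi> w \<Longrightarrow> x' \<in> obj \<Phi> w \<Longrightarrow> y \<in> obj \<Phi> w' \<Longrightarrow> \<beta> (x + x') y = \<beta> x y + \<beta> x' y"
    and "\<And>x y y'. x \<in> obj \<Phi> w \<Longrightarrow> y \<in> obj \<Phi> w' \<Longrightarrow> y' \<in> obj \<Phi> w' \<Longrightarrow> \<beta> x (y + y') = \<beta> x y + \<beta> x y'"
    and "\<And>c x y. x \<in> obj \<Phi> w \<Longrightarrow> y \<in> obj \<Phi> w' \<Longrightarrow> \<beta> (scal \<Phi> c x) y = cscale (cnj c) (\<beta> x y)"
    and "\<And>c x y. x \<in> obj \<Phi> w \<Longrightarrow> y \<in> obj \<Phi> w' \<Longrightarrow> \<beta> x (scal \<Phi> c y) = cscale c (\<beta> x y)"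
  shows "sesq w w' \<beta>"
  using assms by (simp add: sesq_def)

lemma sesqD:
  assumes "sesq w w' \<beta>" "x \<in> obj \<Phi> w" "y \<in> obj \<Phi> w'"
  shows "x' \<in> obj \<Phi> w \<Longrightarrow> \<beta> (x + x') y = \<beta> x y + \<beta> x' y"
    and "y' \<in> obj \<Phi> w' \<Longrightarrow> \<beta> x (y + y') = \<beta> x y + \<beta> x y'"
    and "\<beta> (scal \<Phi> c x) y = cscale (cnj c) (\<beta> x y)"
    and "\<beta> x (scal \<Phi> c y) = cscale c (\<beta> x y)"
  using assms by (auto simp: sesq_def)

lemma sesq_sum_left:
  assumes "sesq w w' \<beta>" "y \<in> obj \<Phi> w'"
  shows "(\<And>k. k \<in> S \<Longrightarrow> x k \<in> obj \<Phi> w) \<Longrightarrow>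
    \<beta> (\<Sum>k\<in>S. scal \<Phi> (c k) (x k)) y = (\<Sum>k\<in>S. cscale (cnj (c k)) (\<beta> (x k) y))"
proof -
  have z: "\<beta> 0 y = 0" using sesqD(3)[OF assms(1) obj_zero assms(2), of 0] by simp
  show "(\<And>k. k \<in> S \<Longrightarrow> x k \<in> obj \<Phi> w) \<Longrightarrow>
    \<beta> (\<Sum>k\<in>S. scal \<Phi> (c k) (x k)) y = (\<Sum>k\<in>S. cscale (cnj (c k)) (\<beta> (x k) y))"
    by (induction S rule: infinite_finite_induct)
      (simp_all add: z sesqD[OF assms(1) _ assms(2)] obj_sum)
qed

lemma sesq_sum_right:
  assumes "sesq w w' \<beta>" "x \<in> obj \<Phi> w"
  shows "(\<And>k. k \<in> S \<Longrightarrow> y k \<in> obj \<Phi> w') \<Longrightarrow>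
    \<beta> x (\<Sum>k\<in>S. scal \<Phi> (c k) (y k)) = (\<Sum>k\<in>S. cscale (c k) (\<beta> x (y k)))"
proof -
  have z: "\<beta> x 0 = 0" using sesqD(4)[OF assms obj_zero, of 0] by simp
  show "(\<And>k. k \<in> S \<Longrightarrow> y k \<in> obj \<Phi> w') \<Longrightarrow>
    \<beta> x (\<Sum>k\<in>S. scal \<Phi> (c k) (y k)) = (\<Sum>k\<in>S. cscale (c k) (\<beta> x (y k)))"
    by (induction S rule: infinite_finite_induct)
      (simp_all add: z sesqD[OF assms] obj_sum)
qed

lemma sesq_frame_left:
  assumes "sesq w w' \<beta>" "frame w S C R" "x \<in> obj \<Phi> w" "y \<in> obj \<Phi> w'"
  shows "\<beta> x y = (\<Sum>k\<in>S. cscale (ip \<Phi> w x (R k)) (\<beta> (C k) y))"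
proof -
  note F = frameD[OF assms(2)]
  have "\<beta> x y = \<beta> (\<Sum>k\<in>S. scal \<Phi> (ip \<Phi> w (R k) x) (C k)) y" using F(4)[OF assms(3)] by simp
  also have "\<dots> = (\<Sum>k\<in>S. cscale (cnj (ip \<Phi> w (R k) x)) (\<beta> (C k) y))"
    by (rule sesq_sum_left[OF assms(1,4)]) (rule F(2))
  also have "\<dots> = (\<Sum>k\<in>S. cscale (ip \<Phi> w x (R k)) (\<beta> (C k) y))"
    by (intro sum.cong) (simp_all add: ip_cnj F(3) assms(3))
  finally show ?thesis .
qed

lemma sesq_frame_right:
  assumes "sesq w w' \<beta>" "frame w' S C R" "x \<in> obj \<Phi> w" "y \<in> obj \<Phi> w'"
  shows "\<beta> x y = (\<Sum>k\<in>S. cscale (ip \<Phi> w' (R k) y) (\<beta> x (C k)))"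
proof -
  note F = frameD[OF assms(2)]
  have "\<beta> x y = \<beta> x (\<Sum>k\<in>S. scal \<Phi> (ip \<Phi> w' (R k) y) (C k))" using F(4)[OF assms(4)] by simp
  also have "\<dots> = (\<Sum>k\<in>S. cscale (ip \<Phi> w' (R k) y) (\<beta> x (C k)))"
    by (rule sesq_sum_right[OF assms(1,3)]) (rule F(2))
  finally show ?thesis .
qed

text \<open>The universal way of checking identities here: a sesquilinear identity holds once it
  holds on the vectors of one frame in each argument, and the two frames may be chosen
  independently.\<close>

lemma sesq_ext:
  assumes \<beta>: "sesq w w' \<beta>" and \<gamma>: "sesq w w' \<gamma>" and F: "frame w S C R" and F': "frame w' S' C' R'"
    and eq: "\<And>k l. k \<in> S \<Longrightarrow> l \<in> S' \<Longrightarrow> \<beta> (C k) (C' l) = \<gamma> (C k) (C' l)"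
    and x: "x \<in> obj \<Phi> w" and y: "y \<in> obj \<Phi> w'"
  shows "\<beta> x y = \<gamma> x y"
proof -
  have "\<beta> (C k) y = \<gamma> (C k) y" if "k \<in> S" for k
    using that eq frameD(2)[OF F]
    by (simp add: sesq_frame_right[OF \<beta> F' _ y] sesq_frame_right[OF \<gamma> F' _ y])
  then show ?thesis by (simp add: sesq_frame_left[OF \<beta> F x y] sesq_frame_left[OF \<gamma> F x y])
qed

text \<open>Makes the comultiplication of the coend independent of the chosen orthonormal bases.\<close>
lemma frame_trace:
  assumes \<gamma>: "sesq w w \<gamma>" and F: "frame w S C R" and F': "frame w S' C' R'"
  shows "(\<Sum>k\<in>S. \<gamma> (R k) (C k)) = (\<Sum>l\<in>S'. \<gamma> (R' l) (C' l))"
proof -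
  note f = frameD[OF F] and f' = frameD[OF F']
  have "(\<Sum>l\<in>S'. \<gamma> (R' l) (C' l)) = (\<Sum>l\<in>S'. \<Sum>k\<in>S. cscale (ip \<Phi> w (R k) (C' l)) (\<gamma> (R' l) (C k)))"
    using f' by (intro sum.cong sesq_frame_right[OF \<gamma> F]) auto
  also have "\<dots> = (\<Sum>k\<in>S. \<Sum>l\<in>S'. cscale (ip \<Phi> w (R k) (C' l)) (\<gamma> (R' l) (C k)))"
    by (rule sum.swap)
  also have "\<dots> = (\<Sum>k\<in>S. \<gamma> (R k) (C k))"
    using f by (intro sum.cong sesq_frame_left[OF \<gamma> frame_sym[OF F'], symmetric]) auto
  finally show ?thesis by simp
qed

end

section \<open>The zigzag identities\<close>

text \<open>Each of the two zigzags glues to one directed path through five distinct points. The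
  explicit list of its transitive closure shows at once that no loop occurs and which end points
  remain connected.\<close>

lemma trancl_path:
  assumes R: "R = {(a, b), (b, c), (c, e), (e, f)}" and dist: "distinct [a, b, c, e, f]"
  shows "acyclic R" "R\<^sup>+ = {(a, b), (a, c), (a, e), (a, f), (b, c), (b, e), (b, f), (c, e), (c, f), (e, f)}"
proof -
  let ?T = "{(a, b), (a, c), (a, e), (a, f), (b, c), (b, e), (b, f), (c, e), (c, f), (e, f)}"
  have sub: "(x, y) \<in> ?T" if "(x, y) \<in> R\<^sup>+" for x y
    using that
  proof (induction rule: trancl_induct)
    case (base y) then show ?case unfolding R by blast
  next
    case (step y z)
    then show ?case using dist unfolding R by auto
  qed
  have e: "(a, b) \<in> R\<^sup>+" "(b, c) \<in> R\<^sup>+" "(c, e) \<in> R\<^sup>+" "(e, f) \<in> R\<^sup>+" unfolding R by blast+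
  have "(a, c) \<in> R\<^sup>+" "(b, e) \<in> R\<^sup>+" "(c, f) \<in> R\<^sup>+" using e by (meson trancl_trans)+
  moreover from this have "(a, e) \<in> R\<^sup>+" "(b, f) \<in> R\<^sup>+" using e by (meson trancl_trans)+
  moreover from this have "(a, f) \<in> R\<^sup>+" using e by (meson trancl_trans)
  ultimately have "?T \<subseteq> R\<^sup>+" using e by blast
  moreover have "R\<^sup>+ \<subseteq> ?T" by (rule subrelI) (rule sub)
  ultimately show eq: "R\<^sup>+ = ?T" by (rule subset_antisym[rotated])
  show "acyclic R" unfolding acyclic_def eq using dist by auto
qed

text \<open>The two ways of straightening a bent string: through X \<otimes> Xstar \<otimes> X back
  to \<open>X\<close>, and through Xstar \<otimes> X \<otimes> Xstar back to \<open>Xstar\<close>.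
  They exhibit the arc and the cup as a duality pairing and its copairing.\<close>

lemma zigzag_diagrams:
  defines "D1 \<equiv> dtensor 1 1 (id_diagram [X]) {(Lo 0, Lo 1)}" and "E1 \<equiv> dtensor 2 0 {(Up 0, Up 1)} (id_diagram [X])"
    and "D2 \<equiv> dtensor 0 2 {(Lo 0, Lo 1)} (id_diagram [Xstar])" and "E2 \<equiv> dtensor 1 1 (id_diagram [Xstar]) {(Up 0, Up 1)}"
  shows "acyclic (glue D1 E1)" "concat_diagram D1 E1 = id_diagram [X]"
    "acyclic (glue D2 E2)" "concat_diagram D2 E2 = id_diagram [Xstar]"
proof -
  have g1: "glue D1 E1 = {((0, 0), (1, 0)), ((1, 0), (1, 1)), ((1, 1), (1, 2)), ((1, 2), (2, 0))}"
    by (auto simp: D1_def E1_def dtensor_def id_diagram_single glue_def)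
  have t1: "acyclic (glue D1 E1)" "(glue D1 E1)\<^sup>+ = {((0, 0), (1, 0)), ((0, 0), (1, 1)), ((0, 0), (1, 2)), ((0, 0), (2, 0)), ((1, 0), (1, 1)),
      ((1, 0), (1, 2)), ((1, 0), (2, 0)), ((1, 1), (1, 2)), ((1, 1), (2, 0)), ((1, 2), (2, 0))}"
    using trancl_path[OF g1] by simp_all
  show "acyclic (glue D1 E1)" by (rule t1)
  show "concat_diagram D1 E1 = id_diagram [X]"
  proof (rule diagram_eqI)
    fix a b show "(a, b) \<in> concat_diagram D1 E1 \<longleftrightarrow> (a, b) \<in> id_diagram [X]"
      unfolding concat_diagram_def id_diagram_single mem_Collect_eq prod.case t1(2)
      by (cases a; cases b) simp_all
  qed
  have g2: "glue D2 E2 = {((2, 0), (1, 0)), ((1, 0), (1, 1)), ((1, 1), (1, 2)), ((1, 2), (0, 0))}"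
    by (auto simp: D2_def E2_def dtensor_def id_diagram_single glue_def)
  have t2: "acyclic (glue D2 E2)" "(glue D2 E2)\<^sup>+ = {((2, 0), (1, 0)), ((2, 0), (1, 1)), ((2, 0), (1, 2)), ((2, 0), (0, 0)), ((1, 0), (1, 1)),
      ((1, 0), (1, 2)), ((1, 0), (0, 0)), ((1, 1), (1, 2)), ((1, 1), (0, 0)), ((1, 2), (0, 0))}"
    using trancl_path[OF g2] by simp_all
  show "acyclic (glue D2 E2)" by (rule t2)
  show "concat_diagram D2 E2 = id_diagram [Xstar]"
  proof (rule diagram_eqI)
    fix a b show "(a, b) \<in> concat_diagram D2 E2 \<longleftrightarrow> (a, b) \<in> id_diagram [Xstar]"
      unfolding concat_diagram_def id_diagram_single mem_Collect_eq prod.case t2(2)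
      by (cases a; cases b) simp_all
  qed
qed

lemma star_mor_bvec:
  assumes "d \<noteq> 0"
  obtains s where "s \<noteq> 0" "star_mor d (bvec D) = cscale s (bvec (reflect D))"
  using assms that[of "of_real ((d / \<bar>d\<bar>) powi sharp D)"] by (simp add: star_mor_def)

lemma cap_simps:
  "cap X = {(Up 0, Up 1)}" "cap Xstar = {(Up 1, Up 0)}"
  "reflect (cap X) = {(Lo 1, Lo 0)}" "reflect (cap Xstar) = {(Lo 0, Lo 1)}"
  by (auto simp: cap_def reflect_def)

text \<open>The basis \<open>v'\<close> of \<Phi>(\<open>Xstar\<close>) is the one called
  \<open>w\<close> in the theorem. That it has as many elements as \<open>v\<close> is a consequence
  of duality, see \<open>length_v'\<close>.\<close>

locale based_fiber_functor = unitary_fiber_functor d \<Phi>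
  for d :: real and \<Phi> :: "'a::ab_group_add functor_data" +
  fixes v v' :: "'a list"
  assumes d_nonzero: "d \<noteq> 0"
    and onb_v: "onb \<Phi> [X] v" and onb_v': "onb \<Phi> [Xstar] v'"
begin

definition n :: nat where "n = length v"

text \<open>The value of the arc lies in the one-dimensional space \<Phi>(I); pairing with the unit
  vector extracts the number a_ij.\<close>

definition arc_coeff :: "nat \<Rightarrow> nat \<Rightarrow> complex" where
  "arc_coeff i j = ip \<Phi> [] (unit_vector \<Phi>) (mor \<Phi> [X, Xstar] [] eps_X (tens \<Phi> [X] [Xstar] (v ! i) (v' ! j)))"

text \<open>\<open>q i\<close> represents the functional \<open>\<epsilon>(v\<^sub>i \<otimes> _)\<close>, since the inner product is antilinear on the left.\<close>

definition q :: "nat \<Rightarrow> 'a" where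
  "q i = (\<Sum>l<length v'. scal \<Phi> (cnj (arc_coeff i l)) (v' ! l))"

definition cup_vector :: 'a where
  "cup_vector = mor \<Phi> [] [Xstar, X] (bvec {(Lo 0, Lo 1)}) (unit_vector \<Phi>)"

text \<open>The component of the cup vector along \<open>v ! i\<close>, so that the cup vector is
  the sum of the p_i \<otimes> v_i, as stated in \<open>cup_vector_eq\<close>.\<close>

definition p :: "nat \<Rightarrow> 'a" where
  "p i = (\<Sum>l<length v'. scal \<Phi> (ip \<Phi> [Xstar, X] (tens \<Phi> [Xstar] [X] (v' ! l) (v ! i)) cup_vector) (v' ! l))"

lemma v_closed [simp]: "i < n \<Longrightarrow> v ! i \<in> obj \<Phi> [X]"
  using onbD(1)[OF onb_v] by (simp add: n_def)

lemma v'_closed [simp]: "i < length v' \<Longrightarrow> v' ! i \<in> obj \<Phi> [Xstar]"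
  using onbD(1)[OF onb_v'] by simp

lemma q_closed [simp]: "q i \<in> obj \<Phi> [Xstar]"
  unfolding q_def by (intro obj_sum obj_scale) simp

lemma p_closed [simp]: "p i \<in> obj \<Phi> [Xstar]"
  unfolding p_def by (intro obj_sum obj_scale) simp

lemma frame_v: "frame [X] {..<n} ((!) v) ((!) v)"
  using onb_frame[OF onb_v] by (simp add: n_def)

lemma tens_closed2 [simp]:
  "x \<in> obj \<Phi> [a] \<Longrightarrow> y \<in> obj \<Phi> [b] \<Longrightarrow> tens \<Phi> [a] [b] x y \<in> obj \<Phi> [a, b]"
  using tens_closed[of x "[a]" y "[b]"] by simp

lemma eps_Hom: "eps_X \<in> Hom [X, Xstar] []"
  unfolding eps_X_def by (rule bvec_Hom[OF single_arc_K(2)])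

lemma ip_q: "y \<in> obj \<Phi> [Xstar] \<Longrightarrow> ip \<Phi> [Xstar] (q i) y = (\<Sum>l<length v'. arc_coeff i l * ip \<Phi> [Xstar] (v' ! l) y)"
  unfolding q_def by (subst ip_sum_left) (simp_all add: ip_scale_left)

lemma eps_v:
  assumes i: "i < n" and y: "y \<in> obj \<Phi> [Xstar]"
  shows "mor \<Phi> [X, Xstar] [] eps_X (tens \<Phi> [X] [Xstar] (v ! i) y) = scal \<Phi> (ip \<Phi> [Xstar] (q i) y) (unit_vector \<Phi>)"
proof -
  let ?c = "\<lambda>l. ip \<Phi> [Xstar] (v' ! l) y"
  have 1: "mor \<Phi> [X, Xstar] [] eps_X (tens \<Phi> [X] [Xstar] (v ! i) (v' ! l)) = scal \<Phi> (arc_coeff i l) (unit_vector \<Phi>)"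
    if "l < length v'" for l
    unfolding arc_coeff_def by (rule obj_Nil_eq[symmetric], rule mor_closed[OF eps_Hom]) (simp add: i that)
  have "tens \<Phi> [X] [Xstar] (v ! i) y = tens \<Phi> [X] [Xstar] (v ! i) (\<Sum>l<length v'. scal \<Phi> (?c l) (v' ! l))"
    using frameD(4)[OF onb_frame[OF onb_v'] y] by simp
  also have "\<dots> = (\<Sum>l<length v'. scal \<Phi> (?c l) (tens \<Phi> [X] [Xstar] (v ! i) (v' ! l)))"
    by (rule tens_sum_right) (simp_all add: i)
  also have "mor \<Phi> [X, Xstar] [] eps_X \<dots> =
      (\<Sum>l<length v'. scal \<Phi> (?c l) (mor \<Phi> [X, Xstar] [] eps_X (tens \<Phi> [X] [Xstar] (v ! i) (v' ! l))))"
    by (rule mor_sum[OF eps_Hom]) (simp add: i)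
  also have "\<dots> = (\<Sum>l<length v'. scal \<Phi> (arc_coeff i l * ?c l) (unit_vector \<Phi>))"
    by (intro sum.cong) (simp_all add: 1 mult.commute)
  also have "\<dots> = scal \<Phi> (ip \<Phi> [Xstar] (q i) y) (unit_vector \<Phi>)"
    by (simp add: ip_q[OF y] H.scale_sum_left)
  finally show ?thesis .
qed

lemma eps_tens:
  assumes x: "x \<in> obj \<Phi> [X]" and y: "y \<in> obj \<Phi> [Xstar]"
  shows "mor \<Phi> [X, Xstar] [] eps_X (tens \<Phi> [X] [Xstar] x y) =
    scal \<Phi> (\<Sum>k<n. ip \<Phi> [X] (v ! k) x * ip \<Phi> [Xstar] (q k) y) (unit_vector \<Phi>)"
proof -
  let ?c = "\<lambda>k. ip \<Phi> [X] (v ! k) x"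
  have "tens \<Phi> [X] [Xstar] x y = tens \<Phi> [X] [Xstar] (\<Sum>k<n. scal \<Phi> (?c k) (v ! k)) y"
    using frameD(4)[OF frame_v x] by simp
  also have "\<dots> = (\<Sum>k<n. scal \<Phi> (?c k) (tens \<Phi> [X] [Xstar] (v ! k) y))"
    by (rule tens_sum_left) (simp_all add: y)
  also have "mor \<Phi> [X, Xstar] [] eps_X \<dots> =
      (\<Sum>k<n. scal \<Phi> (?c k) (mor \<Phi> [X, Xstar] [] eps_X (tens \<Phi> [X] [Xstar] (v ! k) y)))"
    by (rule mor_sum[OF eps_Hom]) (simp add: y)
  also have "\<dots> = (\<Sum>k<n. scal \<Phi> (?c k * ip \<Phi> [Xstar] (q k) y) (unit_vector \<Phi>))"
    by (intro sum.cong) (simp_all add: eps_v y)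
  finally show ?thesis by (simp add: H.scale_sum_left)
qed

lemma cup_Hom: "bvec {(Lo 0, Lo 1)} \<in> Hom [] [Xstar, X]"
  by (rule bvec_Hom[OF single_arc_K(5)])

lemma cup_closed [simp]: "cup_vector \<in> obj \<Phi> [Xstar, X]"
  unfolding cup_vector_def by (rule mor_closed[OF cup_Hom]) simp

lemma cup_vector_eq: "cup_vector = (\<Sum>i<n. tens \<Phi> [Xstar] [X] (p i) (v ! i))"
proof -
  let ?c = "\<lambda>l i. ip \<Phi> [Xstar, X] (tens \<Phi> [Xstar] [X] (v' ! l) (v ! i)) cup_vector"
  let ?S = "{..<length v'} \<times> {..<n}"
  have "cup_vector = (\<Sum>k\<in>?S. scal \<Phi> (ip \<Phi> ([Xstar] @ [X])
      ((\<lambda>(l, i). tens \<Phi> [Xstar] [X] (v' ! l) (v ! i)) k) cup_vector) ((\<lambda>(l, i). tens \<Phi> [Xstar] [X] (v' ! l) (v ! i)) k))"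
    by (rule frameD(4)[OF frame_tensor[OF onb_frame[OF onb_v'] frame_v], symmetric]) simp
  also have "\<dots> = (\<Sum>(l, i)\<in>?S. scal \<Phi> (?c l i) (tens \<Phi> [Xstar] [X] (v' ! l) (v ! i)))"
    by (simp add: case_prod_beta)
  also have "\<dots> = (\<Sum>l<length v'. \<Sum>i<n. scal \<Phi> (?c l i) (tens \<Phi> [Xstar] [X] (v' ! l) (v ! i)))"
    by (simp add: sum.cartesian_product)
  also have "\<dots> = (\<Sum>i<n. \<Sum>l<length v'. scal \<Phi> (?c l i) (tens \<Phi> [Xstar] [X] (v' ! l) (v ! i)))"
    by (rule sum.swap)
  also have "\<dots> = (\<Sum>i<n. tens \<Phi> [Xstar] [X] (p i) (v ! i))"
    unfolding p_def by (intro sum.cong refl tens_sum_left[symmetric]) simp_all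
  finally show ?thesis .
qed

text \<open>The image of the first zigzag at \<open>v ! j\<close>: tensoring with the cup vector
  gives the sum of the v_j \<otimes> p_i \<otimes> v_i, and the arc contracts the first two factors
  to the inner product of \<open>q j\<close> and \<open>p i\<close>.\<close>

lemma zigzag_v:
  assumes j: "j < n"
  shows "(\<Sum>i<n. scal \<Phi> (ip \<Phi> [Xstar] (q j) (p i)) (v ! i)) = v ! j"
proof -
  let ?f = "tensor_mor 1 1 (bvec (id_diagram [X])) (bvec {(Lo 0, Lo 1)})"
  let ?g = "tensor_mor 2 0 eps_X (bvec (id_diagram [X]))"
  note idH = bvec_Hom[OF id_diagram_K[of "[X]"]]
  have fH: "?f \<in> Hom [X] [X, Xstar, X]" using tensor_mor_Hom[OF idH cup_Hom] by simp
  have gH: "?g \<in> Hom [X, Xstar, X] [X]" using tensor_mor_Hom[OF eps_Hom idH] by (simp add: numeral_2_eq_2)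
  have gf: "comp_mor d ?g ?f = bvec (id_diagram [X])"
    unfolding eps_X_def tensor_mor_bvec
    by (simp only: comp_mor_acyclic[OF zigzag_diagrams(1)] zigzag_diagrams(2))
  have f: "mor \<Phi> [X] [X, Xstar, X] ?f (v ! j) = tens \<Phi> [X] [Xstar, X] (v ! j) cup_vector"
    using tensor_mor[OF idH cup_Hom, of "v ! j" "unit_vector \<Phi>"] j
    by (simp add: unit_right cup_vector_def[symmetric, simplified] id)
  have f': "\<dots> = (\<Sum>i<n. scal \<Phi> 1 (tens \<Phi> [X, Xstar] [X] (tens \<Phi> [X] [Xstar] (v ! j) (p i)) (v ! i)))"
  proof -
    \<comment> \<open>The trivial coefficients bring the sum into the form to which
      \<open>tens_sum_right\<close> and \<open>mor_sum\<close> apply.\<close>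
    have "cup_vector = (\<Sum>i<n. scal \<Phi> 1 (tens \<Phi> [Xstar] [X] (p i) (v ! i)))"
      by (simp add: cup_vector_eq)
    then have "tens \<Phi> [X] [Xstar, X] (v ! j) cup_vector =
        (\<Sum>i<n. scal \<Phi> 1 (tens \<Phi> [X] [Xstar, X] (v ! j) (tens \<Phi> [Xstar] [X] (p i) (v ! i))))"
      by (simp only:) (rule tens_sum_right, simp_all add: j)
    also have "\<dots> = (\<Sum>i<n. scal \<Phi> 1 (tens \<Phi> [X, Xstar] [X] (tens \<Phi> [X] [Xstar] (v ! j) (p i)) (v ! i)))"
      using tensor_assoc[of "v ! j" "[X]" "p _" "[Xstar]" "v ! _" "[X]"] j by (intro sum.cong) simp_all
    finally show ?thesis .
  qed
  have g: "mor \<Phi> [X, Xstar, X] [X] ?g (tens \<Phi> [X, Xstar] [X] (tens \<Phi> [X] [Xstar] (v ! j) (p i)) (v ! i)) =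
      scal \<Phi> (ip \<Phi> [Xstar] (q j) (p i)) (v ! i)" if "i < n" for i
    using tensor_mor[OF eps_Hom idH, of "tens \<Phi> [X] [Xstar] (v ! j) (p i)" "v ! i"] j that
    by (simp add: eps_v id T.scale_left unit_left numeral_2_eq_2)
  have "v ! j = mor \<Phi> [X, Xstar, X] [X] ?g (mor \<Phi> [X] [X, Xstar, X] ?f (v ! j))"
    using comp[OF fH gH, of "v ! j"] j unfolding gf by (simp add: id)
  also have "\<dots> = (\<Sum>i<n. scal \<Phi> 1 (mor \<Phi> [X, Xstar, X] [X] ?g
      (tens \<Phi> [X, Xstar] [X] (tens \<Phi> [X] [Xstar] (v ! j) (p i)) (v ! i))))"
    unfolding f f' by (rule mor_sum[OF gH])
      (use tens_closed[of "tens \<Phi> [X] [Xstar] (v ! j) (p _)" "[X, Xstar]" "v ! _" "[X]"] j in simp)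
  finally show ?thesis by (simp add: g)
qed

text \<open>Comparison of the coefficients of \<open>v ! j\<close> in the first zigzag
  identity.\<close>

lemma ip_q_p: "i < n \<Longrightarrow> j < n \<Longrightarrow> ip \<Phi> [Xstar] (q i) (p j) = (if i = j then 1 else 0)"
proof -
  assume i: "i < n" and j: "j < n"
  have "ip \<Phi> [X] (v ! j) (\<Sum>k<n. scal \<Phi> (ip \<Phi> [Xstar] (q i) (p k)) (v ! k)) =
      (\<Sum>k<n. ip \<Phi> [Xstar] (q i) (p k) * (if j = k then 1 else 0))"
    using onbD(4)[OF onb_v] j by (subst ip_sum_right) (simp_all add: H.inner_scale n_def)
  also have "\<dots> = ip \<Phi> [Xstar] (q i) (p j)" using j by (simp add: if_distrib cong: if_cong)
  finally show ?thesis using onbD(4)[OF onb_v, of j i] i j unfolding zigzag_v[OF i] by (simp add: n_def eq_commute)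
qed

text \<open>The image of the second zigzag at \<open>y\<close>: the cup vector is put in front,
  giving the sum of the p_i \<otimes> v_i \<otimes> y, and the arc contracts the last two
  factors.\<close>

lemma frame_p_q: "frame [Xstar] {..<n} p q"
  unfolding frame_def
proof (intro conjI ballI)
  fix y assume y: "y \<in> obj \<Phi> [Xstar]"
  let ?f = "tensor_mor 0 2 (bvec {(Lo 0, Lo 1)}) (bvec (id_diagram [Xstar]))"
  let ?g = "tensor_mor 1 1 (bvec (id_diagram [Xstar])) eps_X"
  note idH = bvec_Hom[OF id_diagram_K[of "[Xstar]"]]
  have fH: "?f \<in> Hom [Xstar] [Xstar, X, Xstar]" using tensor_mor_Hom[OF cup_Hom idH] by (simp add: numeral_2_eq_2)
  have gH: "?g \<in> Hom [Xstar, X, Xstar] [Xstar]" using tensor_mor_Hom[OF idH eps_Hom] by simp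
  have gf: "comp_mor d ?g ?f = bvec (id_diagram [Xstar])"
    unfolding eps_X_def tensor_mor_bvec
    by (simp only: comp_mor_acyclic[OF zigzag_diagrams(3)] zigzag_diagrams(4))
  have f: "mor \<Phi> [Xstar] [Xstar, X, Xstar] ?f y = tens \<Phi> [Xstar, X] [Xstar] cup_vector y"
    using tensor_mor[OF cup_Hom idH, of "unit_vector \<Phi>" y] y
    by (simp add: unit_left cup_vector_def[symmetric, simplified] id numeral_2_eq_2)
  have f': "\<dots> = (\<Sum>i<n. scal \<Phi> 1 (tens \<Phi> [Xstar] [X, Xstar] (p i) (tens \<Phi> [X] [Xstar] (v ! i) y)))"
  proof -
    have "cup_vector = (\<Sum>i<n. scal \<Phi> 1 (tens \<Phi> [Xstar] [X] (p i) (v ! i)))"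
      by (simp add: cup_vector_eq)
    then have "tens \<Phi> [Xstar, X] [Xstar] cup_vector y =
        (\<Sum>i<n. scal \<Phi> 1 (tens \<Phi> [Xstar, X] [Xstar] (tens \<Phi> [Xstar] [X] (p i) (v ! i)) y))"
      by (simp only:) (rule tens_sum_left, simp_all add: y)
    also have "\<dots> = (\<Sum>i<n. scal \<Phi> 1 (tens \<Phi> [Xstar] [X, Xstar] (p i) (tens \<Phi> [X] [Xstar] (v ! i) y)))"
      using tensor_assoc[of "p _" "[Xstar]" "v ! _" "[X]" y "[Xstar]"] y by (intro sum.cong) simp_all
    finally show ?thesis .
  qed
  have g: "mor \<Phi> [Xstar, X, Xstar] [Xstar] ?g (tens \<Phi> [Xstar] [X, Xstar] (p i) (tens \<Phi> [X] [Xstar] (v ! i) y)) =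
      scal \<Phi> (ip \<Phi> [Xstar] (q i) y) (p i)" if "i < n" for i
    using tensor_mor[OF idH eps_Hom, of "p i" "tens \<Phi> [X] [Xstar] (v ! i) y"] that y
    by (simp add: eps_v id T.scale_right unit_right)
  have "y = mor \<Phi> [Xstar, X, Xstar] [Xstar] ?g (mor \<Phi> [Xstar] [Xstar, X, Xstar] ?f y)"
    using comp[OF fH gH y] y unfolding gf by (simp add: id)
  also have "\<dots> = (\<Sum>i<n. scal \<Phi> 1 (mor \<Phi> [Xstar, X, Xstar] [Xstar] ?g
      (tens \<Phi> [Xstar] [X, Xstar] (p i) (tens \<Phi> [X] [Xstar] (v ! i) y))))"
    unfolding f f' by (rule mor_sum[OF gH])
      (use tens_closed[of "p _" "[Xstar]" "tens \<Phi> [X] [Xstar] (v ! _) y" "[X, Xstar]"] y in simp)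
  also have "\<dots> = (\<Sum>i<n. scal \<Phi> (ip \<Phi> [Xstar] (q i) y) (p i))"
    by (intro sum.cong) (simp_all add: g[simplified])
  finally show "(\<Sum>i<n. scal \<Phi> (ip \<Phi> [Xstar] (q i) y) (p i)) = y" by (rule sym)
qed simp_all

lemma arc_coeff_eq: "l < length v' \<Longrightarrow> arc_coeff k l = ip \<Phi> [Xstar] (q k) (v' ! l)"
proof -
  assume l: "l < length v'"
  have "ip \<Phi> [Xstar] (q k) (v' ! l) = (\<Sum>m<length v'. if m = l then arc_coeff k m else 0)"
    unfolding ip_q[OF v'_closed[OF l]] using onbD(4)[OF onb_v'] l by (intro sum.cong) auto
  then show ?thesis using l by simp
qed

text \<open>The trace of the identity of \<Phi>(\<open>Xstar\<close>) is computed twice: with the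
  dual pair \<open>p\<close>, \<open>q\<close> it is \<open>n\<close>, with the orthonormal basis
  \<open>v'\<close> it is the length of that basis.\<close>

lemma length_v': "length v' = n"
proof -
  have "of_nat n = (\<Sum>k<n. ip \<Phi> [Xstar] (q k) (p k))" by (simp add: ip_q_p)
  also have "\<dots> = (\<Sum>k<n. \<Sum>l<length v'. arc_coeff k l * ip \<Phi> [Xstar] (v' ! l) (p k))"
    by (simp add: ip_q)
  also have "\<dots> = (\<Sum>l<length v'. \<Sum>k<n. arc_coeff k l * ip \<Phi> [Xstar] (v' ! l) (p k))"
    by (rule sum.swap)
  also have "\<dots> = (\<Sum>l<length v'. ip \<Phi> [Xstar] (v' ! l) (v' ! l))"
  proof (intro sum.cong refl)
    fix l assume "l \<in> {..<length v'}"
    then have l: "l < length v'" by simp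
    have "ip \<Phi> [Xstar] (v' ! l) (v' ! l) =
        ip \<Phi> [Xstar] (v' ! l) (\<Sum>k<n. scal \<Phi> (ip \<Phi> [Xstar] (q k) (v' ! l)) (p k))"
      using frameD(4)[OF frame_p_q v'_closed[OF l]] by simp
    also have "\<dots> = (\<Sum>k<n. arc_coeff k l * ip \<Phi> [Xstar] (v' ! l) (p k))"
      unfolding arc_coeff_eq[OF l] by (subst ip_sum_right) (simp_all add: l H.inner_scale)
    finally show "(\<Sum>k<n. arc_coeff k l * ip \<Phi> [Xstar] (v' ! l) (p k)) = ip \<Phi> [Xstar] (v' ! l) (v' ! l)" ..
  qed
  also have "\<dots> = of_nat (length v')" using onbD(4)[OF onb_v'] by simp
  finally have "(of_nat n :: complex) = of_nat (length v')" .
  then show ?thesis unfolding of_nat_eq_iff by simp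
qed

lemma frame_q_p: "frame [Xstar] {..<n} q p"
  by (rule frame_sym[OF frame_p_q])

text \<open>The formal adjoint of \<open>u\<^sub>i\<^sub>j\<close> is the coefficient of \<open>X\<^sup>*\<close> at \<open>(R Xstar i, C Xstar j) = (p i, q j)\<close>.\<close>

fun C :: "letter \<Rightarrow> nat \<Rightarrow> 'a" where
  "C X i = v ! i"
| "C Xstar i = q i"

fun R :: "letter \<Rightarrow> nat \<Rightarrow> 'a" where
  "R X i = v ! i"
| "R Xstar i = p i"

lemma C_closed [simp]: "i < n \<Longrightarrow> C a i \<in> obj \<Phi> [a]" and R_closed [simp]: "i < n \<Longrightarrow> R a i \<in> obj \<Phi> [a]"
  by (cases a; simp)+

lemma frame_letter: "frame [a] {..<n} (C a) (R a)"
proof (cases a)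
  case X
  have "C X = (!) v" "R X = (!) v" by auto
  then show ?thesis using frame_v X by simp
next
  case Xstar
  have "C Xstar = q" "R Xstar = p" by auto
  then show ?thesis using frame_q_p Xstar by simp
qed

lemma ip_R_C: "i < n \<Longrightarrow> j < n \<Longrightarrow> ip \<Phi> [a] (R a i) (C a j) = (if i = j then 1 else 0)"
proof (cases a)
  case X
  assume "i < n" "j < n"
  then show ?thesis using onbD(4)[OF onb_v, of i j] X by (simp add: n_def)
next
  case Xstar
  assume ij: "i < n" "j < n"
  have "ip \<Phi> [Xstar] (p i) (q j) = cnj (ip \<Phi> [Xstar] (q j) (p i))" by (simp add: ip_cnj)
  then show ?thesis using ij Xstar by (simp add: ip_q_p)
qed

text \<open>Up to a nonzero scalar the image of 1 under the cup from I to a \<otimes> dual a. For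
  \<open>X\<close> it is the vector representing the arc, the sum of the v_k \<otimes> q_k; for
  \<open>Xstar\<close> it is the cup vector, the sum of the p_k \<otimes> v_k. Pairing
  \<open>R\<close> with \<open>C\<close> of the dual letter treats both at once.\<close>

definition arc_vector :: "letter \<Rightarrow> 'a" where
  "arc_vector a = (\<Sum>k<n. tens \<Phi> [a] [dual a] (R a k) (C (dual a) k))"

lemma arc_vector_closed [simp]: "arc_vector a \<in> obj \<Phi> [a, dual a]"
  unfolding arc_vector_def by (intro obj_sum) simp

lemma adj_eps: "adj [X, Xstar] [] eps_X (unit_vector \<Phi>) = arc_vector X"
proof (rule ip_tens_ext[of _ "[X]" "[Xstar]"])
  show "adj [X, Xstar] [] eps_X (unit_vector \<Phi>) \<in> obj \<Phi> ([X] @ [Xstar])" by (simp add: eps_Hom)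
  show "arc_vector X \<in> obj \<Phi> ([X] @ [Xstar])" using arc_vector_closed[of X] by simp
  fix a b assume ab: "a \<in> obj \<Phi> [X]" "b \<in> obj \<Phi> [Xstar]"
  have "ip \<Phi> [X, Xstar] (arc_vector X) (tens \<Phi> [X] [Xstar] a b) =
      (\<Sum>k<n. ip \<Phi> [X, Xstar] (tens \<Phi> [X] [Xstar] (v ! k) (q k)) (tens \<Phi> [X] [Xstar] a b))"
    unfolding arc_vector_def by (subst ip_sum_left) (simp_all add: ab)
  also have "\<dots> = (\<Sum>k<n. ip \<Phi> [X] (v ! k) a * ip \<Phi> [Xstar] (q k) b)"
    using T.inner_tensor[of _ "[X]" a _ "[Xstar]" b] ab by (intro sum.cong) simp_all
  finally show "ip \<Phi> ([X] @ [Xstar]) (adj [X, Xstar] [] eps_X (unit_vector \<Phi>)) (tens \<Phi> [X] [Xstar] a b) =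
      ip \<Phi> ([X] @ [Xstar]) (arc_vector X) (tens \<Phi> [X] [Xstar] a b)"
    using ab by (simp add: ip_adj[OF eps_Hom] eps_tens H.inner_scale unit_inner)
qed

lemma cap_Hom: "bvec (cap a) \<in> Hom [a, dual a] []" and reflect_cap_Hom: "bvec (reflect (cap a)) \<in> Hom [] [a, dual a]"
  by (rule bvec_Hom[OF cap_K], rule bvec_Hom[OF reflect_K[OF cap_K]])

text \<open>The sign in the star operation enters only through the nonzero scalars.\<close>
lemma adj_cap:
  obtains s t where "s \<noteq> 0" "adj [a, dual a] [] (bvec (cap a)) (unit_vector \<Phi>) = scal \<Phi> s (arc_vector a)"
    "t \<noteq> 0" "mor \<Phi> [] [a, dual a] (bvec (reflect (cap a))) (unit_vector \<Phi>) = scal \<Phi> t (arc_vector a)"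
proof -
  obtain s where s: "s \<noteq> 0" "star_mor d (bvec (cap a)) = cscale s (bvec (reflect (cap a)))"
    using star_mor_bvec[OF d_nonzero] by blast
  have eq: "adj [a, dual a] [] (bvec (cap a)) (unit_vector \<Phi>) =
      scal \<Phi> s (mor \<Phi> [] [a, dual a] (bvec (reflect (cap a))) (unit_vector \<Phi>))"
    unfolding adj_def s(2) by (rule linear_scale[OF reflect_cap_Hom]) simp
  show ?thesis
  proof (cases a)
    \<comment> \<open>For \<open>X\<close> the adjoint of the cap is known from
      \<open>adj_eps\<close>, and the cup follows on dividing by \<open>s\<close>. For
      \<open>Xstar\<close> the cup is the cup vector, and the adjoint of the cap follows on
      multiplying by \<open>s\<close>.\<close>
    case X
    have 1: "adj [a, dual a] [] (bvec (cap a)) (unit_vector \<Phi>) = arc_vector a"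
      using adj_eps X by (simp add: cap_simps eps_X_def)
    have "scal \<Phi> (1 / s) (scal \<Phi> s (mor \<Phi> [] [a, dual a] (bvec (reflect (cap a))) (unit_vector \<Phi>))) =
        scal \<Phi> (1 / s) (arc_vector a)" using eq 1 by simp
    then have 2: "mor \<Phi> [] [a, dual a] (bvec (reflect (cap a))) (unit_vector \<Phi>) = scal \<Phi> (1 / s) (arc_vector a)"
      using s(1) by simp
    show ?thesis using that[of 1 "1 / s"] 1 2 s(1) by simp
  next
    case Xstar
    have "mor \<Phi> [] [a, dual a] (bvec (reflect (cap a))) (unit_vector \<Phi>) = arc_vector a"
      using cup_vector_eq unfolding Xstar cap_simps(4) cup_vector_def arc_vector_def by simp
    then show ?thesis using that[of s 1] eq s(1) by simp
  qed
qed

end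

section \<open>Quotients by ideals and their Hopf star structure\<close>

lemma linear_ringI:
  fixes F :: "(complex, 'g \<Rightarrow>\<^sub>0 complex) module"
  assumes ops: "add F = (+)" "zero F = 0" and sub: "fvec.subspace (carrier F)"
    and closed: "\<And>a b. a \<in> carrier F \<Longrightarrow> b \<in> carrier F \<Longrightarrow> a \<otimes>\<^bsub>F\<^esub> b \<in> carrier F"
    and one: "\<one>\<^bsub>F\<^esub> \<in> carrier F" "\<And>a. a \<in> carrier F \<Longrightarrow> \<one>\<^bsub>F\<^esub> \<otimes>\<^bsub>F\<^esub> a = a" "\<And>a. a \<in> carrier F \<Longrightarrow> a \<otimes>\<^bsub>F\<^esub> \<one>\<^bsub>F\<^esub> = a"
    and assoc: "\<And>a b c. a \<in> carrier F \<Longrightarrow> b \<in> carrier F \<Longrightarrow> c \<in> carrier F \<Longrightarrow>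
      (a \<otimes>\<^bsub>F\<^esub> b) \<otimes>\<^bsub>F\<^esub> c = a \<otimes>\<^bsub>F\<^esub> (b \<otimes>\<^bsub>F\<^esub> c)"
    and distrib: "\<And>a b c. (a + b) \<otimes>\<^bsub>F\<^esub> c = a \<otimes>\<^bsub>F\<^esub> c + b \<otimes>\<^bsub>F\<^esub> c" "\<And>a b c. c \<otimes>\<^bsub>F\<^esub> (a + b) = c \<otimes>\<^bsub>F\<^esub> a + c \<otimes>\<^bsub>F\<^esub> b"
  shows "ring F"
proof (rule ringI)
  show "abelian_group F"
  proof (rule abelian_groupI)
    show "\<exists>y\<in>carrier F. y \<oplus>\<^bsub>F\<^esub> x = \<zero>\<^bsub>F\<^esub>" if "x \<in> carrier F" for x
      using fvec.subspace_neg[OF sub that] by (intro bexI[of _ "- x"]) (simp_all add: ops)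
  qed (simp_all add: ops fvec.subspace_add[OF sub] fvec.subspace_0[OF sub] ac_simps)
  show "monoid F" by (rule monoidI) (use closed one assoc in auto)
qed (simp_all add: ops distrib)

lemma linear_additive_subgroup:
  fixes F :: "(complex, 'g \<Rightarrow>\<^sub>0 complex) module"
  assumes "ring F" "add F = (+)" "zero F = 0" "fvec.subspace I" "I \<subseteq> carrier F"
  shows "subgroup I (add_monoid F)"
proof -
  interpret ring F by fact
  have minus: "\<ominus>\<^bsub>F\<^esub> x = - x" if "x \<in> I" for x
  proof (rule minus_equality)
    show "- x \<oplus>\<^bsub>F\<^esub> x = \<zero>\<^bsub>F\<^esub>" by (simp add: assms)
  qed (use that fvec.subspace_neg[OF assms(4) that] assms(5) in auto)
  show ?thesis
    using assms minus
    by (intro add.subgroupI) (auto simp: a_inv_def[symmetric] fvec.subspace_add fvec.subspace_neg dest: fvec.subspace_0)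
qed

text \<open>Operations on cosets are defined as unions over all representatives. When every
  representative yields the same coset, the union is that coset; this is the form in which
  well-definedness is used.\<close>

lemma UN_eq_const: "a \<in> S \<Longrightarrow> (\<And>b. b \<in> S \<Longrightarrow> f b = c) \<Longrightarrow> (\<Union>b\<in>S. f b) = c"
  by blast

text \<open>A common setting for two quotients: the free algebra modulo the relations of the arcs,
  and the algebra of symbols modulo the coend relations.\<close>

locale linear_quotient =
  fixes F :: "(complex, 'g \<Rightarrow>\<^sub>0 complex) module" and I :: "('g \<Rightarrow>\<^sub>0 complex) set"
  assumes ideal: "ideal I F"
    and ops: "add F = (+)" "zero F = 0" "module.smult F = cscale"
    and subspace_carrier: "fvec.subspace (carrier F)" and subspace_I: "fvec.subspace I"
begin

sublocale ideal I F by (rule ideal)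

abbreviation cls where "cls a \<equiv> I +>\<^bsub>F\<^esub> a"

lemma cls_def: "cls a = {h + a |h. h \<in> I}"
  unfolding a_r_coset_def' ops by auto

lemma mem_cls: "b \<in> cls a \<longleftrightarrow> b - a \<in> I"
proof
  assume "b - a \<in> I"
  then have "b - a + a \<in> cls a" unfolding cls_def by blast
  then show "b \<in> cls a" by simp
qed (auto simp: cls_def)

lemma cls_eq_iff: "cls a = cls b \<longleftrightarrow> a - b \<in> I"
proof
  assume "cls a = cls b"
  moreover have "a \<in> cls a" by (simp add: mem_cls fvec.subspace_0[OF subspace_I])
  ultimately show "a - b \<in> I" by (simp add: mem_cls)
next
  assume ab: "a - b \<in> I"
  have "c - a \<in> I \<longleftrightarrow> c - b \<in> I" for c
    using fvec.subspace_add[OF subspace_I _ ab, of "c - a"] fvec.subspace_diff[OF subspace_I _ ab, of "c - b"]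
    by auto
  then show "cls a = cls b" by (auto simp: mem_cls)
qed

lemma I_carrier: "a \<in> I \<Longrightarrow> a \<in> carrier F"
  by (rule Icarr)

lemma cls_carrier: "b \<in> cls a \<Longrightarrow> a \<in> carrier F \<Longrightarrow> b \<in> carrier F"
  using fvec.subspace_add[OF subspace_carrier I_carrier[of "b - a"], of a] by (simp add: mem_cls)

abbreviation Q where "Q \<equiv> quotient_algebra F I"

lemma carrier_Q: "S \<in> carrier Q \<longleftrightarrow> (\<exists>a\<in>carrier F. S = cls a)"
  by (auto simp: quotient_algebra_def FactRing_def A_RCOSETS_def')

lemma cls_Q [simp]: "a \<in> carrier F \<Longrightarrow> cls a \<in> carrier Q"
  by (auto simp: carrier_Q)

lemma mult_Q: "a \<in> carrier F \<Longrightarrow> b \<in> carrier F \<Longrightarrow> cls a \<otimes>\<^bsub>Q\<^esub> cls b = cls (a \<otimes>\<^bsub>F\<^esub> b)"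
  by (simp add: quotient_algebra_def FactRing_def rcoset_mult_add)

lemma add_Q: "a \<in> carrier F \<Longrightarrow> b \<in> carrier F \<Longrightarrow> cls a \<oplus>\<^bsub>Q\<^esub> cls b = cls (a + b)"
  by (simp add: quotient_algebra_def FactRing_def a_rcos_sum ops)

lemma one_Q: "\<one>\<^bsub>Q\<^esub> = cls \<one>\<^bsub>F\<^esub>"
  by (simp add: quotient_algebra_def FactRing_def)

lemma zero_Q: "\<zero>\<^bsub>Q\<^esub> = cls 0"
  by (auto simp: quotient_algebra_def FactRing_def mem_cls)

lemma smult_Q: "c \<odot>\<^bsub>Q\<^esub> cls a = cls (cscale c a)"
proof -
  have "cls (cscale c b) = cls (cscale c a)" if "b \<in> cls a" for b
    using that fvec.subspace_scale[OF subspace_I, of "b - a" c]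
    by (simp add: cls_eq_iff mem_cls fvec.scale_right_diff_distrib)
  moreover have "a \<in> cls a" by (simp add: mem_cls fvec.subspace_0[OF subspace_I])
  ultimately have "(\<Union>b\<in>cls a. cls (cscale c b)) = cls (cscale c a)" by (intro UN_eq_const)
  then show ?thesis by (simp add: quotient_algebra_def ops)
qed

lemma quotient_map_cls:
  assumes "\<And>b. b \<in> I \<Longrightarrow> s b \<in> I" "\<And>a b. s (a - b) = s a - s b"
  shows "quotient_map F I s (cls a) = cls (s a)"
proof -
  have "cls (s b) = cls (s a)" if "b \<in> cls a" for b
    using that assms(1)[of "b - a"] by (simp add: cls_eq_iff mem_cls assms(2))
  moreover have "a \<in> cls a" by (simp add: mem_cls fvec.subspace_0[OF subspace_I])
  ultimately show ?thesis unfolding quotient_map_def by (intro UN_eq_const)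
qed

text \<open>\<open>quotient_algebra\<close> copies the operations of \<open>F Quot I\<close> into a
  module record, so the ring laws are transferred field by field.\<close>

lemma ring_Q: "ring Q"
proof -
  interpret FQ: ring "F Quot I" by (rule quotient_is_ring)
  have f: "carrier Q = carrier (F Quot I)" "monoid.mult Q = monoid.mult (F Quot I)" "one Q = one (F Quot I)"
    "zero Q = zero (F Quot I)" "add Q = add (F Quot I)"
    by (simp_all add: quotient_algebra_def)
  show ?thesis
  proof (rule ringI)
    show "abelian_group Q"
    proof (rule abelian_groupI)
      show "x \<oplus>\<^bsub>Q\<^esub> y = y \<oplus>\<^bsub>Q\<^esub> x" if "x \<in> carrier Q" "y \<in> carrier Q" for x y
        using that unfolding f by (rule FQ.a_comm)
      show "\<exists>y\<in>carrier Q. y \<oplus>\<^bsub>Q\<^esub> x = \<zero>\<^bsub>Q\<^esub>" if "x \<in> carrier Q" for x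
        using FQ.add.l_inv_ex[of x] that by (auto simp: f)
    qed (simp_all add: f FQ.a_assoc)
    show "monoid Q" by (rule monoidI) (simp_all add: f FQ.m_assoc)
  qed (simp_all add: f FQ.l_distr FQ.r_distr)
qed

lemma finsum_Q:
  assumes "finite S" "\<And>k. k \<in> S \<Longrightarrow> b k \<in> carrier F"
  shows "(\<Oplus>\<^bsub>Q\<^esub>k\<in>S. cls (b k)) = cls (\<Sum>k\<in>S. b k)"
  using assms
proof (induction S rule: finite_induct)
  interpret Q: ring Q by (rule ring_Q)
  case empty then show ?case by (simp add: zero_Q)
next
  interpret Q: ring Q by (rule ring_Q)
  case (insert k S)
  have "(\<Sum>k\<in>S. b k) \<in> carrier F" using insert by (intro fvec.subspace_sum[OF subspace_carrier]) auto
  then show ?case using insert by (simp add: add_Q)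
qed

end

section \<open>Tensor squares and comparison of two quotients\<close>

lemma subspace_tensor_rel: "fvec.subspace (tensor_rel M)"
  unfolding tensor_rel_def by (rule fvec.subspace_span)

lemma tensor_rel_gens:
  "x \<in> carrier M \<Longrightarrow> x' \<in> carrier M \<Longrightarrow> y \<in> carrier M \<Longrightarrow>
    bvec (x \<oplus>\<^bsub>M\<^esub> x', y) - bvec (x, y) - bvec (x', y) \<in> tensor_rel M"
  "x \<in> carrier M \<Longrightarrow> y \<in> carrier M \<Longrightarrow> y' \<in> carrier M \<Longrightarrow>
    bvec (x, y \<oplus>\<^bsub>M\<^esub> y') - bvec (x, y) - bvec (x, y') \<in> tensor_rel M"
  "x \<in> carrier M \<Longrightarrow> y \<in> carrier M \<Longrightarrow> bvec (c \<odot>\<^bsub>M\<^esub> x, y) - cscale c (bvec (x, y)) \<in> tensor_rel M"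
  "x \<in> carrier M \<Longrightarrow> y \<in> carrier M \<Longrightarrow> bvec (x, c \<odot>\<^bsub>M\<^esub> y) - cscale c (bvec (x, y)) \<in> tensor_rel M"
  unfolding tensor_rel_def by (rule fvec.span_base, blast)+

lemma tensor_class_eq: "s - t \<in> tensor_rel M \<Longrightarrow> tensor_class M s = tensor_class M t"
proof -
  have "tensor_class M s \<subseteq> tensor_class M t" if st: "s - t \<in> tensor_rel M" for s t
  proof
    fix u assume "u \<in> tensor_class M s"
    then obtain r where "u = s + r" "r \<in> tensor_rel M" by (auto simp: tensor_class_def)
    then have "u = t + (s - t + r)" "s - t + r \<in> tensor_rel M"
      using st fvec.subspace_add[OF subspace_tensor_rel] by auto
    then show "u \<in> tensor_class M t" unfolding tensor_class_def by blast
  qed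
  moreover have "t - s \<in> tensor_rel M" if "s - t \<in> tensor_rel M"
    using fvec.subspace_neg[OF subspace_tensor_rel that] by simp
  ultimately show "s - t \<in> tensor_rel M \<Longrightarrow> tensor_class M s = tensor_class M t" by (intro subset_antisym) auto
qed

lemma mem_tensor_class: "u \<in> tensor_class M t \<longleftrightarrow> u - t \<in> tensor_rel M"
proof
  assume "u - t \<in> tensor_rel M"
  moreover have "u = t + (u - t)" by simp
  ultimately show "u \<in> tensor_class M t" unfolding tensor_class_def by blast
qed (auto simp: tensor_class_def)

text \<open>The hypotheses say that \<open>T\<close> induces an isomorphism of the quotients.
  Surjectivity is asked only modulo \<open>J\<close>, since for the coend the image of
  \<open>T\<close> contains only symbols built from the chosen dual bases.\<close>

locale linear_quotient_hom =
  F: linear_quotient F I + G: linear_quotient G J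
  for F :: "(complex, 'g \<Rightarrow>\<^sub>0 complex) module" and I
    and G :: "(complex, 'h \<Rightarrow>\<^sub>0 complex) module" and J +
  fixes T :: "('g \<Rightarrow>\<^sub>0 complex) \<Rightarrow> ('h \<Rightarrow>\<^sub>0 complex)"
  assumes T_linear: "clinear T" and T_closed: "a \<in> carrier F \<Longrightarrow> T a \<in> carrier G"
    and T_mult: "a \<in> carrier F \<Longrightarrow> b \<in> carrier F \<Longrightarrow> T (a \<otimes>\<^bsub>F\<^esub> b) = T a \<otimes>\<^bsub>G\<^esub> T b"
    and T_one: "T \<one>\<^bsub>F\<^esub> = \<one>\<^bsub>G\<^esub>"
    and T_kernel: "a \<in> carrier F \<Longrightarrow> T a \<in> J \<longleftrightarrow> a \<in> I"
    and T_surj: "g \<in> carrier G \<Longrightarrow> \<exists>a\<in>carrier F. g - T a \<in> J"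
begin

definition \<theta> where "\<theta> S = (\<Union>a\<in>S. G.cls (T a))"

lemma \<theta>_cls:
  assumes "a \<in> carrier F"
  shows "\<theta> (F.cls a) = G.cls (T a)"
proof -
  have "G.cls (T b) = G.cls (T a)" if "b \<in> F.cls a" for b
  proof -
    have "T (b - a) \<in> J" using that T_kernel[OF F.I_carrier[of "b - a"]] by (simp add: F.mem_cls)
    then show ?thesis by (simp add: G.cls_eq_iff clinear_diff[OF T_linear])
  qed
  moreover have "a \<in> F.cls a" by (simp add: F.mem_cls fvec.subspace_0[OF F.subspace_I])
  ultimately show ?thesis unfolding \<theta>_def by (intro UN_eq_const)
qed

lemma \<theta>_smult: "x \<in> carrier F.Q \<Longrightarrow> \<theta> (c \<odot>\<^bsub>F.Q\<^esub> x) = c \<odot>\<^bsub>G.Q\<^esub> \<theta> x"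
  using fvec.subspace_scale[OF F.subspace_carrier]
  by (auto simp: F.carrier_Q F.smult_Q G.smult_Q \<theta>_cls clinear_cscale[OF T_linear])

lemma \<theta>_iso: "\<theta> \<in> ring_iso F.Q G.Q"
proof -
  have "\<theta> \<in> Ring.ring_hom F.Q G.Q"
  proof (rule ring_hom_memI)
    fix x y assume "x \<in> carrier F.Q" "y \<in> carrier F.Q"
    then obtain a b where ab: "a \<in> carrier F" "b \<in> carrier F" "x = F.cls a" "y = F.cls b"
      by (auto simp: F.carrier_Q)
    have "a + b \<in> carrier F" using ab fvec.subspace_add[OF F.subspace_carrier] by auto
    then show "\<theta> (x \<oplus>\<^bsub>F.Q\<^esub> y) = \<theta> x \<oplus>\<^bsub>G.Q\<^esub> \<theta> y"
      using ab by (simp add: F.add_Q G.add_Q \<theta>_cls T_closed clinear_add[OF T_linear])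
    show "\<theta> (x \<otimes>\<^bsub>F.Q\<^esub> y) = \<theta> x \<otimes>\<^bsub>G.Q\<^esub> \<theta> y"
      using ab by (simp add: F.mult_Q G.mult_Q \<theta>_cls T_closed T_mult)
  qed (auto simp: F.carrier_Q \<theta>_cls T_closed F.one_Q G.one_Q T_one)
  moreover have "bij_betw \<theta> (carrier F.Q) (carrier G.Q)"
  proof (rule bij_betwI')
    fix x y assume "x \<in> carrier F.Q" "y \<in> carrier F.Q"
    then obtain a b where ab: "a \<in> carrier F" "b \<in> carrier F" "x = F.cls a" "y = F.cls b"
      by (auto simp: F.carrier_Q)
    have "a - b \<in> carrier F" using ab fvec.subspace_diff[OF F.subspace_carrier] by auto
    then have "T a - T b \<in> J \<longleftrightarrow> a - b \<in> I" using T_kernel by (simp add: clinear_diff[OF T_linear, symmetric])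
    then show "\<theta> x = \<theta> y \<longleftrightarrow> x = y" by (simp add: ab \<theta>_cls F.cls_eq_iff G.cls_eq_iff)
  next
    fix x assume "x \<in> carrier F.Q" then show "\<theta> x \<in> carrier G.Q"
      by (auto simp: F.carrier_Q \<theta>_cls T_closed)
  next
    fix y assume "y \<in> carrier G.Q"
    then obtain b where b: "b \<in> carrier G" "y = G.cls b" by (auto simp: G.carrier_Q)
    obtain a where a: "a \<in> carrier F" "b - T a \<in> J" using T_surj[OF b(1)] by blast
    then have "y = \<theta> (F.cls a)" by (simp add: b \<theta>_cls G.cls_eq_iff)
    then show "\<exists>x\<in>carrier F.Q. y = \<theta> x" using a by auto
  qed
  ultimately show ?thesis by (simp add: ring_iso_def)
qed

text \<open>The map \<theta> \<otimes> \<theta> is well defined on the tensor square: as \<theta> is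
  linear, it sends each of the four kinds of bilinearity relation to one of the same kind.\<close>

lemma tensor_rel_\<theta>:
  assumes "r \<in> tensor_rel F.Q"
  shows "lin_ext (\<lambda>(y, z). bvec (\<theta> y, \<theta> z)) r \<in> tensor_rel G.Q"
proof (rule clinear_span[OF clinear_lin_ext subspace_tensor_rel _ assms[unfolded tensor_rel_def]])
  have hom: "\<theta> \<in> Ring.ring_hom F.Q G.Q" using \<theta>_iso by (simp add: ring_iso_def)
  note h = ring_hom_closed[OF hom] ring_hom_add[OF hom] \<theta>_smult
  note D = lin_ext_diff lin_ext_cscale lin_ext_bvec prod.case
  fix s assume "s \<in> {bvec (x \<oplus>\<^bsub>F.Q\<^esub> x', y) - bvec (x, y) - bvec (x', y) |x x' y.
        x \<in> carrier F.Q \<and> x' \<in> carrier F.Q \<and> y \<in> carrier F.Q} \<union>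
     {bvec (x, y \<oplus>\<^bsub>F.Q\<^esub> y') - bvec (x, y) - bvec (x, y') |x y y'.
        x \<in> carrier F.Q \<and> y \<in> carrier F.Q \<and> y' \<in> carrier F.Q} \<union>
     {bvec (c \<odot>\<^bsub>F.Q\<^esub> x, y) - cscale c (bvec (x, y)) |c x y. x \<in> carrier F.Q \<and> y \<in> carrier F.Q} \<union>
     {bvec (x, c \<odot>\<^bsub>F.Q\<^esub> y) - cscale c (bvec (x, y)) |c x y. x \<in> carrier F.Q \<and> y \<in> carrier F.Q}"
  then consider x x' y where "s = bvec (x \<oplus>\<^bsub>F.Q\<^esub> x', y) - bvec (x, y) - bvec (x', y)"
      "x \<in> carrier F.Q" "x' \<in> carrier F.Q" "y \<in> carrier F.Q"
    | x y y' where "s = bvec (x, y \<oplus>\<^bsub>F.Q\<^esub> y') - bvec (x, y) - bvec (x, y')"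
      "x \<in> carrier F.Q" "y \<in> carrier F.Q" "y' \<in> carrier F.Q"
    | c x y where "s = bvec (c \<odot>\<^bsub>F.Q\<^esub> x, y) - cscale c (bvec (x, y))" "x \<in> carrier F.Q" "y \<in> carrier F.Q"
    | c x y where "s = bvec (x, c \<odot>\<^bsub>F.Q\<^esub> y) - cscale c (bvec (x, y))" "x \<in> carrier F.Q" "y \<in> carrier F.Q"
    by blast
  then show "lin_ext (\<lambda>(y, z). bvec (\<theta> y, \<theta> z)) s \<in> tensor_rel G.Q"
  proof cases
    case 1 show ?thesis unfolding 1(1) D h(2)[OF 1(2,3)] by (rule tensor_rel_gens) (intro h 1)+
  next
    case 2 show ?thesis unfolding 2(1) D h(2)[OF 2(3,4)] by (rule tensor_rel_gens) (intro h 2)+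
  next
    case 3 show ?thesis unfolding 3(1) D h(3)[OF 3(2)] by (rule tensor_rel_gens) (intro h 3)+
  next
    case 4 show ?thesis unfolding 4(1) D h(3)[OF 4(3)] by (rule tensor_rel_gens) (intro h 4)+
  qed
qed

abbreviation DG where "DG \<delta>\<^sub>G b \<equiv> lin_ext (\<lambda>(x, y). bvec (G.cls x, G.cls y)) (\<delta>\<^sub>G b)"

text \<open>The comultiplications are given on representatives. The coideal condition on
  \<open>J\<close> makes the one on the target well defined, and \<open>compat\<close> compares the
  two modulo bilinearity; independence of representatives on the source is then obtained by
  transport to the target.\<close>

theorem hopf_star_isoI:
  assumes star: "\<And>a. a \<in> carrier F \<Longrightarrow> \<theta> (s (F.cls a)) = s' (G.cls (T a))"
    and lin: "clinear \<delta>\<^sub>G"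
    and keys: "\<And>a. a \<in> carrier F \<Longrightarrow> Poly_Mapping.keys (\<delta>\<^sub>F a) \<subseteq> carrier F \<times> carrier F"
    and coideal: "\<And>b. b \<in> J \<Longrightarrow> DG \<delta>\<^sub>G b \<in> tensor_rel G.Q"
    and compat: "\<And>a. a \<in> carrier F \<Longrightarrow>
      lin_ext (\<lambda>(x, y). bvec (G.cls (T x), G.cls (T y))) (\<delta>\<^sub>F a) - DG \<delta>\<^sub>G (T a) \<in> tensor_rel G.Q"
  shows "hopf_star_iso (with_hopf_star F.Q s (quotient_comult F I \<delta>\<^sub>F))
    (with_hopf_star G.Q s' (quotient_comult G J \<delta>\<^sub>G)) \<theta>" (is "hopf_star_iso ?A ?B \<theta>")
  unfolding hopf_star_iso_def
proof (intro conjI allI ballI)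
  have fields: "carrier ?A = carrier F.Q" "carrier ?B = carrier G.Q" "star ?A = s" "star ?B = s'"
    "module.smult ?A = module.smult F.Q" "module.smult ?B = module.smult G.Q"
    "comult ?A = quotient_comult F I \<delta>\<^sub>F" "comult ?B = quotient_comult G J \<delta>\<^sub>G"
    "tensor_class ?B = tensor_class G.Q"
    by (simp_all add: with_hopf_star_def tensor_class_def[abs_def] tensor_rel_def)
  show "\<theta> \<in> ring_iso ?A ?B"
    using \<theta>_iso by (simp add: ring_iso_def Ring.ring_hom_def with_hopf_star_def)
  show "\<theta> (c \<odot>\<^bsub>?A\<^esub> x) = c \<odot>\<^bsub>?B\<^esub> \<theta> x" if "x \<in> carrier ?A" for c x
    using that unfolding fields by (rule \<theta>_smult)
  show "\<theta> (star ?A x) = star ?B (\<theta> x)" if "x \<in> carrier ?A" for x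
    using that unfolding fields by (auto simp: F.carrier_Q \<theta>_cls star)
  fix x assume "x \<in> carrier ?A"
  then obtain a where a: "a \<in> carrier F" "x = F.cls a" by (auto simp: fields F.carrier_Q)
  let ?\<tau> = "lin_ext (\<lambda>(y, z). bvec (\<theta> y, \<theta> z))"
  let ?E = "\<lambda>a. lin_ext (\<lambda>(x, y). bvec (F.cls x, F.cls y)) (\<delta>\<^sub>F a)"
  have DGlin: "clinear (\<lambda>b. DG \<delta>\<^sub>G b)" by (rule clinear_compose[OF clinear_lin_ext lin])
  have DGcls: "tensor_class G.Q (DG \<delta>\<^sub>G b) = tensor_class G.Q (DG \<delta>\<^sub>G (T a))" if "b \<in> G.cls (T a)" for b
    using that coideal[of "b - T a"] by (intro tensor_class_eq) (simp add: G.mem_cls clinear_diff[OF DGlin])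
  have "comult ?B (\<theta> x) = tensor_class G.Q (DG \<delta>\<^sub>G (T a))"
  proof -
    have "T a \<in> G.cls (T a)" by (simp add: G.mem_cls fvec.subspace_0[OF G.subspace_I])
    then show ?thesis unfolding fields a(2) \<theta>_cls[OF a(1)] quotient_comult_def
      by (rule UN_eq_const) (rule DGcls)
  qed
  moreover have "(\<Union>t\<in>comult ?A x. tensor_class ?B (?\<tau> t)) = tensor_class G.Q (DG \<delta>\<^sub>G (T a))"
  proof -
    \<comment> \<open>An arbitrary representative \<open>t\<close> is moved in three stages: to
      \<open>?E b\<close> by \<open>tensor_rel_\<theta>\<close>, from there to the target by
      \<open>compat\<close> for the same \<open>b\<close>, and from \<open>T b\<close> to
      \<open>T a\<close> by the coideal condition.\<close>
    have eq: "tensor_class G.Q (?\<tau> t) = tensor_class G.Q (DG \<delta>\<^sub>G (T a))"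
      if "t \<in> tensor_class F.Q (?E b)" "b \<in> F.cls a" for t b
    proof -
      have b: "b \<in> carrier F" using F.cls_carrier that(2) a(1) by blast
      have "?\<tau> (?E b) = lin_ext (\<lambda>(x, y). bvec (G.cls (T x), G.cls (T y))) (\<delta>\<^sub>F b)"
        unfolding lin_ext_compose
      proof (rule lin_ext_cong, clarify)
        fix x y assume "(x, y) \<in> Poly_Mapping.keys (\<delta>\<^sub>F b)"
        then have "x \<in> carrier F" "y \<in> carrier F" using keys[OF b] by auto
        then show "?\<tau> (bvec (F.cls x, F.cls y)) = bvec (G.cls (T x), G.cls (T y))" by (simp add: \<theta>_cls)
      qed
      then have 1: "?\<tau> (?E b) - DG \<delta>\<^sub>G (T b) \<in> tensor_rel G.Q" using compat[OF b] by simp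
      have "?\<tau> (t - ?E b) \<in> tensor_rel G.Q" using that(1) by (intro tensor_rel_\<theta>) (simp add: mem_tensor_class)
      then have "?\<tau> t - ?\<tau> (?E b) \<in> tensor_rel G.Q" by (simp add: lin_ext_diff)
      from fvec.subspace_add[OF subspace_tensor_rel this 1]
      have "tensor_class G.Q (?\<tau> t) = tensor_class G.Q (DG \<delta>\<^sub>G (T b))" by (intro tensor_class_eq) simp
      also have "\<dots> = tensor_class G.Q (DG \<delta>\<^sub>G (T a))"
      proof (rule DGcls)
        have "F.cls b = F.cls a" using that(2) by (simp add: F.cls_eq_iff F.mem_cls)
        then have "\<theta> (F.cls b) = \<theta> (F.cls a)" by simp
        then show "T b \<in> G.cls (T a)" by (simp add: \<theta>_cls a b G.mem_cls G.cls_eq_iff)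
      qed
      finally show ?thesis .
    qed
    have "?E a \<in> tensor_class F.Q (?E a)" "a \<in> F.cls a"
      by (simp_all add: mem_tensor_class F.mem_cls fvec.subspace_0[OF F.subspace_I] fvec.subspace_0[OF subspace_tensor_rel])
    then have "?E a \<in> (\<Union>a\<in>F.cls a. tensor_class F.Q (?E a))" by (rule UN_I[rotated])
    then show ?thesis unfolding fields a(2) quotient_comult_def
      by (rule UN_eq_const) (erule UN_E, rule eq)
  qed
  ultimately show "comult ?B (\<theta> x) = (\<Union>t\<in>comult ?A x. tensor_class ?B (?\<tau> t))" by simp
qed

end

section \<open>The coend\<close>

context unitary_fiber_functor
begin

lemma sesq_adj:
  assumes "sesq w w \<beta>" "f \<in> Hom w w'"
  shows "sesq w' w (\<lambda>x y. \<beta> (adj w w' f x) y)"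
proof -
  have add: "adj w w' f (x + x') = adj w w' f x + adj w w' f x'" if "x \<in> obj \<Phi> w'" "x' \<in> obj \<Phi> w'" for x x'
    using that assms(2) by (simp add: adj_def mor_add star_mor_Hom)
  have scale: "adj w w' f (scal \<Phi> c x) = scal \<Phi> c (adj w w' f x)" if "x \<in> obj \<Phi> w'" for c x
    using that assms(2) by (simp add: adj_def mor_scale star_mor_Hom)
  show ?thesis
    by (rule sesqI) (simp_all add: add scale sesqD[OF assms(1)] assms(2))
qed

lemma sesq_mor:
  assumes "sesq w' w' \<beta>" "f \<in> Hom w w'"
  shows "sesq w' w (\<lambda>x y. \<beta> x (mor \<Phi> w w' f y))"
  by (rule sesqI) (simp_all add: mor_add mor_scale mor_closed sesqD[OF assms(1)] assms(2))

lemma adj_id [simp]: "x \<in> obj \<Phi> w \<Longrightarrow> adj w w (bvec (id_diagram w)) x = x"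
  by (rule adj_unique[OF bvec_Hom[OF id_diagram_K]]) (simp_all add: id)

end

lemma coeff_algebra_simps [simp]:
  "carrier (coeff_algebra \<Phi>) = {a. Poly_Mapping.keys a \<subseteq> coeff_symbols \<Phi>}"
  "one (coeff_algebra \<Phi>) = bvec ([], unit_vector \<Phi>, unit_vector \<Phi>)"
  "zero (coeff_algebra \<Phi>) = 0" "add (coeff_algebra \<Phi>) = (+)" "module.smult (coeff_algebra \<Phi>) = cscale"
  by (simp_all add: coeff_algebra_def)

lemma coeff_mult_bvec [simp]:
  "bvec (w, x, y) \<otimes>\<^bsub>coeff_algebra \<Phi>\<^esub> bvec (w', x', y') = bvec (w @ w', tens \<Phi> w w' x x', tens \<Phi> w w' y y')"
  by (simp add: coeff_algebra_def)

lemma clinear_coeff_mult: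
  "clinear (\<lambda>a. a \<otimes>\<^bsub>coeff_algebra \<Phi>\<^esub> b)" "clinear (\<lambda>b. a \<otimes>\<^bsub>coeff_algebra \<Phi>\<^esub> b)"
  by (simp_all add: coeff_algebra_def clinear_bilin_left clinear_bilin_right)

context based_fiber_functor
begin

text \<open>Tensor products of \<open>v\<close> and \<open>v'\<close> provide orthonormal bases for
  every word. Thus the choice made in \<open>coeff_comult\<close> is meaningful and the intertwining
  relations are available for every pair of words.\<close>

lemma onb_exists: "\<exists>\<xi>. onb \<Phi> w \<xi>"
proof (induction w)
  case Nil then show ?case using onb_unit by blast
next
  case (Cons a w)
  have "\<exists>\<xi>. onb \<Phi> [a] \<xi>" using onb_v onb_v' by (cases a) blast+
  then show ?case using Cons onb_tensor[of "[a]" _ w] by fastforce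
qed

lemma bvec_coeff_carrier [simp]:
  "bvec (w, x, y) \<in> carrier (coeff_algebra \<Phi>) \<longleftrightarrow> x \<in> obj \<Phi> w \<and> y \<in> obj \<Phi> w"
  by (simp add: coeff_symbols_def)

lemma coeff_symbolE:
  assumes "a \<in> carrier (coeff_algebra \<Phi>)" "g \<in> Poly_Mapping.keys a"
  obtains w x y where "g = (w, x, y)" "x \<in> obj \<Phi> w" "y \<in> obj \<Phi> w"
  using assms by (auto simp: coeff_symbols_def)

lemma subspace_coeff_carrier: "fvec.subspace (carrier (coeff_algebra \<Phi>))"
  using subspace_free by simp

lemma coeff_mult_closed:
  assumes "a \<in> carrier (coeff_algebra \<Phi>)" "b \<in> carrier (coeff_algebra \<Phi>)"
  shows "a \<otimes>\<^bsub>coeff_algebra \<Phi>\<^esub> b \<in> carrier (coeff_algebra \<Phi>)"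
proof (rule clinear_in_subspace[OF clinear_coeff_mult(1) subspace_coeff_carrier])
  fix g assume "g \<in> Poly_Mapping.keys a"
  then obtain w x y where g: "g = (w, x, y)" "x \<in> obj \<Phi> w" "y \<in> obj \<Phi> w" by (rule coeff_symbolE[OF assms(1)])
  show "bvec g \<otimes>\<^bsub>coeff_algebra \<Phi>\<^esub> b \<in> carrier (coeff_algebra \<Phi>)"
  proof (rule clinear_in_subspace[OF clinear_coeff_mult(2) subspace_coeff_carrier])
    fix h assume "h \<in> Poly_Mapping.keys b"
    then obtain w' x' y' where h: "h = (w', x', y')" "x' \<in> obj \<Phi> w'" "y' \<in> obj \<Phi> w'"
      by (rule coeff_symbolE[OF assms(2)])
    show "bvec g \<otimes>\<^bsub>coeff_algebra \<Phi>\<^esub> bvec h \<in> carrier (coeff_algebra \<Phi>)"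
      unfolding g(1) h(1) coeff_mult_bvec bvec_coeff_carrier using g h by simp
  qed
qed

lemma coeff_mult_assoc:
  assumes "a \<in> carrier (coeff_algebra \<Phi>)" "b \<in> carrier (coeff_algebra \<Phi>)" "c \<in> carrier (coeff_algebra \<Phi>)"
  shows "(a \<otimes>\<^bsub>coeff_algebra \<Phi>\<^esub> b) \<otimes>\<^bsub>coeff_algebra \<Phi>\<^esub> c = a \<otimes>\<^bsub>coeff_algebra \<Phi>\<^esub> (b \<otimes>\<^bsub>coeff_algebra \<Phi>\<^esub> c)"
proof -
  note L = clinear_coeff_mult[of \<Phi>]
  show ?thesis
  proof (rule clinear_cong[OF clinear_compose[OF L(1) L(1)] L(1)])
    fix g assume "g \<in> Poly_Mapping.keys a"
    then obtain w x y where g: "g = (w, x, y)" "x \<in> obj \<Phi> w" "y \<in> obj \<Phi> w" by (rule coeff_symbolE[OF assms(1)])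
    show "(bvec g \<otimes>\<^bsub>coeff_algebra \<Phi>\<^esub> b) \<otimes>\<^bsub>coeff_algebra \<Phi>\<^esub> c = bvec g \<otimes>\<^bsub>coeff_algebra \<Phi>\<^esub> (b \<otimes>\<^bsub>coeff_algebra \<Phi>\<^esub> c)"
    proof (rule clinear_cong[OF clinear_compose[OF L(1) L(2)] clinear_compose[OF L(2) L(1)]])
      fix h assume "h \<in> Poly_Mapping.keys b"
      then obtain w' x' y' where h: "h = (w', x', y')" "x' \<in> obj \<Phi> w'" "y' \<in> obj \<Phi> w'"
        by (rule coeff_symbolE[OF assms(2)])
      show "(bvec g \<otimes>\<^bsub>coeff_algebra \<Phi>\<^esub> bvec h) \<otimes>\<^bsub>coeff_algebra \<Phi>\<^esub> c = bvec g \<otimes>\<^bsub>coeff_algebra \<Phi>\<^esub> (bvec h \<otimes>\<^bsub>coeff_algebra \<Phi>\<^esub> c)"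
      proof (rule clinear_cong[OF L(2) clinear_compose[OF L(2) L(2)]])
        fix k assume "k \<in> Poly_Mapping.keys c"
        then obtain w'' x'' y'' where k: "k = (w'', x'', y'')" "x'' \<in> obj \<Phi> w''" "y'' \<in> obj \<Phi> w''"
          by (rule coeff_symbolE[OF assms(3)])
        show "(bvec g \<otimes>\<^bsub>coeff_algebra \<Phi>\<^esub> bvec h) \<otimes>\<^bsub>coeff_algebra \<Phi>\<^esub> bvec k = bvec g \<otimes>\<^bsub>coeff_algebra \<Phi>\<^esub> (bvec h \<otimes>\<^bsub>coeff_algebra \<Phi>\<^esub> bvec k)"
          unfolding g(1) h(1) k(1) coeff_mult_bvec using g h k by (simp add: tensor_assoc)
      qed
    qed
  qed
qed

lemma ring_coeff_algebra: "ring (coeff_algebra \<Phi>)"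
proof (rule linear_ringI)
  fix a assume a: "a \<in> carrier (coeff_algebra \<Phi>)"
  show "\<one>\<^bsub>coeff_algebra \<Phi>\<^esub> \<otimes>\<^bsub>coeff_algebra \<Phi>\<^esub> a = a"
  proof (rule clinear_cong[OF clinear_coeff_mult(2) clinear_id])
    fix g assume "g \<in> Poly_Mapping.keys a"
    then obtain w x y where g: "g = (w, x, y)" "x \<in> obj \<Phi> w" "y \<in> obj \<Phi> w" by (rule coeff_symbolE[OF a])
    show "\<one>\<^bsub>coeff_algebra \<Phi>\<^esub> \<otimes>\<^bsub>coeff_algebra \<Phi>\<^esub> bvec g = bvec g"
      unfolding g(1) coeff_algebra_simps coeff_mult_bvec using g by (simp add: unit_left)
  qed
  show "a \<otimes>\<^bsub>coeff_algebra \<Phi>\<^esub> \<one>\<^bsub>coeff_algebra \<Phi>\<^esub> = a"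
  proof (rule clinear_cong[OF clinear_coeff_mult(1) clinear_id])
    fix g assume "g \<in> Poly_Mapping.keys a"
    then obtain w x y where g: "g = (w, x, y)" "x \<in> obj \<Phi> w" "y \<in> obj \<Phi> w" by (rule coeff_symbolE[OF a])
    show "bvec g \<otimes>\<^bsub>coeff_algebra \<Phi>\<^esub> \<one>\<^bsub>coeff_algebra \<Phi>\<^esub> = bvec g"
      unfolding g(1) coeff_algebra_simps coeff_mult_bvec using g by (simp add: unit_right)
  qed
next
  show "\<one>\<^bsub>coeff_algebra \<Phi>\<^esub> \<in> carrier (coeff_algebra \<Phi>)"
    unfolding coeff_algebra_simps(2) bvec_coeff_carrier by simp
  show "(a + b) \<otimes>\<^bsub>coeff_algebra \<Phi>\<^esub> c = a \<otimes>\<^bsub>coeff_algebra \<Phi>\<^esub> c + b \<otimes>\<^bsub>coeff_algebra \<Phi>\<^esub> c" for a b c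
    by (rule clinear_add[OF clinear_coeff_mult(1)])
  show "c \<otimes>\<^bsub>coeff_algebra \<Phi>\<^esub> (a + b) = c \<otimes>\<^bsub>coeff_algebra \<Phi>\<^esub> a + c \<otimes>\<^bsub>coeff_algebra \<Phi>\<^esub> b" for a b c
    by (rule clinear_add[OF clinear_coeff_mult(2)])
qed (simp_all only: coeff_algebra_simps(3,4) subspace_coeff_carrier coeff_mult_closed coeff_mult_assoc)

lemma covariance_relI:
  "x \<in> obj \<Phi> w \<Longrightarrow> x' \<in> obj \<Phi> w \<Longrightarrow> y \<in> obj \<Phi> w \<Longrightarrow>
    bvec (w, x + x', y) - bvec (w, x, y) - bvec (w, x', y) \<in> covariance_rel \<Phi>"
  "x \<in> obj \<Phi> w \<Longrightarrow> y \<in> obj \<Phi> w \<Longrightarrow> y' \<in> obj \<Phi> w \<Longrightarrow>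
    bvec (w, x, y + y') - bvec (w, x, y) - bvec (w, x, y') \<in> covariance_rel \<Phi>"
  "x \<in> obj \<Phi> w \<Longrightarrow> y \<in> obj \<Phi> w \<Longrightarrow> bvec (w, scal \<Phi> c x, y) - cscale (cnj c) (bvec (w, x, y)) \<in> covariance_rel \<Phi>"
  "x \<in> obj \<Phi> w \<Longrightarrow> y \<in> obj \<Phi> w \<Longrightarrow> bvec (w, x, scal \<Phi> c y) - cscale c (bvec (w, x, y)) \<in> covariance_rel \<Phi>"
  unfolding covariance_rel_def by blast+

lemma covariance_relE:
  assumes "r \<in> covariance_rel \<Phi>"
  obtains w x x' y where "r = bvec (w, x + x', y) - bvec (w, x, y) - bvec (w, x', y)"
      "x \<in> obj \<Phi> w" "x' \<in> obj \<Phi> w" "y \<in> obj \<Phi> w"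
    | w x y y' where "r = bvec (w, x, y + y') - bvec (w, x, y) - bvec (w, x, y')"
      "x \<in> obj \<Phi> w" "y \<in> obj \<Phi> w" "y' \<in> obj \<Phi> w"
    | w c x y where "r = bvec (w, scal \<Phi> c x, y) - cscale (cnj c) (bvec (w, x, y))" "x \<in> obj \<Phi> w" "y \<in> obj \<Phi> w"
    | w c x y where "r = bvec (w, x, scal \<Phi> c y) - cscale c (bvec (w, x, y))" "x \<in> obj \<Phi> w" "y \<in> obj \<Phi> w"
  using assms unfolding covariance_rel_def by blast

text \<open>The four families of covariance relations are precisely the four clauses of
  \<open>sesq\<close>. Combined with a linear map of prescribed kernel, this makes the class of a
  symbol a sesquilinear function of its two vectors.\<close>

lemma sesq_bvec_iff:
  assumes \<pi>: "clinear \<pi>"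
  shows "(\<forall>r\<in>covariance_rel \<Phi>. \<pi> r = 0) \<longleftrightarrow> (\<forall>w. sesq w w (\<lambda>x y. \<pi> (bvec (w, x, y))))"
proof safe
  note L = clinear_diff[OF \<pi>] clinear_cscale[OF \<pi>]
  fix w assume z: "\<forall>r\<in>covariance_rel \<Phi>. \<pi> r = 0"
  show "sesq w w (\<lambda>x y. \<pi> (bvec (w, x, y)))"
  proof (rule sesqI)
    show "\<pi> (bvec (w, x + x', y)) = \<pi> (bvec (w, x, y)) + \<pi> (bvec (w, x', y))"
      if "x \<in> obj \<Phi> w" "x' \<in> obj \<Phi> w" "y \<in> obj \<Phi> w" for x x' y
      using bspec[OF z covariance_relI(1)[OF that]] unfolding L by (simp only: diff_diff_eq right_minus_eq)
    show "\<pi> (bvec (w, x, y + y')) = \<pi> (bvec (w, x, y)) + \<pi> (bvec (w, x, y'))"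
      if "x \<in> obj \<Phi> w" "y \<in> obj \<Phi> w" "y' \<in> obj \<Phi> w" for x y y'
      using bspec[OF z covariance_relI(2)[OF that]] unfolding L by (simp only: diff_diff_eq right_minus_eq)
    show "\<pi> (bvec (w, scal \<Phi> c x, y)) = cscale (cnj c) (\<pi> (bvec (w, x, y)))"
      if "x \<in> obj \<Phi> w" "y \<in> obj \<Phi> w" for c x y
      using bspec[OF z covariance_relI(3)[OF that]] unfolding L by (simp only: right_minus_eq)
    show "\<pi> (bvec (w, x, scal \<Phi> c y)) = cscale c (\<pi> (bvec (w, x, y)))"
      if "x \<in> obj \<Phi> w" "y \<in> obj \<Phi> w" for c x y
      using bspec[OF z covariance_relI(4)[OF that]] unfolding L by (simp only: right_minus_eq)
  qed
next
  note L = clinear_diff[OF \<pi>] clinear_cscale[OF \<pi>]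
  fix r assume s: "\<forall>w. sesq w w (\<lambda>x y. \<pi> (bvec (w, x, y)))" and r: "r \<in> covariance_rel \<Phi>"
  note S = sesqD[OF spec[OF s]]
  from r show "\<pi> r = 0"
    by (cases rule: covariance_relE) (simp_all add: L S)
qed

text \<open>The matrix relations are expansions in \<xi> and \<eta> of a relation without bases,
  which identifies the symbol at (f^* x, y) with the symbol at (x, f y). Together with
  \<open>coend_rel_adj\<close> this characterises the coend relations as the least subspace of its
  kind, and all later inclusions are proved through it.\<close>

lemma coend_rel_least:
  assumes M: "fvec.subspace M" and cov: "covariance_rel \<Phi> \<subseteq> M"
    and adj: "\<And>w w' f x y. f \<in> Hom w w' \<Longrightarrow> x \<in> obj \<Phi> w' \<Longrightarrow> y \<in> obj \<Phi> w \<Longrightarrow>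
      bvec (w, adj w w' f x, y) - bvec (w', x, mor \<Phi> w w' f y) \<in> M"
  shows "coend_rel \<Phi> \<subseteq> M"
  unfolding coend_rel_def
proof (rule fvec.span_minimal[OF _ M], rule Un_least[OF cov], rule subsetI)
  obtain \<pi> :: "'a coeff_space \<Rightarrow> 'a coeff_space" where \<pi>: "clinear \<pi>" "\<And>a. \<pi> a = 0 \<longleftrightarrow> a \<in> M"
    using exists_linear_with_kernel[OF M] by blast
  note L = clinear_diff[OF \<pi>(1)] clinear_cscale[OF \<pi>(1)] clinear_sum[OF \<pi>(1)]
  have S: "sesq w w (\<lambda>x y. \<pi> (bvec (w, x, y)))" for w
    using sesq_bvec_iff[OF \<pi>(1)] cov \<pi>(2) by blast
  fix r assume "r \<in> intertwiner_rel \<Phi>"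
  then obtain w w' f \<xi> \<eta> j k where
    r: "r = (\<Sum>i<length \<xi>. cscale (ip \<Phi> w' (\<eta> ! k) (mor \<Phi> w w' f (\<xi> ! i))) (bvec (w, \<xi> ! i, \<xi> ! j))) -
      (\<Sum>l<length \<eta>. cscale (ip \<Phi> w' (\<eta> ! l) (mor \<Phi> w w' f (\<xi> ! j))) (bvec (w', \<eta> ! k, \<eta> ! l)))"
    and f: "f \<in> Hom w w'" and \<xi>: "onb \<Phi> w \<xi>" and \<eta>: "onb \<Phi> w' \<eta>" and jk: "j < length \<xi>" "k < length \<eta>"
    unfolding intertwiner_rel_def by blast
  have o: "\<xi> ! j \<in> obj \<Phi> w" "\<eta> ! k \<in> obj \<Phi> w'" using onbD(1)[OF \<xi> jk(1)] onbD(1)[OF \<eta> jk(2)] by auto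
  have "\<pi> r = (\<Sum>i<length \<xi>. cscale (ip \<Phi> w (adj w w' f (\<eta> ! k)) (\<xi> ! i)) (\<pi> (bvec (w, \<xi> ! i, \<xi> ! j)))) -
      (\<Sum>l<length \<eta>. cscale (ip \<Phi> w' (\<eta> ! l) (mor \<Phi> w w' f (\<xi> ! j))) (\<pi> (bvec (w', \<eta> ! k, \<eta> ! l))))"
    unfolding r L using ip_adj[OF f o(2)] onbD(1)[OF \<xi>] by (intro arg_cong2[of _ _ _ _ minus] sum.cong) simp_all
  also have "\<dots> = \<pi> (bvec (w, adj w w' f (\<eta> ! k), \<xi> ! j)) - \<pi> (bvec (w', \<eta> ! k, mor \<Phi> w w' f (\<xi> ! j)))"
    using sesq_frame_left[OF S onb_frame[OF \<xi>] adj_closed[OF f o(2)] o(1)]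
      sesq_frame_right[OF S onb_frame[OF \<eta>] o(2) mor_closed[OF f o(1)]] by simp
  also have "\<dots> = 0" using adj[OF f o(2,1)] \<pi>(2) by (simp only: L[symmetric])
  finally show "r \<in> M" using \<pi>(2) by simp
qed

lemma subspace_coend_rel: "fvec.subspace (coend_rel \<Phi>)"
  unfolding coend_rel_def by (rule fvec.subspace_span)

lemma covariance_in_coend_rel: "covariance_rel \<Phi> \<subseteq> coend_rel \<Phi>"
  unfolding coend_rel_def using fvec.span_superset by blast

text \<open>Modulo the covariance relations both symbols are sesquilinear in \<open>x\<close> and
  \<open>y\<close>, so orthonormal basis vectors suffice; there the difference is a generator of the
  intertwining relations.\<close>

lemma coend_rel_adj:
  assumes f: "f \<in> Hom w w'" and x: "x \<in> obj \<Phi> w'" and y: "y \<in> obj \<Phi> w"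
  shows "bvec (w, adj w w' f x, y) - bvec (w', x, mor \<Phi> w w' f y) \<in> coend_rel \<Phi>"
proof -
  obtain \<pi> :: "'a coeff_space \<Rightarrow> 'a coeff_space" where \<pi>: "clinear \<pi>" "\<And>a. \<pi> a = 0 \<longleftrightarrow> a \<in> coend_rel \<Phi>"
    using exists_linear_with_kernel[OF subspace_coend_rel] by blast
  note L = clinear_diff[OF \<pi>(1)] clinear_cscale[OF \<pi>(1)] clinear_sum[OF \<pi>(1)]
  have S: "sesq w w (\<lambda>x y. \<pi> (bvec (w, x, y)))" for w
    using sesq_bvec_iff[OF \<pi>(1)] covariance_in_coend_rel \<pi>(2) by blast
  obtain \<xi> \<eta> where \<xi>: "onb \<Phi> w \<xi>" and \<eta>: "onb \<Phi> w' \<eta>" using onb_exists by blast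
  have "\<pi> (bvec (w, adj w w' f x, y)) = \<pi> (bvec (w', x, mor \<Phi> w w' f y))"
  proof (rule sesq_ext[OF sesq_adj[OF S f] sesq_mor[OF S f] onb_frame[OF \<eta>] onb_frame[OF \<xi>] _ x y])
    fix k j assume jk: "k \<in> {..<length \<eta>}" "j \<in> {..<length \<xi>}"
    have o: "\<xi> ! j \<in> obj \<Phi> w" "\<eta> ! k \<in> obj \<Phi> w'" using onbD(1)[OF \<xi>] onbD(1)[OF \<eta>] jk by auto
    let ?r = "(\<Sum>i<length \<xi>. cscale (ip \<Phi> w' (\<eta> ! k) (mor \<Phi> w w' f (\<xi> ! i))) (bvec (w, \<xi> ! i, \<xi> ! j))) -
      (\<Sum>l<length \<eta>. cscale (ip \<Phi> w' (\<eta> ! l) (mor \<Phi> w w' f (\<xi> ! j))) (bvec (w', \<eta> ! k, \<eta> ! l)))"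
    have "?r \<in> intertwiner_rel \<Phi>" unfolding intertwiner_rel_def using f \<xi> \<eta> jk by blast
    then have "\<pi> ?r = 0" using \<pi>(2) fvec.span_base unfolding coend_rel_def by blast
    then have "(\<Sum>i<length \<xi>. cscale (ip \<Phi> w' (\<eta> ! k) (mor \<Phi> w w' f (\<xi> ! i))) (\<pi> (bvec (w, \<xi> ! i, \<xi> ! j)))) =
      (\<Sum>l<length \<eta>. cscale (ip \<Phi> w' (\<eta> ! l) (mor \<Phi> w w' f (\<xi> ! j))) (\<pi> (bvec (w', \<eta> ! k, \<eta> ! l))))"
      unfolding L by (simp only: right_minus_eq)
    moreover have "(\<Sum>i<length \<xi>. cscale (ip \<Phi> w' (\<eta> ! k) (mor \<Phi> w w' f (\<xi> ! i))) (\<pi> (bvec (w, \<xi> ! i, \<xi> ! j)))) =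
      (\<Sum>i<length \<xi>. cscale (ip \<Phi> w (adj w w' f (\<eta> ! k)) (\<xi> ! i)) (\<pi> (bvec (w, \<xi> ! i, \<xi> ! j))))"
      using ip_adj[OF f o(2)] onbD(1)[OF \<xi>] by (intro sum.cong) simp_all
    ultimately show "\<pi> (bvec (w, adj w w' f (\<eta> ! k), \<xi> ! j)) = \<pi> (bvec (w', \<eta> ! k, mor \<Phi> w w' f (\<xi> ! j)))"
      using sesq_frame_left[OF S onb_frame[OF \<xi>] adj_closed[OF f o(2)] o(1)]
        sesq_frame_right[OF S onb_frame[OF \<eta>] o(2) mor_closed[OF f o(1)]] by simp
  qed
  then have "\<pi> (bvec (w, adj w w' f x, y) - bvec (w', x, mor \<Phi> w w' f y)) = 0"
    unfolding L by (simp only: right_minus_eq)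
  then show ?thesis unfolding \<pi>(2) .
qed

lemma coend_rel_carrier: "coend_rel \<Phi> \<subseteq> carrier (coeff_algebra \<Phi>)"
proof (rule coend_rel_least[OF subspace_coeff_carrier])
  note D = fvec.subspace_diff[OF subspace_coeff_carrier] fvec.subspace_scale[OF subspace_coeff_carrier]
  show "covariance_rel \<Phi> \<subseteq> carrier (coeff_algebra \<Phi>)"
    by (rule subsetI, erule covariance_relE; simp only:; intro D; simp only: bvec_coeff_carrier; simp)
  fix w w' f x y assume "f \<in> Hom w w'" "x \<in> obj \<Phi> w'" "y \<in> obj \<Phi> w"
  then show "bvec (w, adj w w' f x, y) - bvec (w', x, mor \<Phi> w w' f y) \<in> carrier (coeff_algebra \<Phi>)"
    by (intro D) (simp_all only: bvec_coeff_carrier adj_closed mor_closed simp_thms)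
qed

text \<open>Multiplying the relation of f by a symbol of the word \<open>w0\<close> produces the
  relation of f \<otimes> id for that word. This closure is what makes the span of the relations an
  ideal.\<close>

lemma coend_rel_mult_right:
  assumes b: "b \<in> carrier (coeff_algebra \<Phi>)" and a: "a \<in> coend_rel \<Phi>"
  shows "a \<otimes>\<^bsub>coeff_algebra \<Phi>\<^esub> b \<in> coend_rel \<Phi>"
proof (rule clinear_in_subspace[OF clinear_coeff_mult(2) subspace_coend_rel])
  fix g assume "g \<in> Poly_Mapping.keys b"
  then obtain w0 x0 y0 where g: "g = (w0, x0, y0)" "x0 \<in> obj \<Phi> w0" "y0 \<in> obj \<Phi> w0" by (rule coeff_symbolE[OF b])
  let ?F = "\<lambda>a. a \<otimes>\<^bsub>coeff_algebra \<Phi>\<^esub> bvec g"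
  note lin = clinear_coeff_mult(1)[of \<Phi> "bvec g"]
  note L = clinear_diff[OF lin] clinear_cscale[OF lin]
  note c = subsetD[OF covariance_in_coend_rel covariance_relI(1)] subsetD[OF covariance_in_coend_rel covariance_relI(2)]
    subsetD[OF covariance_in_coend_rel covariance_relI(3)] subsetD[OF covariance_in_coend_rel covariance_relI(4)]
  have "coend_rel \<Phi> \<subseteq> {a. ?F a \<in> coend_rel \<Phi>}"
  proof (rule coend_rel_least[OF subspace_preimage[OF lin subspace_coend_rel]])
    show "covariance_rel \<Phi> \<subseteq> {a. ?F a \<in> coend_rel \<Phi>}"
    proof
      fix r assume "r \<in> covariance_rel \<Phi>"
      then have "?F r \<in> coend_rel \<Phi>"
        by (cases rule: covariance_relE)
          (simp_all only: L, simp_all only: g(1) coeff_mult_bvec T.add_left T.add_right T.scale_left T.scale_right g(2,3) c tens_closed)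
      then show "r \<in> {a. ?F a \<in> coend_rel \<Phi>}" by simp
    qed
    fix w w' f x y assume f: "f \<in> Hom w w'" and x: "x \<in> obj \<Phi> w'" and y: "y \<in> obj \<Phi> w"
    note i = bvec_Hom[OF id_diagram_K[of w0]]
    have "bvec (w @ w0, adj (w @ w0) (w' @ w0) (tensor_mor (length w) (length w') f (bvec (id_diagram w0))) (tens \<Phi> w' w0 x x0),
        tens \<Phi> w w0 y y0) - bvec (w' @ w0, tens \<Phi> w' w0 x x0, mor \<Phi> (w @ w0) (w' @ w0)
        (tensor_mor (length w) (length w') f (bvec (id_diagram w0))) (tens \<Phi> w w0 y y0)) \<in> coend_rel \<Phi>"
      using x y g by (intro coend_rel_adj tensor_mor_Hom f i) simp_all
    then have "?F (bvec (w, adj w w' f x, y) - bvec (w', x, mor \<Phi> w w' f y)) \<in> coend_rel \<Phi>"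
      unfolding L using adj_tensor[OF f i x g(2)] tensor_mor[OF f i y g(3)] g
      by (simp only: g(1) coeff_mult_bvec adj_id id)
    then show "bvec (w, adj w w' f x, y) - bvec (w', x, mor \<Phi> w w' f y) \<in> {a. ?F a \<in> coend_rel \<Phi>}" by simp
  qed
  then show "?F a \<in> coend_rel \<Phi>" using a by blast
qed

text \<open>The mirror image of the preceding argument, with id \<otimes> f in place of f \<otimes>
  id.\<close>

lemma coend_rel_mult_left:
  assumes b: "b \<in> carrier (coeff_algebra \<Phi>)" and a: "a \<in> coend_rel \<Phi>"
  shows "b \<otimes>\<^bsub>coeff_algebra \<Phi>\<^esub> a \<in> coend_rel \<Phi>"
proof (rule clinear_in_subspace[OF clinear_coeff_mult(1) subspace_coend_rel])
  fix g assume "g \<in> Poly_Mapping.keys b"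
  then obtain w0 x0 y0 where g: "g = (w0, x0, y0)" "x0 \<in> obj \<Phi> w0" "y0 \<in> obj \<Phi> w0" by (rule coeff_symbolE[OF b])
  let ?F = "\<lambda>a. bvec g \<otimes>\<^bsub>coeff_algebra \<Phi>\<^esub> a"
  note lin = clinear_coeff_mult(2)[of \<Phi> "bvec g"]
  note L = clinear_diff[OF lin] clinear_cscale[OF lin]
  note c = subsetD[OF covariance_in_coend_rel covariance_relI(1)] subsetD[OF covariance_in_coend_rel covariance_relI(2)]
    subsetD[OF covariance_in_coend_rel covariance_relI(3)] subsetD[OF covariance_in_coend_rel covariance_relI(4)]
  have "coend_rel \<Phi> \<subseteq> {a. ?F a \<in> coend_rel \<Phi>}"
  proof (rule coend_rel_least[OF subspace_preimage[OF lin subspace_coend_rel]])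
    show "covariance_rel \<Phi> \<subseteq> {a. ?F a \<in> coend_rel \<Phi>}"
    proof
      fix r assume "r \<in> covariance_rel \<Phi>"
      then have "?F r \<in> coend_rel \<Phi>"
        by (cases rule: covariance_relE)
          (simp_all only: L, simp_all only: g(1) coeff_mult_bvec T.add_left T.add_right T.scale_left T.scale_right g(2,3) c tens_closed)
      then show "r \<in> {a. ?F a \<in> coend_rel \<Phi>}" by simp
    qed
    fix w w' f x y assume f: "f \<in> Hom w w'" and x: "x \<in> obj \<Phi> w'" and y: "y \<in> obj \<Phi> w"
    note i = bvec_Hom[OF id_diagram_K[of w0]]
    have "bvec (w0 @ w, adj (w0 @ w) (w0 @ w') (tensor_mor (length w0) (length w0) (bvec (id_diagram w0)) f) (tens \<Phi> w0 w' x0 x),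
        tens \<Phi> w0 w y0 y) - bvec (w0 @ w', tens \<Phi> w0 w' x0 x, mor \<Phi> (w0 @ w) (w0 @ w')
        (tensor_mor (length w0) (length w0) (bvec (id_diagram w0)) f) (tens \<Phi> w0 w y0 y)) \<in> coend_rel \<Phi>"
      using x y g by (intro coend_rel_adj tensor_mor_Hom f i) simp_all
    then have "?F (bvec (w, adj w w' f x, y) - bvec (w', x, mor \<Phi> w w' f y)) \<in> coend_rel \<Phi>"
      unfolding L using adj_tensor[OF i f g(2) x] tensor_mor[OF i f g(3) y] g
      by (simp only: g(1) coeff_mult_bvec adj_id id)
    then show "bvec (w, adj w w' f x, y) - bvec (w', x, mor \<Phi> w w' f y) \<in> {a. ?F a \<in> coend_rel \<Phi>}" by simp
  qed
  then show "?F a \<in> coend_rel \<Phi>" using a by blast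
qed

lemma ideal_coend_rel: "ideal (coend_rel \<Phi>) (coeff_algebra \<Phi>)"
  by (rule idealI[OF ring_coeff_algebra])
    (intro linear_additive_subgroup ring_coeff_algebra coeff_algebra_simps subspace_coend_rel coend_rel_carrier
      coend_rel_mult_left coend_rel_mult_right | assumption)+

sublocale coend: linear_quotient "coeff_algebra \<Phi>" "coend_rel \<Phi>"
  by (intro linear_quotient.intro ideal_coend_rel coeff_algebra_simps subspace_coeff_carrier subspace_coend_rel)

lemma coefficient_Q: "x \<in> obj \<Phi> w \<Longrightarrow> y \<in> obj \<Phi> w \<Longrightarrow> coefficient \<Phi> w x y \<in> carrier coend.Q"
  unfolding coefficient_def by (intro coend.cls_Q) (simp only: bvec_coeff_carrier simp_thms)

lemma coefficient_sesquilinear: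
  assumes x: "x \<in> obj \<Phi> w" and y: "y \<in> obj \<Phi> w"
  shows "x' \<in> obj \<Phi> w \<Longrightarrow> coefficient \<Phi> w (x + x') y = coefficient \<Phi> w x y \<oplus>\<^bsub>coend.Q\<^esub> coefficient \<Phi> w x' y"
    "y' \<in> obj \<Phi> w \<Longrightarrow> coefficient \<Phi> w x (y + y') = coefficient \<Phi> w x y \<oplus>\<^bsub>coend.Q\<^esub> coefficient \<Phi> w x y'"
    "coefficient \<Phi> w (scal \<Phi> c x) y = cnj c \<odot>\<^bsub>coend.Q\<^esub> coefficient \<Phi> w x y"
    "coefficient \<Phi> w x (scal \<Phi> c y) = c \<odot>\<^bsub>coend.Q\<^esub> coefficient \<Phi> w x y"
proof -
  note c = subsetD[OF covariance_in_coend_rel covariance_relI(1)] subsetD[OF covariance_in_coend_rel covariance_relI(2)]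
    subsetD[OF covariance_in_coend_rel covariance_relI(3)] subsetD[OF covariance_in_coend_rel covariance_relI(4)]
  show "coefficient \<Phi> w (x + x') y = coefficient \<Phi> w x y \<oplus>\<^bsub>coend.Q\<^esub> coefficient \<Phi> w x' y" if "x' \<in> obj \<Phi> w"
    using c(1)[OF x that y] x y that unfolding coefficient_def
    by (subst coend.add_Q) (simp_all only: bvec_coeff_carrier coend.cls_eq_iff diff_diff_eq simp_thms)
  show "coefficient \<Phi> w x (y + y') = coefficient \<Phi> w x y \<oplus>\<^bsub>coend.Q\<^esub> coefficient \<Phi> w x y'" if "y' \<in> obj \<Phi> w"
    using c(2)[OF x y that] x y that unfolding coefficient_def
    by (subst coend.add_Q) (simp_all only: bvec_coeff_carrier coend.cls_eq_iff diff_diff_eq simp_thms)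
  show "coefficient \<Phi> w (scal \<Phi> c x) y = cnj c \<odot>\<^bsub>coend.Q\<^esub> coefficient \<Phi> w x y"
    using c(3)[OF x y] unfolding coefficient_def coend.smult_Q coend.cls_eq_iff .
  show "coefficient \<Phi> w x (scal \<Phi> c y) = c \<odot>\<^bsub>coend.Q\<^esub> coefficient \<Phi> w x y"
    using c(4)[OF x y] unfolding coefficient_def coend.smult_Q coend.cls_eq_iff .
qed

lemma coefficient_adj:
  "f \<in> Hom w w' \<Longrightarrow> x \<in> obj \<Phi> w' \<Longrightarrow> y \<in> obj \<Phi> w \<Longrightarrow>
    coefficient \<Phi> w (adj w w' f x) y = coefficient \<Phi> w' x (mor \<Phi> w w' f y)"
  unfolding coefficient_def coend.cls_eq_iff by (rule coend_rel_adj)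

section \<open>The comultiplication of the coend\<close>

text \<open>In the first form the outer vectors \<open>x\<close>, \<open>y\<close> are fixed and the
  inner ones vary; \<open>r\<close> comes first because it enters antilinearly. Its trace over a
  frame is the comultiplication. In the second form the inner vectors are fixed, which gives
  sesquilinearity of the comultiplication in \<open>x\<close> and \<open>y\<close>.\<close>

lemma sesq_coefficient_tensor:
  assumes \<tau>: "clinear \<tau>" "\<And>t. \<tau> t = 0 \<longleftrightarrow> t \<in> tensor_rel coend.Q"
  shows "x \<in> obj \<Phi> w' \<Longrightarrow> y \<in> obj \<Phi> w \<Longrightarrow> sesq w w' (\<lambda>r c. \<tau> (bvec (coefficient \<Phi> w' x c, coefficient \<Phi> w r y)))"
    and "r \<in> obj \<Phi> w' \<Longrightarrow> c \<in> obj \<Phi> w \<Longrightarrow> sesq w w' (\<lambda>x y. \<tau> (bvec (coefficient \<Phi> w x c, coefficient \<Phi> w' r y)))"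
proof -
  note L = clinear_diff[OF \<tau>(1)] clinear_cscale[OF \<tau>(1)]
  have add1: "\<tau> (bvec (a \<oplus>\<^bsub>coend.Q\<^esub> a', b)) = \<tau> (bvec (a, b)) + \<tau> (bvec (a', b))"
    if "a \<in> carrier coend.Q" "a' \<in> carrier coend.Q" "b \<in> carrier coend.Q" for a a' b
    using tensor_rel_gens(1)[OF that] unfolding \<tau>(2)[symmetric] L by (simp only: diff_diff_eq right_minus_eq)
  have add2: "\<tau> (bvec (a, b \<oplus>\<^bsub>coend.Q\<^esub> b')) = \<tau> (bvec (a, b)) + \<tau> (bvec (a, b'))"
    if "a \<in> carrier coend.Q" "b \<in> carrier coend.Q" "b' \<in> carrier coend.Q" for a b b'
    using tensor_rel_gens(2)[OF that] unfolding \<tau>(2)[symmetric] L by (simp only: diff_diff_eq right_minus_eq)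
  have sc1: "\<tau> (bvec (k \<odot>\<^bsub>coend.Q\<^esub> a, b)) = cscale k (\<tau> (bvec (a, b)))"
    if "a \<in> carrier coend.Q" "b \<in> carrier coend.Q" for a b k
    using tensor_rel_gens(3)[OF that, of k] unfolding \<tau>(2)[symmetric] L by (simp only: diff_diff_eq right_minus_eq)
  have sc2: "\<tau> (bvec (a, k \<odot>\<^bsub>coend.Q\<^esub> b)) = cscale k (\<tau> (bvec (a, b)))"
    if "a \<in> carrier coend.Q" "b \<in> carrier coend.Q" for a b k
    using tensor_rel_gens(4)[OF that, of k] unfolding \<tau>(2)[symmetric] L by (simp only: diff_diff_eq right_minus_eq)
  note R = coefficient_sesquilinear coefficient_Q add1 add2 sc1 sc2
  show "sesq w w' (\<lambda>r c. \<tau> (bvec (coefficient \<Phi> w' x c, coefficient \<Phi> w r y)))"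
    if "x \<in> obj \<Phi> w'" "y \<in> obj \<Phi> w"
    by (rule sesqI) (simp_all add: R that)
  show "sesq w w' (\<lambda>x y. \<tau> (bvec (coefficient \<Phi> w x c, coefficient \<Phi> w' r y)))"
    if "r \<in> obj \<Phi> w'" "c \<in> obj \<Phi> w"
    by (rule sesqI) (simp_all add: R that)
qed

abbreviation coend_comult where
  "coend_comult b \<equiv> lin_ext (\<lambda>(x, y). bvec (coend.cls x, coend.cls y)) (coeff_comult \<Phi> b)"

lemma coend_comult_bvec:
  "coend_comult (bvec (w, x, y)) = (let \<xi> = (SOME \<xi>. onb \<Phi> w \<xi>) in
    \<Sum>k<length \<xi>. bvec (coefficient \<Phi> w x (\<xi> ! k), coefficient \<Phi> w (\<xi> ! k) y))"
  by (simp add: coeff_comult_def Let_def lin_ext_sum coefficient_def)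

text \<open>By \<open>frame_trace\<close> the orthonormal basis chosen in
  \<open>coeff_comult\<close> may be replaced by any frame, in particular by the one that matches
  the generators of the free algebra.\<close>

lemma coend_comult_frame:
  assumes \<tau>: "clinear \<tau>" "\<And>t. \<tau> t = 0 \<longleftrightarrow> t \<in> tensor_rel coend.Q"
    and F: "frame w S C' R'" and x: "x \<in> obj \<Phi> w" and y: "y \<in> obj \<Phi> w"
  shows "\<tau> (coend_comult (bvec (w, x, y))) =
    (\<Sum>k\<in>S. \<tau> (bvec (coefficient \<Phi> w x (C' k), coefficient \<Phi> w (R' k) y)))"
proof -
  have "onb \<Phi> w (SOME \<xi>. onb \<Phi> w \<xi>)" using onb_exists by (rule someI_ex)
  from frame_trace[OF sesq_coefficient_tensor(1)[OF \<tau> x y] onb_frame[OF this] F]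
  show ?thesis unfolding coend_comult_bvec Let_def clinear_sum[OF \<tau>(1)] .
qed

text \<open>An intertwining relation is pushed through the sum over inner vectors: f^* x on the left
  becomes f applied to the inner vector on the right of the first factor, the frame of
  \<open>w\<close> is exchanged for one of \<open>w'\<close> with f^* now in the second factor, and
  there it moves over to \<open>y\<close>.\<close>

lemma coend_comult_coideal:
  assumes "b \<in> coend_rel \<Phi>"
  shows "coend_comult b \<in> tensor_rel coend.Q"
proof -
  obtain \<tau> :: "('a coeff_space set \<times> 'a coeff_space set \<Rightarrow>\<^sub>0 complex) \<Rightarrow>
      ('a coeff_space set \<times> 'a coeff_space set \<Rightarrow>\<^sub>0 complex)" where \<tau>: "clinear \<tau>" "\<And>t. \<tau> t = 0 \<longleftrightarrow> t \<in> tensor_rel coend.Q"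
    using exists_linear_with_kernel[OF subspace_tensor_rel[of coend.Q]] by blast
  have lin: "clinear (\<lambda>b. \<tau> (coend_comult b))"
    unfolding coeff_comult_def by (rule clinear_compose[OF \<tau>(1) clinear_compose[OF clinear_lin_ext clinear_lin_ext]])
  have z: "fvec.subspace {0 :: 'a coeff_space set \<times> 'a coeff_space set \<Rightarrow>\<^sub>0 complex}"
    by (rule fvec.subspace_single_0)
  have "coend_rel \<Phi> \<subseteq> {b. \<tau> (coend_comult b) \<in> {0}}"
  proof (rule coend_rel_least[OF subspace_preimage[OF lin z]])
    have "sesq w w (\<lambda>x y. \<tau> (coend_comult (bvec (w, x, y))))" for w
    proof -
      obtain \<xi> where \<xi>: "onb \<Phi> w \<xi>" using onb_exists by blast
      note e = coend_comult_frame[OF \<tau> onb_frame[OF \<xi>]]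
      have S: "sesq w w (\<lambda>x y. \<tau> (bvec (coefficient \<Phi> w x (\<xi> ! k), coefficient \<Phi> w (\<xi> ! k) y)))"
        if "k < length \<xi>" for k
        using onbD(1)[OF \<xi> that] by (intro sesq_coefficient_tensor(2)[OF \<tau>])
      show ?thesis
        by (rule sesqI; simp only: e obj_add obj_scale fvec.scale_sum_right sum.distrib[symmetric];
            intro sum.cong refl; simp add: sesqD[OF S])
    qed
    then show "covariance_rel \<Phi> \<subseteq> {b. \<tau> (coend_comult b) \<in> {0}}"
      using sesq_bvec_iff[OF lin] by blast
    fix w w' f x y assume f: "f \<in> Hom w w'" and x: "x \<in> obj \<Phi> w'" and y: "y \<in> obj \<Phi> w"
    obtain \<xi> \<eta> where \<xi>: "onb \<Phi> w \<xi>" and \<eta>: "onb \<Phi> w' \<eta>" using onb_exists by blast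
    note o = onbD(1)[OF \<xi>] onbD(1)[OF \<eta>]
    \<comment> \<open>The mixed form that takes its first vector from \<open>w\<close> and its
      second from \<open>w'\<close>; evaluating its trace against f in both spaces connects the two
      comultiplications.\<close>
    define \<sigma> where "\<sigma> r c = \<tau> (bvec (coefficient \<Phi> w' x c, coefficient \<Phi> w r y))" for r c
    have S: "sesq w w' \<sigma>" unfolding \<sigma>_def by (rule sesq_coefficient_tensor(1)[OF \<tau> x y])
    have "\<tau> (coend_comult (bvec (w, adj w w' f x, y))) = (\<Sum>k<length \<xi>. \<sigma> (\<xi> ! k) (mor \<Phi> w w' f (\<xi> ! k)))"
      unfolding coend_comult_frame[OF \<tau> onb_frame[OF \<xi>] adj_closed[OF f x] y] \<sigma>_def
      using o by (intro sum.cong) (simp_all add: coefficient_adj[OF f x])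
    also have "\<dots> = (\<Sum>k<length \<xi>. \<Sum>l<length \<eta>. cscale (ip \<Phi> w' (\<eta> ! l) (mor \<Phi> w w' f (\<xi> ! k))) (\<sigma> (\<xi> ! k) (\<eta> ! l)))"
      using o by (intro sum.cong sesq_frame_right[OF S onb_frame[OF \<eta>]]) (simp_all add: mor_closed[OF f])
    also have "\<dots> = (\<Sum>l<length \<eta>. \<Sum>k<length \<xi>. cscale (ip \<Phi> w' (\<eta> ! l) (mor \<Phi> w w' f (\<xi> ! k))) (\<sigma> (\<xi> ! k) (\<eta> ! l)))"
      by (rule sum.swap)
    also have "\<dots> = (\<Sum>l<length \<eta>. \<sigma> (adj w w' f (\<eta> ! l)) (\<eta> ! l))"
    proof (intro sum.cong refl)
      fix l assume "l \<in> {..<length \<eta>}"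
      then have l: "\<eta> ! l \<in> obj \<Phi> w'" using o by simp
      show "(\<Sum>k<length \<xi>. cscale (ip \<Phi> w' (\<eta> ! l) (mor \<Phi> w w' f (\<xi> ! k))) (\<sigma> (\<xi> ! k) (\<eta> ! l))) =
          \<sigma> (adj w w' f (\<eta> ! l)) (\<eta> ! l)"
        unfolding sesq_frame_left[OF S onb_frame[OF \<xi>] adj_closed[OF f l] l]
        using o by (intro sum.cong) (simp_all add: ip_adj[OF f l])
    qed
    also have "\<dots> = \<tau> (coend_comult (bvec (w', x, mor \<Phi> w w' f y)))"
      unfolding coend_comult_frame[OF \<tau> onb_frame[OF \<eta>] x mor_closed[OF f y]] \<sigma>_def
      using o by (intro sum.cong) (simp_all add: coefficient_adj[OF f _ y])
    finally have "\<tau> (coend_comult (bvec (w, adj w w' f x, y))) = \<tau> (coend_comult (bvec (w', x, mor \<Phi> w w' f y)))" .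
    then have "\<tau> (coend_comult (bvec (w, adj w w' f x, y) - bvec (w', x, mor \<Phi> w w' f y))) = 0"
      unfolding clinear_diff[OF lin] by (simp only: right_minus_eq)
    then show "bvec (w, adj w w' f x, y) - bvec (w', x, mor \<Phi> w w' f y) \<in> {b. \<tau> (coend_comult b) \<in> {0}}"
      by blast
  qed
  then show ?thesis using assms \<tau>(2) by blast
qed

end

section \<open>Words in the generators and coefficients\<close>

lemma cscale_single: "cscale c (Poly_Mapping.single g x) = Poly_Mapping.single g (c * x)"
  by (rule poly_mapping_eqI) (simp add: lookup_single when_def)

lemma cscale_bvec: "cscale c (bvec g) = Poly_Mapping.single g c"
  by (simp add: cscale_single)

text \<open>Puts the convolution product into the shape of a bilinear extension, so that it obeys
  the same linearity lemmas as the product of symbols.\<close>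

lemma free_star_mult_eq: "(a :: free_star) * b = bilin_ext (\<lambda>v w. bvec (v + w)) a b"
proof -
  let ?a = "Poly_Mapping.lookup a" and ?b = "Poly_Mapping.lookup b"
  have "a * b = (\<Sum>v\<in>Poly_Mapping.keys a. Poly_Mapping.single v (?a v)) * (\<Sum>w\<in>Poly_Mapping.keys b. Poly_Mapping.single w (?b w))"
    by (rule arg_cong2[OF free_decomp[of a, unfolded cscale_bvec] free_decomp[of b, unfolded cscale_bvec]])
  also have "\<dots> = (\<Sum>v\<in>Poly_Mapping.keys a. \<Sum>w\<in>Poly_Mapping.keys b. Poly_Mapping.single (v + w) (?a v * ?b w))"
    by (simp add: sum_product mult_single)
  also have "\<dots> = bilin_ext (\<lambda>v w. bvec (v + w)) a b"
    by (simp add: bilin_ext_def lin_ext_def fvec.scale_sum_right cscale_single)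
  finally show ?thesis .
qed

lemma clinear_free_mult: "clinear (\<lambda>a. (a :: free_star) * b)" "clinear (\<lambda>b. (a :: free_star) * b)"
  unfolding free_star_mult_eq by (rule clinear_bilin_left, rule clinear_bilin_right)

lemma cscale_mult_left: "cscale c (a :: free_star) * b = cscale c (a * b)"
  using clinear_cscale[OF clinear_free_mult(1)] .

lemma cscale_mult_right: "(a :: free_star) * cscale c b = cscale c (a * b)"
  using clinear_cscale[OF clinear_free_mult(2)] .

lemma bvec_fword_mult: "bvec (FWord u) * bvec (FWord v) = (bvec (FWord (u @ v)) :: free_star)"
  by (simp add: mult_single plus_fword_def)

lemma bvec_fword_Nil: "bvec (FWord []) = (1 :: free_star)"
  by (metis single_one zero_fword_def)

lemma free_algebra_simps [simp]:
  "monoid.mult (free_algebra m) = (*)" "one (free_algebra m) = 1" "zero (free_algebra m) = 0"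
  "add (free_algebra m) = (+)" "module.smult (free_algebra m) = cscale"
  by (simp_all add: free_algebra_def)

lemma carrier_free_algebra:
  "carrier (free_algebra m) = {a. Poly_Mapping.keys a \<subseteq> {w. \<forall>(i, j, s)\<in>set (letters w). i < m \<and> j < m}}"
  by (auto simp: free_algebra_def)

lemma subspace_free_algebra: "fvec.subspace (carrier (free_algebra m))"
  unfolding carrier_free_algebra by (rule subspace_free)

lemma free_algebra_mult_closed:
  assumes "a \<in> carrier (free_algebra m)" "b \<in> carrier (free_algebra m)"
  shows "a * b \<in> carrier (free_algebra m)"
proof (rule clinear_in_subspace[OF clinear_free_mult(1) subspace_free_algebra])
  fix v assume v: "v \<in> Poly_Mapping.keys a"
  show "bvec v * b \<in> carrier (free_algebra m)"
  proof (rule clinear_in_subspace[OF clinear_free_mult(2) subspace_free_algebra])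
    fix w assume "w \<in> Poly_Mapping.keys b"
    then show "bvec v * bvec w \<in> carrier (free_algebra m)"
      using v assms by (auto simp: carrier_free_algebra mult_single plus_fword_def)
  qed
qed

lemma one_free_algebra: "1 \<in> carrier (free_algebra m)"
  by (simp add: carrier_free_algebra bvec_fword_Nil[symmetric] del: single_one)

lemma gen_free_algebra: "i < m \<Longrightarrow> j < m \<Longrightarrow> gen (i, j, s) \<in> carrier (free_algebra m)"
  by (simp add: carrier_free_algebra gen_def)

lemma ring_free_algebra: "ring (free_algebra m)"
  by (rule linear_ringI)
    (simp_all add: subspace_free_algebra free_algebra_mult_closed one_free_algebra algebra_simps)

text \<open>An ideal absorbs multiplication by scalar multiples of 1, which is scaling.\<close>

lemma subspace_free_ideal:
  assumes "ideal I (free_algebra m)"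
  shows "fvec.subspace I"
proof (rule fvec.subspaceI)
  interpret ideal I "free_algebra m" by fact
  show "0 \<in> I" using additive_subgroup.zero_closed[OF additive_subgroup_axioms] by simp
  show "a + b \<in> I" if "a \<in> I" "b \<in> I" for a b
    using additive_subgroup.a_closed[OF additive_subgroup_axioms that] by simp
  show "cscale c a \<in> I" if "a \<in> I" for c a
  proof -
    have "cscale c 1 \<in> carrier (free_algebra m)"
      by (rule fvec.subspace_scale[OF subspace_free_algebra one_free_algebra])
    then have "cscale c 1 * a \<in> I" using I_l_closed[OF that] by simp
    then show ?thesis by (simp add: cscale_mult_left)
  qed
qed

lemma linear_quotient_free: "ideal I (free_algebra m) \<Longrightarrow> linear_quotient (free_algebra m) I"
  by (intro linear_quotient.intro subspace_free_algebra subspace_free_ideal) simp_all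

context based_fiber_functor
begin

text \<open>The simple tensor of the vectors \<open>V a i\<close> along a word. The index list is
  read with \<open>hd\<close> and \<open>tl\<close> and is meaningful when it belongs to
  \<open>Ix w\<close>.\<close>

fun wvec :: "(letter \<Rightarrow> nat \<Rightarrow> 'a) \<Rightarrow> word \<Rightarrow> nat list \<Rightarrow> 'a" where
  "wvec V [] I = unit_vector \<Phi>"
| "wvec V (a # w) I = tens \<Phi> [a] w (V a (hd I)) (wvec V w (tl I))"

definition Ix :: "word \<Rightarrow> nat list set" where
  "Ix w = {I. length I = length w \<and> set I \<subseteq> {..<n}}"

lemma Ix_simps: "Ix [] = {[]}" "Ix (a # w) = (\<lambda>(i, I). i # I) ` ({..<n} \<times> Ix w)"
proof -
  show "Ix [] = {[]}" by (auto simp: Ix_def)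
  show "Ix (a # w) = (\<lambda>(i, I). i # I) ` ({..<n} \<times> Ix w)"
  proof (rule Set.set_eqI)
    fix I show "I \<in> Ix (a # w) \<longleftrightarrow> I \<in> (\<lambda>(i, I). i # I) ` ({..<n} \<times> Ix w)"
      by (cases I) (auto simp: Ix_def image_iff)
  qed
qed

lemma Ix_append: "I \<in> Ix w \<Longrightarrow> I' \<in> Ix w' \<Longrightarrow> I @ I' \<in> Ix (w @ w')"
  by (auto simp: Ix_def)

lemma frame_reindex:
  assumes F: "frame w S (\<lambda>k. C' (h k)) (\<lambda>k. R' (h k))" and h: "inj_on h S"
  shows "frame w (h ` S) C' R'"
  using F h unfolding frame_def by (simp add: sum.reindex)

lemma tens_closed_Cons [simp]:
  "x \<in> obj \<Phi> [a] \<Longrightarrow> y \<in> obj \<Phi> w \<Longrightarrow> tens \<Phi> [a] w x y \<in> obj \<Phi> (a # w)"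
  using tens_closed[of x "[a]" y w] by simp

lemma wvec_closed:
  assumes "\<And>a i. i < n \<Longrightarrow> V a i \<in> obj \<Phi> [a]" "I \<in> Ix w"
  shows "wvec V w I \<in> obj \<Phi> w"
  using assms(2)
proof (induction w arbitrary: I)
  case (Cons a w)
  then show ?case using assms(1) by (auto simp: Ix_simps)
qed simp

lemma wvec_C_closed [simp]: "I \<in> Ix w \<Longrightarrow> wvec C w I \<in> obj \<Phi> w"
  and wvec_R_closed [simp]: "I \<in> Ix w \<Longrightarrow> wvec R w I \<in> obj \<Phi> w"
  by (rule wvec_closed[OF C_closed], assumption+, rule wvec_closed[OF R_closed], assumption+)

lemma wvec_append:
  assumes V: "\<And>a i. i < n \<Longrightarrow> V a i \<in> obj \<Phi> [a]" and I: "I \<in> Ix w" and I': "I' \<in> Ix w'"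
  shows "wvec V (w @ w') (I @ I') = tens \<Phi> w w' (wvec V w I) (wvec V w' I')"
  using I
proof (induction w arbitrary: I)
  case Nil
  then show ?case using wvec_closed[OF V I'] by (simp add: Ix_simps unit_left)
next
  case (Cons a w)
  then obtain i J where iJ: "I = i # J" "i < n" "J \<in> Ix w" by (auto simp: Ix_simps)
  then show ?case
    using Cons.IH[OF iJ(3)] tensor_assoc[OF V[OF iJ(2)] wvec_closed[OF V iJ(3)] wvec_closed[OF V I']] by simp
qed

lemma frame_word: "frame w (Ix w) (wvec C w) (wvec R w)"
proof (induction w)
  case Nil
  have "frame [] {..<length [unit_vector \<Phi>]} ((!) [unit_vector \<Phi>]) ((!) [unit_vector \<Phi>])"
    by (rule onb_frame[OF onb_unit])
  then show ?case by (simp add: frame_def Ix_simps)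
next
  case (Cons a w)
  have "frame ([a] @ w) ({..<n} \<times> Ix w) (\<lambda>(i, j). tens \<Phi> [a] w (C a i) (wvec C w j)) (\<lambda>(i, j). tens \<Phi> [a] w (R a i) (wvec R w j))"
    by (rule frame_tensor[OF frame_letter Cons])
  then have F: "frame (a # w) ({..<n} \<times> Ix w) (\<lambda>k. wvec C (a # w) ((\<lambda>(i, I). i # I) k)) (\<lambda>k. wvec R (a # w) ((\<lambda>(i, I). i # I) k))"
    by (simp add: case_prod_unfold)
  show ?case unfolding Ix_simps 
    by (rule frame_reindex[of "a # w" "{..<n} \<times> Ix w" "wvec C (a # w)" "\<lambda>(i, I). i # I" "wvec R (a # w)", OF F])
      (auto simp: inj_on_def)
qed

lemma finite_Ix [simp]: "finite (Ix w)"
  by (rule frameD(1)[OF frame_word])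

lemma ip_wvec:
  assumes "I \<in> Ix w" "J \<in> Ix w"
  shows "ip \<Phi> w (wvec R w I) (wvec C w J) = (if I = J then 1 else 0)"
  using assms
proof (induction w arbitrary: I J)
  case Nil then show ?case by (simp add: Ix_simps unit_inner)
next
  case (Cons a w)
  then obtain i I' j J' where ij: "I = i # I'" "J = j # J'" "i < n" "j < n" "I' \<in> Ix w" "J' \<in> Ix w"
    by (auto simp: Ix_simps)
  have "ip \<Phi> ([a] @ w) (tens \<Phi> [a] w (R a i) (wvec R w I')) (tens \<Phi> [a] w (C a j) (wvec C w J')) =
      ip \<Phi> [a] (R a i) (C a j) * ip \<Phi> w (wvec R w I') (wvec C w J')"
    using ij by (intro T.inner_tensor) simp_all
  then show ?case using ij by (simp add: ip_R_C Cons.IH)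
qed

text \<open>The monomial for the multi-indices \<open>I\<close> and \<open>J\<close>: a letter
  \<open>X\<close> contributes a generator, a letter \<open>Xstar\<close> the formal adjoint of one,
  which is why the flag is the test for \<open>Xstar\<close>.\<close>

definition uword :: "word \<Rightarrow> nat list \<Rightarrow> nat list \<Rightarrow> free_star" where
  "uword w I J = bvec (FWord (zip I (zip J (map ((=) Xstar) w))))"

lemma uword_append:
  "I \<in> Ix w \<Longrightarrow> J \<in> Ix w \<Longrightarrow> I' \<in> Ix w' \<Longrightarrow> J' \<in> Ix w' \<Longrightarrow>
    uword (w @ w') (I @ I') (J @ J') = uword w I J * uword w' I' J'"
  by (simp add: uword_def bvec_fword_mult Ix_def)

lemma uword_Nil [simp]: "uword [] [] [] = 1"
  by (simp add: uword_def bvec_fword_Nil)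

lemma uword_single: "uword [a] [i] [j] = gen (i, j, a = Xstar)"
  by (simp add: uword_def gen_def eq_commute)

lemma uword_closed [simp]: "I \<in> Ix w \<Longrightarrow> J \<in> Ix w \<Longrightarrow> uword w I J \<in> carrier (free_algebra n)"
  by (force simp: uword_def carrier_free_algebra Ix_def set_zip subset_iff)

text \<open>The element of the free algebra that represents the coefficient \<open>(w, x, y)\<close>.\<close>

definition B :: "word \<Rightarrow> 'a \<Rightarrow> 'a \<Rightarrow> free_star" where
  "B w x y = (\<Sum>I\<in>Ix w. \<Sum>J\<in>Ix w. cscale (ip \<Phi> w x (wvec C w I) * ip \<Phi> w (wvec R w J) y) (uword w I J))"

lemma B_closed [simp]: "B w x y \<in> carrier (free_algebra n)"
  unfolding B_def by (intro fvec.subspace_sum[OF subspace_free_algebra] fvec.subspace_scale[OF subspace_free_algebra] uword_closed)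

lemma sesq_B: "sesq w w (B w)"
proof (rule sesqI)
  show "B w (x + x') y = B w x y + B w x' y" if "x \<in> obj \<Phi> w" "x' \<in> obj \<Phi> w" "y \<in> obj \<Phi> w" for x x' y
    unfolding B_def sum.distrib[symmetric] using that
    by (intro sum.cong refl) (simp add: ip_add_left distrib_right fvec.scale_left_distrib)
  show "B w x (y + y') = B w x y + B w x y'" if "x \<in> obj \<Phi> w" "y \<in> obj \<Phi> w" "y' \<in> obj \<Phi> w" for x y y'
    unfolding B_def sum.distrib[symmetric] using that
    by (intro sum.cong refl) (simp add: H.inner_add distrib_left fvec.scale_left_distrib)
  show "B w (scal \<Phi> c x) y = cscale (cnj c) (B w x y)" if "x \<in> obj \<Phi> w" "y \<in> obj \<Phi> w" for c x y
    unfolding B_def fvec.scale_sum_right using that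
    by (intro sum.cong refl) (simp add: ip_scale_left mult.assoc)
  show "B w x (scal \<Phi> c y) = cscale c (B w x y)" if "x \<in> obj \<Phi> w" "y \<in> obj \<Phi> w" for c x y
    unfolding B_def fvec.scale_sum_right using that
    by (intro sum.cong refl) (simp add: H.inner_scale mult.left_commute)
qed

lemma B_basis:
  assumes "I \<in> Ix w" "J \<in> Ix w"
  shows "B w (wvec R w I) (wvec C w J) = uword w I J"
proof -
  have "B w (wvec R w I) (wvec C w J) =
      (\<Sum>I'\<in>Ix w. \<Sum>J'\<in>Ix w. if I = I' then if J' = J then uword w I' J' else 0 else 0)"
    unfolding B_def using assms by (intro sum.cong refl) (simp add: ip_wvec)
  also have "\<dots> = (\<Sum>I'\<in>Ix w. if I = I' then uword w I' J else 0)"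
  proof (intro sum.cong refl)
    fix I' show "(\<Sum>J'\<in>Ix w. if I = I' then if J' = J then uword w I' J' else 0 else 0) = (if I = I' then uword w I' J else 0)"
      using assms(2) by (cases "I = I'") simp_all
  qed
  finally show ?thesis using assms(1) by simp
qed

lemma sesq_clinear: "clinear F \<Longrightarrow> sesq w w' \<beta> \<Longrightarrow> sesq w w' (\<lambda>x y. F (\<beta> x y))"
  unfolding sesq_def by (simp add: clinear_add clinear_cscale)

lemma sesq_tensor:
  assumes "sesq (w1 @ w2) (w1' @ w2') \<beta>"
  shows "x2 \<in> obj \<Phi> w2 \<Longrightarrow> y2 \<in> obj \<Phi> w2' \<Longrightarrow> sesq w1 w1' (\<lambda>x y. \<beta> (tens \<Phi> w1 w2 x x2) (tens \<Phi> w1' w2' y y2))"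
    and "x1 \<in> obj \<Phi> w1 \<Longrightarrow> y1 \<in> obj \<Phi> w1' \<Longrightarrow> sesq w2 w2' (\<lambda>x y. \<beta> (tens \<Phi> w1 w2 x1 x) (tens \<Phi> w1' w2' y1 y))"
  by (rule sesqI; simp add: T.add_left T.add_right T.scale_left T.scale_right sesqD[OF assms])+

text \<open>On the simple tensors of frame vectors this is concatenation of monomials.
  Sesquilinearity extends it to arbitrary vectors, first in the factor \<open>w\<close> and then in
  the factor \<open>w'\<close>.\<close>

lemma B_tensor:
  assumes x: "x \<in> obj \<Phi> w" and y: "y \<in> obj \<Phi> w" and x': "x' \<in> obj \<Phi> w'" and y': "y' \<in> obj \<Phi> w'"
  shows "B (w @ w') (tens \<Phi> w w' x x') (tens \<Phi> w w' y y') = B w x y * B w' x' y'"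
proof -
  note FR = frame_sym[OF frame_word] and FC = frame_word
  have "B (w @ w') (tens \<Phi> w w' x (wvec R w' I')) (tens \<Phi> w w' y (wvec C w' J')) =
      B w x y * B w' (wvec R w' I') (wvec C w' J')" if IJ': "I' \<in> Ix w'" "J' \<in> Ix w'" for I' J'
  proof (rule sesq_ext[OF sesq_tensor(1)[OF sesq_B] sesq_clinear[OF clinear_free_mult(1) sesq_B] FR FC _ x y])
    fix I J assume IJ: "I \<in> Ix w" "J \<in> Ix w"
    have "tens \<Phi> w w' (wvec R w I) (wvec R w' I') = wvec R (w @ w') (I @ I')"
      "tens \<Phi> w w' (wvec C w J) (wvec C w' J') = wvec C (w @ w') (J @ J')"
      using wvec_append[OF R_closed IJ(1) IJ'(1)] wvec_append[OF C_closed IJ(2) IJ'(2)] by simp_all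
    then show "B (w @ w') (tens \<Phi> w w' (wvec R w I) (wvec R w' I')) (tens \<Phi> w w' (wvec C w J) (wvec C w' J')) =
        B w (wvec R w I) (wvec C w J) * B w' (wvec R w' I') (wvec C w' J')"
      using IJ IJ' by (simp only: B_basis Ix_append uword_append)
  qed (use IJ' in simp_all)
  then show ?thesis
    by (intro sesq_ext[OF sesq_tensor(2)[OF sesq_B x y] sesq_clinear[OF clinear_free_mult(2) sesq_B] FR FC _ x' y'])
qed

lemma B_Nil: "x \<in> obj \<Phi> [] \<Longrightarrow> B [] x (unit_vector \<Phi>) = cscale (ip \<Phi> [] x (unit_vector \<Phi>)) 1"
  "y \<in> obj \<Phi> [] \<Longrightarrow> B [] (unit_vector \<Phi>) y = cscale (ip \<Phi> [] (unit_vector \<Phi>) y) 1"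
  by (simp_all add: B_def Ix_simps unit_inner)

text \<open>The two families express that the cap and the cup of \<open>a\<close> are intertwiners.\<close>

definition arc_rel :: "free_star set" where
  "arc_rel =
    {B [a, dual a] (tens \<Phi> [a] [dual a] (R a i) (R (dual a) j)) (arc_vector a) -
       cscale (ip \<Phi> [a, dual a] (tens \<Phi> [a] [dual a] (R a i) (R (dual a) j)) (arc_vector a)) 1 |a i j. i < n \<and> j < n} \<union>
    {B [a, dual a] (arc_vector a) (tens \<Phi> [a] [dual a] (C a i) (C (dual a) j)) -
       cscale (ip \<Phi> [a, dual a] (arc_vector a) (tens \<Phi> [a] [dual a] (C a i) (C (dual a) j))) 1 |a i j. i < n \<and> j < n}"

lemma arc_rel_carrier: "arc_rel \<subseteq> carrier (free_algebra n)"
  unfolding arc_rel_def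
  by (auto intro!: fvec.subspace_diff[OF subspace_free_algebra] fvec.subspace_scale[OF subspace_free_algebra] one_free_algebra)

definition arc_ideal :: "free_star set" where
  "arc_ideal = Idl\<^bsub>free_algebra n\<^esub> arc_rel"

lemma ideal_arc_ideal: "ideal arc_ideal (free_algebra n)"
  unfolding arc_ideal_def by (rule ring.genideal_ideal[OF ring_free_algebra arc_rel_carrier])

lemma arc_rel_ideal: "arc_rel \<subseteq> arc_ideal"
  unfolding arc_ideal_def by (rule ring.genideal_self[OF ring_free_algebra arc_rel_carrier])

sublocale free: linear_quotient "free_algebra n" arc_ideal
  by (rule linear_quotient_free[OF ideal_arc_ideal])

lemma arc_ideal_mult: "a \<in> arc_ideal \<Longrightarrow> b \<in> carrier (free_algebra n) \<Longrightarrow> a * b \<in> arc_ideal"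
  "a \<in> arc_ideal \<Longrightarrow> b \<in> carrier (free_algebra n) \<Longrightarrow> b * a \<in> arc_ideal"
  using free.I_r_closed free.I_l_closed by simp_all

lemma frame_letters:
  "frame [a, b] ({..<n} \<times> {..<n}) (\<lambda>(i, j). tens \<Phi> [a] [b] (C a i) (C b j)) (\<lambda>(i, j). tens \<Phi> [a] [b] (R a i) (R b j))"
  using frame_tensor[OF frame_letter[of a] frame_letter[of b]] by simp

lemma frame_unit: "frame [] {()} (\<lambda>_. unit_vector \<Phi>) (\<lambda>_. unit_vector \<Phi>)"
  unfolding frame_def by (simp add: obj_Nil_eq)

section \<open>Every morphism intertwines modulo the relations of the arcs\<close>

text \<open>The relation without bases, transported to the free algebra by \<open>B\<close>.
  Membership in \<open>Hom\<close> is a premise inside the predicate; in this way composites can be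
  handled without a separate proof that concatenation respects types.\<close>

definition intertwines :: "word \<Rightarrow> word \<Rightarrow> morphism \<Rightarrow> bool" where
  "intertwines w w' f \<longleftrightarrow> (f \<in> Hom w w' \<longrightarrow> (\<forall>x\<in>obj \<Phi> w'. \<forall>y\<in>obj \<Phi> w.
    B w (adj w w' f x) y - B w' x (mor \<Phi> w w' f y) \<in> arc_ideal))"

lemma intertwinesI:
  assumes F: "frame w' S C1 R1" and F': "frame w S' C2 R2"
    and eq: "\<And>k l. f \<in> Hom w w' \<Longrightarrow> k \<in> S \<Longrightarrow> l \<in> S' \<Longrightarrow>
      B w (adj w w' f (C1 k)) (C2 l) - B w' (C1 k) (mor \<Phi> w w' f (C2 l)) \<in> arc_ideal"
  shows "intertwines w w' f"
  unfolding intertwines_def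
proof (intro impI ballI)
  fix x y assume f: "f \<in> Hom w w'" and x: "x \<in> obj \<Phi> w'" and y: "y \<in> obj \<Phi> w"
  obtain \<pi> :: "free_star \<Rightarrow> free_star" where \<pi>: "clinear \<pi>" "\<And>a. \<pi> a = 0 \<longleftrightarrow> a \<in> arc_ideal"
    using exists_linear_with_kernel[OF free.subspace_I] by blast
  note P = linear_with_kernel_eq[OF \<pi>]
  have S: "sesq w w (\<lambda>x y. \<pi> (B w x y))" for w by (rule sesq_clinear[OF \<pi>(1) sesq_B])
  have "\<pi> (B w (adj w w' f x) y) = \<pi> (B w' x (mor \<Phi> w w' f y))"
    by (rule sesq_ext[OF sesq_adj[OF S f] sesq_mor[OF S f] F F' _ x y]) (use eq[OF f] P in simp)
  then show "B w (adj w w' f x) y - B w' x (mor \<Phi> w w' f y) \<in> arc_ideal" unfolding P .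
qed

lemma intertwines_id: "intertwines w w (bvec (id_diagram w))"
  unfolding intertwines_def by (simp add: id fvec.subspace_0[OF free.subspace_I])

text \<open>By \<open>adj_cap\<close> the defect is a scalar multiple of a generator in the second
  family of \<open>arc_rel\<close>. The scalar is \<open>cnj s\<close> because \<open>B\<close> is
  conjugate-linear on the left; for the cup it is \<open>- t\<close>, with a generator of the first
  family.\<close>

lemma intertwines_cap: "intertwines [a, dual a] [] (bvec (cap a))"
proof (rule intertwinesI[OF frame_unit frame_letters])
  let ?f = "bvec (cap a)"
  obtain s t where s: "adj [a, dual a] [] ?f (unit_vector \<Phi>) = scal \<Phi> s (arc_vector a)"
    using adj_cap by metis
  fix k l assume f: "?f \<in> Hom [a, dual a] []" and l: "l \<in> {..<n} \<times> {..<n}"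
  obtain i j where ij: "l = (i, j)" "i < n" "j < n" using l by auto
  let ?y = "tens \<Phi> [a] [dual a] (C a i) (C (dual a) j)"
  have y: "?y \<in> obj \<Phi> [a, dual a]" using ij by simp
  have "B [] (unit_vector \<Phi>) (mor \<Phi> [a, dual a] [] ?f ?y) = cscale (ip \<Phi> [a, dual a] (scal \<Phi> s (arc_vector a)) ?y) 1"
    using ip_adj[OF f unit_closed y] by (simp add: B_Nil(2) mor_closed[OF f y] s)
  also have "\<dots> = cscale (cnj s) (cscale (ip \<Phi> [a, dual a] (arc_vector a) ?y) 1)"
    by (simp add: ip_scale_left y)
  finally have eq: "B [a, dual a] (adj [a, dual a] [] ?f (unit_vector \<Phi>)) ?y - B [] (unit_vector \<Phi>) (mor \<Phi> [a, dual a] [] ?f ?y) =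
      cscale (cnj s) (B [a, dual a] (arc_vector a) ?y - cscale (ip \<Phi> [a, dual a] (arc_vector a) ?y) 1)"
    by (simp add: s sesqD(3)[OF sesq_B] y fvec.scale_right_diff_distrib)
  have "B [a, dual a] (arc_vector a) ?y - cscale (ip \<Phi> [a, dual a] (arc_vector a) ?y) 1 \<in> arc_ideal"
    using arc_rel_ideal ij unfolding arc_rel_def by blast
  then show "B [a, dual a] (adj [a, dual a] [] ?f (unit_vector \<Phi>)) ((\<lambda>(i, j). tens \<Phi> [a] [dual a] (C a i) (C (dual a) j)) l) -
      B [] (unit_vector \<Phi>) (mor \<Phi> [a, dual a] [] ?f ((\<lambda>(i, j). tens \<Phi> [a] [dual a] (C a i) (C (dual a) j)) l)) \<in> arc_ideal"
    unfolding ij(1) prod.case eq by (rule fvec.subspace_scale[OF free.subspace_I])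
qed

lemma intertwines_cup: "intertwines [] [a, dual a] (bvec (reflect (cap a)))"
proof (rule intertwinesI[OF frame_sym[OF frame_letters] frame_unit])
  let ?f = "bvec (reflect (cap a))"
  obtain t where t: "mor \<Phi> [] [a, dual a] ?f (unit_vector \<Phi>) = scal \<Phi> t (arc_vector a)"
    using adj_cap by metis
  fix k l assume f: "?f \<in> Hom [] [a, dual a]" and k: "k \<in> {..<n} \<times> {..<n}"
  obtain i j where ij: "k = (i, j)" "i < n" "j < n" using k by auto
  let ?x = "tens \<Phi> [a] [dual a] (R a i) (R (dual a) j)"
  have x: "?x \<in> obj \<Phi> [a, dual a]" using ij by simp
  have "B [] (adj [] [a, dual a] ?f ?x) (unit_vector \<Phi>) = cscale (ip \<Phi> [a, dual a] ?x (scal \<Phi> t (arc_vector a))) 1"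
    using ip_adj[OF f x unit_closed] by (simp add: B_Nil(1) adj_closed[OF f x] t)
  also have "\<dots> = cscale t (cscale (ip \<Phi> [a, dual a] ?x (arc_vector a)) 1)"
    by (simp add: H.inner_scale x)
  finally have eq: "B [] (adj [] [a, dual a] ?f ?x) (unit_vector \<Phi>) - B [a, dual a] ?x (mor \<Phi> [] [a, dual a] ?f (unit_vector \<Phi>)) =
      cscale (- t) (B [a, dual a] ?x (arc_vector a) - cscale (ip \<Phi> [a, dual a] ?x (arc_vector a)) 1)"
    by (simp add: t sesqD(4)[OF sesq_B] x fvec.scale_right_diff_distrib)
  have "B [a, dual a] ?x (arc_vector a) - cscale (ip \<Phi> [a, dual a] ?x (arc_vector a)) 1 \<in> arc_ideal"
    using arc_rel_ideal ij unfolding arc_rel_def by blast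
  then show "B [] (adj [] [a, dual a] ?f ((\<lambda>(i, j). tens \<Phi> [a] [dual a] (R a i) (R (dual a) j)) k)) (unit_vector \<Phi>) -
      B [a, dual a] ((\<lambda>(i, j). tens \<Phi> [a] [dual a] (R a i) (R (dual a) j)) k) (mor \<Phi> [] [a, dual a] ?f (unit_vector \<Phi>)) \<in> arc_ideal"
    unfolding ij(1) prod.case eq by (rule fvec.subspace_scale[OF free.subspace_I])
qed

lemma intertwines_comp:
  assumes f: "f \<in> Hom w w'" and g: "g \<in> Hom w' w''" and kf: "intertwines w w' f" and kg: "intertwines w' w'' g"
  shows "intertwines w w'' (comp_mor d g f)"
  unfolding intertwines_def
proof (intro impI ballI)
  fix x y assume gf: "comp_mor d g f \<in> Hom w w''" and x: "x \<in> obj \<Phi> w''" and y: "y \<in> obj \<Phi> w"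
  have adj: "adj w w'' (comp_mor d g f) x = adj w w' f (adj w' w'' g x)"
    by (rule adj_unique[OF gf x]) (use x f g in \<open>simp_all add: ip_adj comp mor_closed\<close>)
  have "B w (adj w w' f (adj w' w'' g x)) y - B w' (adj w' w'' g x) (mor \<Phi> w w' f y) \<in> arc_ideal"
    using kf f x y g unfolding intertwines_def by simp
  moreover have "B w' (adj w' w'' g x) (mor \<Phi> w w' f y) - B w'' x (mor \<Phi> w' w'' g (mor \<Phi> w w' f y)) \<in> arc_ideal"
    using kg g x mor_closed[OF f y] unfolding intertwines_def by simp
  ultimately have "B w (adj w w' f (adj w' w'' g x)) y - B w'' x (mor \<Phi> w' w'' g (mor \<Phi> w w' f y)) \<in> arc_ideal"
    using fvec.subspace_add[OF free.subspace_I] by fastforce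
  then show "B w (adj w w'' (comp_mor d g f) x) y - B w'' x (mor \<Phi> w w'' (comp_mor d g f) y) \<in> arc_ideal"
    by (simp only: adj comp[OF f g y])
qed

lemma arc_ideal_mult_cong:
  assumes "a - a' \<in> arc_ideal" "b - b' \<in> arc_ideal" "b \<in> carrier (free_algebra n)" "a' \<in> carrier (free_algebra n)"
  shows "a * b - a' * b' \<in> arc_ideal"
proof -
  have "a * b - a' * b' = (a - a') * b + a' * (b - b')" by (simp add: algebra_simps)
  then show ?thesis using assms arc_ideal_mult fvec.subspace_add[OF free.subspace_I] by simp
qed

lemma intertwines_tensor:
  assumes f: "f \<in> Hom w1 w1'" and g: "g \<in> Hom w2 w2'" and kf: "intertwines w1 w1' f" and kg: "intertwines w2 w2' g"
  shows "intertwines (w1 @ w2) (w1' @ w2') (tensor_mor (length w1) (length w1') f g)"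
proof (rule intertwinesI[OF frame_tensor[OF frame_word frame_word] frame_tensor[OF frame_word frame_word]])
  fix k l assume k: "k \<in> Ix w1' \<times> Ix w2'" and l: "l \<in> Ix w1 \<times> Ix w2"
  obtain I1 I2 J1 J2 where IJ: "k = (I1, I2)" "l = (J1, J2)" "I1 \<in> Ix w1'" "I2 \<in> Ix w2'" "J1 \<in> Ix w1" "J2 \<in> Ix w2"
    using k l by auto
  let ?x1 = "wvec C w1' I1" and ?x2 = "wvec C w2' I2" and ?y1 = "wvec C w1 J1" and ?y2 = "wvec C w2 J2"
  let ?h = "tensor_mor (length w1) (length w1') f g"
  have "B (w1 @ w2) (tens \<Phi> w1 w2 (adj w1 w1' f ?x1) (adj w2 w2' g ?x2)) (tens \<Phi> w1 w2 ?y1 ?y2) -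
      B (w1' @ w2') (tens \<Phi> w1' w2' ?x1 ?x2) (tens \<Phi> w1' w2' (mor \<Phi> w1 w1' f ?y1) (mor \<Phi> w2 w2' g ?y2)) \<in> arc_ideal"
    using kf kg f g IJ by (simp add: B_tensor mor_closed intertwines_def arc_ideal_mult_cong)
  then have "B (w1 @ w2) (adj (w1 @ w2) (w1' @ w2') ?h (tens \<Phi> w1' w2' ?x1 ?x2)) (tens \<Phi> w1 w2 ?y1 ?y2) -
      B (w1' @ w2') (tens \<Phi> w1' w2' ?x1 ?x2) (mor \<Phi> (w1 @ w2) (w1' @ w2') ?h (tens \<Phi> w1 w2 ?y1 ?y2)) \<in> arc_ideal"
    using IJ by (simp add: adj_tensor[OF f g] tensor_mor[OF f g])
  then show "B (w1 @ w2) (adj (w1 @ w2) (w1' @ w2') ?h ((\<lambda>(i, j). tens \<Phi> w1' w2' (wvec C w1' i) (wvec C w2' j)) k))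
      ((\<lambda>(i, j). tens \<Phi> w1 w2 (wvec C w1 i) (wvec C w2 j)) l) -
      B (w1' @ w2') ((\<lambda>(i, j). tens \<Phi> w1' w2' (wvec C w1' i) (wvec C w2' j)) k)
      (mor \<Phi> (w1 @ w2) (w1' @ w2') ?h ((\<lambda>(i, j). tens \<Phi> w1 w2 (wvec C w1 i) (wvec C w2 j)) l)) \<in> arc_ideal"
    unfolding IJ(1,2) prod.case .
qed

lemma intertwines_diagram: "D \<in> K w w' \<Longrightarrow> intertwines w w' (bvec D)"
  by (rule K_generated[where G = intertwines and d = d])
    (use intertwines_id[of "[]"] intertwines_id intertwines_cap intertwines_cup intertwines_comp intertwines_tensor in \<open>simp_all add: id_diagram_Nil\<close>)

text \<open>The defect is linear in f: the adjoint depends antilinearly on f, and so does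
  \<open>B\<close> on its first vector. Hence the morphisms with defect in the ideal form a
  subspace, which contains all diagrams.\<close>

lemma B_intertwines:
  assumes f: "f \<in> Hom w w'" and x: "x \<in> obj \<Phi> w'" and y: "y \<in> obj \<Phi> w"
  shows "B w (adj w w' f x) y - B w' x (mor \<Phi> w w' f y) \<in> arc_ideal"
proof -
  let ?E = "\<lambda>f. B w (adj w w' f x) y - B w' x (mor \<Phi> w w' f y)"
  let ?M = "{f \<in> Hom w w'. ?E f \<in> arc_ideal}"
  have "fvec.subspace ?M"
  proof (rule fvec.subspaceI)
    have Hadd: "f + g \<in> Hom w w'" if "f \<in> Hom w w'" "g \<in> Hom w w'" for f g
      by (rule fvec.subspace_add[OF subspace_Hom that])
    have Hsc: "cscale c f \<in> Hom w w'" if "f \<in> Hom w w'" for c f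
      by (rule fvec.subspace_scale[OF subspace_Hom that])
    have add: "adj w w' (f + g) x = adj w w' f x + adj w w' g x" if fg: "f \<in> Hom w w'" "g \<in> Hom w w'" for f g
      by (rule adj_unique[OF Hadd[OF fg] x])
        (use fg x in \<open>simp_all add: ip_add_left ip_adj linear_add H.inner_add mor_closed\<close>)
    have sc: "adj w w' (cscale c f) x = scal \<Phi> (cnj c) (adj w w' f x)" if f: "f \<in> Hom w w'" for c f
      by (rule adj_unique[OF Hsc[OF f] x])
        (use f x in \<open>simp_all add: ip_scale_left ip_adj linear_scale H.inner_scale mor_closed\<close>)
    show sc': "cscale c f \<in> ?M" if "f \<in> ?M" for c f
    proof -
      have f: "f \<in> Hom w w'" using that by simp
      have "?E (cscale c f) = cscale c (?E f)"
        using f x y by (simp add: sc linear_scale mor_closed sesqD[OF sesq_B] fvec.scale_right_diff_distrib)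
      then show ?thesis using that Hsc fvec.subspace_scale[OF free.subspace_I] by simp
    qed
    show "f + g \<in> ?M" if "f \<in> ?M" "g \<in> ?M" for f g
    proof -
      have fg: "f \<in> Hom w w'" "g \<in> Hom w w'" using that by simp_all
      have "?E (f + g) = ?E f + ?E g"
        using fg x y by (simp add: add linear_add mor_closed sesqD[OF sesq_B])
      then show ?thesis using that Hadd fvec.subspace_add[OF free.subspace_I] by simp
    qed
    have z: "(0 :: morphism) \<in> Hom w w'" by (rule fvec.subspace_0[OF subspace_Hom])
    have "?E 0 = 0"
      using sc[OF z, of 0] linear_scale[OF z y, of 0] sesqD(3)[OF sesq_B obj_zero[of w] y, of 0]
        sesqD(4)[OF sesq_B x obj_zero[of w'], of 0] by simp
    then show "0 \<in> ?M" using z fvec.subspace_0[OF free.subspace_I] by simp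
  qed
  moreover have "bvec D \<in> ?M" if "D \<in> Poly_Mapping.keys f" for D
  proof -
    have "D \<in> K w w'" using that f by (auto simp: Hom_def)
    then show ?thesis using intertwines_diagram[of D w w'] bvec_Hom x y by (simp add: intertwines_def)
  qed
  ultimately have "lin_ext bvec f \<in> ?M" by (rule lin_ext_in_subspace)
  then show ?thesis by simp
qed

section \<open>The free algebra compared with the algebra of symbols\<close>

definition coeff_to_free :: "'a coeff_space \<Rightarrow> free_star" where
  "coeff_to_free = lin_ext (\<lambda>(w, x, y). B w x y)"

lemma coeff_to_free_bvec [simp]: "coeff_to_free (bvec (w, x, y)) = B w x y"
  by (simp add: coeff_to_free_def)

lemma clinear_coeff_to_free: "clinear coeff_to_free"
  unfolding coeff_to_free_def by (rule clinear_lin_ext)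

lemma coeff_to_free_closed: "coeff_to_free b \<in> carrier (free_algebra n)"
  unfolding coeff_to_free_def by (rule lin_ext_in_subspace[OF subspace_free_algebra]) (auto split: prod.split)

lemma coeff_to_free_coend_rel:
  assumes "b \<in> coend_rel \<Phi>"
  shows "coeff_to_free b \<in> arc_ideal"
proof -
  have "coend_rel \<Phi> \<subseteq> {b. coeff_to_free b \<in> arc_ideal}"
  proof (rule coend_rel_least[OF subspace_preimage[OF clinear_coeff_to_free free.subspace_I]])
    have "\<forall>r\<in>covariance_rel \<Phi>. coeff_to_free r = 0"
      unfolding sesq_bvec_iff[OF clinear_coeff_to_free] by (simp add: sesq_B)
    then show "covariance_rel \<Phi> \<subseteq> {b. coeff_to_free b \<in> arc_ideal}"
      using fvec.subspace_0[OF free.subspace_I] by auto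
    fix w w' f x y assume "f \<in> Hom w w'" "x \<in> obj \<Phi> w'" "y \<in> obj \<Phi> w"
    then show "bvec (w, adj w w' f x, y) - bvec (w', x, mor \<Phi> w w' f y) \<in> {b. coeff_to_free b \<in> arc_ideal}"
      using B_intertwines by (simp add: clinear_diff[OF clinear_coeff_to_free])
  qed
  then show ?thesis using assms by blast
qed

text \<open>Reads a monomial as the symbol at the simple tensors of \<open>R\<close> and
  \<open>C\<close> vectors. This map is multiplicative on the nose, because simple tensors are
  compatible with concatenation; \<open>coeff_to_free\<close> inverts it exactly on one side and
  modulo the coend relations on the other.\<close>

definition free_to_coeff :: "free_star \<Rightarrow> 'a coeff_space" where
  "free_to_coeff = lin_ext (\<lambda>v. let w = map (\<lambda>(i, j, s). if s then Xstar else X) (letters v)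
    in bvec (w, wvec R w (map fst (letters v)), wvec C w (map (\<lambda>g. fst (snd g)) (letters v))))"

lemma clinear_free_to_coeff: "clinear free_to_coeff"
  unfolding free_to_coeff_def by (rule clinear_lin_ext)

lemma free_to_coeff_uword:
  assumes "I \<in> Ix w" "J \<in> Ix w"
  shows "free_to_coeff (uword w I J) = bvec (w, wvec R w I, wvec C w J)"
proof -
  let ?gs = "zip I (zip J (map ((=) Xstar) w))"
  have l: "length I = length w" "length J = length w" using assms by (auto simp: Ix_def)
  have "map (\<lambda>(i, j, s). if s then Xstar else X) ?gs = map ((\<lambda>s. if s then Xstar else X) \<circ> ((=) Xstar)) w"
    using l by (intro nth_equalityI) auto
  also have "\<dots> = w"
  proof -
    have "(if Xstar = a then Xstar else X) = a" for a by (cases a) simp_all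
    then show ?thesis by (simp only: comp_def list.map_ident)
  qed
  finally have w: "map (\<lambda>(i, j, s). if s then Xstar else X) ?gs = w" .
  have "map fst ?gs = I" "map (\<lambda>g. fst (snd g)) ?gs = J"
    using l by (auto intro!: nth_equalityI)
  then show ?thesis by (simp add: free_to_coeff_def uword_def w)
qed

lemma free_word_cases:
  assumes "a \<in> carrier (free_algebra n)" "u \<in> Poly_Mapping.keys a"
  obtains w I J where "I \<in> Ix w" "J \<in> Ix w" "bvec u = uword w I J"
proof -
  let ?gs = "letters u"
  let ?w = "map (\<lambda>(i, j, s). if s then Xstar else X) ?gs"
  let ?I = "map fst ?gs" and ?J = "map (\<lambda>g. fst (snd g)) ?gs"
  have gs: "i < n \<and> j < n" if "(i, j, s) \<in> set ?gs" for i j s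
    using assms that by (auto simp: carrier_free_algebra)
  have "?I \<in> Ix ?w" "?J \<in> Ix ?w" using gs by (auto simp: Ix_def)
  moreover have "zip ?I (zip ?J (map ((=) Xstar) ?w)) = ?gs"
    by (rule nth_equalityI) (auto split: prod.split simp: prod_eq_iff)
  then have "bvec u = uword ?w ?I ?J" by (cases u) (simp add: uword_def)
  ultimately show ?thesis by (rule that)
qed

lemma free_to_coeff_closed:
  assumes "a \<in> carrier (free_algebra n)"
  shows "free_to_coeff a \<in> carrier (coeff_algebra \<Phi>)"
proof (rule clinear_in_subspace[OF clinear_free_to_coeff subspace_coeff_carrier])
  fix u assume "u \<in> Poly_Mapping.keys a"
  then obtain w I J where "I \<in> Ix w" "J \<in> Ix w" "bvec u = uword w I J" by (rule free_word_cases[OF assms])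
  then show "free_to_coeff (bvec u) \<in> carrier (coeff_algebra \<Phi>)"
    by (simp only: free_to_coeff_uword bvec_coeff_carrier wvec_C_closed wvec_R_closed simp_thms)
qed

lemma free_to_coeff_one: "free_to_coeff 1 = \<one>\<^bsub>coeff_algebra \<Phi>\<^esub>"
  using free_to_coeff_uword[of "[]" "[]" "[]"] by (simp add: Ix_simps)

lemma free_to_coeff_mult:
  assumes "a \<in> carrier (free_algebra n)" "b \<in> carrier (free_algebra n)"
  shows "free_to_coeff (a * b) = free_to_coeff a \<otimes>\<^bsub>coeff_algebra \<Phi>\<^esub> free_to_coeff b"
proof -
  note T = clinear_free_to_coeff and M = clinear_coeff_mult[of \<Phi>] and P = clinear_free_mult
  show ?thesis
  proof (rule clinear_cong[OF clinear_compose[OF T P(1)] clinear_compose[OF M(1) T]])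
    fix u assume "u \<in> Poly_Mapping.keys a"
    then obtain w I J where u: "I \<in> Ix w" "J \<in> Ix w" "bvec u = uword w I J" by (rule free_word_cases[OF assms(1)])
    show "free_to_coeff (bvec u * b) = free_to_coeff (bvec u) \<otimes>\<^bsub>coeff_algebra \<Phi>\<^esub> free_to_coeff b"
    proof (rule clinear_cong[OF clinear_compose[OF T P(2)] clinear_compose[OF M(2) T]])
      fix u' assume "u' \<in> Poly_Mapping.keys b"
      then obtain w' I' J' where u': "I' \<in> Ix w'" "J' \<in> Ix w'" "bvec u' = uword w' I' J'"
        by (rule free_word_cases[OF assms(2)])
      show "free_to_coeff (bvec u * bvec u') = free_to_coeff (bvec u) \<otimes>\<^bsub>coeff_algebra \<Phi>\<^esub> free_to_coeff (bvec u')"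
        unfolding u(3) u'(3) using u u'
        by (simp only: uword_append[symmetric] free_to_coeff_uword Ix_append coeff_mult_bvec
            wvec_append[OF R_closed] wvec_append[OF C_closed])
    qed
  qed
qed

lemma coeff_to_free_to_coeff:
  assumes "a \<in> carrier (free_algebra n)"
  shows "coeff_to_free (free_to_coeff a) = a"
proof (rule clinear_cong[OF clinear_compose[OF clinear_coeff_to_free clinear_free_to_coeff] clinear_id])
  fix u assume "u \<in> Poly_Mapping.keys a"
  then obtain w I J where "I \<in> Ix w" "J \<in> Ix w" "bvec u = uword w I J" by (rule free_word_cases[OF assms])
  then show "coeff_to_free (free_to_coeff (bvec u)) = bvec u"
    by (simp only: free_to_coeff_uword coeff_to_free_bvec B_basis)
qed

text \<open>On frame vectors the two symbols are equal. In general \<open>B\<close> has expanded the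
  vectors in the frames, and covariance undoes the expansion.\<close>

lemma bvec_free_to_coeff_B:
  assumes x: "x \<in> obj \<Phi> w" and y: "y \<in> obj \<Phi> w"
  shows "bvec (w, x, y) - free_to_coeff (B w x y) \<in> coend_rel \<Phi>"
proof -
  obtain \<pi> :: "'a coeff_space \<Rightarrow> 'a coeff_space" where \<pi>: "clinear \<pi>" "\<And>a. \<pi> a = 0 \<longleftrightarrow> a \<in> coend_rel \<Phi>"
    using exists_linear_with_kernel[OF subspace_coend_rel] by blast
  have S: "sesq w w (\<lambda>x y. \<pi> (bvec (w, x, y)))"
    using sesq_bvec_iff[OF \<pi>(1)] covariance_in_coend_rel \<pi>(2) by blast
  have "\<pi> (bvec (w, x, y)) = \<pi> (free_to_coeff (B w x y))"
    by (rule sesq_ext[OF S sesq_clinear[OF clinear_compose[OF \<pi>(1) clinear_free_to_coeff] sesq_B]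
          frame_sym[OF frame_word] frame_word _ x y])
      (simp only: B_basis free_to_coeff_uword)
  then show ?thesis unfolding linear_with_kernel_eq[OF \<pi>] .
qed

lemma free_to_coeff_surj:
  assumes b: "b \<in> carrier (coeff_algebra \<Phi>)"
  shows "b - free_to_coeff (coeff_to_free b) \<in> coend_rel \<Phi>"
proof (rule clinear_in_subspace[OF _ subspace_coend_rel, of "\<lambda>b. b - free_to_coeff (coeff_to_free b)"])
  have "clinear (\<lambda>b. free_to_coeff (coeff_to_free b))"
    by (rule clinear_compose[OF clinear_free_to_coeff clinear_coeff_to_free])
  then show "clinear (\<lambda>b. b - free_to_coeff (coeff_to_free b))"
    by (simp add: clinear_def fvec.scale_right_diff_distrib)
  fix g assume "g \<in> Poly_Mapping.keys b"
  then obtain w x y where "g = (w, x, y)" "x \<in> obj \<Phi> w" "y \<in> obj \<Phi> w" by (rule coeff_symbolE[OF b])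
  then show "bvec g - free_to_coeff (coeff_to_free (bvec g)) \<in> coend_rel \<Phi>"
    by (simp only: coeff_to_free_bvec bvec_free_to_coeff_B)
qed

text \<open>The coend relation of a cap or cup is a multiple of the wanted one by a scalar of
  \<open>adj_cap\<close> or its conjugate. In this direction one has to divide by it, so the fact
  that it does not vanish is used.\<close>

lemma free_to_coeff_arc_rel:
  assumes "a \<in> arc_rel"
  shows "free_to_coeff a \<in> coend_rel \<Phi>"
proof -
  obtain \<pi> :: "'a coeff_space \<Rightarrow> 'a coeff_space" where \<pi>: "clinear \<pi>" "\<And>a. \<pi> a = 0 \<longleftrightarrow> a \<in> coend_rel \<Phi>"
    using exists_linear_with_kernel[OF subspace_coend_rel] by blast
  note P = linear_with_kernel_eq[OF \<pi>]
  have S: "sesq w w (\<lambda>x y. \<pi> (bvec (w, x, y)))" for w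
    using sesq_bvec_iff[OF \<pi>(1)] covariance_in_coend_rel \<pi>(2) by blast
  let ?T = "\<lambda>a. \<pi> (free_to_coeff a)" and ?u = "unit_vector \<Phi>"
  have lin: "clinear ?T" by (rule clinear_compose[OF \<pi>(1) clinear_free_to_coeff])
  have TB: "?T (B w x y) = \<pi> (bvec (w, x, y))" if "x \<in> obj \<Phi> w" "y \<in> obj \<Phi> w" for w x y
    using bvec_free_to_coeff_B[OF that] unfolding P[symmetric] by (rule sym)
  have one: "?T 1 = \<pi> (bvec ([], ?u, ?u))" by (simp add: free_to_coeff_one)
  have adj: "\<pi> (bvec (w, adj w w' f x, y)) = \<pi> (bvec (w', x, mor \<Phi> w w' f y))"
    if "f \<in> Hom w w'" "x \<in> obj \<Phi> w'" "y \<in> obj \<Phi> w" for w w' f x y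
    using coend_rel_adj[OF that] unfolding P[symmetric] .
  have right: "?T (B [b, dual b] x (arc_vector b) - cscale (ip \<Phi> [b, dual b] x (arc_vector b)) 1) = 0"
    if x: "x \<in> obj \<Phi> [b, dual b]" for b x
  proof -
    let ?f = "bvec (reflect (cap b))"
    obtain t where t: "t \<noteq> 0" "mor \<Phi> [] [b, dual b] ?f ?u = scal \<Phi> t (arc_vector b)"
      using adj_cap by metis
    note f = reflect_cap_Hom[of b]
    \<comment> \<open>The adjoint of the cup takes values in \<Phi>(I), so its value is a multiple
      of the unit vector; the adjunction then identifies the factor.\<close>
    define c where "c = ip \<Phi> [] ?u (adj [] [b, dual b] ?f x)"
    have ad: "adj [] [b, dual b] ?f x = scal \<Phi> c ?u"
      unfolding c_def by (rule obj_Nil_eq[OF adj_closed[OF f x], symmetric])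
    have c: "cnj c = t * ip \<Phi> [b, dual b] x (arc_vector b)"
      using ip_adj[OF f x unit_closed] x unfolding ad t(2)
      by (simp add: ip_scale_left unit_inner H.inner_scale)
    have "cscale t (\<pi> (bvec ([b, dual b], x, arc_vector b))) = cscale t (cscale (ip \<Phi> [b, dual b] x (arc_vector b)) (?T 1))"
      using adj[OF f x unit_closed] unfolding ad t(2) one
      using sesqD(4)[OF S x arc_vector_closed] sesqD(3)[OF S unit_closed unit_closed] by (simp add: c)
    then have "\<pi> (bvec ([b, dual b], x, arc_vector b)) = cscale (ip \<Phi> [b, dual b] x (arc_vector b)) (?T 1)"
      using t(1) fvec.scale_left_imp_eq by blast
    then show ?thesis by (simp add: clinear_diff[OF lin] clinear_cscale[OF lin] TB[OF x arc_vector_closed])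
  qed
  have left: "?T (B [b, dual b] (arc_vector b) y - cscale (ip \<Phi> [b, dual b] (arc_vector b) y) 1) = 0"
    if y: "y \<in> obj \<Phi> [b, dual b]" for b y
  proof -
    let ?f = "bvec (cap b)"
    obtain s where s: "s \<noteq> 0" "adj [b, dual b] [] ?f ?u = scal \<Phi> s (arc_vector b)"
      using adj_cap by metis
    note f = cap_Hom[of b]
    define c where "c = ip \<Phi> [] ?u (mor \<Phi> [b, dual b] [] ?f y)"
    have mo: "mor \<Phi> [b, dual b] [] ?f y = scal \<Phi> c ?u"
      unfolding c_def by (rule obj_Nil_eq[OF mor_closed[OF f y], symmetric])
    have c: "c = cnj s * ip \<Phi> [b, dual b] (arc_vector b) y"
      using ip_adj[OF f unit_closed y] y unfolding s(2) by (simp add: ip_scale_left c_def)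
    have "cscale (cnj s) (\<pi> (bvec ([b, dual b], arc_vector b, y))) =
        cscale (cnj s) (cscale (ip \<Phi> [b, dual b] (arc_vector b) y) (?T 1))"
      using adj[OF f unit_closed y] unfolding s(2) mo one
      using sesqD(3)[OF S arc_vector_closed y] sesqD(4)[OF S unit_closed unit_closed] by (simp add: c)
    then have "\<pi> (bvec ([b, dual b], arc_vector b, y)) = cscale (ip \<Phi> [b, dual b] (arc_vector b) y) (?T 1)"
      using s(1) complex_cnj_zero_iff[of s] fvec.scale_left_imp_eq by blast
    then show ?thesis by (simp add: clinear_diff[OF lin] clinear_cscale[OF lin] TB[OF arc_vector_closed y])
  qed
  have "?T a = 0"
    using assms unfolding arc_rel_def
  proof (elim UnE CollectE exE conjE)
    fix b i j assume "i < n" "j < n" and a: "a = B [b, dual b] (tens \<Phi> [b] [dual b] (R b i) (R (dual b) j)) (arc_vector b) -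
       cscale (ip \<Phi> [b, dual b] (tens \<Phi> [b] [dual b] (R b i) (R (dual b) j)) (arc_vector b)) 1"
    then show "?T a = 0" unfolding a by (intro right) simp
  next
    fix b i j assume "i < n" "j < n" and a: "a = B [b, dual b] (arc_vector b) (tens \<Phi> [b] [dual b] (C b i) (C (dual b) j)) -
       cscale (ip \<Phi> [b, dual b] (arc_vector b) (tens \<Phi> [b] [dual b] (C b i) (C (dual b) j))) 1"
    then show "?T a = 0" unfolding a by (intro left) simp
  qed
  then show ?thesis using \<pi>(2) by simp
qed

lemma free_to_coeff_arc_ideal:
  assumes "a \<in> arc_ideal"
  shows "free_to_coeff a \<in> coend_rel \<Phi>"
proof -
  let ?M = "{a \<in> carrier (free_algebra n). free_to_coeff a \<in> coend_rel \<Phi>}"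
  have sub: "fvec.subspace ?M"
    using fvec.subspace_inter[OF subspace_free_algebra[of n] subspace_preimage[OF clinear_free_to_coeff subspace_coend_rel]]
    by (simp add: Collect_conj_eq)
  have "ideal ?M (free_algebra n)"
  proof (rule idealI[OF ring_free_algebra])
    show "subgroup ?M (add_monoid (free_algebra n))"
      by (rule linear_additive_subgroup[OF ring_free_algebra _ _ sub]) auto
    fix a x assume a: "a \<in> ?M" and x: "x \<in> carrier (free_algebra n)"
    show "x \<otimes>\<^bsub>free_algebra n\<^esub> a \<in> ?M" "a \<otimes>\<^bsub>free_algebra n\<^esub> x \<in> ?M"
      using a x free_to_coeff_mult coend_rel_mult_left coend_rel_mult_right free_to_coeff_closed
      by (simp_all add: free_algebra_mult_closed del: coeff_algebra_simps)
  qed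
  then have "arc_ideal \<subseteq> ?M"
    unfolding arc_ideal_def using arc_rel_carrier free_to_coeff_arc_rel
    by (intro ring.genideal_minimal[OF ring_free_algebra]) auto
  then show ?thesis using assms by blast
qed

text \<open>The kernel is determined from both sides: \<open>free_to_coeff\<close> sends the ideal
  into the coend relations because it does so on the arc relations, and the left inverse
  \<open>coeff_to_free\<close> sends the coend relations back into the ideal.\<close>

sublocale TK: linear_quotient_hom "free_algebra n" arc_ideal "coeff_algebra \<Phi>" "coend_rel \<Phi>" free_to_coeff
proof unfold_locales
  fix a assume a: "a \<in> carrier (free_algebra n)"
  show "free_to_coeff a \<in> carrier (coeff_algebra \<Phi>)" by (rule free_to_coeff_closed[OF a])
  show "free_to_coeff (a \<otimes>\<^bsub>free_algebra n\<^esub> b) = free_to_coeff a \<otimes>\<^bsub>coeff_algebra \<Phi>\<^esub> free_to_coeff b"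
    if "b \<in> carrier (free_algebra n)" for b
    using free_to_coeff_mult[OF a that] by simp
  show "free_to_coeff a \<in> coend_rel \<Phi> \<longleftrightarrow> a \<in> arc_ideal"
    using free_to_coeff_arc_ideal coeff_to_free_coend_rel[of "free_to_coeff a"] coeff_to_free_to_coeff[OF a] by auto
next
  fix b assume "b \<in> carrier (coeff_algebra \<Phi>)"
  then show "\<exists>a\<in>carrier (free_algebra n). b - free_to_coeff a \<in> coend_rel \<Phi>"
    using free_to_coeff_surj coeff_to_free_closed by blast
qed (use clinear_free_to_coeff free_to_coeff_one in simp_all)

end

section \<open>The star structure\<close>

definition aclinear :: "(('g \<Rightarrow>\<^sub>0 complex) \<Rightarrow> ('h \<Rightarrow>\<^sub>0 complex)) \<Rightarrow> bool" where
  "aclinear F \<longleftrightarrow> (\<forall>a b. F (a + b) = F a + F b) \<and> (\<forall>c a. F (cscale c a) = cscale (cnj c) (F a))"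

lemma aclinear_add: "aclinear F \<Longrightarrow> F (a + b) = F a + F b"
  and aclinear_cscale: "aclinear F \<Longrightarrow> F (cscale c a) = cscale (cnj c) (F a)"
  by (simp_all add: aclinear_def)

lemma aclinear_zero: "aclinear F \<Longrightarrow> F 0 = 0"
  using aclinear_cscale[of F 0 0] by simp

lemma aclinear_sum: "aclinear F \<Longrightarrow> F (sum g S) = (\<Sum>s\<in>S. F (g s))"
  by (induction S rule: infinite_finite_induct) (simp_all add: aclinear_zero aclinear_add)

lemma aclinear_diff: "aclinear F \<Longrightarrow> F (a - b) = F a - F b"
  using aclinear_add[of F "a - b" b] by simp

lemma aclinear_cong:
  assumes "aclinear F" "aclinear G" "\<And>g. g \<in> Poly_Mapping.keys a \<Longrightarrow> F (bvec g) = G (bvec g)"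
  shows "F a = G a"
proof -
  have *: "F a = (\<Sum>g\<in>Poly_Mapping.keys a. cscale (cnj (Poly_Mapping.lookup a g)) (F (bvec g)))" if "aclinear F" for F
    using arg_cong[OF free_decomp[of a], of F] by (simp only: aclinear_sum[OF that] aclinear_cscale[OF that])
  show ?thesis unfolding *[OF assms(1)] *[OF assms(2)] using assms(3) by simp
qed

lemma aclinear_conj_lin_ext: "aclinear (conj_lin_ext f)"
  by (simp add: aclinear_def conj_lin_ext_add conj_lin_ext_cscale)

lemma aclinear_compose:
  "clinear F \<Longrightarrow> aclinear G \<Longrightarrow> aclinear (\<lambda>a. F (G a))" "aclinear F \<Longrightarrow> clinear G \<Longrightarrow> aclinear (\<lambda>a. F (G a))"
  "aclinear F \<Longrightarrow> aclinear G \<Longrightarrow> clinear (\<lambda>a. F (G a))"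
  by (simp_all add: aclinear_def clinear_def)

lemma aclinear_free_invol: "aclinear free_invol"
  unfolding free_invol_def by (rule aclinear_conj_lin_ext)

lemma free_invol_bvec: "free_invol (bvec u) = bvec (FWord (rev (map (\<lambda>(i, j, s). (i, j, \<not> s)) (letters u))))"
  by (simp add: free_invol_def)

lemma free_invol_mult: "free_invol (a * b) = free_invol b * free_invol a"
proof -
  note I = aclinear_free_invol and P = clinear_free_mult
  show ?thesis
  proof (rule aclinear_cong[OF aclinear_compose(2)[OF I P(1)] aclinear_compose(1)[OF P(2) I]])
    fix u show "free_invol (bvec u * b) = free_invol b * free_invol (bvec u)"
    proof (rule aclinear_cong[OF aclinear_compose(2)[OF I P(2)] aclinear_compose(1)[OF P(1) I]])
      fix t show "free_invol (bvec u * bvec t) = free_invol (bvec t) * free_invol (bvec u)"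
        by (cases u; cases t) (simp only: bvec_fword_mult free_invol_bvec fword.sel map_append rev_append)
    qed
  qed
qed

lemma free_invol_invol [simp]: "free_invol (free_invol a) = a"
proof (rule clinear_cong[OF aclinear_compose(3)[OF aclinear_free_invol aclinear_free_invol] clinear_id])
  fix u :: "(nat \<times> nat \<times> bool) fword"
  have "(\<lambda>(i, j, s). (i, j, \<not> s)) \<circ> (\<lambda>(i, j, s). (i, j, \<not> s)) = (id :: nat \<times> nat \<times> bool \<Rightarrow> _)" by auto
  then show "free_invol (free_invol (bvec u)) = bvec u"
    by (cases u) (simp add: free_invol_bvec rev_map[symmetric])
qed

lemma free_invol_one [simp]: "free_invol 1 = 1"
  using free_invol_bvec[of "FWord []"] by (simp add: bvec_fword_Nil)

lemma free_invol_gen [simp]: "free_invol (gen (i, j, s)) = gen (i, j, \<not> s)"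
  by (simp add: gen_def free_invol_bvec)

lemma free_invol_closed: "a \<in> carrier (free_algebra m) \<Longrightarrow> free_invol a \<in> carrier (free_algebra m)"
  unfolding free_invol_def by (rule conj_lin_ext_in_subspace[OF subspace_free_algebra])
    (fastforce simp: carrier_free_algebra)

context based_fiber_functor
begin

section \<open>The relations of the arcs in terms of generators\<close>

lemma B_letter: "i < n \<Longrightarrow> j < n \<Longrightarrow> B [a] (R a i) (C a j) = gen (i, j, a = Xstar)"
  using B_basis[of "[i]" "[a]" "[j]"] by (simp add: Ix_def unit_right uword_single)

lemma B_X: "i < n \<Longrightarrow> j < n \<Longrightarrow> B [X] (v ! i) (v ! j) = gen (i, j, False)"
  using B_letter[of i j X] by simp

lemma B_Xstar: "i < n \<Longrightarrow> j < n \<Longrightarrow> B [Xstar] (p i) (q j) = gen (i, j, True)"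
  using B_letter[of i j Xstar] by simp

text \<open>Generators are the coefficients at (p, q), so the first vector has to be expanded in the
  \<open>p b\<close>. The expansion coefficients are entries of the Gram matrix of
  \<open>q\<close>.\<close>

lemma B_q_q:
  assumes "j < n"
  shows "B [Xstar] (q k) (q j) = (\<Sum>b<n. cscale (ip \<Phi> [Xstar] (q k) (q b)) (gen (b, j, True)))"
  unfolding sesq_frame_left[OF sesq_B frame_p_q q_closed q_closed] using assms
  by (intro sum.cong) (simp_all add: B_Xstar)

lemma B_p_p:
  assumes "i < n"
  shows "B [Xstar] (p i) (p k) = (\<Sum>b<n. cscale (ip \<Phi> [Xstar] (p b) (p k)) (gen (i, b, True)))"
  unfolding sesq_frame_right[OF sesq_B frame_q_p p_closed p_closed] using assms
  by (intro sum.cong) (simp_all add: B_Xstar)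

text \<open>This and the next three definitions are the entries of u u^* - 1, u^* u - 1, u^t Q ubar
  - Q and ubar P u^t - P, where Q and P are the Gram matrices of \<open>q\<close> and of
  \<open>p\<close>.\<close>

definition unitary_row_rel :: "nat \<Rightarrow> nat \<Rightarrow> free_star" where
  "unitary_row_rel i j = (\<Sum>k<n. gen (i, k, False) * gen (j, k, True)) - (if i = j then 1 else 0)"

definition unitary_col_rel :: "nat \<Rightarrow> nat \<Rightarrow> free_star" where
  "unitary_col_rel i j = (\<Sum>k<n. gen (k, i, True) * gen (k, j, False)) - (if i = j then 1 else 0)"

definition gram_q_rel :: "nat \<Rightarrow> nat \<Rightarrow> free_star" where
  "gram_q_rel i j = (\<Sum>k<n. \<Sum>b<n. cscale (ip \<Phi> [Xstar] (q k) (q b)) (gen (k, i, False) * gen (b, j, True))) -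
    cscale (ip \<Phi> [Xstar] (q i) (q j)) 1"

definition gram_p_rel :: "nat \<Rightarrow> nat \<Rightarrow> free_star" where
  "gram_p_rel i j = (\<Sum>k<n. \<Sum>b<n. cscale (ip \<Phi> [Xstar] (p k) (p b)) (gen (i, k, True) * gen (j, b, False))) -
    cscale (ip \<Phi> [Xstar] (p i) (p j)) 1"

lemma ip_v: "i < n \<Longrightarrow> j < n \<Longrightarrow> ip \<Phi> [X] (v ! i) (v ! j) = (if i = j then 1 else 0)"
  using ip_R_C[of i j X] by simp

lemma ip_p_q: "i < n \<Longrightarrow> j < n \<Longrightarrow> ip \<Phi> [Xstar] (p i) (q j) = (if i = j then 1 else 0)"
  using ip_R_C[of i j Xstar] by simp

lemma B_arc_right:
  assumes x: "x \<in> obj \<Phi> [a]" and y: "y \<in> obj \<Phi> [dual a]"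
  shows "B [a, dual a] (tens \<Phi> [a] [dual a] x y) (arc_vector a) = (\<Sum>k<n. B [a] x (R a k) * B [dual a] y (C (dual a) k))"
    "ip \<Phi> [a, dual a] (tens \<Phi> [a] [dual a] x y) (arc_vector a) = (\<Sum>k<n. ip \<Phi> [a] x (R a k) * ip \<Phi> [dual a] y (C (dual a) k))"
proof -
  have arc: "arc_vector a = (\<Sum>k<n. scal \<Phi> 1 (tens \<Phi> [a] [dual a] (R a k) (C (dual a) k)))"
    by (simp add: arc_vector_def)
  show "B [a, dual a] (tens \<Phi> [a] [dual a] x y) (arc_vector a) = (\<Sum>k<n. B [a] x (R a k) * B [dual a] y (C (dual a) k))"
    unfolding arc using x y B_tensor[of x "[a]" _ y "[dual a]"]
    by (subst sesq_sum_right[OF sesq_B]) (simp_all)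
  show "ip \<Phi> [a, dual a] (tens \<Phi> [a] [dual a] x y) (arc_vector a) = (\<Sum>k<n. ip \<Phi> [a] x (R a k) * ip \<Phi> [dual a] y (C (dual a) k))"
    unfolding arc_vector_def using x y T.inner_tensor[of x "[a]" _ y "[dual a]"]
    by (subst ip_sum_right) simp_all
qed

lemma B_arc_left:
  assumes x: "x \<in> obj \<Phi> [a]" and y: "y \<in> obj \<Phi> [dual a]"
  shows "B [a, dual a] (arc_vector a) (tens \<Phi> [a] [dual a] x y) = (\<Sum>k<n. B [a] (R a k) x * B [dual a] (C (dual a) k) y)"
    "ip \<Phi> [a, dual a] (arc_vector a) (tens \<Phi> [a] [dual a] x y) = (\<Sum>k<n. ip \<Phi> [a] (R a k) x * ip \<Phi> [dual a] (C (dual a) k) y)"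
proof -
  have arc: "arc_vector a = (\<Sum>k<n. scal \<Phi> 1 (tens \<Phi> [a] [dual a] (R a k) (C (dual a) k)))"
    by (simp add: arc_vector_def)
  show "B [a, dual a] (arc_vector a) (tens \<Phi> [a] [dual a] x y) = (\<Sum>k<n. B [a] (R a k) x * B [dual a] (C (dual a) k) y)"
    unfolding arc using x y B_tensor[of _ "[a]" x _ "[dual a]" y]
    by (subst sesq_sum_left[OF sesq_B]) (simp_all)
  show "ip \<Phi> [a, dual a] (arc_vector a) (tens \<Phi> [a] [dual a] x y) = (\<Sum>k<n. ip \<Phi> [a] (R a k) x * ip \<Phi> [dual a] (C (dual a) k) y)"
    unfolding arc_vector_def using x y T.inner_tensor[of _ "[a]" x _ "[dual a]" y]
    by (subst ip_sum_left) simp_all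
qed

text \<open>On the scalar side the sum over \<open>k\<close> collapses by orthonormality of
  \<open>v\<close> or by duality of \<open>p\<close> and \<open>q\<close>. What is left is a
  Kronecker delta in two of the families and a Gram entry in the other two.\<close>

lemma arc_rel_elements:
  assumes i: "i < n" and j: "j < n"
  shows "B [X, dual X] (tens \<Phi> [X] [dual X] (R X i) (R (dual X) j)) (arc_vector X) -
      cscale (ip \<Phi> [X, dual X] (tens \<Phi> [X] [dual X] (R X i) (R (dual X) j)) (arc_vector X)) 1 = unitary_row_rel i j"
    "B [Xstar, dual Xstar] (arc_vector Xstar) (tens \<Phi> [Xstar] [dual Xstar] (C Xstar i) (C (dual Xstar) j)) -
      cscale (ip \<Phi> [Xstar, dual Xstar] (arc_vector Xstar) (tens \<Phi> [Xstar] [dual Xstar] (C Xstar i) (C (dual Xstar) j))) 1 = unitary_col_rel i j"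
    "B [X, dual X] (arc_vector X) (tens \<Phi> [X] [dual X] (C X i) (C (dual X) j)) -
      cscale (ip \<Phi> [X, dual X] (arc_vector X) (tens \<Phi> [X] [dual X] (C X i) (C (dual X) j))) 1 = gram_q_rel i j"
    "B [Xstar, dual Xstar] (tens \<Phi> [Xstar] [dual Xstar] (R Xstar i) (R (dual Xstar) j)) (arc_vector Xstar) -
      cscale (ip \<Phi> [Xstar, dual Xstar] (tens \<Phi> [Xstar] [dual Xstar] (R Xstar i) (R (dual Xstar) j)) (arc_vector Xstar)) 1 = gram_p_rel i j"
proof -
  have d1: "(\<Sum>k<n. (if i = k then 1 else 0) * (if j = k then 1 else 0)) = (if i = j then 1 else (0 :: complex))"
    using i by (simp add: if_distrib cong: if_cong)
  have d2: "(\<Sum>k<n. (if k = i then 1 else 0) * (if k = j then 1 else 0)) = (if i = j then 1 else (0 :: complex))"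
    using i by (simp add: if_distrib cong: if_cong)
  have one: "cscale (if i = j then 1 else 0) 1 = (if i = j then 1 else (0 :: free_star))" by simp
  have c: "i < n \<Longrightarrow> R a i \<in> obj \<Phi> [a]" "j < n \<Longrightarrow> R a j \<in> obj \<Phi> [a]" "i < n \<Longrightarrow> C a i \<in> obj \<Phi> [a]" "j < n \<Longrightarrow> C a j \<in> obj \<Phi> [a]" for a
    by simp_all
  note c = c(1)[OF i] c(2)[OF j] c(3)[OF i] c(4)[OF j]
  have s1: "(\<Sum>k<n. B [X] (R X i) (R X k) * B [dual X] (R (dual X) j) (C (dual X) k)) = (\<Sum>k<n. gen (i, k, False) * gen (j, k, True))"
    "(\<Sum>k<n. ip \<Phi> [X] (R X i) (R X k) * ip \<Phi> [dual X] (R (dual X) j) (C (dual X) k)) =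
      (\<Sum>k<n. (if i = k then 1 else 0) * (if j = k then 1 else 0))"
    using i j by (auto intro!: sum.cong simp: B_X B_Xstar ip_v ip_p_q)
  show "B [X, dual X] (tens \<Phi> [X] [dual X] (R X i) (R (dual X) j)) (arc_vector X) -
      cscale (ip \<Phi> [X, dual X] (tens \<Phi> [X] [dual X] (R X i) (R (dual X) j)) (arc_vector X)) 1 = unitary_row_rel i j"
    unfolding B_arc_right[OF c(1,2)] s1 d1 unitary_row_rel_def one ..
  have s2: "(\<Sum>k<n. B [Xstar] (R Xstar k) (C Xstar i) * B [dual Xstar] (C (dual Xstar) k) (C (dual Xstar) j)) = (\<Sum>k<n. gen (k, i, True) * gen (k, j, False))"
    "(\<Sum>k<n. ip \<Phi> [Xstar] (R Xstar k) (C Xstar i) * ip \<Phi> [dual Xstar] (C (dual Xstar) k) (C (dual Xstar) j)) =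
      (\<Sum>k<n. (if k = i then 1 else 0) * (if k = j then 1 else 0))"
    using i j by (auto intro!: sum.cong simp: B_X B_Xstar ip_v ip_p_q)
  show "B [Xstar, dual Xstar] (arc_vector Xstar) (tens \<Phi> [Xstar] [dual Xstar] (C Xstar i) (C (dual Xstar) j)) -
      cscale (ip \<Phi> [Xstar, dual Xstar] (arc_vector Xstar) (tens \<Phi> [Xstar] [dual Xstar] (C Xstar i) (C (dual Xstar) j))) 1 = unitary_col_rel i j"
    unfolding B_arc_left[OF c(3,4)] s2 d2 unitary_col_rel_def one ..
  have s3: "(\<Sum>k<n. B [X] (R X k) (C X i) * B [dual X] (C (dual X) k) (C (dual X) j)) =
      (\<Sum>k<n. \<Sum>b<n. cscale (ip \<Phi> [Xstar] (q k) (q b)) (gen (k, i, False) * gen (b, j, True)))"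
    "(\<Sum>k<n. ip \<Phi> [X] (R X k) (C X i) * ip \<Phi> [dual X] (C (dual X) k) (C (dual X) j)) = ip \<Phi> [Xstar] (q i) (q j)"
  proof -
    show "(\<Sum>k<n. B [X] (R X k) (C X i) * B [dual X] (C (dual X) k) (C (dual X) j)) =
      (\<Sum>k<n. \<Sum>b<n. cscale (ip \<Phi> [Xstar] (q k) (q b)) (gen (k, i, False) * gen (b, j, True)))"
      using i j by (intro sum.cong refl) (simp add: B_X B_q_q sum_distrib_left cscale_mult_right)
    have "(\<Sum>k<n. ip \<Phi> [X] (R X k) (C X i) * ip \<Phi> [dual X] (C (dual X) k) (C (dual X) j)) =
        (\<Sum>k<n. if k = i then ip \<Phi> [Xstar] (q k) (q j) else 0)"
      using i by (intro sum.cong refl) (simp add: ip_v)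
    then show "(\<Sum>k<n. ip \<Phi> [X] (R X k) (C X i) * ip \<Phi> [dual X] (C (dual X) k) (C (dual X) j)) = ip \<Phi> [Xstar] (q i) (q j)"
      using i by simp
  qed
  show "B [X, dual X] (arc_vector X) (tens \<Phi> [X] [dual X] (C X i) (C (dual X) j)) -
      cscale (ip \<Phi> [X, dual X] (arc_vector X) (tens \<Phi> [X] [dual X] (C X i) (C (dual X) j))) 1 = gram_q_rel i j"
    unfolding B_arc_left[OF c(3,4)] s3 gram_q_rel_def ..
  have s4: "(\<Sum>k<n. B [Xstar] (R Xstar i) (R Xstar k) * B [dual Xstar] (R (dual Xstar) j) (C (dual Xstar) k)) =
      (\<Sum>k<n. \<Sum>b<n. cscale (ip \<Phi> [Xstar] (p k) (p b)) (gen (i, k, True) * gen (j, b, False)))"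
    "(\<Sum>k<n. ip \<Phi> [Xstar] (R Xstar i) (R Xstar k) * ip \<Phi> [dual Xstar] (R (dual Xstar) j) (C (dual Xstar) k)) = ip \<Phi> [Xstar] (p i) (p j)"
  proof -
    have "(\<Sum>k<n. B [Xstar] (R Xstar i) (R Xstar k) * B [dual Xstar] (R (dual Xstar) j) (C (dual Xstar) k)) =
      (\<Sum>k<n. \<Sum>b<n. cscale (ip \<Phi> [Xstar] (p b) (p k)) (gen (i, b, True) * gen (j, k, False)))"
      using i j by (intro sum.cong refl) (simp add: B_X B_p_p sum_distrib_right cscale_mult_left)
    also have "\<dots> = (\<Sum>k<n. \<Sum>b<n. cscale (ip \<Phi> [Xstar] (p k) (p b)) (gen (i, k, True) * gen (j, b, False)))"
      by (rule sum.swap)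
    finally show "(\<Sum>k<n. B [Xstar] (R Xstar i) (R Xstar k) * B [dual Xstar] (R (dual Xstar) j) (C (dual Xstar) k)) =
      (\<Sum>k<n. \<Sum>b<n. cscale (ip \<Phi> [Xstar] (p k) (p b)) (gen (i, k, True) * gen (j, b, False)))" .
    have "(\<Sum>k<n. ip \<Phi> [Xstar] (R Xstar i) (R Xstar k) * ip \<Phi> [dual Xstar] (R (dual Xstar) j) (C (dual Xstar) k)) =
        (\<Sum>k<n. if j = k then ip \<Phi> [Xstar] (p i) (p k) else 0)"
      using j by (intro sum.cong refl) (simp add: ip_v)
    then show "(\<Sum>k<n. ip \<Phi> [Xstar] (R Xstar i) (R Xstar k) * ip \<Phi> [dual Xstar] (R (dual Xstar) j) (C (dual Xstar) k)) = ip \<Phi> [Xstar] (p i) (p j)"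
      using j by simp
  qed
  show "B [Xstar, dual Xstar] (tens \<Phi> [Xstar] [dual Xstar] (R Xstar i) (R (dual Xstar) j)) (arc_vector Xstar) -
      cscale (ip \<Phi> [Xstar, dual Xstar] (tens \<Phi> [Xstar] [dual Xstar] (R Xstar i) (R (dual Xstar) j)) (arc_vector Xstar)) 1 = gram_p_rel i j"
    unfolding B_arc_right[OF c(1,2)] s4 gram_p_rel_def ..
qed

lemma arc_rel_eq: "arc_rel = (\<Union>i<n. \<Union>j<n. {unitary_row_rel i j, unitary_col_rel i j, gram_q_rel i j, gram_p_rel i j})" (is "_ = ?S")
proof
  show "arc_rel \<subseteq> ?S"
  proof
    fix r assume "r \<in> arc_rel"
    then obtain a i j where ij: "i < n" "j < n" and
      r: "r = B [a, dual a] (tens \<Phi> [a] [dual a] (R a i) (R (dual a) j)) (arc_vector a) -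
       cscale (ip \<Phi> [a, dual a] (tens \<Phi> [a] [dual a] (R a i) (R (dual a) j)) (arc_vector a)) 1 \<or>
      r = B [a, dual a] (arc_vector a) (tens \<Phi> [a] [dual a] (C a i) (C (dual a) j)) -
       cscale (ip \<Phi> [a, dual a] (arc_vector a) (tens \<Phi> [a] [dual a] (C a i) (C (dual a) j))) 1"
      unfolding arc_rel_def by blast
    have "r \<in> {unitary_row_rel i j, unitary_col_rel i j, gram_q_rel i j, gram_p_rel i j}"
      using r by (cases a) (simp_all only: arc_rel_elements[OF ij], blast+)
    then show "r \<in> ?S" using ij by blast
  qed
  show "?S \<subseteq> arc_rel"
  proof
    fix r assume "r \<in> ?S"
    then obtain i j where ij: "i < n" "j < n" and "r = unitary_row_rel i j \<or> r = unitary_col_rel i j \<or> r = gram_q_rel i j \<or> r = gram_p_rel i j" by blast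
    then show "r \<in> arc_rel" unfolding arc_rel_elements[OF ij, symmetric] arc_rel_def using ij by blast
  qed
qed

text \<open>The involution reverses products and conjugates scalars. Since Gram matrices are
  Hermitian, each family is mapped to itself with its indices exchanged, and the ideal it generates
  is invariant.\<close>

lemma free_invol_rel:
  "free_invol (unitary_row_rel i j) = unitary_row_rel j i" "free_invol (unitary_col_rel i j) = unitary_col_rel j i"
  "free_invol (gram_q_rel i j) = gram_q_rel j i" "free_invol (gram_p_rel i j) = gram_p_rel j i"
proof -
  note A = aclinear_diff[OF aclinear_free_invol] aclinear_sum[OF aclinear_free_invol] aclinear_cscale[OF aclinear_free_invol]
    aclinear_zero[OF aclinear_free_invol] free_invol_mult
  show "free_invol (unitary_row_rel i j) = unitary_row_rel j i" "free_invol (unitary_col_rel i j) = unitary_col_rel j i"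
    unfolding unitary_row_rel_def unitary_col_rel_def by (auto simp: A)
  show "free_invol (gram_q_rel i j) = gram_q_rel j i"
    unfolding gram_q_rel_def A by (simp add: ip_cnj) (rule sum.swap)
  show "free_invol (gram_p_rel i j) = gram_p_rel j i"
    unfolding gram_p_rel_def A by (simp add: ip_cnj) (rule sum.swap)
qed

lemma free_invol_arc_rel: "free_invol ` arc_rel \<subseteq> arc_rel"
proof (rule image_subsetI)
  fix r assume "r \<in> arc_rel"
  then obtain i j where ij: "i < n" "j < n" and "r = unitary_row_rel i j \<or> r = unitary_col_rel i j \<or> r = gram_q_rel i j \<or> r = gram_p_rel i j"
    unfolding arc_rel_eq by blast
  then have "free_invol r \<in> {unitary_row_rel j i, unitary_col_rel j i, gram_q_rel j i, gram_p_rel j i}" using free_invol_rel[of i j] by auto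
  then show "free_invol r \<in> arc_rel" unfolding arc_rel_eq using ij by blast
qed

lemma free_invol_arc_ideal:
  assumes "a \<in> arc_ideal"
  shows "free_invol a \<in> arc_ideal"
proof -
  let ?M = "{a \<in> carrier (free_algebra n). free_invol a \<in> arc_ideal}"
  note I = aclinear_free_invol
  have sub: "fvec.subspace ?M"
    by (rule fvec.subspaceI)
      (simp_all add: fvec.subspace_0[OF subspace_free_algebra] fvec.subspace_add[OF subspace_free_algebra]
        fvec.subspace_scale[OF subspace_free_algebra] fvec.subspace_0[OF free.subspace_I]
        fvec.subspace_add[OF free.subspace_I] fvec.subspace_scale[OF free.subspace_I]
        aclinear_zero[OF I] aclinear_add[OF I] aclinear_cscale[OF I])
  have "ideal ?M (free_algebra n)"
  proof (rule idealI[OF ring_free_algebra])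
    show "subgroup ?M (add_monoid (free_algebra n))"
      by (rule linear_additive_subgroup[OF ring_free_algebra _ _ sub]) auto
    fix a x assume a: "a \<in> ?M" and x: "x \<in> carrier (free_algebra n)"
    show "x \<otimes>\<^bsub>free_algebra n\<^esub> a \<in> ?M" "a \<otimes>\<^bsub>free_algebra n\<^esub> x \<in> ?M"
      using a x by (simp_all add: free_algebra_mult_closed free_invol_mult arc_ideal_mult free_invol_closed)
  qed
  then have "arc_ideal \<subseteq> ?M"
    unfolding arc_ideal_def using arc_rel_carrier free_invol_arc_rel arc_rel_ideal
    by (intro ring.genideal_minimal[OF ring_free_algebra]) (auto simp: arc_ideal_def[symmetric])
  then show ?thesis using assms by blast
qed

section \<open>Unitarity of all coefficient matrices\<close>

text \<open>For the matrix U of coefficients of a word, this is U U^* as a sesquilinear form, and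
  \<open>col_norm\<close> is U^* U. Neither depends on the frame, see \<open>norm_frame\<close>, so
  orthonormal bases and dual bases give the same form.\<close>

definition row_norm :: "word \<Rightarrow> 'a \<Rightarrow> 'a \<Rightarrow> free_star" where
  "row_norm w x y = (\<Sum>I\<in>Ix w. B w x (wvec C w I) * free_invol (B w y (wvec R w I)))"

definition col_norm :: "word \<Rightarrow> 'a \<Rightarrow> 'a \<Rightarrow> free_star" where
  "col_norm w x y = (\<Sum>I\<in>Ix w. free_invol (B w (wvec C w I) x) * B w (wvec R w I) y)"

lemma sesq_products:
  assumes "x \<in> obj \<Phi> w" "y \<in> obj \<Phi> w"
  shows "sesq w w (\<lambda>r c. B w x c * free_invol (B w y r))" "sesq w w (\<lambda>r c. free_invol (B w c x) * B w r y)"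
    "sesq w w (\<lambda>x' y'. B w x' x * free_invol (B w y' y))" "sesq w w (\<lambda>x' y'. free_invol (B w x x') * B w y y')"
proof -
  note I = aclinear_add[OF aclinear_free_invol] aclinear_cscale[OF aclinear_free_invol]
  note S = sesqD[OF sesq_B] I distrib_left distrib_right cscale_mult_left cscale_mult_right assms
  show "sesq w w (\<lambda>r c. B w x c * free_invol (B w y r))" "sesq w w (\<lambda>r c. free_invol (B w c x) * B w r y)"
    "sesq w w (\<lambda>x' y'. B w x' x * free_invol (B w y' y))" "sesq w w (\<lambda>x' y'. free_invol (B w x x') * B w y y')"
    by (rule sesqI; simp add: S)+
qed

lemma norm_frame:
  assumes "frame w S C' R'" "x \<in> obj \<Phi> w" "y \<in> obj \<Phi> w"
  shows "row_norm w x y = (\<Sum>k\<in>S. B w x (C' k) * free_invol (B w y (R' k)))"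
    "col_norm w x y = (\<Sum>k\<in>S. free_invol (B w (C' k) x) * B w (R' k) y)"
  unfolding row_norm_def col_norm_def
  using frame_trace[OF sesq_products(1)[OF assms(2,3)] frame_word assms(1)]
    frame_trace[OF sesq_products(2)[OF assms(2,3)] frame_word assms(1)] by simp_all

lemma sesq_setsum:
  assumes "\<And>k. k \<in> S \<Longrightarrow> sesq w w' (\<lambda>x y. \<beta> k x y)"
  shows "sesq w w' (\<lambda>x y. \<Sum>k\<in>S. \<beta> k x y)"
  by (rule sesqI) (simp_all add: sesqD[OF assms] sum.distrib fvec.scale_sum_right)

lemma sesq_norm: "sesq w w (row_norm w)" "sesq w w (col_norm w)"
  unfolding row_norm_def[abs_def] col_norm_def[abs_def]
  by (rule sesq_setsum, rule sesq_products; simp)+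

lemma sesq_ip: "sesq w w (\<lambda>x y. cscale (ip \<Phi> w x y) (a :: free_star))"
  by (rule sesqI) (simp_all add: ip_add_left H.inner_add ip_scale_left H.inner_scale fvec.scale_left_distrib)

definition unitary_word :: "word \<Rightarrow> bool" where
  "unitary_word w \<longleftrightarrow> (\<forall>x\<in>obj \<Phi> w. \<forall>y\<in>obj \<Phi> w.
    row_norm w x y - cscale (ip \<Phi> w x y) 1 \<in> arc_ideal \<and> col_norm w x y - cscale (ip \<Phi> w x y) 1 \<in> arc_ideal)"

text \<open>The row form is tested on \<open>R\<close> vectors and the column form on
  \<open>C\<close> vectors: the letter coefficients in these forms are then generators, up to the
  Gram expansions \<open>B_p_p\<close> and \<open>B_q_q\<close>.\<close>

lemma unitary_wordI:
  assumes F: "frame w S C' R'"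
    and row: "\<And>k l. k \<in> S \<Longrightarrow> l \<in> S \<Longrightarrow> row_norm w (R' k) (R' l) - cscale (ip \<Phi> w (R' k) (R' l)) 1 \<in> arc_ideal"
    and col: "\<And>k l. k \<in> S \<Longrightarrow> l \<in> S \<Longrightarrow> col_norm w (C' k) (C' l) - cscale (ip \<Phi> w (C' k) (C' l)) 1 \<in> arc_ideal"
  shows "unitary_word w"
  unfolding unitary_word_def
proof (intro ballI)
  fix x y assume x: "x \<in> obj \<Phi> w" and y: "y \<in> obj \<Phi> w"
  obtain \<pi> :: "free_star \<Rightarrow> free_star" where \<pi>: "clinear \<pi>" "\<And>a. \<pi> a = 0 \<longleftrightarrow> a \<in> arc_ideal"
    using exists_linear_with_kernel[OF free.subspace_I] by blast
  note P = linear_with_kernel_eq[OF \<pi>]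
  note FR = frame_sym[OF F]
  have "\<pi> (row_norm w x y) = \<pi> (cscale (ip \<Phi> w x y) 1)"
    by (rule sesq_ext[OF sesq_clinear[OF \<pi>(1) sesq_norm(1)] sesq_clinear[OF \<pi>(1) sesq_ip] FR FR _ x y])
      (use row P in simp)
  moreover have "\<pi> (col_norm w x y) = \<pi> (cscale (ip \<Phi> w x y) 1)"
    by (rule sesq_ext[OF sesq_clinear[OF \<pi>(1) sesq_norm(2)] sesq_clinear[OF \<pi>(1) sesq_ip] F F _ x y])
      (use col P in simp)
  ultimately show "row_norm w x y - cscale (ip \<Phi> w x y) 1 \<in> arc_ideal \<and> col_norm w x y - cscale (ip \<Phi> w x y) 1 \<in> arc_ideal"
    unfolding P by blast
qed

lemma rels_arc_ideal: "i < n \<Longrightarrow> j < n \<Longrightarrow> unitary_row_rel i j \<in> arc_ideal \<and> unitary_col_rel i j \<in> arc_ideal \<and> gram_q_rel i j \<in> arc_ideal \<and> gram_p_rel i j \<in> arc_ideal"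
  using arc_rel_ideal unfolding arc_rel_eq by blast

text \<open>The four families appear a second time. The two unitary ones say that the matrix of
  \<open>X\<close> is unitary; the two Gram families say the same of the matrix of
  \<open>Xstar\<close>, written in the dual bases.\<close>

lemma unitary_letter: "unitary_word [a]"
proof (rule unitary_wordI[OF frame_letter])
  note A = aclinear_sum[OF aclinear_free_invol] aclinear_cscale[OF aclinear_free_invol]
  note one = if_distrib[of "\<lambda>c. cscale c _"]
  fix i j assume "i \<in> {..<n}" "j \<in> {..<n}"
  then have ij: "i < n" "j < n" by auto
  have "row_norm [a] (R a i) (R a j) - cscale (ip \<Phi> [a] (R a i) (R a j)) 1 = (if a = X then unitary_row_rel i j else gram_p_rel i j)"
  proof (cases a)
    case X
    have "row_norm [X] (v ! i) (v ! j) = (\<Sum>k<n. gen (i, k, False) * gen (j, k, True))"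
      unfolding norm_frame(1)[OF frame_v v_closed[OF ij(1)] v_closed[OF ij(2)]]
      using ij by (intro sum.cong) (simp_all add: B_X)
    then show ?thesis using X ij by (simp add: unitary_row_rel_def ip_v)
  next
    case Xstar
    have "row_norm [Xstar] (p i) (p j) =
        (\<Sum>k<n. \<Sum>b<n. cscale (ip \<Phi> [Xstar] (p k) (p b)) (gen (i, k, True) * gen (j, b, False)))"
      unfolding norm_frame(1)[OF frame_q_p p_closed p_closed]
      using ij by (intro sum.cong) (simp_all add: B_Xstar B_p_p A sum_distrib_left cscale_mult_right ip_cnj)
    then show ?thesis using Xstar by (simp add: gram_p_rel_def)
  qed
  then show "row_norm [a] (R a i) (R a j) - cscale (ip \<Phi> [a] (R a i) (R a j)) 1 \<in> arc_ideal"
    using rels_arc_ideal[OF ij] by simp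
  have "col_norm [a] (C a i) (C a j) - cscale (ip \<Phi> [a] (C a i) (C a j)) 1 = (if a = X then unitary_col_rel i j else gram_q_rel i j)"
  proof (cases a)
    case X
    have "col_norm [X] (v ! i) (v ! j) = (\<Sum>k<n. gen (k, i, True) * gen (k, j, False))"
      unfolding norm_frame(2)[OF frame_v v_closed[OF ij(1)] v_closed[OF ij(2)]]
      using ij by (intro sum.cong) (simp_all add: B_X)
    then show ?thesis using X ij by (simp add: unitary_col_rel_def ip_v)
  next
    case Xstar
    have "col_norm [Xstar] (q i) (q j) =
        (\<Sum>k<n. \<Sum>b<n. cscale (ip \<Phi> [Xstar] (q b) (q k)) (gen (b, i, False) * gen (k, j, True)))"
      unfolding norm_frame(2)[OF frame_q_p q_closed q_closed]
      using ij by (intro sum.cong) (simp_all add: B_Xstar B_q_q A sum_distrib_right cscale_mult_left ip_cnj)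
    also have "\<dots> = (\<Sum>k<n. \<Sum>b<n. cscale (ip \<Phi> [Xstar] (q k) (q b)) (gen (k, i, False) * gen (b, j, True)))"
      by (rule sum.swap)
    finally show ?thesis using Xstar by (simp add: gram_q_rel_def)
  qed
  then show "col_norm [a] (C a i) (C a j) - cscale (ip \<Phi> [a] (C a i) (C a j)) 1 \<in> arc_ideal"
    using rels_arc_ideal[OF ij] by simp
qed

lemma arc_ideal_sandwich:
  assumes "s - cscale c 1 \<in> arc_ideal" "a \<in> carrier (free_algebra n)" "b \<in> carrier (free_algebra n)"
  shows "a * s * b - cscale c (a * b) \<in> arc_ideal"
proof -
  have "a * s * b - cscale c (a * b) = a * (s - cscale c 1) * b"
    by (simp add: algebra_simps cscale_mult_left cscale_mult_right)
  then show ?thesis using assms arc_ideal_mult by simp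
qed

text \<open>Entries of a tensor product are products, and the involution reverses their order, so
  one factor is enclosed by the other. In the row form the factor of \<open>w'\<close> is inside and
  collapses first to a scalar; in the column form it is the factor of \<open>w\<close>.\<close>

lemma unitary_append:
  assumes w: "unitary_word w" and w': "unitary_word w'"
  shows "unitary_word (w @ w')"
proof (rule unitary_wordI[OF frame_tensor[OF frame_word frame_word]])
  note FT = frame_tensor[OF frame_word[of w] frame_word[of w']]
  note inv = free_invol_closed[OF B_closed]
  note L = fvec.subspace_add[OF free.subspace_I]
  fix k l assume "k \<in> Ix w \<times> Ix w'" "l \<in> Ix w \<times> Ix w'"
  then obtain I I' J J' where IJ: "k = (I, I')" "l = (J, J')" "I \<in> Ix w" "J \<in> Ix w" "I' \<in> Ix w'" "J' \<in> Ix w'" by auto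
  have row: "row_norm (w @ w') (tens \<Phi> w w' x x') (tens \<Phi> w w' y y') -
      cscale (ip \<Phi> (w @ w') (tens \<Phi> w w' x x') (tens \<Phi> w w' y y')) 1 \<in> arc_ideal"
    if x: "x \<in> obj \<Phi> w" "x' \<in> obj \<Phi> w'" and y: "y \<in> obj \<Phi> w" "y' \<in> obj \<Phi> w'" for x x' y y'
  proof -
    let ?c = "ip \<Phi> w' x' y'" and ?B = "\<lambda>k. B w x (wvec C w k)" and ?D = "\<lambda>k. free_invol (B w y (wvec R w k))"
    have "row_norm (w @ w') (tens \<Phi> w w' x x') (tens \<Phi> w w' y y') =
        (\<Sum>(k, l)\<in>Ix w \<times> Ix w'. ?B k * (B w' x' (wvec C w' l) * free_invol (B w' y' (wvec R w' l))) * ?D k)"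
      unfolding norm_frame(1)[OF FT tens_closed[OF x] tens_closed[OF y]]
      using x y by (intro sum.cong refl) (auto simp: B_tensor free_invol_mult mult.assoc)
    also have "\<dots> = (\<Sum>k\<in>Ix w. ?B k * row_norm w' x' y' * ?D k)"
      by (simp add: sum.cartesian_product[symmetric] row_norm_def sum_distrib_left sum_distrib_right)
    finally have 1: "row_norm (w @ w') (tens \<Phi> w w' x x') (tens \<Phi> w w' y y') = \<dots>" .
    have "?B k * row_norm w' x' y' * ?D k - cscale ?c (?B k * ?D k) \<in> arc_ideal" for k
      using w' x y by (intro arc_ideal_sandwich inv B_closed) (simp add: unitary_word_def)
    then have "(\<Sum>k\<in>Ix w. ?B k * row_norm w' x' y' * ?D k - cscale ?c (?B k * ?D k)) \<in> arc_ideal"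
      by (intro fvec.subspace_sum[OF free.subspace_I])
    then have 2: "(\<Sum>k\<in>Ix w. ?B k * row_norm w' x' y' * ?D k) - cscale ?c (row_norm w x y) \<in> arc_ideal"
      by (simp add: sum_subtractf row_norm_def fvec.scale_sum_right)
    have "cscale ?c (row_norm w x y - cscale (ip \<Phi> w x y) 1) \<in> arc_ideal"
      using w x y by (intro fvec.subspace_scale[OF free.subspace_I]) (simp add: unitary_word_def)
    from L[OF 2 this] show ?thesis
      unfolding 1 using x y by (simp add: T.inner_tensor fvec.scale_right_diff_distrib mult.commute)
  qed
  have col: "col_norm (w @ w') (tens \<Phi> w w' x x') (tens \<Phi> w w' y y') -
      cscale (ip \<Phi> (w @ w') (tens \<Phi> w w' x x') (tens \<Phi> w w' y y')) 1 \<in> arc_ideal"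
    if x: "x \<in> obj \<Phi> w" "x' \<in> obj \<Phi> w'" and y: "y \<in> obj \<Phi> w" "y' \<in> obj \<Phi> w'" for x x' y y'
  proof -
    let ?c = "ip \<Phi> w x y" and ?B = "\<lambda>k. free_invol (B w' (wvec C w' k) x')" and ?D = "\<lambda>k. B w' (wvec R w' k) y'"
    have "col_norm (w @ w') (tens \<Phi> w w' x x') (tens \<Phi> w w' y y') =
        (\<Sum>(k, l)\<in>Ix w \<times> Ix w'. ?B l * (free_invol (B w (wvec C w k) x) * B w (wvec R w k) y) * ?D l)"
      unfolding norm_frame(2)[OF FT tens_closed[OF x] tens_closed[OF y]]
      using x y by (intro sum.cong refl) (auto simp: B_tensor free_invol_mult mult.assoc)
    also have "\<dots> = (\<Sum>l\<in>Ix w'. \<Sum>k\<in>Ix w. ?B l * (free_invol (B w (wvec C w k) x) * B w (wvec R w k) y) * ?D l)"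
      unfolding sum.cartesian_product[symmetric] by (rule sum.swap)
    also have "\<dots> = (\<Sum>k\<in>Ix w'. ?B k * col_norm w x y * ?D k)"
      by (simp add: col_norm_def sum_distrib_left sum_distrib_right)
    finally have 1: "col_norm (w @ w') (tens \<Phi> w w' x x') (tens \<Phi> w w' y y') = \<dots>" .
    have "?B k * col_norm w x y * ?D k - cscale ?c (?B k * ?D k) \<in> arc_ideal" for k
      using w x y by (intro arc_ideal_sandwich inv B_closed) (simp add: unitary_word_def)
    then have "(\<Sum>k\<in>Ix w'. ?B k * col_norm w x y * ?D k - cscale ?c (?B k * ?D k)) \<in> arc_ideal"
      by (intro fvec.subspace_sum[OF free.subspace_I])
    then have 2: "(\<Sum>k\<in>Ix w'. ?B k * col_norm w x y * ?D k) - cscale ?c (col_norm w' x' y') \<in> arc_ideal"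
      by (simp add: sum_subtractf col_norm_def fvec.scale_sum_right)
    have "cscale ?c (col_norm w' x' y' - cscale (ip \<Phi> w' x' y') 1) \<in> arc_ideal"
      using w' x y by (intro fvec.subspace_scale[OF free.subspace_I]) (simp add: unitary_word_def)
    from L[OF 2 this] show ?thesis
      unfolding 1 using x y by (simp add: T.inner_tensor fvec.scale_right_diff_distrib)
  qed
  show "row_norm (w @ w') ((\<lambda>(i, j). tens \<Phi> w w' (wvec R w i) (wvec R w' j)) k) ((\<lambda>(i, j). tens \<Phi> w w' (wvec R w i) (wvec R w' j)) l) -
      cscale (ip \<Phi> (w @ w') ((\<lambda>(i, j). tens \<Phi> w w' (wvec R w i) (wvec R w' j)) k) ((\<lambda>(i, j). tens \<Phi> w w' (wvec R w i) (wvec R w' j)) l)) 1 \<in> arc_ideal"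
    unfolding IJ(1,2) prod.case using IJ by (intro row) simp_all
  show "col_norm (w @ w') ((\<lambda>(i, j). tens \<Phi> w w' (wvec C w i) (wvec C w' j)) k) ((\<lambda>(i, j). tens \<Phi> w w' (wvec C w i) (wvec C w' j)) l) -
      cscale (ip \<Phi> (w @ w') ((\<lambda>(i, j). tens \<Phi> w w' (wvec C w i) (wvec C w' j)) k) ((\<lambda>(i, j). tens \<Phi> w w' (wvec C w i) (wvec C w' j)) l)) 1 \<in> arc_ideal"
    unfolding IJ(1,2) prod.case using IJ by (intro col) simp_all
qed

lemma unitary_word: "unitary_word w"
proof (induction w)
  case Nil
  show ?case
  proof (rule unitary_wordI[OF frame_unit])
    have "B [] (unit_vector \<Phi>) (unit_vector \<Phi>) = 1" using B_Nil(1)[OF unit_closed] by (simp add: unit_inner)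
    then have "row_norm [] (unit_vector \<Phi>) (unit_vector \<Phi>) = 1" "col_norm [] (unit_vector \<Phi>) (unit_vector \<Phi>) = 1"
      by (simp_all add: norm_frame[OF frame_unit])
    then show "row_norm [] (unit_vector \<Phi>) (unit_vector \<Phi>) - cscale (ip \<Phi> [] (unit_vector \<Phi>) (unit_vector \<Phi>)) 1 \<in> arc_ideal"
      "col_norm [] (unit_vector \<Phi>) (unit_vector \<Phi>) - cscale (ip \<Phi> [] (unit_vector \<Phi>) (unit_vector \<Phi>)) 1 \<in> arc_ideal"
      by (simp_all add: unit_inner fvec.subspace_0[OF free.subspace_I])
  qed
next
  case (Cons a w)
  then show ?case using unitary_append[OF unitary_letter[of a]] by simp
qed

section \<open>The star operation of the coend\<close>

interpretation Q: ring coend.Q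
  by (rule coend.ring_Q)

definition tk :: "free_star \<Rightarrow> 'a coeff_space set" where
  "tk a = coend.cls (free_to_coeff a)"

lemma tk_Q [simp]: "a \<in> carrier (free_algebra n) \<Longrightarrow> tk a \<in> carrier coend.Q"
  unfolding tk_def by (intro coend.cls_Q free_to_coeff_closed)

lemma tk_surj:
  assumes "S \<in> carrier coend.Q"
  obtains a where "a \<in> carrier (free_algebra n)" "S = tk a"
proof -
  obtain b where b: "b \<in> carrier (coeff_algebra \<Phi>)" "S = coend.cls b" using assms unfolding coend.carrier_Q by blast
  have "S = tk (coeff_to_free b)" unfolding tk_def b(2) coend.cls_eq_iff by (rule free_to_coeff_surj[OF b(1)])
  then show ?thesis using that coeff_to_free_closed by blast
qed

lemma tk_eq_iff: "a \<in> carrier (free_algebra n) \<Longrightarrow> b \<in> carrier (free_algebra n) \<Longrightarrow> tk a = tk b \<longleftrightarrow> a - b \<in> arc_ideal"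
  unfolding tk_def coend.cls_eq_iff clinear_diff[OF clinear_free_to_coeff, symmetric]
  by (rule TK.T_kernel, rule fvec.subspace_diff[OF subspace_free_algebra])

lemma tk_add: "a \<in> carrier (free_algebra n) \<Longrightarrow> b \<in> carrier (free_algebra n) \<Longrightarrow> tk a \<oplus>\<^bsub>coend.Q\<^esub> tk b = tk (a + b)"
  unfolding tk_def clinear_add[OF clinear_free_to_coeff] by (intro coend.add_Q free_to_coeff_closed)

lemma tk_mult: "a \<in> carrier (free_algebra n) \<Longrightarrow> b \<in> carrier (free_algebra n) \<Longrightarrow> tk a \<otimes>\<^bsub>coend.Q\<^esub> tk b = tk (a * b)"
  unfolding tk_def by (subst coend.mult_Q) (simp_all only: free_to_coeff_closed free_to_coeff_mult)

lemma tk_smult: "c \<odot>\<^bsub>coend.Q\<^esub> tk a = tk (cscale c a)"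
  unfolding tk_def clinear_cscale[OF clinear_free_to_coeff] by (rule coend.smult_Q)

lemma tk_one: "\<one>\<^bsub>coend.Q\<^esub> = tk 1"
  unfolding tk_def free_to_coeff_one by (rule coend.one_Q)

lemma tk_zero: "\<zero>\<^bsub>coend.Q\<^esub> = tk 0"
  unfolding tk_def clinear_zero[OF clinear_free_to_coeff] by (rule coend.zero_Q)

lemma coefficient_tk: "x \<in> obj \<Phi> w \<Longrightarrow> y \<in> obj \<Phi> w \<Longrightarrow> coefficient \<Phi> w x y = tk (B w x y)"
  unfolding coefficient_def tk_def coend.cls_eq_iff by (rule bvec_free_to_coeff_B)

lemma finsum_tk:
  fixes m :: nat
  assumes "\<And>k. k < m \<Longrightarrow> b k \<in> carrier (free_algebra n)" "\<And>k. k < m \<Longrightarrow> f k = tk (b k)"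
  shows "(\<Oplus>\<^bsub>coend.Q\<^esub>k\<in>{..<m}. f k) = tk (\<Sum>k<m. b k)"
proof -
  have "(\<Oplus>\<^bsub>coend.Q\<^esub>k\<in>{..<m}. f k) = (\<Oplus>\<^bsub>coend.Q\<^esub>k\<in>{..<m}. coend.cls (free_to_coeff (b k)))"
    by (rule Q.finsum_cong') (use assms in \<open>auto simp: tk_def[symmetric]\<close>)
  also have "\<dots> = coend.cls (\<Sum>k<m. free_to_coeff (b k))"
    by (rule coend.finsum_Q) (use assms free_to_coeff_closed in auto)
  finally show ?thesis by (simp only: tk_def clinear_sum[OF clinear_free_to_coeff])
qed

text \<open>Transports \<open>free_invol\<close> along the isomorphism by choosing a representative.
  The restriction to the carrier matches the extensional function space in
  \<open>star_structure\<close>, so that uniqueness can hold literally.\<close>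

definition tk_star :: "'a coeff_space set \<Rightarrow> 'a coeff_space set" where
  "tk_star = (\<lambda>S\<in>carrier coend.Q. tk (free_invol (SOME a. a \<in> carrier (free_algebra n) \<and> S = tk a)))"

lemma tk_star_tk:
  assumes a: "a \<in> carrier (free_algebra n)"
  shows "tk_star (tk a) = tk (free_invol a)"
proof -
  define a' where "a' = (SOME a'. a' \<in> carrier (free_algebra n) \<and> tk a = tk a')"
  have a': "a' \<in> carrier (free_algebra n)" "tk a = tk a'"
    using someI[of "\<lambda>a'. a' \<in> carrier (free_algebra n) \<and> tk a = tk a'" a] a unfolding a'_def by auto
  then have "a' - a \<in> arc_ideal" using tk_eq_iff[OF a'(1) a] by simp
  then have "free_invol a' - free_invol a \<in> arc_ideal"
    using free_invol_arc_ideal by (simp add: aclinear_diff[OF aclinear_free_invol, symmetric])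
  then have "tk (free_invol a') = tk (free_invol a)"
    using tk_eq_iff[OF free_invol_closed[OF a'(1)] free_invol_closed[OF a]] by simp
  then show ?thesis using a by (simp add: tk_star_def a'_def)
qed

lemma star_structure_tk_star: "star_structure coend.Q tk_star"
proof -
  note c = fvec.subspace_add[OF subspace_free_algebra] fvec.subspace_scale[OF subspace_free_algebra]
    free_algebra_mult_closed free_invol_closed
  note I = aclinear_add[OF aclinear_free_invol] aclinear_cscale[OF aclinear_free_invol] free_invol_mult
  have cl: "tk_star S \<in> carrier coend.Q" if "S \<in> carrier coend.Q" for S
    using that by (rule tk_surj) (simp add: tk_star_tk free_invol_closed)
  show ?thesis
    unfolding star_structure_def
  proof (intro conjI allI ballI)
    show "tk_star \<in> carrier coend.Q \<rightarrow>\<^sub>E carrier coend.Q"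
      using cl by (auto simp: tk_star_def)
    fix S assume "S \<in> carrier coend.Q"
    then obtain a where a: "a \<in> carrier (free_algebra n)" "S = tk a" by (rule tk_surj)
    show "tk_star (tk_star S) = S" unfolding a(2) by (simp add: tk_star_tk a free_invol_closed)
    show "tk_star (k \<odot>\<^bsub>coend.Q\<^esub> S) = cnj k \<odot>\<^bsub>coend.Q\<^esub> tk_star S" for k
      unfolding a(2) by (simp add: tk_star_tk a(1) tk_smult c I)
    fix S' assume "S' \<in> carrier coend.Q"
    then obtain b where b: "b \<in> carrier (free_algebra n)" "S' = tk b" by (rule tk_surj)
    show "tk_star (S \<oplus>\<^bsub>coend.Q\<^esub> S') = tk_star S \<oplus>\<^bsub>coend.Q\<^esub> tk_star S'"
      unfolding a(2) b(2) by (simp add: tk_star_tk a(1) b(1) tk_add c I)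
    show "tk_star (S \<otimes>\<^bsub>coend.Q\<^esub> S') = tk_star S' \<otimes>\<^bsub>coend.Q\<^esub> tk_star S"
      unfolding a(2) b(2) by (simp add: tk_star_tk a(1) b(1) tk_mult c I)
  qed
qed

text \<open>A left inverse and a right inverse of the same matrix agree modulo the ideal: the triple
  product of \<open>r0\<close>, \<open>u\<close> and \<open>r\<close> is evaluated in two ways. The
  indices of \<open>r\<close> and \<open>r0\<close> are placed as for entrywise adjoints, hence
  transposed.\<close>

lemma left_right_inverse_congruent:
  fixes m :: nat
  assumes u: "\<And>i j. i < m \<Longrightarrow> j < m \<Longrightarrow> u i j \<in> carrier (free_algebra n)"
    and r: "\<And>i j. i < m \<Longrightarrow> j < m \<Longrightarrow> r i j \<in> carrier (free_algebra n)"
    and r0: "\<And>i j. i < m \<Longrightarrow> j < m \<Longrightarrow> r0 i j \<in> carrier (free_algebra n)"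
    and row: "\<And>i j. i < m \<Longrightarrow> j < m \<Longrightarrow> (\<Sum>k<m. u i k * r j k) - (if i = j then 1 else 0) \<in> arc_ideal"
    and col: "\<And>i j. i < m \<Longrightarrow> j < m \<Longrightarrow> (\<Sum>k<m. r0 k i * u k j) - (if i = j then 1 else 0) \<in> arc_ideal"
    and jl: "j < m" "l < m"
  shows "r j l - r0 j l \<in> arc_ideal"
proof -
  note S = fvec.subspace_sum[OF free.subspace_I]
  have "(\<Sum>i<m. r0 i l * ((\<Sum>k<m. u i k * r j k) - (if i = j then 1 else 0))) \<in> arc_ideal"
    using row r0 jl by (intro S arc_ideal_mult(2)) auto
  moreover have "(\<Sum>k<m. ((\<Sum>i<m. r0 i l * u i k) - (if l = k then 1 else 0)) * r j k) \<in> arc_ideal"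
    using col r jl by (intro S arc_ideal_mult(1)) auto
  moreover have "(\<Sum>i<m. r0 i l * ((\<Sum>k<m. u i k * r j k) - (if i = j then 1 else 0))) =
      (\<Sum>i<m. \<Sum>k<m. r0 i l * u i k * r j k) - r0 j l"
  proof -
    have "(\<Sum>i<m. r0 i l * (if i = j then 1 else 0)) = (\<Sum>i<m. if i = j then r0 i l else 0)"
      by (intro sum.cong) auto
    then have "(\<Sum>i<m. r0 i l * (if i = j then 1 else 0)) = r0 j l" using jl by simp
    then show ?thesis by (simp add: right_diff_distrib sum_subtractf sum_distrib_left mult.assoc)
  qed
  moreover have "(\<Sum>k<m. ((\<Sum>i<m. r0 i l * u i k) - (if l = k then 1 else 0)) * r j k) =
      (\<Sum>i<m. \<Sum>k<m. r0 i l * u i k * r j k) - r j l"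
  proof -
    have "(\<Sum>k<m. (if l = k then 1 else 0) * r j k) = (\<Sum>k<m. if l = k then r j k else 0)"
      by (intro sum.cong) auto
    then have "(\<Sum>k<m. (if l = k then 1 else 0) * r j k) = r j l" using jl by simp
    moreover have "(\<Sum>k<m. \<Sum>i<m. r0 i l * u i k * r j k) = (\<Sum>i<m. \<Sum>k<m. r0 i l * u i k * r j k)"
      by (rule sum.swap)
    ultimately show ?thesis by (simp add: left_diff_distrib sum_subtractf sum_distrib_right)
  qed
  ultimately have "(\<Sum>i<m. \<Sum>k<m. r0 i l * u i k * r j k) - r0 j l \<in> arc_ideal"
    "(\<Sum>i<m. \<Sum>k<m. r0 i l * u i k * r j k) - r j l \<in> arc_ideal" by simp_all
  from fvec.subspace_diff[OF free.subspace_I this] show ?thesis by simp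
qed

lemma tk_delta: "(if i = j then \<one>\<^bsub>coend.Q\<^esub> else \<zero>\<^bsub>coend.Q\<^esub>) = tk (if i = j then 1 else 0)"
  by (simp add: tk_one tk_zero)

lemma delta_carrier: "(if i = j then 1 else 0) \<in> carrier (free_algebra n)"
  by (simp add: one_free_algebra fvec.subspace_0[OF subspace_free_algebra])

text \<open>
  Any star structure as in \<^const>\<open>coend_star\<close> provides right inverses of the coefficient matrices, for
  which \<open>tk_star\<close> provides left inverses; so the two agree on coefficients, and these span.
\<close>
lemma coend_star_eq: "coend_star \<Phi> = tk_star"
  unfolding coend_star_def Let_def coend_algebra_def
proof (rule the_equality)
  note sums = fvec.subspace_sum[OF subspace_free_algebra] free_algebra_mult_closed free_invol_closed B_closed
  show "star_structure coend.Q tk_star \<and> (\<forall>w \<xi>. onb \<Phi> w \<xi> \<longrightarrow> (\<forall>i<length \<xi>. \<forall>j<length \<xi>.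
     (\<Oplus>\<^bsub>coend.Q\<^esub>k\<in>{..<length \<xi>}. coefficient \<Phi> w (\<xi> ! i) (\<xi> ! k) \<otimes>\<^bsub>coend.Q\<^esub> tk_star (coefficient \<Phi> w (\<xi> ! j) (\<xi> ! k))) =
       (if i = j then \<one>\<^bsub>coend.Q\<^esub> else \<zero>\<^bsub>coend.Q\<^esub>) \<and>
     (\<Oplus>\<^bsub>coend.Q\<^esub>k\<in>{..<length \<xi>}. tk_star (coefficient \<Phi> w (\<xi> ! k) (\<xi> ! i)) \<otimes>\<^bsub>coend.Q\<^esub> coefficient \<Phi> w (\<xi> ! k) (\<xi> ! j)) =
       (if i = j then \<one>\<^bsub>coend.Q\<^esub> else \<zero>\<^bsub>coend.Q\<^esub>)))"
  proof (intro conjI allI impI star_structure_tk_star)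
    fix w \<xi> i j assume \<xi>: "onb \<Phi> w \<xi>" and ij: "i < length \<xi>" "j < length \<xi>"
    let ?b = "\<lambda>i j. B w (\<xi> ! i) (\<xi> ! j)"
    note o = onbD(1)[OF \<xi>]
    have ip1: "cscale (ip \<Phi> w (\<xi> ! i) (\<xi> ! j)) 1 = (if i = j then 1 else (0 :: free_star))"
      using onbD(4)[OF \<xi> ij] by simp
    have u: "row_norm w (\<xi> ! i) (\<xi> ! j) - (if i = j then 1 else 0) \<in> arc_ideal"
      "col_norm w (\<xi> ! i) (\<xi> ! j) - (if i = j then 1 else 0) \<in> arc_ideal"
      using unitary_word[of w] o[OF ij(1)] o[OF ij(2)] unfolding unitary_word_def ip1[symmetric] by blast+
    have "(\<Oplus>\<^bsub>coend.Q\<^esub>k\<in>{..<length \<xi>}. coefficient \<Phi> w (\<xi> ! i) (\<xi> ! k) \<otimes>\<^bsub>coend.Q\<^esub> tk_star (coefficient \<Phi> w (\<xi> ! j) (\<xi> ! k))) =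
        tk (\<Sum>k<length \<xi>. ?b i k * free_invol (?b j k))"
      using ij o by (intro finsum_tk) (simp_all add: sums coefficient_tk tk_star_tk tk_mult)
    also have "\<dots> = tk (if i = j then 1 else 0)"
      using u(1) unfolding norm_frame(1)[OF onb_frame[OF \<xi>] o[OF ij(1)] o[OF ij(2)]]
      by (subst tk_eq_iff[OF _ delta_carrier]) (auto intro!: sums)
    finally show "(\<Oplus>\<^bsub>coend.Q\<^esub>k\<in>{..<length \<xi>}. coefficient \<Phi> w (\<xi> ! i) (\<xi> ! k) \<otimes>\<^bsub>coend.Q\<^esub> tk_star (coefficient \<Phi> w (\<xi> ! j) (\<xi> ! k))) =
       (if i = j then \<one>\<^bsub>coend.Q\<^esub> else \<zero>\<^bsub>coend.Q\<^esub>)" unfolding tk_delta .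
    have "(\<Oplus>\<^bsub>coend.Q\<^esub>k\<in>{..<length \<xi>}. tk_star (coefficient \<Phi> w (\<xi> ! k) (\<xi> ! i)) \<otimes>\<^bsub>coend.Q\<^esub> coefficient \<Phi> w (\<xi> ! k) (\<xi> ! j)) =
        tk (\<Sum>k<length \<xi>. free_invol (?b k i) * ?b k j)"
      using ij o by (intro finsum_tk) (simp_all add: sums coefficient_tk tk_star_tk tk_mult)
    also have "\<dots> = tk (if i = j then 1 else 0)"
      using u(2) unfolding norm_frame(2)[OF onb_frame[OF \<xi>] o[OF ij(1)] o[OF ij(2)]]
      by (subst tk_eq_iff[OF _ delta_carrier]) (auto intro!: sums)
    finally show "(\<Oplus>\<^bsub>coend.Q\<^esub>k\<in>{..<length \<xi>}. tk_star (coefficient \<Phi> w (\<xi> ! k) (\<xi> ! i)) \<otimes>\<^bsub>coend.Q\<^esub> coefficient \<Phi> w (\<xi> ! k) (\<xi> ! j)) =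
       (if i = j then \<one>\<^bsub>coend.Q\<^esub> else \<zero>\<^bsub>coend.Q\<^esub>)" unfolding tk_delta .
  qed
next
  note sums = fvec.subspace_sum[OF subspace_free_algebra] free_algebra_mult_closed free_invol_closed B_closed
  fix s assume s: "star_structure coend.Q s \<and> (\<forall>w \<xi>. onb \<Phi> w \<xi> \<longrightarrow> (\<forall>i<length \<xi>. \<forall>j<length \<xi>.
     (\<Oplus>\<^bsub>coend.Q\<^esub>k\<in>{..<length \<xi>}. coefficient \<Phi> w (\<xi> ! i) (\<xi> ! k) \<otimes>\<^bsub>coend.Q\<^esub> s (coefficient \<Phi> w (\<xi> ! j) (\<xi> ! k))) =
       (if i = j then \<one>\<^bsub>coend.Q\<^esub> else \<zero>\<^bsub>coend.Q\<^esub>) \<and>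
     (\<Oplus>\<^bsub>coend.Q\<^esub>k\<in>{..<length \<xi>}. s (coefficient \<Phi> w (\<xi> ! k) (\<xi> ! i)) \<otimes>\<^bsub>coend.Q\<^esub> coefficient \<Phi> w (\<xi> ! k) (\<xi> ! j)) =
       (if i = j then \<one>\<^bsub>coend.Q\<^esub> else \<zero>\<^bsub>coend.Q\<^esub>)))"
  have sS: "s \<in> carrier coend.Q \<rightarrow>\<^sub>E carrier coend.Q"
    "\<And>x y. x \<in> carrier coend.Q \<Longrightarrow> y \<in> carrier coend.Q \<Longrightarrow> s (x \<oplus>\<^bsub>coend.Q\<^esub> y) = s x \<oplus>\<^bsub>coend.Q\<^esub> s y"
    "\<And>k x. x \<in> carrier coend.Q \<Longrightarrow> s (k \<odot>\<^bsub>coend.Q\<^esub> x) = cnj k \<odot>\<^bsub>coend.Q\<^esub> s x"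
  proof -
    note ss = conjunct1[OF s, unfolded star_structure_def]
    show "s \<in> carrier coend.Q \<rightarrow>\<^sub>E carrier coend.Q" by (rule conjunct1[OF ss])
    show "s (x \<oplus>\<^bsub>coend.Q\<^esub> y) = s x \<oplus>\<^bsub>coend.Q\<^esub> s y"
      if "x \<in> carrier coend.Q" "y \<in> carrier coend.Q" for x y
      using conjunct1[OF conjunct2[OF ss]] that by blast
    show "s (k \<odot>\<^bsub>coend.Q\<^esub> x) = cnj k \<odot>\<^bsub>coend.Q\<^esub> s x" if "x \<in> carrier coend.Q" for k x
      using conjunct1[OF conjunct2[OF conjunct2[OF ss]]] that by blast
  qed
  have onb_eq: "s (tk (B w (\<xi> ! j) (\<xi> ! l))) = tk_star (tk (B w (\<xi> ! j) (\<xi> ! l)))"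
    if \<xi>: "onb \<Phi> w \<xi>" and jl: "j < length \<xi>" "l < length \<xi>" for w \<xi> j l
  proof -
    let ?b = "\<lambda>i j. B w (\<xi> ! i) (\<xi> ! j)" and ?m = "length \<xi>"
    note o = onbD(1)[OF \<xi>]
    have "\<exists>a. a \<in> carrier (free_algebra n) \<and> s (tk (?b i j)) = tk a" for i j
    proof -
      have "s (tk (?b i j)) \<in> carrier coend.Q" using sS(1) by (intro PiE_mem[OF sS(1)]) simp
      then show ?thesis by (rule tk_surj) blast
    qed
    \<comment> \<open>The values of \<open>s\<close> are represented in the free algebra, where the
      comparison of left and right inverses takes place.\<close>
    then obtain r where r: "\<And>i j. r i j \<in> carrier (free_algebra n) \<and> s (tk (?b i j)) = tk (r i j)" by metis
    have "r j l - free_invol (?b j l) \<in> arc_ideal"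
    proof (rule left_right_inverse_congruent[of ?m ?b r "\<lambda>i j. free_invol (?b i j)"])
      fix i j assume ij: "i < ?m" "j < ?m"
      have ip1: "cscale (ip \<Phi> w (\<xi> ! i) (\<xi> ! j)) 1 = (if i = j then 1 else (0 :: free_star))"
        using onbD(4)[OF \<xi> ij] by simp
      show "(\<Sum>k<?m. free_invol (?b k i) * ?b k j) - (if i = j then 1 else 0) \<in> arc_ideal"
        using unitary_word[of w] o[OF ij(1)] o[OF ij(2)]
        unfolding unitary_word_def ip1[symmetric] norm_frame(2)[OF onb_frame[OF \<xi>] o[OF ij(1)] o[OF ij(2)], symmetric]
        by blast
      have "(\<Oplus>\<^bsub>coend.Q\<^esub>k\<in>{..<?m}. coefficient \<Phi> w (\<xi> ! i) (\<xi> ! k) \<otimes>\<^bsub>coend.Q\<^esub> s (coefficient \<Phi> w (\<xi> ! j) (\<xi> ! k))) =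
          tk (\<Sum>k<?m. ?b i k * r j k)"
        using ij o r by (intro finsum_tk) (simp_all add: sums coefficient_tk tk_mult)
      then have "tk (\<Sum>k<?m. ?b i k * r j k) = tk (if i = j then 1 else 0)"
        using conjunct1[OF conjunct2[OF s, rule_format, OF \<xi> ij]] unfolding tk_delta by (rule trans[OF sym])
      then show "(\<Sum>k<?m. ?b i k * r j k) - (if i = j then 1 else 0) \<in> arc_ideal"
        using r by (subst (asm) tk_eq_iff[OF _ delta_carrier]) (auto intro!: sums)
    qed (use r jl in \<open>auto intro: sums\<close>)
    then have "tk (r j l) = tk (free_invol (?b j l))" using r by (subst tk_eq_iff) (auto intro: sums)
    then show ?thesis using r by (simp add: tk_star_tk)
  qed
  let ?M = "{a \<in> carrier (free_algebra n). s (tk a) = tk_star (tk a)}"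
  note tS = star_structure_tk_star[unfolded star_structure_def]
  have sub: "fvec.subspace ?M"
  proof (rule fvec.subspaceI)
    have z: "0 \<in> carrier (free_algebra n)" by (rule fvec.subspace_0[OF subspace_free_algebra])
    show sc: "cscale k a \<in> ?M" if "a \<in> ?M" for k a
      using that sS(3)[of "tk a" k] tS fvec.subspace_scale[OF subspace_free_algebra]
      by (auto simp: tk_smult[symmetric])
    show "a + b \<in> ?M" if "a \<in> ?M" "b \<in> ?M" for a b
      using that sS(2)[of "tk a" "tk b"] tS fvec.subspace_add[OF subspace_free_algebra]
      by (auto simp: tk_add[symmetric])
    \<comment> \<open>Zero is written as 0 times itself; conjugate linearity of \<open>s\<close>
      then forces its value there to be zero.\<close>
    have "s (tk (cscale 0 0)) = tk_star (tk (cscale 0 0))"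
    proof -
      obtain a where a: "a \<in> carrier (free_algebra n)" "s (tk 0) = tk a"
        using PiE_mem[OF sS(1) tk_Q[OF z]] by (rule tk_surj)
      show ?thesis
        unfolding tk_smult[symmetric] sS(3)[OF tk_Q[OF z]] a(2) tk_star_tk[OF z]
        using tS z tk_star_tk[OF z] by (simp add: tk_smult aclinear_zero[OF aclinear_free_invol])
    qed
    then show "0 \<in> ?M" using z by simp
  qed
  have B_M: "B w x y \<in> ?M" if x: "x \<in> obj \<Phi> w" and y: "y \<in> obj \<Phi> w" for w x y
  proof -
    obtain \<xi> where \<xi>: "onb \<Phi> w \<xi>" using onb_exists by blast
    note o = onbD(1)[OF \<xi>]
    have "B w x y = (\<Sum>j<length \<xi>. cscale (ip \<Phi> w x (\<xi> ! j)) (\<Sum>l<length \<xi>. cscale (ip \<Phi> w (\<xi> ! l) y) (B w (\<xi> ! j) (\<xi> ! l))))"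
      unfolding sesq_frame_left[OF sesq_B onb_frame[OF \<xi>] x y]
      using o by (intro sum.cong refl arg_cong[where f = "cscale _"] sesq_frame_right[OF sesq_B onb_frame[OF \<xi>] _ y]) simp
    also have "\<dots> \<in> ?M"
      using onb_eq[OF \<xi>] by (intro fvec.subspace_sum[OF sub] fvec.subspace_scale[OF sub]) simp
    finally show ?thesis .
  qed
  show "s = tk_star"
  proof (rule PiE_ext[OF sS(1) conjunct1[OF tS]])
    fix S assume "S \<in> carrier coend.Q"
    then obtain a where a: "a \<in> carrier (free_algebra n)" "S = tk a" by (rule tk_surj)
    have "lin_ext bvec a \<in> ?M"
    proof (rule lin_ext_in_subspace[OF sub])
      fix u assume "u \<in> Poly_Mapping.keys a"
      then obtain w I J where "I \<in> Ix w" "J \<in> Ix w" "bvec u = uword w I J" by (rule free_word_cases[OF a(1)])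
      then show "bvec u \<in> ?M" using B_M[of "wvec R w I" w "wvec C w J"] by (simp only: B_basis wvec_C_closed wvec_R_closed)
    qed
    then show "s S = tk_star S" using a by simp
  qed
qed

section \<open>Comultiplication on monomials, and the isomorphism\<close>

text \<open>Multiplying out the generator formula letter by letter produces one summand for each
  intermediate multi-index \<open>L\<close>.\<close>

lemma word_comult_eq:
  assumes "I \<in> Ix w" "J \<in> Ix w"
  shows "word_comult n (zip I (zip J (map ((=) Xstar) w))) = (\<Sum>L\<in>Ix w. bvec (uword w I L, uword w L J))"
  using assms
proof (induction w arbitrary: I J)
  case Nil
  then show ?case by (simp add: Ix_simps)
next
  case (Cons a w)
  then obtain i I' j J' where ij: "I = i # I'" "J = j # J'" "i < n" "j < n" "I' \<in> Ix w" "J' \<in> Ix w"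
    by (auto simp: Ix_simps)
  have u: "gen (i, k, Xstar = a) * uword w L M = uword (a # w) (i # L) (k # M)" for i k L M
    by (simp add: gen_def uword_def bvec_fword_mult)
  have "word_comult n (zip I (zip J (map ((=) Xstar) (a # w)))) =
      (\<Sum>k<n. \<Sum>L\<in>Ix w. bvec (uword (a # w) I (k # L), uword (a # w) (k # L) J))"
    by (simp add: ij Cons.IH[OF ij(5,6)] lin_ext_sum u)
  also have "\<dots> = (\<Sum>L\<in>Ix (a # w). bvec (uword (a # w) I L, uword (a # w) L J))"
    unfolding Ix_simps by (subst sum.reindex) (auto simp: inj_on_def sum.cartesian_product case_prod_unfold)
  finally show ?case .
qed

lemma free_comult_uword:
  "I \<in> Ix w \<Longrightarrow> J \<in> Ix w \<Longrightarrow> free_comult n (uword w I J) = (\<Sum>L\<in>Ix w. bvec (uword w I L, uword w L J))"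
  unfolding uword_def[of w I J] free_comult_def by (simp add: word_comult_eq)

lemma clinear_free_comult: "clinear (free_comult n)"
  unfolding free_comult_def by (rule clinear_lin_ext)

lemma free_comult_keys:
  assumes a: "a \<in> carrier (free_algebra n)"
  shows "Poly_Mapping.keys (free_comult n a) \<subseteq> carrier (free_algebra n) \<times> carrier (free_algebra n)"
proof -
  let ?M = "{t. Poly_Mapping.keys t \<subseteq> carrier (free_algebra n) \<times> carrier (free_algebra n)}"
  have "free_comult n a \<in> ?M"
  proof (rule clinear_in_subspace[OF clinear_free_comult subspace_free])
    fix u assume "u \<in> Poly_Mapping.keys a"
    then obtain w I J where u: "I \<in> Ix w" "J \<in> Ix w" "bvec u = uword w I J" by (rule free_word_cases[OF a])
    show "free_comult n (bvec u) \<in> ?M"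
      unfolding u(3) free_comult_uword[OF u(1,2)] using u
      by (intro fvec.subspace_sum[OF subspace_free]) simp
  qed
  then show ?thesis by simp
qed

text \<open>The sum over intermediate multi-indices is the comultiplication of the coend evaluated
  in the frame of \<open>C\<close> and \<open>R\<close> simple tensors. The freedom of frame in
  \<open>coend_comult_frame\<close> is essential here, as the coend itself is defined with an
  orthonormal basis.\<close>

lemma free_comult_compatible:
  assumes a: "a \<in> carrier (free_algebra n)"
  shows "lin_ext (\<lambda>(x, y). bvec (tk x, tk y)) (free_comult n a) - coend_comult (free_to_coeff a) \<in> tensor_rel coend.Q"
proof -
  obtain \<tau> :: "('a coeff_space set \<times> 'a coeff_space set \<Rightarrow>\<^sub>0 complex) \<Rightarrow>
      ('a coeff_space set \<times> 'a coeff_space set \<Rightarrow>\<^sub>0 complex)"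
    where \<tau>: "clinear \<tau>" "\<And>t. \<tau> t = 0 \<longleftrightarrow> t \<in> tensor_rel coend.Q"
    using exists_linear_with_kernel[OF subspace_tensor_rel[of coend.Q]] by blast
  have l1: "clinear (\<lambda>a. \<tau> (lin_ext (\<lambda>(x, y). bvec (tk x, tk y)) (free_comult n a)))"
    by (rule clinear_compose[OF \<tau>(1) clinear_compose[OF clinear_lin_ext clinear_free_comult]])
  have l2: "clinear (\<lambda>a. \<tau> (coend_comult (free_to_coeff a)))"
    unfolding coeff_comult_def
    by (rule clinear_compose[OF \<tau>(1) clinear_compose[OF clinear_lin_ext clinear_compose[OF clinear_lin_ext clinear_free_to_coeff]]])
  have "\<tau> (lin_ext (\<lambda>(x, y). bvec (tk x, tk y)) (free_comult n a)) = \<tau> (coend_comult (free_to_coeff a))"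
  proof (rule clinear_cong[OF l1 l2])
    fix u assume "u \<in> Poly_Mapping.keys a"
    then obtain w I J where u: "I \<in> Ix w" "J \<in> Ix w" "bvec u = uword w I J" by (rule free_word_cases[OF a])
    have "\<tau> (lin_ext (\<lambda>(x, y). bvec (tk x, tk y)) (free_comult n (uword w I J))) =
        (\<Sum>L\<in>Ix w. \<tau> (bvec (tk (uword w I L), tk (uword w L J))))"
      by (simp add: free_comult_uword u lin_ext_sum clinear_sum[OF \<tau>(1)])
    also have "\<dots> = (\<Sum>L\<in>Ix w. \<tau> (bvec (coefficient \<Phi> w (wvec R w I) (wvec C w L), coefficient \<Phi> w (wvec R w L) (wvec C w J))))"
      using u by (intro sum.cong refl) (simp add: coefficient_tk B_basis)
    also have "\<dots> = \<tau> (coend_comult (free_to_coeff (uword w I J)))"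
      unfolding free_to_coeff_uword[OF u(1,2)]
      using u by (intro coend_comult_frame[OF \<tau> frame_word, symmetric]) simp_all
    finally show "\<tau> (lin_ext (\<lambda>(x, y). bvec (tk x, tk y)) (free_comult n (bvec u))) = \<tau> (coend_comult (free_to_coeff (bvec u)))"
      unfolding u(3) .
  qed
  then show ?thesis unfolding linear_with_kernel_eq[OF \<tau>] .
qed

lemma clinear_coeff_comult: "clinear (coeff_comult \<Phi>)"
  unfolding coeff_comult_def by (rule clinear_lin_ext)

text \<open>The presentation of the coend by generators and the relations of the arcs. Both
  universal quantum groups are compared with it through their defining ideals.\<close>

theorem tannaka_iso:
  "hopf_star_iso (with_hopf_star free.Q (quotient_map (free_algebra n) arc_ideal free_invol)
     (quotient_comult (free_algebra n) arc_ideal (free_comult n))) (tannaka_algebra \<Phi>) TK.\<theta>"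
  unfolding tannaka_algebra_def coend_algebra_def
proof (rule TK.hopf_star_isoI[OF _ clinear_coeff_comult free_comult_keys coend_comult_coideal])
  fix a assume a: "a \<in> carrier (free_algebra n)"
  have "quotient_map (free_algebra n) arc_ideal free_invol (free.cls a) = free.cls (free_invol a)"
    by (rule free.quotient_map_cls[OF free_invol_arc_ideal aclinear_diff[OF aclinear_free_invol]])
  then show "TK.\<theta> (quotient_map (free_algebra n) arc_ideal free_invol (free.cls a)) = coend_star \<Phi> (coend.cls (free_to_coeff a))"
    using a tk_star_tk[OF a] by (simp add: TK.\<theta>_cls free_invol_closed coend_star_eq tk_def)
  show "lin_ext (\<lambda>(x, y). bvec (coend.cls (free_to_coeff x), coend.cls (free_to_coeff y))) (free_comult n a) -
      coend_comult (free_to_coeff a) \<in> tensor_rel coend.Q"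
    using free_comult_compatible[OF a] unfolding tk_def .
qed

lemma tannaka_iso_gen:
  assumes "i < n" "j < n"
  shows "TK.\<theta> (free.cls (gen (i, j, False))) = coefficient \<Phi> [X] (v ! i) (v ! j)"
  using assms TK.\<theta>_cls[OF gen_free_algebra[OF assms]] coefficient_tk[of "v ! i" "[X]" "v ! j"]
  by (simp add: B_X tk_def)

end

section \<open>The relations of Van Daele and Wang and of Banica\<close>

lemma mat_mult_entry:
  "A \<in> carrier_mat nr m \<Longrightarrow> B \<in> carrier_mat m nc \<Longrightarrow> i < nr \<Longrightarrow> j < nc \<Longrightarrow>
    (A * B) $$ (i, j) = (\<Sum>k<m. A $$ (i, k) * B $$ (k, j))"
  by (auto simp: scalar_prod_def lessThan_atLeast0 intro!: sum.cong)

lemma mat_adjoint_eq: "mat_adjoint A = mat (dim_col A) (dim_row A) (\<lambda>(i, j). cnj (A $$ (j, i)))"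
  unfolding mat_adjoint_def by (rule eq_matI) (auto simp: mat_of_rows_index)

lemma mat_adjoint_dims: "dim_row (mat_adjoint (A :: complex mat)) = dim_col A" "dim_col (mat_adjoint A) = dim_row A"
  unfolding mat_adjoint_eq by simp_all

lemma mat_adjoint_index:
  "A \<in> carrier_mat nr nc \<Longrightarrow> i < nc \<Longrightarrow> j < nr \<Longrightarrow> mat_adjoint A $$ (i, j) = cnj (A $$ (j, i))"
  unfolding mat_adjoint_eq by auto

text \<open>A one-sided inverse of a square matrix over a field is two-sided, so
  \<open>mat_inverse\<close> succeeds on \<open>Q\<close> and its result must be
  \<open>P\<close>.\<close>

lemma inv_mat_eqI:
  assumes Q: "Q \<in> carrier_mat m m" and P: "P \<in> carrier_mat m m" and QP: "Q * P = 1\<^sub>m m"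
  shows "inv_mat Q = P"
proof -
  have PQ: "P * Q = 1\<^sub>m m" by (rule mat_mult_left_right_inverse[OF Q P QP])
  have "Q \<in> Units (ring_mat TYPE(complex) m ())"
    unfolding Units_def ring_mat_simps using Q P QP PQ by auto
  then obtain B where B: "mat_inverse Q = Some B" using mat_inverse(1)[OF Q, of "()"] by (cases "mat_inverse Q") auto
  then have "B * Q = 1\<^sub>m m" "B \<in> carrier_mat m m" using mat_inverse(2)[OF Q B] by auto
  moreover from this have "B * (Q * P) = (B * Q) * P" by (intro assoc_mult_mat[OF _ Q P, symmetric])
  ultimately have "B = P" using P QP by simp
  then show ?thesis by (simp add: inv_mat_def B)
qed

lemma transpose_bar_entry:
  "M \<in> carrier_mat nr nc \<Longrightarrow> i < nc \<Longrightarrow> j < nr \<Longrightarrow> transpose_mat (bar_mat M) $$ (i, j) = free_invol (M $$ (j, i))"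
  by (auto simp: bar_mat_def)

text \<open>Scalars sit in the free algebra as multiples of the empty word. The embedding is a
  semiring homomorphism, so products of scalar matrices may be computed over the complex
  numbers.\<close>

interpretation single_hom: semiring_hom "\<lambda>c :: complex. Poly_Mapping.single (0 :: (nat \<times> nat \<times> bool) fword) c"
  by unfold_locales (simp_all add: single_add mult_single)

lemma scalar_mat_mult:
  "A \<in> carrier_mat nr m \<Longrightarrow> B \<in> carrier_mat m nc \<Longrightarrow> scalar_mat (A * B) = scalar_mat A * scalar_mat B"
  unfolding scalar_mat_def by (rule single_hom.mat_hom_mult)

lemma scalar_mat_one: "scalar_mat (1\<^sub>m m) = 1\<^sub>m m"
  unfolding scalar_mat_def by (rule single_hom.mat_hom_one)

lemma scalar_mat_carrier [simp]: "A \<in> carrier_mat nr nc \<Longrightarrow> scalar_mat A \<in> carrier_mat nr nc"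
  by (simp add: scalar_mat_def)

lemma scalar_mat_index:
  "A \<in> carrier_mat nr nc \<Longrightarrow> i < nr \<Longrightarrow> j < nc \<Longrightarrow> scalar_mat A $$ (i, j) = Poly_Mapping.single 0 (A $$ (i, j))"
  by (auto simp: scalar_mat_def)

lemma single_zero_mult: "Poly_Mapping.single 0 c * (a :: free_star) = cscale c a"
  "(a :: free_star) * Poly_Mapping.single 0 c = cscale c a"
proof -
  have "Poly_Mapping.single 0 c = cscale c (1 :: free_star)" by (metis cscale_bvec single_one)
  then show "Poly_Mapping.single 0 c * a = cscale c a" "a * Poly_Mapping.single 0 c = cscale c a"
    by (simp_all add: cscale_mult_left cscale_mult_right)
qed

lemma scalar_mat_entry:
  assumes S: "S \<in> carrier_mat nr m" and M: "M \<in> carrier_mat m m'" and T: "T \<in> carrier_mat m' nc" and ij: "i < nr" "j < nc"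
  shows "(scalar_mat S * M * scalar_mat T) $$ (i, j) = (\<Sum>l<m'. \<Sum>k<m. cscale (S $$ (i, k) * T $$ (l, j)) (M $$ (k, l)))"
proof -
  have SM: "scalar_mat S * M \<in> carrier_mat nr m'" by (rule mult_carrier_mat[OF scalar_mat_carrier[OF S] M])
  have e: "(scalar_mat S * M) $$ (i, l) = (\<Sum>k<m. cscale (S $$ (i, k)) (M $$ (k, l)))" if "l < m'" for l
    unfolding mat_mult_entry[OF scalar_mat_carrier[OF S] M ij(1) that]
    using ij by (intro sum.cong) (simp_all add: scalar_mat_index[OF S] single_zero_mult)
  show ?thesis
    unfolding mat_mult_entry[OF SM scalar_mat_carrier[OF T] ij]
    using ij by (intro sum.cong) (simp_all add: e scalar_mat_index[OF T] single_zero_mult fvec.scale_sum_right mult.commute)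
qed

lemma elements_scalar_mat_span:
  assumes S: "S \<in> carrier_mat nr m" and M: "M \<in> carrier_mat m m'" and T: "T \<in> carrier_mat m' nc"
  shows "elements_mat (scalar_mat S * M * scalar_mat T) \<subseteq> fvec.span (elements_mat M)"
proof
  fix r assume "r \<in> elements_mat (scalar_mat S * M * scalar_mat T)"
  then obtain i j where ij: "i < nr" "j < nc" and r: "r = (scalar_mat S * M * scalar_mat T) $$ (i, j)"
    using elements_matD[of r] S M T by (auto simp: scalar_mat_def)
  show "r \<in> fvec.span (elements_mat M)"
    unfolding r scalar_mat_entry[OF S M T ij]
    by (intro fvec.span_sum fvec.span_scale fvec.span_base elements_matI[OF M]) auto
qed

text \<open>Entries of a product with scalar matrices on both sides are linear combinations of the
  entries of \<open>M\<close>, and the inverse matrices give the converse. Relations written as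
  matrix equations may thus be multiplied by invertible scalar matrices.\<close>

lemma span_elements_scalar_mat:
  assumes c: "S \<in> carrier_mat m m" "S' \<in> carrier_mat m m" "T \<in> carrier_mat m m" "T' \<in> carrier_mat m m" "M \<in> carrier_mat m m"
    and inv: "S' * S = 1\<^sub>m m" "T * T' = 1\<^sub>m m"
  shows "fvec.span (elements_mat (scalar_mat S * M * scalar_mat T)) = fvec.span (elements_mat M)"
proof -
  let ?N = "scalar_mat S * M * scalar_mat T"
  have N: "?N \<in> carrier_mat m m"
    by (rule mult_carrier_mat[OF mult_carrier_mat[OF scalar_mat_carrier[OF c(1)] c(5)] scalar_mat_carrier[OF c(3)]])
  have "scalar_mat S' * ?N * scalar_mat T' = (scalar_mat S' * scalar_mat S) * M * (scalar_mat T * scalar_mat T')"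
    using c by (simp add: assoc_mult_mat[of _ m m _ m _ m] mult_carrier_mat[of _ m m _ m])
  also have "\<dots> = M"
    using c inv by (simp add: scalar_mat_mult[symmetric, of _ m m _ m] scalar_mat_one)
  finally have M: "scalar_mat S' * ?N * scalar_mat T' = M" .
  have "elements_mat M \<subseteq> fvec.span (elements_mat ?N)"
    using elements_scalar_mat_span[OF c(2) N c(4)] unfolding M .
  moreover have "elements_mat ?N \<subseteq> fvec.span (elements_mat M)"
    by (rule elements_scalar_mat_span[OF c(1,5,3)])
  ultimately show ?thesis by (intro subset_antisym fvec.span_minimal fvec.subspace_span)
qed

lemma span_Un_cong: "fvec.span S = fvec.span S' \<Longrightarrow> fvec.span T = fvec.span T' \<Longrightarrow> fvec.span (S \<union> T) = fvec.span (S' \<union> T')"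
  by (simp add: fvec.span_Un)

context based_fiber_functor
begin

definition arc_mat :: "complex mat" where
  "arc_mat = mat n n (\<lambda>(i, j). arc_coeff i j)"

text \<open>The components of the vectors \<open>p j\<close> in the basis \<open>v'\<close>.
  Expanding the duality of \<open>q\<close> and \<open>p\<close> over \<open>v'\<close> shows that
  this matrix is inverse to \<open>arc_mat\<close>.\<close>

definition arc_mat_inv :: "complex mat" where
  "arc_mat_inv = mat n n (\<lambda>(i, j). ip \<Phi> [Xstar] (v' ! i) (p j))"

definition gram_q :: "complex mat" where
  "gram_q = mat n n (\<lambda>(i, j). ip \<Phi> [Xstar] (q i) (q j))"

definition gram_p :: "complex mat" where
  "gram_p = mat n n (\<lambda>(i, j). ip \<Phi> [Xstar] (p i) (p j))"

lemma mats_carrier [simp]: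
  "arc_mat \<in> carrier_mat n n" "arc_mat_inv \<in> carrier_mat n n" "gram_q \<in> carrier_mat n n" "gram_p \<in> carrier_mat n n"
  by (simp_all add: arc_mat_def arc_mat_inv_def gram_q_def gram_p_def)

lemma adjoint_carrier [simp]: "(A :: complex mat) \<in> carrier_mat n n \<Longrightarrow> mat_adjoint A \<in> carrier_mat n n"
  using mat_adjoint_dims[of A] by (intro carrier_matI) auto

lemma ip_frame:
  assumes "frame w S C' R'" "x \<in> obj \<Phi> w" "y \<in> obj \<Phi> w"
  shows "ip \<Phi> w x y = (\<Sum>k\<in>S. ip \<Phi> w x (C' k) * ip \<Phi> w (R' k) y)"
proof -
  note F = frameD[OF assms(1)]
  have "ip \<Phi> w x y = ip \<Phi> w x (\<Sum>k\<in>S. scal \<Phi> (ip \<Phi> w (R' k) y) (C' k))" by (simp only: F(4)[OF assms(3)])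
  also have "\<dots> = (\<Sum>k\<in>S. ip \<Phi> w x (C' k) * ip \<Phi> w (R' k) y)"
    by (subst ip_sum_right) (simp_all add: assms F H.inner_scale mult.commute)
  finally show ?thesis .
qed

lemma frame_v': "frame [Xstar] {..<n} ((!) v') ((!) v')"
  using onb_frame[OF onb_v'] by (simp add: length_v')

lemma arc_mat_inverse: "arc_mat * arc_mat_inv = 1\<^sub>m n" "arc_mat_inv * arc_mat = 1\<^sub>m n"
proof -
  have c: "v' ! i \<in> obj \<Phi> [Xstar]" if "i < n" for i using that by (simp add: length_v')
  show "arc_mat * arc_mat_inv = 1\<^sub>m n"
  proof (rule eq_matI)
    fix i j assume "i < dim_row (1\<^sub>m n :: complex mat)" "j < dim_col (1\<^sub>m n :: complex mat)"
    then have ij: "i < n" "j < n" by simp_all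
    have "(arc_mat * arc_mat_inv) $$ (i, j) = (\<Sum>k<n. ip \<Phi> [Xstar] (q i) (v' ! k) * ip \<Phi> [Xstar] (v' ! k) (p j))"
      unfolding mat_mult_entry[OF mats_carrier(1,2) ij] using ij
      by (intro sum.cong) (simp_all add: arc_mat_def arc_mat_inv_def arc_coeff_eq length_v')
    also have "\<dots> = ip \<Phi> [Xstar] (q i) (p j)" by (rule ip_frame[OF frame_v' q_closed p_closed, symmetric])
    finally show "(arc_mat * arc_mat_inv) $$ (i, j) = 1\<^sub>m n $$ (i, j)" using ij by (simp add: ip_q_p)
  qed (simp_all add: arc_mat_def arc_mat_inv_def)
  then show "arc_mat_inv * arc_mat = 1\<^sub>m n" by (intro mat_mult_left_right_inverse[of arc_mat]) simp_all
qed

text \<open>The duality of \<open>q\<close> and \<open>p\<close>, expanded once more in the frame of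
  \<open>q\<close> and \<open>p\<close> itself.\<close>

lemma gram_inverse: "gram_q * gram_p = 1\<^sub>m n" "gram_p * gram_q = 1\<^sub>m n"
proof -
  show "gram_q * gram_p = 1\<^sub>m n"
  proof (rule eq_matI)
    fix i j assume "i < dim_row (1\<^sub>m n :: complex mat)" "j < dim_col (1\<^sub>m n :: complex mat)"
    then have ij: "i < n" "j < n" by simp_all
    have "(gram_q * gram_p) $$ (i, j) = (\<Sum>k<n. ip \<Phi> [Xstar] (q i) (q k) * ip \<Phi> [Xstar] (p k) (p j))"
      unfolding mat_mult_entry[OF mats_carrier(3,4) ij] using ij
      by (intro sum.cong) (simp_all add: gram_q_def gram_p_def)
    also have "\<dots> = ip \<Phi> [Xstar] (q i) (p j)" by (rule ip_frame[OF frame_q_p q_closed p_closed, symmetric])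
    finally show "(gram_q * gram_p) $$ (i, j) = 1\<^sub>m n $$ (i, j)" using ij by (simp add: ip_q_p)
  qed (simp_all add: gram_q_def gram_p_def)
  then show "gram_p * gram_q = 1\<^sub>m n" by (intro mat_mult_left_right_inverse[of gram_q]) simp_all
qed

text \<open>The entries of A are the inner products of the \<open>q i\<close> with the orthonormal
  basis \<open>v'\<close>, so this is Parseval's identity.\<close>

lemma gram_q_eq: "arc_mat * mat_adjoint arc_mat = gram_q"
proof (rule eq_matI)
  have c: "v' ! i \<in> obj \<Phi> [Xstar]" if "i < n" for i using that by (simp add: length_v')
  fix i j assume "i < dim_row gram_q" "j < dim_col gram_q"
  then have ij: "i < n" "j < n" by (simp_all add: gram_q_def)
  have "(arc_mat * mat_adjoint arc_mat) $$ (i, j) = (\<Sum>k<n. ip \<Phi> [Xstar] (q i) (v' ! k) * ip \<Phi> [Xstar] (v' ! k) (q j))"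
    unfolding mat_mult_entry[OF mats_carrier(1) adjoint_carrier[OF mats_carrier(1)] ij] using ij
    by (intro sum.cong) (simp_all add: mat_adjoint_index[OF mats_carrier(1)], simp_all add: arc_mat_def arc_coeff_eq length_v' ip_cnj c)
  also have "\<dots> = ip \<Phi> [Xstar] (q i) (q j)" by (rule ip_frame[OF frame_v' q_closed q_closed, symmetric])
  finally show "(arc_mat * mat_adjoint arc_mat) $$ (i, j) = gram_q $$ (i, j)" using ij by (simp add: gram_q_def)
qed (simp_all add: mat_adjoint_dims, simp_all add: gram_q_def arc_mat_def)

lemma adjoint_inverse: "mat_adjoint arc_mat * mat_adjoint arc_mat_inv = 1\<^sub>m n"
proof (rule eq_matI)
  fix i j assume "i < dim_row (1\<^sub>m n :: complex mat)" "j < dim_col (1\<^sub>m n :: complex mat)"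
  then have ij: "i < n" "j < n" by simp_all
  have "(mat_adjoint arc_mat * mat_adjoint arc_mat_inv) $$ (i, j) = cnj ((arc_mat_inv * arc_mat) $$ (j, i))"
    unfolding mat_mult_entry[OF adjoint_carrier[OF mats_carrier(1)] adjoint_carrier[OF mats_carrier(2)] ij]
      mat_mult_entry[OF mats_carrier(2,1) ij(2,1)] cnj_sum
    using ij by (intro sum.cong) (simp_all add: mat_adjoint_index[OF mats_carrier(1)] mat_adjoint_index[OF mats_carrier(2)] mult.commute)
  then show "(mat_adjoint arc_mat * mat_adjoint arc_mat_inv) $$ (i, j) = 1\<^sub>m n $$ (i, j)"
    using ij by (simp add: arc_mat_inverse)
qed (simp_all add: mat_adjoint_dims, simp_all add: arc_mat_def arc_mat_inv_def)

lemma adjoint_inverse': "mat_adjoint arc_mat_inv * mat_adjoint arc_mat = 1\<^sub>m n"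
  by (rule mat_mult_left_right_inverse[OF _ _ adjoint_inverse]) simp_all

section \<open>The relations as matrix equations\<close>

abbreviation u where "u \<equiv> u_mat n"
abbreviation ub where "ub \<equiv> bar_mat (u_mat n)"

lemma u_carrier [simp]: "u \<in> carrier_mat n n" "ub \<in> carrier_mat n n"
  "transpose_mat u \<in> carrier_mat n n" "transpose_mat ub \<in> carrier_mat n n"
  by (simp_all add: u_mat_def bar_mat_def)

lemma u_entry: "i < n \<Longrightarrow> j < n \<Longrightarrow> u $$ (i, j) = gen (i, j, False)"
  "i < n \<Longrightarrow> j < n \<Longrightarrow> ub $$ (i, j) = gen (i, j, True)"
  by (simp_all add: u_mat_def bar_mat_def)

lemma transpose_u_entry: "i < n \<Longrightarrow> j < n \<Longrightarrow> transpose_mat u $$ (i, j) = gen (j, i, False)"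
  "i < n \<Longrightarrow> j < n \<Longrightarrow> transpose_mat ub $$ (i, j) = gen (j, i, True)"
  by (simp_all add: u_mat_def bar_mat_def)

abbreviation sQ where "sQ \<equiv> scalar_mat gram_q"
abbreviation sP where "sP \<equiv> scalar_mat gram_p"

lemma middle_scalar_entry:
  assumes M: "M \<in> carrier_mat n n" and N: "N \<in> carrier_mat n n" and S: "S \<in> carrier_mat n n" and ij: "i < n" "j < n"
  shows "(M * scalar_mat S * N - scalar_mat S) $$ (i, j) =
    (\<Sum>k<n. \<Sum>b<n. cscale (S $$ (k, b)) (M $$ (i, k) * N $$ (b, j))) - cscale (S $$ (i, j)) 1"
proof -
  have MS: "M * scalar_mat S \<in> carrier_mat n n" using M S by simp
  have e: "(M * scalar_mat S) $$ (i, b) = (\<Sum>k<n. cscale (S $$ (k, b)) (M $$ (i, k)))" if "b < n" for b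
    unfolding mat_mult_entry[OF M scalar_mat_carrier[OF S] ij(1) that]
    using that by (intro sum.cong) (simp_all add: scalar_mat_index[OF S] single_zero_mult)
  have "(M * scalar_mat S * N) $$ (i, j) = (\<Sum>b<n. \<Sum>k<n. cscale (S $$ (k, b)) (M $$ (i, k) * N $$ (b, j)))"
    unfolding mat_mult_entry[OF MS N ij]
    by (intro sum.cong) (simp_all add: e sum_distrib_right cscale_mult_left)
  also have "\<dots> = (\<Sum>k<n. \<Sum>b<n. cscale (S $$ (k, b)) (M $$ (i, k) * N $$ (b, j)))" by (rule sum.swap)
  finally show ?thesis
    using ij scalar_mat_carrier[OF S] single_zero_mult(2)[of 1 "S $$ (i, j)"]
    by (simp add: scalar_mat_index[OF S] carrier_matD[OF scalar_mat_carrier[OF S]] del: index_mult_mat(1))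
qed

definition gram_q_rel_mat where "gram_q_rel_mat = transpose_mat u * sQ * ub - sQ"
definition gram_p_rel_mat where "gram_p_rel_mat = ub * sP * transpose_mat u - sP"

lemma M_carrier [simp]: "gram_q_rel_mat \<in> carrier_mat n n" "gram_p_rel_mat \<in> carrier_mat n n"
  unfolding gram_q_rel_mat_def gram_p_rel_mat_def by (intro minus_carrier_mat scalar_mat_carrier mats_carrier)+

lemma unitary_entry:
  assumes "i < n" "j < n"
  shows "(u * transpose_mat ub - 1\<^sub>m n) $$ (i, j) = unitary_row_rel i j" "(transpose_mat ub * u - 1\<^sub>m n) $$ (i, j) = unitary_col_rel i j"
proof -
  have "(u * transpose_mat ub) $$ (i, j) = (\<Sum>k<n. gen (i, k, False) * gen (j, k, True))"
    unfolding mat_mult_entry[OF u_carrier(1,4) assms] using assms by (intro sum.cong) (simp_all add: u_entry transpose_u_entry)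
  then show "(u * transpose_mat ub - 1\<^sub>m n) $$ (i, j) = unitary_row_rel i j" using assms by (simp add: unitary_row_rel_def)
  have "(transpose_mat ub * u) $$ (i, j) = (\<Sum>k<n. gen (k, i, True) * gen (k, j, False))"
    unfolding mat_mult_entry[OF u_carrier(4,1) assms] using assms by (intro sum.cong) (simp_all add: u_entry transpose_u_entry)
  then show "(transpose_mat ub * u - 1\<^sub>m n) $$ (i, j) = unitary_col_rel i j" using assms by (simp add: unitary_col_rel_def)
qed

lemma M_entry:
  assumes "i < n" "j < n"
  shows "gram_q_rel_mat $$ (i, j) = gram_q_rel i j" "gram_p_rel_mat $$ (i, j) = gram_p_rel i j"
  unfolding gram_q_rel_mat_def gram_p_rel_mat_def gram_q_rel_def gram_p_rel_def middle_scalar_entry[OF u_carrier(3,2) mats_carrier(3) assms]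
    middle_scalar_entry[OF u_carrier(2,3) mats_carrier(4) assms]
  using assms by (auto simp: u_entry transpose_u_entry gram_q_def gram_p_def intro!: sum.cong)

lemma elements_mat_image:
  assumes "M \<in> carrier_mat n n" "\<And>i j. i < n \<Longrightarrow> j < n \<Longrightarrow> M $$ (i, j) = f i j"
  shows "elements_mat M = (\<Union>i<n. \<Union>j<n. {f i j})"
proof (rule subset_antisym; rule subsetI)
  fix r assume r: "r \<in> elements_mat M"
  obtain i j where ij: "i < n" "j < n" "r = M $$ (i, j)"
    using elements_matD[OF r] unfolding carrier_matD[OF assms(1)] by metis
  have "r \<in> {f i j}" unfolding ij(3) assms(2)[OF ij(1,2)] by (rule singletonI)
  with ij show "r \<in> (\<Union>i<n. \<Union>j<n. {f i j})" by (intro UN_I[of i] UN_I[of j]) simp_all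
next
  fix r assume "r \<in> (\<Union>i<n. \<Union>j<n. {f i j})"
  then obtain i j where ij: "i < n" "j < n" "r = f i j" by (elim UN_E) simp
  show "r \<in> elements_mat M" unfolding ij(3) assms(2)[OF ij(1,2), symmetric] by (rule elements_matI[OF assms(1) ij(1,2) refl])
qed

lemma arc_rel_mat: "arc_rel = unitary_rel n u \<union> (elements_mat gram_q_rel_mat \<union> elements_mat gram_p_rel_mat)"
proof -
  have c: "u * transpose_mat ub - 1\<^sub>m n \<in> carrier_mat n n" "transpose_mat ub * u - 1\<^sub>m n \<in> carrier_mat n n"
    by (intro minus_carrier_mat one_carrier_mat)+
  have split: "(\<Union>i<n. \<Union>j<n. {f i j, g i j, h i j, k i j}) =
      ((\<Union>i<n. \<Union>j<n. {f i j}) \<union> (\<Union>i<n. \<Union>j<n. {g i j})) \<union>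
      ((\<Union>i<n. \<Union>j<n. {h i j}) \<union> (\<Union>i<n. \<Union>j<n. {k i j}))"
    for f g h k :: "nat \<Rightarrow> nat \<Rightarrow> free_star"
    unfolding UN_Un_distrib[symmetric] by (simp add: insert_commute)
  show ?thesis
    unfolding unitary_rel_def arc_rel_eq split
    by (simp only: elements_mat_image[OF c(1) unitary_entry(1)] elements_mat_image[OF c(2) unitary_entry(2)]
      elements_mat_image[OF M_carrier(1) M_entry(1)] elements_mat_image[OF M_carrier(2) M_entry(2)])
qed

lemma scalar_cancel: "S \<in> carrier_mat n n \<Longrightarrow> T \<in> carrier_mat n n \<Longrightarrow> S * T = 1\<^sub>m n \<Longrightarrow> scalar_mat S * scalar_mat T = 1\<^sub>m n"
  by (simp add: scalar_mat_mult[symmetric, of _ n n _ n] scalar_mat_one)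

text \<open>With P inverse to Q, the expression u^t Q ubar P - 1 equals (u^t Q ubar - Q) P, and Q
  ubar P u^t - 1 equals Q (ubar P u^t - P). The unitarity of u is common to both sets of
  relations.\<close>

lemma van_daele_wang_span: "fvec.span (van_daele_wang_rel n gram_q) = fvec.span arc_rel"
proof -
  have inv: "inv_mat gram_q = gram_p" by (rule inv_mat_eqI[OF mats_carrier(3,4) gram_inverse(1)])
  have QP: "sQ * sP = 1\<^sub>m n" by (rule scalar_cancel[OF mats_carrier(3,4) gram_inverse(1)])
  have s: "sQ \<in> carrier_mat n n" "sP \<in> carrier_mat n n" by simp_all
  note A = assoc_mult_mat[of _ n n _ n _ n] mult_carrier_mat[of _ n n _ n]
  have tc: "transpose_mat u * sQ * ub \<in> carrier_mat n n" "ub * sP * transpose_mat u \<in> carrier_mat n n"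
    by (intro mult_carrier_mat[of _ n n] s u_carrier)+
  have 3: "transpose_mat u * (sQ * ub * sP) - 1\<^sub>m n = scalar_mat (1\<^sub>m n) * gram_q_rel_mat * sP"
  proof -
    have "scalar_mat (1\<^sub>m n) * gram_q_rel_mat * sP = gram_q_rel_mat * sP"
      unfolding scalar_mat_one left_mult_one_mat[OF M_carrier(1)] ..
    also have "\<dots> = transpose_mat u * sQ * ub * sP - sQ * sP"
      unfolding gram_q_rel_mat_def by (rule minus_mult_distrib_mat[OF tc(1) s])
    also have "transpose_mat u * sQ * ub * sP = transpose_mat u * (sQ * ub * sP)"
      using s by (simp add: A)
    finally show ?thesis unfolding QP by simp
  qed
  have 4: "(sQ * ub * sP) * transpose_mat u - 1\<^sub>m n = sQ * gram_p_rel_mat * scalar_mat (1\<^sub>m n)"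
  proof -
    have "sQ * gram_p_rel_mat * scalar_mat (1\<^sub>m n) = sQ * gram_p_rel_mat"
      unfolding scalar_mat_one by (rule right_mult_one_mat[OF mult_carrier_mat[OF s(1) M_carrier(2)]])
    also have "\<dots> = sQ * (ub * sP * transpose_mat u) - sQ * sP"
      unfolding gram_p_rel_mat_def by (rule mult_minus_distrib_mat[OF s(1) tc(2) s(2)])
    also have "sQ * (ub * sP * transpose_mat u) = (sQ * ub * sP) * transpose_mat u"
      using s by (simp add: A)
    finally show ?thesis unfolding QP by simp
  qed
  have e3: "fvec.span (elements_mat (scalar_mat (1\<^sub>m n) * gram_q_rel_mat * sP)) = fvec.span (elements_mat gram_q_rel_mat)"
    by (rule span_elements_scalar_mat[of _ n "1\<^sub>m n" _ gram_q]) (simp_all add: gram_inverse)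
  have e4: "fvec.span (elements_mat (sQ * gram_p_rel_mat * scalar_mat (1\<^sub>m n))) = fvec.span (elements_mat gram_p_rel_mat)"
    by (rule span_elements_scalar_mat[of _ n gram_p _ "1\<^sub>m n"]) (simp_all add: gram_inverse)
  show ?thesis
    unfolding van_daele_wang_rel_def Let_def inv 3 4 arc_rel_mat Un_assoc
    by (intro span_Un_cong refl e3 e4)
qed

text \<open>Let G be the adjoint of A and N = G ubar G^-1, so that N^* = A^-1 u^t A. As A G = Q and
  hence G^-1 A^-1 = P, the expression N N^* - 1 equals G (ubar P u^t - P) A, and N^* N - 1 equals
  A^-1 (u^t Q ubar - Q) G^-1.\<close>

lemma banica_span: "fvec.span (banica_rel n (mat_adjoint arc_mat)) = fvec.span arc_rel"
proof -
  let ?G = "mat_adjoint arc_mat" and ?G' = "mat_adjoint arc_mat_inv"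
  let ?A = "scalar_mat arc_mat" and ?A' = "scalar_mat arc_mat_inv"
  have c: "?G \<in> carrier_mat n n" "?G' \<in> carrier_mat n n" by simp_all
  have inv: "inv_mat ?G = ?G'" by (rule inv_mat_eqI[OF c adjoint_inverse])
  let ?N = "scalar_mat ?G * ub * scalar_mat ?G'"
  have s: "scalar_mat ?G \<in> carrier_mat n n" "scalar_mat ?G' \<in> carrier_mat n n" "?A \<in> carrier_mat n n" "?A' \<in> carrier_mat n n"
    "sQ \<in> carrier_mat n n" "sP \<in> carrier_mat n n"
    by (rule scalar_mat_carrier, simp)+
  have N: "?N \<in> carrier_mat n n" by (intro mult_carrier_mat[of _ n n] s u_carrier)
  note As = assoc_mult_mat[of _ n n _ n _ n] mult_carrier_mat[of _ n n _ n]
  note I = aclinear_sum[OF aclinear_free_invol] aclinear_cscale[OF aclinear_free_invol]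
  \<comment> \<open>Computed entry by entry: over a noncommutative ring transposition does not
    reverse matrix products, but the scalar entries are central and can be collected.\<close>
  have bar: "transpose_mat (bar_mat ?N) = ?A' * transpose_mat u * ?A"
  proof (rule eq_matI)
    fix i j assume "i < dim_row (?A' * transpose_mat u * ?A)" "j < dim_col (?A' * transpose_mat u * ?A)"
    then have ij: "i < n" "j < n" using s by auto
    have "transpose_mat (bar_mat ?N) $$ (i, j) = free_invol (?N $$ (j, i))"
      by (rule transpose_bar_entry[OF N ij])
    also have "\<dots> = (\<Sum>l<n. \<Sum>k<n. cscale (cnj (?G $$ (j, k) * ?G' $$ (l, i))) (gen (k, l, False)))"
      unfolding scalar_mat_entry[OF c(1) u_carrier(2) c(2) ij(2,1)] I
      by (intro sum.cong) (simp_all add: u_entry)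
    also have "\<dots> = (\<Sum>k<n. \<Sum>l<n. cscale (cnj (?G $$ (j, k) * ?G' $$ (l, i))) (gen (k, l, False)))"
      by (rule sum.swap)
    also have "\<dots> = (?A' * transpose_mat u * ?A) $$ (i, j)"
      unfolding scalar_mat_entry[OF mats_carrier(2) u_carrier(3) mats_carrier(1) ij]
      using ij by (intro sum.cong refl)
        (simp add: transpose_u_entry mat_adjoint_index[OF mats_carrier(1)] mat_adjoint_index[OF mats_carrier(2)] mult.commute)
    finally show "transpose_mat (bar_mat ?N) $$ (i, j) = (?A' * transpose_mat u * ?A) $$ (i, j)" .
  qed (simp_all add: bar_mat_def s[THEN carrier_matD(1)] s[THEN carrier_matD(2)])
  have QG: "arc_mat * ?G = gram_q" by (rule gram_q_eq)
  \<comment> \<open>The left side is shown to be a left inverse of \<open>gram_q\<close>, whose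
    inverse is \<open>gram_p\<close>.\<close>
  have GA: "?G' * arc_mat_inv = gram_p"
  proof -
    have e: "(?G' * arc_mat_inv) * gram_q = 1\<^sub>m n"
    proof -
      have "(?G' * arc_mat_inv) * (arc_mat * ?G) = ?G' * ((arc_mat_inv * arc_mat) * ?G)"
        by (simp add: assoc_mult_mat[of _ n n _ n _ n] mult_carrier_mat[of _ n n _ n])
      then show ?thesis unfolding QG arc_mat_inverse by (simp add: adjoint_inverse' left_mult_one_mat[of _ n n])
    qed
    have "?G' * arc_mat_inv = (?G' * arc_mat_inv) * (gram_q * gram_p)"
      unfolding gram_inverse by (rule right_mult_one_mat[of _ n n, symmetric]) (simp add: mult_carrier_mat[of _ n n _ n])
    also have "\<dots> = ((?G' * arc_mat_inv) * gram_q) * gram_p" by (simp add: assoc_mult_mat[of _ n n _ n _ n] mult_carrier_mat[of _ n n _ n])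
    finally show ?thesis unfolding e by (simp add: left_mult_one_mat[of _ n n])
  qed
  have sGA: "scalar_mat ?G' * ?A' = sP" by (simp add: scalar_mat_mult[symmetric, of _ n n _ n] GA)
  have sAG: "?A * scalar_mat ?G = sQ" by (simp add: scalar_mat_mult[symmetric, of _ n n _ n] QG)
  have GG: "scalar_mat ?G * scalar_mat ?G' = 1\<^sub>m n" by (rule scalar_cancel[OF c adjoint_inverse])
  have AA: "?A' * ?A = 1\<^sub>m n" by (rule scalar_cancel[OF mats_carrier(2,1) arc_mat_inverse(2)])
  have tc: "transpose_mat u * sQ * ub \<in> carrier_mat n n" "ub * sP * transpose_mat u \<in> carrier_mat n n"
    by (intro mult_carrier_mat[of _ n n] s u_carrier)+
  have 4: "?N * transpose_mat (bar_mat ?N) - 1\<^sub>m n = scalar_mat ?G * gram_p_rel_mat * ?A"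
  proof -
    have "scalar_mat ?G * gram_p_rel_mat * ?A = (scalar_mat ?G * (ub * sP * transpose_mat u) - scalar_mat ?G * sP) * ?A"
      unfolding gram_p_rel_mat_def by (subst mult_minus_distrib_mat[OF s(1) tc(2) s(6)]) simp
    also have "\<dots> = scalar_mat ?G * (ub * sP * transpose_mat u) * ?A - scalar_mat ?G * sP * ?A"
      by (rule minus_mult_distrib_mat[OF mult_carrier_mat[OF s(1) tc(2)] mult_carrier_mat[OF s(1,6)] s(3)])
    also have "scalar_mat ?G * sP * ?A = (scalar_mat ?G * scalar_mat ?G') * (?A' * ?A)"
      unfolding sGA[symmetric] using s by (simp add: As)
    also have "\<dots> = 1\<^sub>m n" unfolding GG AA by simp
    also have "scalar_mat ?G * (ub * sP * transpose_mat u) * ?A = ?N * transpose_mat (bar_mat ?N)"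
      unfolding bar sGA[symmetric] using s by (simp add: As)
    finally show ?thesis by simp
  qed
  have 3: "transpose_mat (bar_mat ?N) * ?N - 1\<^sub>m n = ?A' * gram_q_rel_mat * scalar_mat ?G'"
  proof -
    have "?A' * gram_q_rel_mat * scalar_mat ?G' = (?A' * (transpose_mat u * sQ * ub) - ?A' * sQ) * scalar_mat ?G'"
      unfolding gram_q_rel_mat_def by (subst mult_minus_distrib_mat[OF s(4) tc(1) s(5)]) simp
    also have "\<dots> = ?A' * (transpose_mat u * sQ * ub) * scalar_mat ?G' - ?A' * sQ * scalar_mat ?G'"
      by (rule minus_mult_distrib_mat[OF mult_carrier_mat[OF s(4) tc(1)] mult_carrier_mat[OF s(4,5)] s(2)])
    also have "?A' * sQ * scalar_mat ?G' = (?A' * ?A) * (scalar_mat ?G * scalar_mat ?G')"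
      unfolding sAG[symmetric] using s by (simp add: As)
    also have "\<dots> = 1\<^sub>m n" unfolding GG AA by simp
    also have "?A' * (transpose_mat u * sQ * ub) * scalar_mat ?G' = transpose_mat (bar_mat ?N) * ?N"
      unfolding bar sAG[symmetric] using s by (simp add: As)
    finally show ?thesis by simp
  qed
  have e3: "fvec.span (elements_mat (?A' * gram_q_rel_mat * scalar_mat ?G')) = fvec.span (elements_mat gram_q_rel_mat)"
    by (rule span_elements_scalar_mat[of _ n arc_mat _ ?G]) (simp_all add: arc_mat_inverse adjoint_inverse')
  have e4: "fvec.span (elements_mat (scalar_mat ?G * gram_p_rel_mat * ?A)) = fvec.span (elements_mat gram_p_rel_mat)"
    by (rule span_elements_scalar_mat[of _ n ?G' _ arc_mat_inv]) (simp_all add: arc_mat_inverse adjoint_inverse')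
  have N_rel: "unitary_rel n ?N = elements_mat (scalar_mat ?G * gram_p_rel_mat * ?A) \<union> elements_mat (?A' * gram_q_rel_mat * scalar_mat ?G')"
    unfolding unitary_rel_def 3 4 ..
  have rel: "banica_rel n ?G = unitary_rel n u \<union> unitary_rel n ?N" unfolding banica_rel_def inv ..
  show ?thesis
    unfolding rel arc_rel_mat N_rel Un_commute[of "elements_mat gram_q_rel_mat"]
    by (rule span_Un_cong[OF refl span_Un_cong[OF e4 e3]])
qed

text \<open>An ideal here is a subspace, so only the span of the relations counts; and as
  \<open>arc_ideal\<close> is already invariant under the involution, adjoining the adjoints of the
  relations adds nothing.\<close>

lemma star_ideal_eq:
  assumes "fvec.span Rel = fvec.span arc_rel"
  shows "star_ideal n Rel = arc_ideal"
proof -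
  have sub: "fvec.span arc_rel \<subseteq> arc_ideal"
    by (rule fvec.span_minimal[OF arc_rel_ideal free.subspace_I])
  have Rel: "Rel \<subseteq> arc_ideal" using sub fvec.span_superset[of Rel] assms by simp
  then have both: "Rel \<union> free_invol ` Rel \<subseteq> arc_ideal" using free_invol_arc_ideal by blast
  have car: "Rel \<union> free_invol ` Rel \<subseteq> carrier (free_algebra n)" using both free.I_carrier by blast
  have "star_ideal n Rel \<subseteq> arc_ideal"
    unfolding star_ideal_def by (rule ring.genideal_minimal[OF ring_free_algebra ideal_arc_ideal both])
  moreover have "arc_ideal \<subseteq> star_ideal n Rel"
  proof -
    have id: "ideal (star_ideal n Rel) (free_algebra n)"
      unfolding star_ideal_def by (rule ring.genideal_ideal[OF ring_free_algebra car])
    have "Rel \<subseteq> star_ideal n Rel"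
      unfolding star_ideal_def using ring.genideal_self[OF ring_free_algebra car] by blast
    then have "fvec.span Rel \<subseteq> star_ideal n Rel" by (rule fvec.span_minimal[OF _ subspace_free_ideal[OF id]])
    then have "arc_rel \<subseteq> star_ideal n Rel" using fvec.span_superset[of arc_rel] assms by simp
    then show ?thesis unfolding arc_ideal_def by (rule ring.genideal_minimal[OF ring_free_algebra id])
  qed
  ultimately show ?thesis by (rule subset_antisym)
qed

lemma universal_algebra_iso:
  assumes "fvec.span Rel = fvec.span arc_rel"
  shows "hopf_star_iso (universal_algebra n Rel) (tannaka_algebra \<Phi>) TK.\<theta>"
    "i < n \<Longrightarrow> j < n \<Longrightarrow> TK.\<theta> (fundamental_entry n Rel i j) = coefficient \<Phi> [X] (v ! i) (v ! j)"
  using tannaka_iso tannaka_iso_gen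
  by (simp_all add: universal_algebra_def fundamental_entry_def star_ideal_eq[OF assms] Let_def)

end

theorem proposition5p3:
  fixes d :: real and \<Phi> :: "'a::ab_group_add functor_data" and v w :: "'a list"
    and n :: nat and A :: "complex mat"
  assumes "d\<^sup>2 \<ge> 4"
    and "unitary_fiber_functor d \<Phi>"
    and "onb \<Phi> [X] v" and "onb \<Phi> [Xstar] w"
    and "n = length v"
    and "A = mat (length v) (length w) (\<lambda>(i, j). ip \<Phi> [] (unit_vector \<Phi>)
           (mor \<Phi> [X, Xstar] [] eps_X (tens \<Phi> [X] [Xstar] (v ! i) (w ! j))))"
  shows "invertible_mat A \<and>
    (\<exists>\<theta>. hopf_star_iso (Au_van_daele_wang n (A * mat_adjoint A)) (tannaka_algebra \<Phi>) \<theta> \<and>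
      (\<forall>i<n. \<forall>j<n.
        \<theta> (fundamental_entry n (van_daele_wang_rel n (A * mat_adjoint A)) i j) =
        coefficient \<Phi> [X] (v ! i) (v ! j))) \<and>
    (\<exists>\<theta>. hopf_star_iso (Au_banica n (mat_adjoint A)) (tannaka_algebra \<Phi>) \<theta> \<and>
      (\<forall>i<n. \<forall>j<n.
        \<theta> (fundamental_entry n (banica_rel n (mat_adjoint A)) i j) =
        coefficient \<Phi> [X] (v ! i) (v ! j)))"
proof -
  have "d \<noteq> 0" using assms(1) by auto
  then interpret F: based_fiber_functor d \<Phi> v w
    using assms(2-4) by (intro based_fiber_functor.intro based_fiber_functor_axioms.intro)
  have n: "F.n = n" by (simp add: F.n_def assms(5))
  \<comment> \<open>The given matrix has \<open>length w\<close> columns; by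
    \<open>length_v'\<close> it is square of size \<open>n\<close>.\<close>
  have A: "A = F.arc_mat"
    unfolding assms(6) F.arc_mat_def F.arc_coeff_def using F.length_v' n assms(5) by simp
  have "invertible_mat A"
    unfolding A invertible_mat_def inverts_mat_def
    using F.arc_mat_inverse by (auto simp: F.arc_mat_def F.arc_mat_inv_def intro!: exI[of _ F.arc_mat_inv])
  moreover note F.universal_algebra_iso[OF F.van_daele_wang_span] F.universal_algebra_iso[OF F.banica_span]
  ultimately show ?thesis
    unfolding A F.gram_q_eq Au_van_daele_wang_def Au_banica_def n by blast
qed

end
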